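(* Let $\mathcal T_h$ be quasi-uniform and satisfy the mesh condition (M) of the context, and let $\mathcal C_h:H^1(\Omega)\to H^1(\Omega)\cap\mathbb P_1(\mathcal T_h)$ be the modified Clément interpolant defined in the context. For $0\le s\le1$, $$\|w-\mathcal C_hw\|_{L^2(\Omega)}+h\|\nabla(w-\mathcal C_hw)\|_{L^2(\Omega)}\lesssim h^{1+s}|w|_{H^{1+s}(\Omega)}\quad\text{for all }w\in H^{1+s}(\Omega).$$
   Context: $\Omega\subset\mathbb R^2$ is an open bounded polygonal domain, $\partial\Omega=\overline{\Gamma_{\mathrm D}\cup\Gamma_{\mathrm T}}$ with $\Gamma_{\mathrm D},\Gamma_{\mathrm T}$ disjoint, relatively open, of positive length, and $\Gamma_{\mathrm T}$ an open straight line segment with set of endpoints $\partial\Gamma_{\mathrm T}$. $\mathcal T_h$ is a conforming affine shape-regular simplicial mesh of size $h$; $\mathbb P_1(\mathcal T_h)$ is the space of elementwise affine functions; $\mathcal N_h$ and $\mathcal N_h^\partial$ are the interior and boundary vertices; $\mathcal N_h^{\Gamma_{\mathrm T}}$ is the set of mesh vertices in the (relatively open) segment $\Gamma_{\mathrm T}$; $\varphi_z$ is the piecewise affine nodal basis function at $z$. (M) $\Gamma_{\mathrm T}$ contains at least two mesh facets. For each $z\in\partial\Gamma_{\mathrm T}$, let $E_z^1$ be the unique boundary facet in $\Gamma_{\mathrm T}$ containing $z$, and $E_z^2\subset\Gamma_{\mathrm T}$ the unique boundary facet neighboring $E_z^1$ and not containing $z$; then $|E_z^1|\ge|E_z^2|$.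 Interpolant. For $z\in\mathcal N_h^\partial$ let $\tilde\omega_z$ be the union of the boundary facets sharing $z$, and let $z_0=z,z_1,z_2$ be the three distinct vertices of the facets in $\tilde\omega_z$. Let $s_z=\frac1{\int_{\tilde\omega_z}\varphi_z\,ds}\int_{\tilde\omega_z}x\,\varphi_z(x)\,ds$ (a point of $\tilde\omega_z$ when $z\in\mathcal N_h^{\Gamma_{\mathrm T}}$). For $z\in\mathcal N_h^{\Gamma_{\mathrm T}}$ choose weights $\alpha_{z,i}\ge0$, $i=0,1,2$, at least one of them zero, with $\sum_{i=0}^2\alpha_{z,i}=1$, $\sum_{i=0}^2\alpha_{z,i}s_{z_i}=z$, and $\alpha_{z,i}=0$ whenever $z_i\in\partial\Gamma_{\mathrm T}$ (such weights exist under (M)). Define $$\mathcal C_hv=\sum_{z\in\mathcal N_h\cup\mathcal N_h^\partial}v_z\varphi_z,\qquad v_z=\sum_{i=0}^2\frac{\alpha_{z,i}}{\int_{\tilde\omega_{z_i}}\varphi_{z_i}\,ds}\int_{\tilde\omega_{z_i}}v\,\varphi_{z_i}\,ds\ \text{ if }z\in\mathcal N_h^{\Gamma_{\mathrm T}},$$ and $v_z=(\mathcal{SZ}_hv)(z)$ for all remaining vertices, where $\mathcal{SZ}_h$ is the Scott–Zhang interpolant onto continuous piecewise affine functions (nodal value at $z$ equal to $\int_{\sigma_z}\theta_zv\,ds$ with a chosen mesh edge $\sigma_z\ni z$, $\sigma_z\subset\partial\Omega$ if $z\in\partial\Omega$, and $\sigma_z\subset\overline{\Gamma_{\mathrm D}}$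 if $z\in\overline{\Gamma_{\mathrm D}}$, and $\theta_z\in\mathbb P_1(\sigma_z)$ the $L^2(\sigma_z)$-dual basis function of the nodal basis function at $z$). $a\lesssim b$ means $a\le cb$ with $c$ independent of $h$. *)

theory Defs
  imports "HOL-Analysis.Analysis"
begin

type_synonym pt = "real ^ 2"

section \<open>Sobolev spaces on open subsets of the plane\<close>

definition L2 :: "'a measure \<Rightarrow> ('a \<Rightarrow> 'b::euclidean_space) set" where
  "L2 M = {f. f \<in> borel_measurable M \<and> integrable M (\<lambda>x. (norm (f x))\<^sup>2)}"

definition L2_norm :: "'a measure \<Rightarrow> ('a \<Rightarrow> 'b::euclidean_space) \<Rightarrow> real" where
  "L2_norm M f = sqrt (LINT x|M. (norm (f x))\<^sup>2)"

definition partial :: "2 \<Rightarrow> (pt \<Rightarrow> real) \<Rightarrow> pt \<Rightarrow> real" where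
  "partial i f x = frechet_derivative f (at x) (axis i 1)"

primrec C_k :: "nat \<Rightarrow> (pt \<Rightarrow> real) \<Rightarrow> bool" where
  "C_k 0 f \<longleftrightarrow> continuous_on UNIV f"
| "C_k (Suc k) f \<longleftrightarrow> (\<forall>x. f differentiable (at x)) \<and> (\<forall>i. C_k k (partial i f))"

definition test_functions :: "pt set \<Rightarrow> (pt \<Rightarrow> real) set" where
  "test_functions \<Omega> = {\<phi>. (\<forall>k. C_k k \<phi>) \<and>
     compact (closure {x. \<phi> x \<noteq> 0}) \<and> closure {x. \<phi> x \<noteq> 0} \<subseteq> \<Omega>}"

definition locally_integrable :: "pt set \<Rightarrow> (pt \<Rightarrow> 'b::euclidean_space) \<Rightarrow> bool" where
  "locally_integrable \<Omega> f \<longleftrightarrow> (\<forall>K. compact K \<and> K \<subseteq> \<Omega> \<longrightarrow> integrable (lebesgue_on K) f)"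

definition is_weak_gradient :: "pt set \<Rightarrow> (pt \<Rightarrow> real) \<Rightarrow> (pt \<Rightarrow> pt) \<Rightarrow> bool" where
  "is_weak_gradient \<Omega> f g \<longleftrightarrow> locally_integrable \<Omega> f \<and> locally_integrable \<Omega> g \<and>
     (\<forall>\<phi>\<in>test_functions \<Omega>. \<forall>i.
        (LINT x|lebesgue_on \<Omega>. f x * partial i \<phi> x) = - (LINT x|lebesgue_on \<Omega>. g x $ i * \<phi> x))"

text \<open>Weak gradients are unique only up to null sets; every use below is insensitive to the
  representative.\<close>

definition weak_grad :: "pt set \<Rightarrow> (pt \<Rightarrow> real) \<Rightarrow> pt \<Rightarrow> pt" where
  "weak_grad \<Omega> f = (SOME g. is_weak_gradient \<Omega> f g)"

definition H1 :: "pt set \<Rightarrow> (pt \<Rightarrow> real) set" where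
  "H1 \<Omega> = {f. f \<in> L2 (lebesgue_on \<Omega>) \<and> (\<exists>g. is_weak_gradient \<Omega> f g \<and> g \<in> L2 (lebesgue_on \<Omega>))}"

text \<open>The spaces of order \<open>1 + s\<close> for \<open>0 \<le> s \<le> 1\<close>: the integer order spaces at the two ends,
  and the Sobolev-Slobodeckij spaces (in dimension 2) in between.\<close>

definition slobodeckij_kernel :: "real \<Rightarrow> (pt \<Rightarrow> pt) \<Rightarrow> pt \<times> pt \<Rightarrow> real" where
  "slobodeckij_kernel s g = (\<lambda>(x, y). (norm (g x - g y))\<^sup>2 / norm (x - y) powr (2 + 2 * s))"

definition H1plus :: "real \<Rightarrow> pt set \<Rightarrow> (pt \<Rightarrow> real) set" where
  "H1plus s \<Omega> = {w \<in> H1 \<Omega>.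
     if s = 0 then True
     else if s = 1 then \<forall>i. (\<lambda>x. weak_grad \<Omega> w x $ i) \<in> H1 \<Omega>
     else integrable (lebesgue_on \<Omega> \<Otimes>\<^sub>M lebesgue_on \<Omega>) (slobodeckij_kernel s (weak_grad \<Omega> w))}"

definition H1plus_seminorm :: "real \<Rightarrow> pt set \<Rightarrow> (pt \<Rightarrow> real) \<Rightarrow> real" where
  "H1plus_seminorm s \<Omega> w =
     (if s = 0 then L2_norm (lebesgue_on \<Omega>) (weak_grad \<Omega> w)
      else if s = 1 then
        sqrt (\<Sum>i\<in>UNIV. (L2_norm (lebesgue_on \<Omega>) (weak_grad \<Omega> (\<lambda>x. weak_grad \<Omega> w x $ i)))\<^sup>2)
      else sqrt (LINT z|(lebesgue_on \<Omega> \<Otimes>\<^sub>M lebesgue_on \<Omega>). slobodeckij_kernel s (weak_grad \<Omega> w) z))"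


section \<open>Arc length and traces on line segments\<close>

definition arclength_ends :: "pt \<Rightarrow> pt \<Rightarrow> pt measure" where
  "arclength_ends a b = scale_measure (ennreal (dist a b))
     (distr (restrict_space lborel {0..1}) (restrict_space borel (closed_segment a b))
        (\<lambda>t::real. (1 - t) *\<^sub>R a + t *\<^sub>R b))"

text \<open>A segment determines its endpoints up to order, which does not affect the measure.\<close>

definition arclength :: "pt set \<Rightarrow> pt measure" where
  "arclength E = (let (a, b) = (SOME (a, b). E = closed_segment a b) in arclength_ends a b)"

definition seg_length :: "pt set \<Rightarrow> real" where
  "seg_length E = measure (arclength E) E"

text \<open>The trace on a segment \<open>E\<close> in the closure of \<open>\<Omega>\<close> is the extension by continuity, from
  \<open>H\<^sup>1(\<Omega>) \<inter> C(closure \<Omega>)\<close> to \<open>H\<^sup>1(\<Omega>)\<close>, of the restriction to \<open>E\<close>.\<close>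

definition is_trace :: "pt set \<Rightarrow> pt set \<Rightarrow> (pt \<Rightarrow> real) \<Rightarrow> (pt \<Rightarrow> real) \<Rightarrow> bool" where
  "is_trace \<Omega> E v g \<longleftrightarrow> g \<in> L2 (arclength E) \<and>
     (\<exists>u :: nat \<Rightarrow> pt \<Rightarrow> real.
        (\<forall>n. u n \<in> H1 \<Omega> \<and> continuous_on (closure \<Omega>) (u n)) \<and>
        (\<lambda>n. L2_norm (lebesgue_on \<Omega>) (\<lambda>x. u n x - v x)) \<longlonglongrightarrow> 0 \<and>
        (\<lambda>n. L2_norm (lebesgue_on \<Omega>) (\<lambda>x. weak_grad \<Omega> (u n) x - weak_grad \<Omega> v x)) \<longlonglongrightarrow> 0 \<and>
        (\<lambda>n. L2_norm (arclength E) (\<lambda>x. u n x - g x)) \<longlonglongrightarrow> 0)"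

definition seg_trace :: "pt set \<Rightarrow> pt set \<Rightarrow> (pt \<Rightarrow> real) \<Rightarrow> pt \<Rightarrow> real" where
  "seg_trace \<Omega> E v = (SOME g. is_trace \<Omega> E v g)"


section \<open>Polygonal domains and meshes\<close>

definition simple_polygon :: "pt set \<Rightarrow> bool" where
  "simple_polygon J \<longleftrightarrow>
     (\<exists>g. simple_path g \<and> pathfinish g = pathstart g \<and> path_image g = J) \<and>
     (\<exists>S. finite S \<and> J = (\<Union>(a, b)\<in>S. closed_segment a b))"

text \<open>The boundary of a (Lipschitz) polygonal domain consists of finitely many disjoint simple
  closed polygons. A connected open set with such a boundary lies locally on one side of it, so
  slits and points where the domain touches itself are excluded, while holes are allowed.\<close>

definition polygonal_domain :: "pt set \<Rightarrow> bool" where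
  "polygonal_domain \<Omega> \<longleftrightarrow> open \<Omega> \<and> connected \<Omega> \<and> bounded \<Omega> \<and> \<Omega> \<noteq> {} \<and>
     (\<exists>\<J>. finite \<J> \<and> pairwise disjnt \<J> \<and> (\<forall>J\<in>\<J>. simple_polygon J) \<and> frontier \<Omega> = \<Union>\<J>)"

text \<open>Since the boundary is a finite union of segments, a part of it has positive length iff it
  has positive length on some segment.\<close>

definition positive_length :: "pt set \<Rightarrow> pt set \<Rightarrow> bool" where
  "positive_length \<Omega> \<Gamma> \<longleftrightarrow> (\<exists>a b. closed_segment a b \<subseteq> frontier \<Omega> \<and>
     emeasure (arclength (closed_segment a b)) (\<Gamma> \<inter> closed_segment a b) > 0)"

definition boundary_partition :: "pt set \<Rightarrow> pt set \<Rightarrow> pt set \<Rightarrow> bool" where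
  "boundary_partition \<Omega> \<Gamma>D \<Gamma>T \<longleftrightarrow>
     frontier \<Omega> = closure (\<Gamma>D \<union> \<Gamma>T) \<and> \<Gamma>D \<inter> \<Gamma>T = {} \<and>
     openin (top_of_set (frontier \<Omega>)) \<Gamma>D \<and> openin (top_of_set (frontier \<Omega>)) \<Gamma>T \<and>
     positive_length \<Omega> \<Gamma>D \<and> positive_length \<Omega> \<Gamma>T \<and>
     (\<exists>p q. p \<noteq> q \<and> \<Gamma>T = open_segment p q)"

definition vertices :: "pt set set \<Rightarrow> pt set" where
  "vertices \<T> = {z. \<exists>K\<in>\<T>. z extreme_point_of K}"

definition edges :: "pt set set \<Rightarrow> pt set set" where
  "edges \<T> = {E. \<exists>K\<in>\<T>. E facet_of K}"

definition interior_vertices :: "pt set \<Rightarrow> pt set set \<Rightarrow> pt set" where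
  "interior_vertices \<Omega> \<T> = vertices \<T> \<inter> \<Omega>"

definition boundary_vertices :: "pt set \<Rightarrow> pt set set \<Rightarrow> pt set" where
  "boundary_vertices \<Omega> \<T> = vertices \<T> \<inter> frontier \<Omega>"

definition boundary_edges :: "pt set \<Rightarrow> pt set set \<Rightarrow> pt set set" where
  "boundary_edges \<Omega> \<T> = {E \<in> edges \<T>. E \<subseteq> frontier \<Omega>}"

text \<open>Edges are closed, so the ones in the open segment \<open>\<Gamma>T\<close> are those contained in its closure.\<close>

definition edges_in :: "pt set \<Rightarrow> pt set set \<Rightarrow> pt set \<Rightarrow> pt set set" where
  "edges_in \<Omega> \<T> \<Gamma> = {E \<in> boundary_edges \<Omega> \<T>. E \<subseteq> closure \<Gamma>}"

text \<open>A conforming simplicial mesh of \<open>\<Omega>\<close> (elements are closed triangles) that resolves \<open>\<Gamma>T\<close>.\<close>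

definition conforming_mesh :: "pt set \<Rightarrow> pt set \<Rightarrow> pt set set \<Rightarrow> bool" where
  "conforming_mesh \<Omega> \<Gamma>T \<T> \<longleftrightarrow> triangulation \<T> \<and> (\<forall>K\<in>\<T>. 2 simplex K) \<and> \<Union>\<T> = closure \<Omega> \<and>
     closure \<Gamma>T = \<Union>(edges_in \<Omega> \<T> \<Gamma>T)"

definition mesh_size :: "pt set set \<Rightarrow> real" where
  "mesh_size \<T> = Max (diameter ` \<T>)"

definition inradius :: "pt set \<Rightarrow> real" where
  "inradius K = Sup {r. \<exists>x. 0 \<le> r \<and> cball x r \<subseteq> K}"

definition shape_regular :: "real \<Rightarrow> pt set set \<Rightarrow> bool" where
  "shape_regular \<kappa> \<T> \<longleftrightarrow> (\<forall>K\<in>\<T>. diameter K \<le> \<kappa> * inradius K)"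

definition quasi_uniform :: "real \<Rightarrow> pt set set \<Rightarrow> bool" where
  "quasi_uniform \<rho> \<T> \<longleftrightarrow> (\<forall>K\<in>\<T>. mesh_size \<T> \<le> \<rho> * diameter K)"

text \<open>For an open segment, \<open>rel_frontier\<close> is the set of its endpoints.\<close>

definition mesh_condition_M :: "pt set \<Rightarrow> pt set \<Rightarrow> pt set set \<Rightarrow> bool" where
  "mesh_condition_M \<Omega> \<Gamma>T \<T> \<longleftrightarrow> card (edges_in \<Omega> \<T> \<Gamma>T) \<ge> 2 \<and>
     (\<forall>z\<in>rel_frontier \<Gamma>T. \<forall>E1\<in>edges_in \<Omega> \<T> \<Gamma>T. \<forall>E2\<in>edges_in \<Omega> \<T> \<Gamma>T.
        z \<in> E1 \<and> E1 \<inter> E2 \<noteq> {} \<and> z \<notin> E2 \<longrightarrow> seg_length E1 \<ge> seg_length E2)"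


section \<open>Piecewise affine functions and the interpolants\<close>

definition affine_fun_on :: "pt set \<Rightarrow> (pt \<Rightarrow> real) \<Rightarrow> bool" where
  "affine_fun_on S f \<longleftrightarrow> (\<exists>a c. \<forall>x\<in>S. f x = a \<bullet> x + c)"

text \<open>Elementwise affine functions may jump across edges, hence the open elements.\<close>

definition P1 :: "pt set set \<Rightarrow> (pt \<Rightarrow> real) set" where
  "P1 \<T> = {f. \<forall>K\<in>\<T>. affine_fun_on (interior K) f}"

definition nodal_basis :: "pt set set \<Rightarrow> pt \<Rightarrow> pt \<Rightarrow> real" where
  "nodal_basis \<T> z = (THE \<phi>. (\<forall>K\<in>\<T>. affine_fun_on K \<phi>) \<and> (\<forall>x. x \<notin> \<Union>\<T> \<longrightarrow> \<phi> x = 0) \<and>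
     (\<forall>y\<in>vertices \<T>. \<phi> y = (if y = z then 1 else 0)))"

text \<open>The integral over the union of the boundary edges at \<open>z\<close>; the integrand may depend on
  the edge because traces are taken edge by edge.\<close>

definition patch_integral ::
  "pt set \<Rightarrow> pt set set \<Rightarrow> pt \<Rightarrow> (pt set \<Rightarrow> pt \<Rightarrow> 'b::euclidean_space) \<Rightarrow> 'b" where
  "patch_integral \<Omega> \<T> z F = (\<Sum>E | E \<in> boundary_edges \<Omega> \<T> \<and> z \<in> E. LINT x|arclength E. F E x)"

definition patch_mass :: "pt set \<Rightarrow> pt set set \<Rightarrow> pt \<Rightarrow> real" where
  "patch_mass \<Omega> \<T> z = patch_integral \<Omega> \<T> z (\<lambda>E. nodal_basis \<T> z)"

definition patch_centroid :: "pt set \<Rightarrow> pt set set \<Rightarrow> pt \<Rightarrow> pt" where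
  "patch_centroid \<Omega> \<T> z =
     (1 / patch_mass \<Omega> \<T> z) *\<^sub>R patch_integral \<Omega> \<T> z (\<lambda>E x. nodal_basis \<T> z x *\<^sub>R x)"

text \<open>The vertices of the boundary edges at \<open>z\<close>, that is, \<open>{z\<^sub>0, z\<^sub>1, z\<^sub>2}\<close> with \<open>z\<^sub>0 = z\<close>. The
  weights at \<open>z\<close> are indexed by these points, \<open>\<alpha> z z\<^sub>i\<close> being the weight of \<open>z\<^sub>i\<close>.\<close>

definition patch_vertices :: "pt set \<Rightarrow> pt set set \<Rightarrow> pt \<Rightarrow> pt set" where
  "patch_vertices \<Omega> \<T> z = {y \<in> vertices \<T>. \<exists>E\<in>boundary_edges \<Omega> \<T>. z \<in> E \<and> y \<in> E}"

definition admissible_weights ::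
  "pt set \<Rightarrow> pt set \<Rightarrow> pt set set \<Rightarrow> (pt \<Rightarrow> pt \<Rightarrow> real) \<Rightarrow> bool" where
  "admissible_weights \<Omega> \<Gamma>T \<T> \<alpha> \<longleftrightarrow> (\<forall>z\<in>vertices \<T> \<inter> \<Gamma>T.
     (\<forall>y\<in>patch_vertices \<Omega> \<T> z. \<alpha> z y \<ge> 0) \<and>
     (\<exists>y\<in>patch_vertices \<Omega> \<T> z. \<alpha> z y = 0) \<and>
     (\<Sum>y\<in>patch_vertices \<Omega> \<T> z. \<alpha> z y) = 1 \<and>
     (\<Sum>y\<in>patch_vertices \<Omega> \<T> z. \<alpha> z y *\<^sub>R patch_centroid \<Omega> \<T> y) = z \<and>
     (\<forall>y\<in>patch_vertices \<Omega> \<T> z. y \<in> rel_frontier \<Gamma>T \<longrightarrow> \<alpha> z y = 0))"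

definition SZ_edges :: "pt set \<Rightarrow> pt set \<Rightarrow> pt set set \<Rightarrow> (pt \<Rightarrow> pt set) \<Rightarrow> bool" where
  "SZ_edges \<Omega> \<Gamma>D \<T> \<sigma> \<longleftrightarrow> (\<forall>z\<in>vertices \<T>. \<sigma> z \<in> edges \<T> \<and> z \<in> \<sigma> z \<and>
     (z \<in> frontier \<Omega> \<longrightarrow> \<sigma> z \<subseteq> frontier \<Omega>) \<and> (z \<in> closure \<Gamma>D \<longrightarrow> \<sigma> z \<subseteq> closure \<Gamma>D))"

definition dual_basis :: "pt set set \<Rightarrow> pt set \<Rightarrow> pt \<Rightarrow> pt \<Rightarrow> real" where
  "dual_basis \<T> E z = (THE \<theta>. affine_fun_on E \<theta> \<and> (\<forall>x. x \<notin> E \<longrightarrow> \<theta> x = 0) \<and>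
     (\<forall>y\<in>vertices \<T> \<inter> E. (LINT x|arclength E. \<theta> x * nodal_basis \<T> y x) = (if y = z then 1 else 0)))"

definition SZ_value ::
  "pt set \<Rightarrow> pt set set \<Rightarrow> (pt \<Rightarrow> pt set) \<Rightarrow> (pt \<Rightarrow> real) \<Rightarrow> pt \<Rightarrow> real" where
  "SZ_value \<Omega> \<T> \<sigma> v z = (LINT x|arclength (\<sigma> z). dual_basis \<T> (\<sigma> z) z x * seg_trace \<Omega> (\<sigma> z) v x)"

definition clement_value ::
  "pt set \<Rightarrow> pt set \<Rightarrow> pt set set \<Rightarrow> (pt \<Rightarrow> pt \<Rightarrow> real) \<Rightarrow> (pt \<Rightarrow> pt set) \<Rightarrow> (pt \<Rightarrow> real) \<Rightarrow> pt \<Rightarrow> real" where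
  "clement_value \<Omega> \<Gamma>T \<T> \<alpha> \<sigma> v z =
     (if z \<in> \<Gamma>T
      then \<Sum>y\<in>patch_vertices \<Omega> \<T> z. \<alpha> z y / patch_mass \<Omega> \<T> y *
             patch_integral \<Omega> \<T> y (\<lambda>E x. seg_trace \<Omega> E v x * nodal_basis \<T> y x)
      else SZ_value \<Omega> \<T> \<sigma> v z)"

definition clement ::
  "pt set \<Rightarrow> pt set \<Rightarrow> pt set set \<Rightarrow> (pt \<Rightarrow> pt \<Rightarrow> real) \<Rightarrow> (pt \<Rightarrow> pt set) \<Rightarrow> (pt \<Rightarrow> real) \<Rightarrow> pt \<Rightarrow> real" where
  "clement \<Omega> \<Gamma>T \<T> \<alpha> \<sigma> v x =
     (\<Sum>z\<in>interior_vertices \<Omega> \<T> \<union> boundary_vertices \<Omega> \<T>.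
        clement_value \<Omega> \<Gamma>T \<T> \<alpha> \<sigma> v z * nodal_basis \<T> z x)"

end

theory Submission
 imports Defs "HOL-Real_Asymp.Real_Asymp"
begin

text \<open>On each element \<open>K\<close> the function \<open>w\<close> is compared with the affine function \<open>p\<^sub>K\<close> whose gradient is
 the mean of the gradient of \<open>w\<close> (or zero if \<open>s = 0\<close>) and which has the mean value of \<open>w\<close>. Poincare and trace
 inequalities, extended from smooth functions by density, bound \<open>w - p\<^sub>K\<close> on \<open>K\<close> and on its edges. Since
 the boundary is a union of disjoint simple polygons, the elements at a vertex form a chain in which
 neighbours share an edge, so \<open>p\<^sub>K\<close> and \<open>p\<^sub>L\<close> are close for any two elements at a vertex. The Scott-Zhang
 values and, by the centroid condition, the weighted averages on \<open>\<Gamma>T\<close> are exact for affine functions;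
 hence the nodal value at \<open>z\<close> is close to \<open>p\<^sub>K z\<close> for every \<open>K\<close> containing \<open>z\<close>. Summing
 over the elements with finite overlap yields the estimate.\<close>

text \<open>The density behind the Poincare and trace inequalities needs a field pointing into the
  domain, although the boundary is given only topologically. The field comes from the mesh: near a
  boundary point the closed domain is a cone. The Jordan curve theorem excludes slits, and a closed
  curve contains no three segments meeting only in a common end point, so this cone has just two
  boundary rays and an inward direction. The same count of rays yields the chain of elements round a
  vertex: two groups of elements meeting only in the vertex would produce too many rays.
  Approximation may lose factors that depend on the mesh, since they multiply an arbitrarily small
  error; the constants are fixed by the inequalities for C^1 functions. Sobolev spaces are not
  interpolated. Each of the cases s = 0, s = 1 and 0 < s < 1 provides numbers that bound, element by
  element, the deviation of the gradient from a constant and the jump of these constants across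
  edges; everything else is common. For s = 1 the jumps are bounded by the s = 0 theory applied to
  the components of the gradient.\<close>

abbreviation "leb \<equiv> lebesgue_on"

section \<open>Smooth test functions and the fundamental lemma\<close>

text \<open>The polynomial factor makes this family closed under differentiation;
  \<open>flat 1\<close> is the classical exp(-1/t), extended by 0.\<close>

definition flat :: "real poly => real => real" where
 "flat p t = (if t <= 0 then 0 else poly p (1 / t) * exp (- (1 / t)))"

lemma poly_exp_tendsto_0: "((%x::real. poly p x * exp (- x)) \<longlongrightarrow> 0) at_top"
proof -
 have "((%x. \<Sum>i\<le>degree p. coeff p i * (x ^ i / exp x)) \<longlongrightarrow> (\<Sum>i\<le>degree p. coeff p i * 0)) at_top"
  by (intro tendsto_intros tendsto_power_div_exp_0)
 moreover have "(\<Sum>i\<le>degree p. coeff p i * (x ^ i / exp x)) = poly p x * exp (- x)" for x :: real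
  by (simp add: poly_altdef sum_distrib_right exp_minus field_simps sum_divide_distrib)
 ultimately show ?thesis by simp
qed

text \<open>The chain rule contributes the factor (1/t)^2, hence \<open>[:0,0,1:]\<close>. At t = 0
  the quotient from the right is x p(x) exp(-x) with x = 1/h, which tends to 0.\<close>

lemma flat_deriv:
 "(flat p has_real_derivative flat ([:0,0,1:] * (p - pderiv p)) t) (at t)"
proof (cases t "0::real" rule: linorder_cases)
 case less
 have "\<forall>\<^sub>F x in nhds t. flat p x = 0"
  using less by (auto simp: flat_def eventually_nhds intro!: exI[of _ "{..<0}"])
 thus ?thesis
  using less by (subst DERIV_cong_ev[OF refl _ refl]) (auto simp: flat_def)
next
 case greater
 have "((%x. poly p (1 / x) * exp (- (1 / x))) has_real_derivative
   poly ([:0,0,1:] * (p - pderiv p)) (1 / t) * exp (- (1 / t))) (at t)"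
  using greater by (auto intro!: derivative_eq_intros poly_DERIV[THEN DERIV_chain2]
    simp: power2_eq_square field_simps)
 moreover have "\<forall>\<^sub>F x in nhds t. flat p x = poly p (1 / x) * exp (- (1 / x))"
  using greater by (auto simp: flat_def eventually_nhds intro!: exI[of _ "{0<..}"])
 ultimately show ?thesis
  using greater by (subst DERIV_cong_ev[OF refl _ refl]) (auto simp: flat_def)
next
 case equal
 have "((%h. flat p h / h) \<longlongrightarrow> 0) (at_right 0)"
 proof (rule Lim_transform_eventually)
  show "((%h::real. poly ([:0,1:] * p) (inverse h) * exp (- inverse h)) \<longlongrightarrow> 0) (at_right 0)"
   by (rule filterlim_compose[OF poly_exp_tendsto_0 filterlim_inverse_at_top_right])
  show "\<forall>\<^sub>F h in at_right 0. poly ([:0,1:] * p) (inverse h) * exp (- inverse h) = flat p h / h"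
   using eventually_at_right_less[of "0::real"] by eventually_elim (auto simp: flat_def field_simps)
 qed
 moreover have "((%h. flat p h / h) \<longlongrightarrow> 0) (at_left 0)"
 proof (rule Lim_transform_eventually[OF tendsto_const])
  show "\<forall>\<^sub>F h in at_left 0. 0 = flat p h / h"
   unfolding eventually_at_filter by (auto simp: flat_def)
 qed
 ultimately have "((%h. flat p h / h) \<longlongrightarrow> 0) (at 0)"
  by (simp add: filterlim_split_at)
 thus ?thesis using equal by (simp add: DERIV_def flat_def)
qed

text \<open>A generated algebra that contains its own partial derivatives, so that
  \<open>C_k\<close> for every k follows by a plain induction.\<close>

inductive smooth :: "(pt => real) => bool" where
 smooth_flat: "smooth (%x. flat p (alpha * x $ i + beta))"
| smooth_const: "smooth (%x. c)"
| smooth_add: "smooth f ==> smooth g ==> smooth (%x. f x + g x)"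
| smooth_mult: "smooth f ==> smooth g ==> smooth (%x. f x * g x)"

lemma partial_eqI: "(f has_derivative f') (at x) ==> partial i f x = f' (axis i 1)"
 by (simp add: partial_def frechet_derivative_at[symmetric])

lemma smooth_partial: "smooth f ==> (\<forall>x. f differentiable (at x)) \<and> (\<forall>i. smooth (partial i f))"
proof (induction rule: smooth.induct)
 case (smooth_flat p alpha i beta)
 have d: "((%x. flat p (alpha * x $ i + beta)) has_derivative
   (%v. (alpha * v $ i) * flat ([:0,0,1:] * (p - pderiv p)) (alpha * x $ i + beta))) (at x)" for x :: pt
  apply (rule has_derivative_eq_rhs)
  apply (rule DERIV_compose_FDERIV[OF flat_deriv])
  apply (auto intro!: derivative_eq_intros bounded_linear.has_derivative[OF bounded_linear_vec_nth])
  done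
 have "partial j (%x. flat p (alpha * x $ i + beta)) =
   (%x. (alpha * axis j 1 $ i) * flat ([:0,0,1:] * (p - pderiv p)) (alpha * x $ i + beta))" for j
  using partial_eqI[OF d] by blast
 thus ?case
  using d by (auto simp: differentiable_def intro!: smooth.intros)
next
 case (smooth_const c)
 thus ?case
 proof -
  have "partial j (%x. c) = (%x. 0)" for j using partial_eqI[OF has_derivative_const] by (intro ext)
  thus ?thesis by (auto intro: smooth.intros)
 qed
next
 case (smooth_add f g)
 hence "partial j (%x. f x + g x) = (%x. partial j f x + partial j g x)" for j
  by (auto simp: fun_eq_iff partial_def frechet_derivative_works
    intro!: partial_eqI[THEN trans, unfolded partial_def] derivative_eq_intros)
 with smooth_add show ?case by (auto intro!: smooth.intros)
next
 case (smooth_mult f g)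
 hence "partial j (%x. f x * g x) = (%x. f x * partial j g x + partial j f x * g x)" for j
  by (auto simp: fun_eq_iff partial_def frechet_derivative_works
    intro!: partial_eqI[THEN trans, unfolded partial_def] derivative_eq_intros)
 with smooth_mult show ?case by (auto intro!: smooth.intros)
qed

lemma smooth_C_k: "smooth f ==> C_k k f"
proof (induction k arbitrary: f)
 case 0
 thus ?case
  using smooth_partial[OF 0] by (auto simp: continuous_on_eq_continuous_at differentiable_imp_continuous_within)
next
 case (Suc k)
 thus ?case using smooth_partial[OF Suc.prems] by auto
qed

lemma smooth_reflect: "smooth f ==> smooth (%y. f (x - y))"
proof (induction rule: smooth.induct)
 case (smooth_flat p alpha i beta)
 have "(%y. flat p (alpha * (x - y) $ i + beta)) = (%y. flat p ((- alpha) * y $ i + (alpha * x $ i + beta)))"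
  by (auto simp: algebra_simps)
 thus ?case by (metis smooth.smooth_flat)
qed (auto intro: smooth.intros)

text \<open>The offset -1 inside \<open>flat\<close> keeps the support at distance 1/n from the
  boundary of the box, so the closed support lies in the open box. As n grows the bumps tend to the
  indicator of the box.\<close>

definition bump :: "real => pt => pt => pt => real" where
 "bump n a b x = (flat 1 (n * (x $ 1 - a $ 1) - 1) * flat 1 (n * (b $ 1 - x $ 1) - 1)) *
  (flat 1 (n * (x $ 2 - a $ 2) - 1) * flat 1 (n * (b $ 2 - x $ 2) - 1))"

lemma smooth_bump: "smooth (bump n a b)"
proof -
 have "bump n a b = (%x. (flat 1 (n * x $ 1 + (- n * a $ 1 - 1)) * flat 1 ((- n) * x $ 1 + (n * b $ 1 - 1))) *
  (flat 1 (n * x $ 2 + (- n * a $ 2 - 1)) * flat 1 ((- n) * x $ 2 + (n * b $ 2 - 1))))"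
  by (auto simp: bump_def fun_eq_iff algebra_simps)
 thus ?thesis by (simp only:) (intro smooth.intros)
qed

lemma flat_bounds: "0 <= flat 1 t" "flat 1 t <= 1" "flat 1 t = 0 \<longleftrightarrow> t <= 0"
 by (auto simp: flat_def)

lemma bump_bounds: "0 <= bump n a b x" "bump n a b x <= 1"
 by (auto simp: bump_def intro!: mult_le_one mult_nonneg_nonneg flat_bounds)

lemma bump_support:
 assumes "n > 0" "bump n a b x ~= 0"
 shows "x \<in> cbox (a + (1/n) *\<^sub>R 1) (b - (1/n) *\<^sub>R 1)"
proof -
 have "flat 1 (n * (x $ i - a $ i) - 1) ~= 0 \<and> flat 1 (n * (b $ i - x $ i) - 1) ~= 0" for i
  using assms exhaust_2[of i] by (auto simp: bump_def)
 thus ?thesis using assms(1)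
  by (auto simp: mem_box_cart flat_bounds not_le field_simps less_imp_le)
qed

lemma flat_tendsto_1: "((%n. flat 1 (real n * c - 1)) \<longlongrightarrow> (if c > 0 then 1 else 0)) sequentially"
proof (cases "c > 0")
 case True
 have "((%x::real. exp (- (1 / x))) \<longlongrightarrow> exp (- 0)) at_top"
  by (intro tendsto_intros tendsto_divide_0[OF tendsto_const] filterlim_at_top_imp_at_infinity filterlim_ident)
 moreover have "\<forall>\<^sub>F x::real in at_top. exp (- (1 / x)) = flat 1 x"
  using eventually_gt_at_top[of 0] by eventually_elim (auto simp: flat_def)
 ultimately have "((%x::real. flat 1 x) \<longlongrightarrow> 1) at_top"
  using Lim_transform_eventually by fastforce
 moreover have "filterlim (%n. real n * c - 1) at_top sequentially"
  using True by real_asymp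
 ultimately show ?thesis using True filterlim_compose by fastforce
next
 case False
 have "flat 1 (real n * c - 1) = 0" for n
  using False mult_nonneg_nonpos[of "real n" c] by (auto simp: flat_def not_less)
 thus ?thesis using False by simp
qed

lemma bump_tendsto: "((%n. bump (real n) a b x) \<longlongrightarrow> indicator (box a b) x) sequentially"
proof -
 have "((%n. bump (real n) a b x) \<longlongrightarrow>
  ((if x $ 1 - a $ 1 > 0 then 1 else 0) * (if b $ 1 - x $ 1 > 0 then 1 else 0)) *
  ((if x $ 2 - a $ 2 > 0 then 1 else 0) * (if b $ 2 - x $ 2 > 0 then 1 else 0))) sequentially"
  unfolding bump_def by (intro tendsto_mult flat_tendsto_1)
 moreover have "((if x $ 1 - a $ 1 > 0 then 1 else 0) * (if b $ 1 - x $ 1 > 0 then 1 else 0)) *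
  ((if x $ 2 - a $ 2 > 0 then 1 else 0) * (if b $ 2 - x $ 2 > 0 then 1 else 0)) = (indicator (box a b) x :: real)"
  by (auto simp: indicator_def mem_box_cart forall_2)
 ultimately show ?thesis by simp
qed

lemma cbox_shrink_subset_box:
 assumes "n > 0" shows "cbox (a + (1/n) *\<^sub>R 1) (b - (1/n) *\<^sub>R 1) \<subseteq> box a (b :: pt)"
proof
 fix x assume x: "x \<in> cbox (a + (1/n) *\<^sub>R 1) (b - (1/n) *\<^sub>R 1)"
 have "0 < 1 / n" using assms by simp
 moreover have "a $ i + 1 / n <= x $ i \<and> x $ i <= b $ i - 1 / n" for i
  using x by (simp add: mem_box_cart)
 ultimately have "a $ i < x $ i \<and> x $ i < b $ i" for i by (smt (verit))
 thus "x \<in> box a b" by (simp add: mem_box_cart)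
qed

lemma bump_test_function:
 assumes "n > 0" "box a b \<subseteq> Om"
 shows "bump n a b \<in> test_functions Om"
proof -
 have sub: "closure {x. bump n a b x ~= 0} \<subseteq> cbox (a + (1/n) *\<^sub>R 1) (b - (1/n) *\<^sub>R 1)"
  using bump_support[OF assms(1)] by (intro closure_minimal) auto
 moreover have "cbox (a + (1/n) *\<^sub>R 1) (b - (1/n) *\<^sub>R 1) \<subseteq> box a b"
  using assms(1) by (rule cbox_shrink_subset_box)
 moreover have "compact (closure {x. bump n a b x ~= 0})"
  using sub compact_cbox bounded_subset[OF bounded_cbox] compact_eq_bounded_closed by blast
 ultimately show ?thesis
  using assms by (auto simp: test_functions_def smooth_C_k smooth_bump)
qed

lemma continuous_imp_measurable_lebesgue:
 fixes f :: "'a::euclidean_space => 'b::euclidean_space"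
 assumes "continuous_on UNIV f" shows "f \<in> borel_measurable lebesgue"
 using borel_measurable_continuous_onI[OF assms] by (simp add: measurable_completion)

lemma integrable_mult_continuous_bounded:
 fixes f :: "pt => real"
 assumes "integrable M f" "phi \<in> borel_measurable M" "!!x. \<bar>phi x\<bar> <= B"
 shows "integrable M (%x. f x * phi x)"
proof (rule Bochner_Integration.integrable_bound)
 show "integrable M (%x. B * f x)" using assms by simp
 show "AE x in M. norm (f x * phi x) <= norm (B * f x)"
  using assms(3) by (auto simp: abs_mult intro!: AE_I2)
   (metis abs_ge_self abs_ge_zero mult.commute mult_right_mono order_trans)
qed (use assms in auto)

text \<open>Boxes form an intersection-stable generator of the Borel sets, so a Dynkin argument
  extends the vanishing integrals to all Borel sets, which forces F to vanish almost
  everywhere.\<close>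

lemma integral_boxes_zero:
 fixes F :: "pt => real"
 assumes F: "integrable lebesgue F" and box: "!!a b. (LINT x|lebesgue. indicator (box a b) x * F x) = 0"
 shows "AE x in lebesgue. F x = 0"
proof -
 have ind: "integrable lebesgue (%x. indicator A x * F x)" if "A \<in> sets lebesgue" for A
  using integrable_mult_indicator[OF that F] by simp
 have sig: "sigma_sets UNIV (range (%(a, b). box a b)) \<subseteq> sets (lebesgue :: pt measure)"
 proof -
  have "sigma_sets UNIV (range (%(a, b). box a b)) = sets (borel :: pt measure)"
   unfolding borel_eq_box by (simp add: sets_measure_of)
  thus ?thesis using sets_completionI_sets[of _ lborel] by auto
 qed
 have bor: "(LINT x|lebesgue. indicator A x * F x) = 0" if "A \<in> sets borel" for A
 proof -
  have A: "A \<in> sigma_sets UNIV (range (%(a, b). box a b))"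
   using that by (simp add: borel_eq_box)
  have st: "Int_stable (range (%(a, b). box a (b::pt)))"
   unfolding Int_stable_def
  proof safe
   fix a b c d :: pt
   have "box a b \<inter> box c d = box (\<chi> i. max (a$i) (c$i)) (\<chi> i. min (b$i) (d$i))"
    by (auto simp: mem_box_cart)
   thus "box a b \<inter> box c d \<in> range (%(a, b). box a b)" by auto
  qed
  have pw: "range (%(a, b). box a (b::pt)) \<subseteq> Pow UNIV" by simp
  from st pw A show ?thesis
  proof (induct rule: sigma_sets_induct_disjoint)
   case (basic A)
   thus ?case using box by auto
  next
   case empty
   thus ?case by simp
  next
   case (compl A)
   \<comment> \<open>The boxes (-n,n)^2 exhaust the plane, so F has integral zero over the whole
     plane, as complements require.\<close>
   have "(%n. LINT x|lebesgue. indicator (box (- real n *\<^sub>R 1) (real n *\<^sub>R 1)) x * F x) \<longlonglongrightarrow> (LINT x|lebesgue. F x)"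
   proof (rule integral_dominated_convergence[where w = "%x. norm (F x)"])
    show "AE x in lebesgue. (%n. indicator (box (- real n *\<^sub>R 1) (real n *\<^sub>R 1)) x * F x) \<longlonglongrightarrow> F x"
    proof (rule AE_I2)
     fix x :: pt
     obtain N :: nat where N: "norm x < N" using reals_Archimedean2 by blast
     have "\<forall>\<^sub>F n in sequentially. F x = indicator (box (- real n *\<^sub>R 1) (real n *\<^sub>R 1)) x * F x"
      using eventually_ge_at_top[of N]
     proof eventually_elim
      case (elim n)
      hence "\<bar>x $ i\<bar> < real n" for i using component_le_norm_cart[of x i] N by linarith
      hence "x \<in> box (- real n *\<^sub>R 1) (real n *\<^sub>R 1)"
       by (auto simp: mem_box_cart abs_less_iff) (smt (verit))
      thus ?case by simp
     qed
     thus "(%n. indicator (box (- real n *\<^sub>R 1) (real n *\<^sub>R 1)) x * F x) \<longlonglongrightarrow> F x"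
      using Lim_transform_eventually[OF tendsto_const] by fast
    qed
   qed (use F ind in \<open>auto simp: indicator_def intro!: AE_I2 borel_measurable_integrable\<close>)
   hence "(LINT x|lebesgue. F x) = 0" using box LIMSEQ_unique[OF _ tendsto_const] by (simp add: LIMSEQ_const_iff)
   moreover have "(LINT x|lebesgue. indicator (UNIV - A) x * F x) =
     (LINT x|lebesgue. F x - indicator A x * F x)"
    by (rule Bochner_Integration.integral_cong) (auto simp: indicator_def)
   moreover have "A \<in> sets lebesgue" using compl(1) sig by blast
   ultimately show ?case using compl ind[of A] F by (simp add: Bochner_Integration.integral_diff)
  next
   case (union A)
   have m: "A n \<in> sets lebesgue" for n using union(2) sig by blast
   have "(LINT x|lebesgue. indicator (\<Union> (range A)) x *\<^sub>R F x) = (\<Sum>n. LINT x|lebesgue. indicator (A n) x *\<^sub>R F x)"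
    using lebesgue_integral_countable_add[of A lebesgue F] m union ind[of "\<Union> (range A)"]
    by (simp add: set_integrable_def set_lebesgue_integral_def disjoint_family_on_def sets.countable_UN)
   moreover have "(LINT x|lebesgue. indicator (A n) x * F x) = 0" for n
    using union(3) by simp
   ultimately show ?case by simp
  qed
 qed
 \<comment> \<open>F is only Lebesgue measurable; the density argument runs on a Borel
   representative.\<close>
 obtain F' where F': "F' \<in> borel_measurable lborel" "AE x in lborel. F x = F' x"
  using completion_ex_borel_measurable_real[OF borel_measurable_integrable[OF F]] by blast
 have F'': "F' \<in> borel_measurable lebesgue" using F'(1) by (rule measurable_completion)
 have ae: "AE x in lebesgue. F x = F' x" using F'(2) by (rule AE_completion)
 have int: "integrable lborel F'"
  using integrable_cong_AE[OF _ _ ae] F F'' borel_measurable_integrable[OF F] F'(1)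
  by (simp add: integrable_completion)
 have "AE x in lborel. F' x = 0"
 proof (rule sigma_finite_measure.density_zero[OF lborel.sigma_finite_measure_axioms int])
  fix A assume A: "A \<in> sets (lborel :: pt measure)"
  have "set_lebesgue_integral lborel A F' = (LINT x|lebesgue. indicator A x * F' x)"
   using A F'(1) by (simp add: set_lebesgue_integral_def integral_completion)
  also have "... = (LINT x|lebesgue. indicator A x * F x)"
   using A ae by (intro integral_cong_AE borel_measurable_times F'' borel_measurable_integrable[OF F]
     borel_measurable_indicator) (auto intro: sets_completionI_sets)
  finally show "set_lebesgue_integral lborel A F' = 0" using bor A by simp
 qed
 from AE_completion[OF this] ae show ?thesis by eventually_elim simp
qed

lemma integrable_lebesgue_on_mult_compact:
 fixes f psi :: "pt => real"
 assumes f: "locally_integrable Om f" and Om: "Om \<in> sets lebesgue" and S: "compact S" "S \<subseteq> Om"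
  and psi: "continuous_on UNIV psi" "!!x. x \<notin> S ==> psi x = 0"
 shows "integrable (leb Om) (%x. f x * psi x)"
proof -
 have S': "S \<in> sets lebesgue" using S(1) by (simp add: compact_imp_closed)
 have "bounded (psi ` S)"
  by (intro compact_imp_bounded compact_continuous_image continuous_on_subset[OF psi(1)] S(1)) simp
 then obtain B where B: "!!x. x \<in> S ==> \<bar>psi x\<bar> <= B" by (auto simp: bounded_iff)
 have B': "\<bar>psi x\<bar> <= max B 0" for x using B[of x] psi(2)[of x] by (cases "x \<in> S") auto
 have psim: "psi \<in> borel_measurable lebesgue"
  by (rule continuous_imp_measurable_lebesgue[OF psi(1)])
 have "integrable lebesgue (%x. indicator S x *\<^sub>R f x)"
  using f S S' by (auto simp: locally_integrable_def integrable_restrict_space)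
 from integrable_mult_continuous_bounded[OF this psim B']
 have "integrable lebesgue (%x. indicator S x *\<^sub>R f x * psi x)" .
 moreover have "indicator S x *\<^sub>R f x * psi x = indicator Om x *\<^sub>R (f x * psi x)" for x
  using S(2) psi(2)[of x] by (auto simp: indicator_def)
 ultimately have "integrable lebesgue (%x. indicator Om x *\<^sub>R (f x * psi x))" by (simp only:)
 thus ?thesis using Om by (simp add: integrable_restrict_space)
qed

lemma test_function_smooth:
 assumes "phi \<in> test_functions Om"
 shows "phi differentiable (at x)" "continuous_on UNIV phi" "continuous_on UNIV (partial i phi)"
  "x \<notin> closure {x. phi x ~= 0} ==> phi x = 0" "x \<notin> closure {x. phi x ~= 0} ==> partial i phi x = 0"
  "compact (closure {x. phi x ~= 0})" "closure {x. phi x ~= 0} \<subseteq> Om"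
  "(phi has_derivative (%v. \<Sum>i\<in>UNIV. v $ i * partial i phi x)) (at x)"
proof -
 have C: "C_k (Suc 0) phi" "C_k 0 phi" using assms unfolding test_functions_def by blast+
 show d: "phi differentiable (at x)" and "continuous_on UNIV phi" "continuous_on UNIV (partial i phi)"
  using C by auto
 show "x \<notin> closure {x. phi x ~= 0} ==> phi x = 0" using closure_subset[of "{x. phi x ~= 0}"] by blast
 show "compact (closure {x. phi x ~= 0})" "closure {x. phi x ~= 0} \<subseteq> Om"
  using assms unfolding test_functions_def by blast+
 show "partial i phi x = 0" if "x \<notin> closure {x. phi x ~= 0}"
 proof -
  have o: "open (- closure {x. phi x ~= 0})" by auto
  have e: "0 = phi y" if "y \<in> - closure {x. phi x ~= 0}" for y
   using that closure_subset[of "{x. phi x ~= 0}"] by auto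
  have "((%y. 0) has_derivative (%v. 0)) (at x)" by (rule has_derivative_const)
  from has_derivative_transform_within_open[OF this o _ e] that
  have "(phi has_derivative (%v. 0)) (at x)" by simp
  thus ?thesis by (rule partial_eqI)
 qed
 define D where "D = frechet_derivative phi (at x)"
 have D: "(phi has_derivative D) (at x)" using d by (simp add: D_def frechet_derivative_works)
 hence lin: "linear D" by (rule has_derivative_linear)
 have "D v = (\<Sum>i\<in>UNIV. v $ i * partial i phi x)" for v
 proof -
  have "D v = D (\<Sum>i\<in>UNIV. v $ i *\<^sub>R axis i 1)" using basis_expansion[of v] by (simp add: scalar_mult_eq_scaleR)
  also have "... = (\<Sum>i\<in>UNIV. v $ i * D (axis i 1))" using lin by (simp add: linear_sum linear_cmul)
  finally show ?thesis by (simp add: partial_def D_def)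
 qed
 hence "D = (%v. \<Sum>i\<in>UNIV. v $ i * partial i phi x)" by (rule ext)
 with D show "(phi has_derivative (%v. \<Sum>i\<in>UNIV. v $ i * partial i phi x)) (at x)" by simp
qed

lemma locally_integrable_nth:
 "locally_integrable Om g ==> locally_integrable Om (%x. g x $ i)"
 by (auto simp: locally_integrable_def intro!: integrable_bounded_linear[OF bounded_linear_vec_nth])

lemma integrable_test_mult:
 assumes "locally_integrable Om f" "open Om" "phi \<in> test_functions Om"
 shows "integrable (leb Om) (%x. f x * phi x)" "integrable (leb Om) (%x. f x * partial i phi x)"
proof -
 have Om: "Om \<in> sets lebesgue" using assms(2) by simp
 note t = test_function_smooth[OF assms(3)]
 show "integrable (leb Om) (%x. f x * phi x)"
  by (rule integrable_lebesgue_on_mult_compact[OF assms(1) Om t(6,7,2,4)])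
 show "integrable (leb Om) (%x. f x * partial i phi x)"
  by (rule integrable_lebesgue_on_mult_compact[OF assms(1) Om t(6,7,3,5)])
qed

text \<open>Bumps tend to indicators of boxes, so f has integral zero over every box inside a closed
  box in the domain; countably many closed boxes cover the domain.\<close>

lemma fundamental_lemma:
 fixes f :: "pt => real"
 assumes Om: "open Om" and f: "locally_integrable Om f"
  and z: "!!phi. phi \<in> test_functions Om ==> (LINT x|leb Om. f x * phi x) = 0"
 shows "AE x in leb Om. f x = 0"
proof -
 have Omm: "Om \<in> sets lebesgue" using Om by auto
 have cb: "AE x in lebesgue. x \<in> cbox c d --> f x = 0" if cd: "cbox c d \<subseteq> Om" for c d
 proof -
  let ?F = "%x. indicator (box c d) x * f x"
  have int: "integrable lebesgue (%x. indicator (cbox c d) x * f x)"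
  proof -
   have "integrable (leb (cbox c d)) f" using f cd by (auto simp: locally_integrable_def)
   thus ?thesis by (simp add: integrable_restrict_space)
  qed
  have F: "integrable lebesgue ?F"
  proof -
   have "integrable lebesgue (%x. indicator (box c d) x *\<^sub>R (indicator (cbox c d) x * f x))"
    by (rule integrable_mult_indicator[OF _ int]) auto
   moreover have "indicator (box c d) x *\<^sub>R (indicator (cbox c d) x * f x) = ?F x" for x
    using box_subset_cbox[of c d] by (auto simp: indicator_def)
   ultimately show ?thesis by (simp only:)
  qed
  have "AE x in lebesgue. ?F x = 0"
  proof (rule integral_boxes_zero[OF F])
   fix a b :: pt
   \<comment> \<open>The test box is cut with \<open>box c d\<close> because the bumps have to be
     supported in the domain.\<close>
   define a' b' where "a' = (\<chi> i. max (a$i) (c$i))" and "b' = (\<chi> i. min (b$i) (d$i))"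
   have ab: "box a b \<inter> box c d = box a' b'"
    by (auto simp: mem_box_cart a'_def b'_def)
   have sub: "box a' b' \<subseteq> cbox c d" using ab box_subset_cbox by blast
   have "(%n. LINT x|lebesgue. f x * indicator (cbox c d) x * bump (real (Suc n)) a' b' x) \<longlonglongrightarrow>
     (LINT x|lebesgue. f x * indicator (cbox c d) x * indicator (box a' b') x)"
   proof (rule integral_dominated_convergence[where w = "%x. norm (indicator (cbox c d) x * f x)"])
    show "AE x in lebesgue. (%n. f x * indicator (cbox c d) x * bump (real (Suc n)) a' b' x) \<longlonglongrightarrow>
      f x * indicator (cbox c d) x * indicator (box a' b') x"
     by (intro AE_I2 tendsto_mult_left LIMSEQ_Suc[OF bump_tendsto])
    have bm: "bump n a' b' \<in> borel_measurable lebesgue" for n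
     using smooth_C_k[OF smooth_bump, of 0] by (intro continuous_imp_measurable_lebesgue) simp
    show "(%x. f x * indicator (cbox c d) x * bump (real (Suc n)) a' b' x) \<in> borel_measurable lebesgue" for n
     using borel_measurable_integrable[OF int] bm by (auto simp: mult.commute)
    show "(%x. f x * indicator (cbox c d) x * indicator (box a' b') x) \<in> borel_measurable lebesgue"
     using borel_measurable_times[OF borel_measurable_integrable[OF int] borel_measurable_indicator[of "box a' b'"]]
     by (auto simp: mult.commute)
    show "AE x in lebesgue. norm (f x * indicator (cbox c d) x * bump (real (Suc n)) a' b' x) <= norm (indicator (cbox c d) x * f x)" for n
     using bump_bounds[of "real (Suc n)" a' b']
     by (auto simp: abs_mult indicator_def intro!: AE_I2 mult_left_le)
   qed (use int in auto)
   moreover have "(LINT x|lebesgue. f x * indicator (cbox c d) x * bump (real (Suc n)) a' b' x) = 0" for n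
   proof -
    have t: "bump (real (Suc n)) a' b' \<in> test_functions Om"
     using sub cd by (intro bump_test_function) auto
    have "f x * indicator (cbox c d) x * bump (real (Suc n)) a' b' x = indicator Om x *\<^sub>R (f x * bump (real (Suc n)) a' b' x)" for x
    proof (cases "bump (real (Suc n)) a' b' x = 0")
     case False
     hence "x \<in> cbox (a' + (1 / real (Suc n)) *\<^sub>R 1) (b' - (1 / real (Suc n)) *\<^sub>R 1)"
      by (intro bump_support) auto
     hence "x \<in> box a' b'" by (rule subsetD[OF cbox_shrink_subset_box, rotated]) simp
     thus ?thesis using sub cd by (auto simp: indicator_def)
    qed auto
    hence "(LINT x|lebesgue. f x * indicator (cbox c d) x * bump (real (Suc n)) a' b' x) =
      (LINT x|lebesgue. indicator Om x *\<^sub>R (f x * bump (real (Suc n)) a' b' x))" by (simp only:)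
    thus ?thesis using z[OF t] Omm by (simp add: integral_restrict_space)
   qed
   ultimately have "(LINT x|lebesgue. f x * indicator (cbox c d) x * indicator (box a' b') x) = 0"
    by (simp add: LIMSEQ_const_iff)
   moreover have "f x * indicator (cbox c d) x * indicator (box a' b') x = indicator (box a b) x * ?F x" for x
    using ab sub by (auto simp: indicator_def)
   ultimately show "(LINT x|lebesgue. indicator (box a b) x * ?F x) = 0" by simp
  qed
  moreover have "AE x in lebesgue. x \<notin> cbox c d - box c d"
   using negligible_frontier_interval[of c d] by (intro AE_not_in) (simp add: negligible_iff_null_sets)
  ultimately show ?thesis by eventually_elim (auto simp: indicator_def split: if_splits)
 qed
 obtain D where D: "countable D" "D \<subseteq> Pow Om" "!!X. X \<in> D ==> \<exists>a b. X = cbox a b" "\<Union>D = Om"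
  using open_countable_Union_open_cbox[OF Om] by metis
 have "AE x in lebesgue. \<forall>X\<in>D. x \<in> X --> f x = 0"
 proof (subst AE_ball_countable[OF D(1)], rule ballI)
  fix X assume "X \<in> D"
  then obtain a b where "X = cbox a b" "X \<subseteq> Om" using D by blast
  thus "AE x in lebesgue. x \<in> X --> f x = 0" using cb by blast
 qed
 hence "AE x in lebesgue. x \<in> Om --> f x = 0"
  by eventually_elim (use D in blast)
 thus ?thesis using Omm by (simp add: AE_restrict_space_iff)
qed

text \<open>This makes the chosen \<open>weak_grad\<close> computable: any explicit weak gradient
  agrees with it almost everywhere.\<close>

lemma weak_gradient_unique:
 assumes Om: "open Om" and g: "is_weak_gradient Om f g" and g': "is_weak_gradient Om f g'"
 shows "AE x in leb Om. g x = g' x"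
proof -
 have "AE x in leb Om. g x $ i - g' x $ i = 0" for i
 proof (rule fundamental_lemma[OF Om])
  have l: "locally_integrable Om (%x. g x $ i)" "locally_integrable Om (%x. g' x $ i)"
   using g g' locally_integrable_nth by (auto simp: is_weak_gradient_def)
  thus "locally_integrable Om (%x. g x $ i - g' x $ i)" by (auto simp: locally_integrable_def)
  fix phi assume phi: "phi \<in> test_functions Om"
  have "(LINT x|leb Om. (g x $ i - g' x $ i) * phi x) =
    (LINT x|leb Om. g x $ i * phi x) - (LINT x|leb Om. g' x $ i * phi x)"
   by (simp add: left_diff_distrib Bochner_Integration.integral_diff integrable_test_mult[OF l(1) Om phi] integrable_test_mult[OF l(2) Om phi])
  also have "... = 0" using g g' phi by (auto simp: is_weak_gradient_def)
  finally show "(LINT x|leb Om. (g x $ i - g' x $ i) * phi x) = 0" .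
 qed
 hence "AE x in leb Om. \<forall>i. g x $ i - g' x $ i = 0"
  by (simp add: AE_all_countable)
 thus ?thesis by eventually_elim (simp add: vec_eq_iff)
qed

section \<open>Square integrable functions\<close>

text \<open>Squared norms keep the estimates free of roots and add up over the elements.\<close>

definition sqi :: "'a measure => ('a => 'b::euclidean_space) => real" where
 "sqi M f = (LINT x|M. (norm (f x))^2)"

lemma L2_norm_eq: "L2_norm M f = sqrt (sqi M f)" and sqi_nonneg [simp]: "0 <= sqi M f"
 by (auto simp: L2_norm_def sqi_def)

lemma L2_norm_sq: "(L2_norm M f)^2 = sqi M f"
 by (simp add: L2_norm_eq)

lemma norm_add_sq_le: "(norm (a + b))^2 <= 2 * (norm a)^2 + 2 * (norm (b :: 'a::real_normed_vector))^2"
proof -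
 have "(norm (a + b))^2 <= (norm a + norm b)^2" by (intro power_mono norm_triangle_ineq) auto
 also have "... <= 2 * (norm a)^2 + 2 * (norm b)^2"
  using zero_le_power2[of "norm a - norm b"] by (auto simp: power2_eq_square algebra_simps)
 finally show ?thesis .
qed

lemma L2_add: "f \<in> L2 M ==> g \<in> L2 M ==> (%x. f x + g x) \<in> L2 M"
 unfolding L2_def
proof safe
 assume "f \<in> borel_measurable M" "g \<in> borel_measurable M"
  and i: "integrable M (%x. (norm (f x))^2)" "integrable M (%x. (norm (g x))^2)"
 thus m: "(%x. f x + g x) \<in> borel_measurable M" by simp
 show "integrable M (%x. (norm (f x + g x))^2)"
 proof (rule Bochner_Integration.integrable_bound)
  show "integrable M (%x. 2 * (norm (f x))^2 + 2 * (norm (g x))^2)" using i by simp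
  show "AE x in M. norm ((norm (f x + g x))^2) <= norm (2 * (norm (f x))^2 + 2 * (norm (g x))^2)"
   using norm_add_sq_le[of "f _" "g _"] by (intro AE_I2) simp
 qed (use m in simp)
qed

lemma L2_uminus: "f \<in> L2 M ==> (%x. - f x) \<in> L2 M"
 by (auto simp: L2_def)

lemma L2_diff: "f \<in> L2 M ==> g \<in> L2 M ==> (%x. f x - g x) \<in> L2 M"
 using L2_add[OF _ L2_uminus] by fastforce

lemma L2_integrable_sq: "f \<in> L2 M ==> integrable M (%x. (norm (f x))^2)"
 by (simp add: L2_def)

lemma L2_integrable_sq_real: "f \<in> L2 M ==> integrable M (%x. (f x :: real)^2)"
 by (simp add: L2_def)

lemma sqi_add_le:
 assumes "f \<in> L2 M" "g \<in> L2 M"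
 shows "sqi M (%x. f x + g x) <= 2 * sqi M f + 2 * sqi M g"
proof -
 have "sqi M (%x. f x + g x) <= (LINT x|M. 2 * (norm (f x))^2 + 2 * (norm (g x))^2)"
  unfolding sqi_def using assms L2_add[OF assms]
  by (intro integral_mono norm_add_sq_le) (auto simp: L2_integrable_sq)
 thus ?thesis using assms by (simp add: sqi_def L2_integrable_sq)
qed

lemma sqi_diff_le:
 assumes "f \<in> L2 M" "g \<in> L2 M"
 shows "sqi M (%x. f x - g x) <= 2 * sqi M f + 2 * sqi M g"
 using sqi_add_le[OF assms(1) L2_uminus[OF assms(2)]] by (simp add: sqi_def)

lemma sqi_triangle:
 assumes "f \<in> L2 M" "g \<in> L2 M" "k \<in> L2 M"
 shows "sqi M (%x. f x - k x) <= 2 * sqi M (%x. f x - g x) + 2 * sqi M (%x. g x - k x)"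
 using sqi_add_le[OF L2_diff[OF assms(1,2)] L2_diff[OF assms(2,3)]] by simp

lemma sqi_commute: "sqi M (%x. f x - g x) = sqi M (%x. g x - f x)"
 by (simp add: sqi_def norm_minus_commute)

lemma sqi_nth: "g \<in> L2 M ==> (%x. g x $ i) \<in> L2 M \<and> sqi M (%x. g x $ i) <= sqi M (g :: _ => pt)"
proof -
 assume g: "g \<in> L2 M"
 have le: "(g x $ i)^2 <= (norm (g x))^2" for x
  using component_le_norm_cart[of "g x" i] power_mono[of "\<bar>g x $ i\<bar>" "norm (g x)" 2] by simp
 have m: "(%x. g x $ i) \<in> borel_measurable M"
  using g borel_measurable_continuous_onI[of "%v::pt. v $ i"]
  by (auto simp: L2_def continuous_on_component intro: measurable_compose[where N = borel and g = "%v. v $ i"])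
 hence L: "(%x. g x $ i) \<in> L2 M"
  using g le by (auto simp: L2_def intro!: Bochner_Integration.integrable_bound[of M "%x. (norm (g x))^2"])
 moreover have "sqi M (%x. g x $ i) <= sqi M g"
  unfolding sqi_def using le L g by (intro integral_mono) (auto simp: L2_def)
 ultimately show ?thesis by simp
qed

text \<open>The integral of (f - t g)^2 is a nonnegative quadratic in t; the choice t = b / c gives
  the inequality.\<close>

lemma integral_mult_sq_le:
 fixes f g :: "'a => real"
 assumes "integrable M (%x. (f x)^2)" "integrable M (%x. (g x)^2)" "integrable M (%x. f x * g x)"
 shows "(LINT x|M. f x * g x)^2 <= (LINT x|M. (f x)^2) * (LINT x|M. (g x)^2)"
proof -
 define a b c where "a = (LINT x|M. (f x)^2)" and "b = (LINT x|M. f x * g x)" and "c = (LINT x|M. (g x)^2)"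
 have q: "0 <= a - 2 * t * b + t^2 * c" for t
 proof -
  have "0 <= (LINT x|M. (f x - t * g x)^2)" by simp
  also have "... = (LINT x|M. (f x)^2 - 2 * t * (f x * g x) + t^2 * (g x)^2)"
   by (rule Bochner_Integration.integral_cong) (auto simp: power2_eq_square algebra_simps)
  also have "... = a - 2 * t * b + t^2 * c" using assms by (simp add: a_def b_def c_def)
  finally show ?thesis .
 qed
 have "b^2 <= a * c"
 proof (cases "c = 0")
  case True
  have "b = 0"
  proof (rule ccontr)
   assume "b ~= 0"
   \<comment> \<open>With c = 0 this t turns the quadratic into a - (a + 1) = -1.\<close>
   thus False using q[of "(a + 1) / (2 * b)"] True by (simp add: field_simps)
  qed
  thus ?thesis using True by simp
 next
  case False
  hence "c > 0" by (simp add: c_def order_less_le)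
  thus ?thesis using q[of "b / c"] by (simp add: field_simps power2_eq_square)
 qed
 thus ?thesis by (simp add: a_def b_def c_def)
qed

lemma L2_integrable_mult:
 fixes f g :: "'a => real"
 assumes "f \<in> L2 M" "g \<in> L2 M"
 shows "integrable M (%x. f x * g x)"
proof (rule Bochner_Integration.integrable_bound[of M "%x. (f x)^2 + (g x)^2"])
 show "AE x in M. norm (f x * g x) <= norm ((f x)^2 + (g x)^2)"
 proof (rule AE_I2)
  fix x show "norm (f x * g x) <= norm ((f x)^2 + (g x)^2)"
   using sum_squares_bound[of "\<bar>f x\<bar>" "\<bar>g x\<bar>"] mult_nonneg_nonneg[of "\<bar>f x\<bar>" "\<bar>g x\<bar>"]
   unfolding real_norm_def abs_mult power2_abs by linarith
 qed
qed (use assms in \<open>auto simp: L2_def\<close>)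

lemma Cauchy_Schwarz_L2:
 fixes f g :: "'a => real"
 assumes "f \<in> L2 M" "g \<in> L2 M"
 shows "(LINT x|M. f x * g x)^2 <= sqi M f * sqi M g"
 using integral_mult_sq_le[of M f g] L2_integrable_mult[OF assms] assms by (simp add: sqi_def L2_def)

lemma L2_const: "finite_measure M ==> (%x. c) \<in> L2 M"
 by (simp add: L2_def finite_measure.integrable_const)

lemma L2_integrable:
 assumes "finite_measure M" "f \<in> L2 M"
 shows "integrable M f"
proof (rule Bochner_Integration.integrable_bound[of M "%x. 1 + (norm (f x))^2"])
 show "AE x in M. norm (f x) <= norm (1 + (norm (f x))^2)"
 proof (rule AE_I2)
  fix x show "norm (f x) <= norm (1 + (norm (f x))^2)"
   using sum_squares_bound[of "norm (f x)" 1] norm_ge_zero[of "f x"] abs_ge_self[of "1 + (norm (f x))^2"]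
   unfolding real_norm_def power_one mult_1_right by linarith
 qed
 show "integrable M (%x. 1 + (norm (f x))^2)" using assms by (simp add: L2_def finite_measure.integrable_const)
qed (use assms in \<open>auto simp: L2_def\<close>)

lemma integral_sq_le_sqi:
 fixes f :: "'a => real"
 assumes "finite_measure M" "f \<in> L2 M"
 shows "(LINT x|M. f x)^2 <= measure M (space M) * sqi M f"
 using Cauchy_Schwarz_L2[OF assms(2) L2_const[OF assms(1), of 1]] by (simp add: sqi_def mult.commute)

lemma L2_bounded:
 assumes "finite_measure M" "f \<in> borel_measurable M" "!!x. x \<in> space M ==> norm (f x) <= B"
 shows "f \<in> L2 M" "sqi M f <= B^2 * measure M (space M)"
proof -
 have le: "x \<in> space M ==> (norm (f x))^2 <= B^2" for x using assms(3) by (intro power_mono) auto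
 show "f \<in> L2 M"
  unfolding L2_def using assms le
  by (auto intro!: finite_measure.integrable_const_bound[where B = "B^2"] AE_I2)
 thus "sqi M f <= B^2 * measure M (space M)"
  unfolding sqi_def using integral_mono[of M "%x. (norm (f x))^2" "%x. B^2"] le assms(1)
  by (auto simp: L2_integrable_sq finite_measure.integrable_const mult.commute)
qed

lemma sqi_cong_AE:
 assumes "f \<in> borel_measurable M" "g \<in> borel_measurable M" "AE x in M. f x = g x"
 shows "sqi M f = sqi M g"
 unfolding sqi_def using assms by (intro integral_cong_AE) auto

text \<open>Completeness of Lebesgue measure makes this work. It lets the chosen weak gradient
  inherit measurability and square integrability from any other one.\<close>

lemma lebesgue_on_measurable_cong_AE:
 fixes f g :: "pt => 'b::euclidean_space"
 assumes "Om \<in> sets lebesgue" "f \<in> borel_measurable (leb Om)" "AE x in leb Om. f x = g x"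
 shows "g \<in> borel_measurable (leb Om)"
proof -
 have "(%x. if x \<in> Om then f x else 0) \<in> borel_measurable lebesgue"
  using assms by (simp add: borel_measurable_if)
 moreover have "AE x in lebesgue. (if x \<in> Om then f x else 0) = (if x \<in> Om then g x else 0)"
  using assms(1,3) by (auto simp: AE_restrict_space_iff)
 ultimately have "(%x. if x \<in> Om then g x else 0) \<in> borel_measurable lebesgue"
  by (rule borel_measurable_AE)
 thus ?thesis using assms by (simp add: borel_measurable_if)
qed

lemma L2_cong_AE:
 fixes f g :: "pt => 'b::euclidean_space"
 assumes "Om \<in> sets lebesgue" "f \<in> L2 (leb Om)" "AE x in leb Om. f x = g x"
 shows "g \<in> L2 (leb Om)" "sqi (leb Om) g = sqi (leb Om) f"
proof -
 have g: "g \<in> borel_measurable (leb Om)"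
  using assms lebesgue_on_measurable_cong_AE by (auto simp: L2_def)
 have "AE x in leb Om. (norm (f x))^2 = (norm (g x))^2" using assms(3) by eventually_elim simp
 thus "g \<in> L2 (leb Om)"
  using assms(2) g integrable_cong_AE[of "%x. (norm (f x))^2" "leb Om" "%x. (norm (g x))^2"]
  by (auto simp: L2_def)
 show "sqi (leb Om) g = sqi (leb Om) f"
  using assms g by (intro sqi_cong_AE) (auto simp: L2_def)
qed

lemma L2_subset:
 fixes f :: "pt => 'b::euclidean_space"
 assumes "f \<in> L2 (leb T)" "S \<subseteq> T" "S \<in> sets lebesgue" "T \<in> sets lebesgue"
 shows "f \<in> L2 (leb S)" "sqi (leb S) f <= sqi (leb T) f"
proof -
 have m: "f \<in> borel_measurable (leb S)"
  using assms measurable_restrict_mono by (auto simp: L2_def)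
 have i: "integrable lebesgue (%x. indicator T x *\<^sub>R (norm (f x))^2)"
  using assms by (simp add: L2_def integrable_restrict_space)
 have eq: "indicator S x *\<^sub>R (indicator T x *\<^sub>R (norm (f x))^2) = indicator S x *\<^sub>R (norm (f x))^2" for x
  using assms(2) by (auto simp: indicator_def)
 have i2: "integrable lebesgue (%x. indicator S x *\<^sub>R (norm (f x))^2)"
  using integrable_mult_indicator[OF assms(3) i] unfolding eq .
 thus "f \<in> L2 (leb S)" using assms m by (simp add: L2_def integrable_restrict_space)
 show "sqi (leb S) f <= sqi (leb T) f"
  using assms i i2 by (auto simp: sqi_def integral_restrict_space indicator_def intro!: integral_mono)
qed

lemma L2_locally_integrable:
 assumes "f \<in> L2 (leb Om)" "open Om"
 shows "locally_integrable Om f"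
 unfolding locally_integrable_def
proof safe
 fix K assume K: "compact K" "K \<subseteq> Om"
 hence "finite_measure (leb K)" by (intro finite_measure_lebesgue_on lmeasurable_compact)
 moreover have "f \<in> L2 (leb K)"
  using L2_subset(1)[OF assms(1) K(2)] K(1) assms(2) by (simp add: compact_imp_closed)
 ultimately show "integrable (leb K) f" by (rule L2_integrable)
qed

text \<open>Riesz-Fischer: along a subsequence with geometrically small steps the steps are summable
  in L^1, as the measure is finite, so it converges almost everywhere; Fatou's lemma turns this into
  L^2 convergence of the whole sequence. Traces are obtained as such limits.\<close>

lemma L2_complete:
 fixes u :: "nat => 'a => real"
 assumes M: "finite_measure M" and u: "!!n. u n \<in> L2 M"
  and cau: "!!e. e > 0 ==> \<exists>N. \<forall>m\<ge>N. \<forall>n\<ge>N. sqi M (%x. u m x - u n x) < e"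
 obtains g where "g \<in> L2 M" "(%n. sqi M (%x. u n x - g x)) \<longlonglongrightarrow> 0"
proof -
 have "\<exists>r. strict_mono r \<and> (\<forall>k. \<forall>m\<ge>r k. \<forall>n\<ge>r k. sqi M (%x. u m x - u n x) < (1/4)^k)"
 proof -
  obtain N where N: "!!k. \<forall>m\<ge>N k. \<forall>n\<ge>N k. sqi M (%x. u m x - u n x) < (1/4)^k"
  proof -
   have "\<forall>k. \<exists>N. \<forall>m\<ge>N. \<forall>n\<ge>N. sqi M (%x. u m x - u n x) < (1/4)^k" by (intro allI cau) simp
   thus ?thesis using that by metis
  qed
  \<comment> \<open>Partial sums make \<open>r\<close> strictly increasing and at least
    \<open>N k\<close>.\<close>
  define r where "r k = (\<Sum>i\<le>k. N i + 1)" for k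
  have "strict_mono r" by (auto simp: strict_mono_Suc_iff r_def)
  moreover have "N k <= r k" for k unfolding r_def by (cases k) auto
  moreover have "\<forall>m\<ge>r k. \<forall>n\<ge>r k. sqi M (%x. u m x - u n x) < (1/4)^k" for k
   using N[of k] order_trans[OF \<open>N k <= r k\<close>] by blast
  ultimately show ?thesis by blast
 qed
 then obtain r where r: "strict_mono r" "!!k m n. m >= r k ==> n >= r k ==> sqi M (%x. u m x - u n x) < (1/4)^k"
  by blast
 define v where "v k = u (r k)" for k
 have v: "v k \<in> L2 M" for k using u by (simp add: v_def)
 have vm [measurable]: "v k \<in> borel_measurable M" for k using v by (simp add: L2_def)
 define D where "D k x = v (Suc k) x - v k x" for k x
 have D: "D k \<in> L2 M" for k unfolding D_def using v by (intro L2_diff)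
 have Dm [measurable]: "D k \<in> borel_measurable M" for k using D by (simp add: L2_def)
 have Dint: "integrable M (%x. \<bar>D k x\<bar>)" for k using L2_integrable[OF M D] by simp
 define mu where "mu = measure M (space M)"
 have Dbound: "(LINT x|M. \<bar>D k x\<bar>) <= sqrt mu * (1/2)^k" for k
 proof (rule power2_le_imp_le)
  have "(LINT x|M. \<bar>D k x\<bar>)^2 <= mu * sqi M (%x. \<bar>D k x\<bar>)"
   using integral_sq_le_sqi[OF M, of "%x. \<bar>D k x\<bar>"] D[of k] by (auto simp: mu_def L2_def)
  also have "sqi M (%x. \<bar>D k x\<bar>) <= (1/4)^k"
   using r(2)[of k "r (Suc k)" "r k"] strict_monoD[OF r(1), of k "Suc k"]
   by (simp add: sqi_def D_def v_def less_imp_le)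
  finally have "(LINT x|M. \<bar>D k x\<bar>)^2 <= mu * (1/4)^k" by (simp add: mu_def mult_left_mono)
  thus "(LINT x|M. \<bar>D k x\<bar>)^2 <= (sqrt mu * (1/2)^k)^2"
  proof -
   have "((1/2::real)^k)^2 = (1/4)^k" by (simp add: power2_eq_square flip: power_mult_distrib)
   thus ?thesis using \<open>(LINT x|M. \<bar>D k x\<bar>)^2 <= mu * (1/4)^k\<close> by (simp add: power_mult_distrib mu_def)
  qed
 qed (simp add: mu_def)
 have "(\<integral>\<^sup>+x. (\<Sum>k. ennreal \<bar>D k x\<bar>) \<partial>M) = (\<Sum>k. \<integral>\<^sup>+x. ennreal \<bar>D k x\<bar> \<partial>M)"
  by (intro nn_integral_suminf) measurable
 also have "... = (\<Sum>k. ennreal (LINT x|M. \<bar>D k x\<bar>))"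
  using Dint by (simp add: nn_integral_eq_integral)
 also have "... <= (\<Sum>k. ennreal (sqrt mu * (1/2)^k))"
  using Dbound by (intro suminf_le ennreal_leI) auto
 also have "... < \<infinity>"
  using summable_mult[OF complete_algebra_summable_geometric[of "1/2::real"], of "sqrt mu"]
  by (subst suminf_ennreal2) (auto simp: mu_def)
 finally have "AE x in M. (\<Sum>k. ennreal \<bar>D k x\<bar>) ~= \<infinity>"
  by (intro nn_integral_noteq_infinite) auto
 hence conv: "AE x in M. convergent (%k. v k x)"
 proof eventually_elim
  case (elim x)
  hence "summable (%k. \<bar>D k x\<bar>)" by (intro summable_suminf_not_top) auto
  hence "summable (%k. D k x)" by (rule summable_rabs_cancel)
  hence "convergent (%n. \<Sum>k<n. D k x)" by (simp add: summable_iff_convergent)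
  moreover have "(\<Sum>k<n. D k x) = v n x - v 0 x" for n
   by (induction n) (auto simp: D_def)
  ultimately have "convergent (%n. v n x - v 0 x + v 0 x)"
   by (intro convergent_add) (auto simp: convergent_const)
  thus ?case by simp
 qed
 define g where "g x = lim (%k. v k x)" for x
 have gm [measurable]: "g \<in> borel_measurable M" unfolding g_def by (rule borel_measurable_lim_metric) auto
 have lim: "AE x in M. (%k. v k x) \<longlonglongrightarrow> g x"
  using conv by eventually_elim (simp add: g_def convergent_LIMSEQ_iff)
 \<comment> \<open>Fatou's lemma in the second function only: \<open>u n\<close> stays fixed while
   \<open>v j\<close> runs to its limit.\<close>
 have fatou: "(\<integral>\<^sup>+x. ennreal ((u n x - g x)^2) \<partial>M) <= ennreal ((1/4)^k)" if n: "n >= r k" for n k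
 proof -
  have un [measurable]: "u n \<in> borel_measurable M" using u by (simp add: L2_def)
  have "AE x in M. ennreal ((u n x - g x)^2) = liminf (%j. ennreal ((u n x - v j x)^2))"
   using lim
  proof eventually_elim
   case (elim x)
   hence "(%j. ennreal ((u n x - v j x)^2)) \<longlonglongrightarrow> ennreal ((u n x - g x)^2)"
    by (intro tendsto_intros)
   thus ?case by (rule lim_imp_Liminf[symmetric, rotated]) simp
  qed
  hence "(\<integral>\<^sup>+x. ennreal ((u n x - g x)^2) \<partial>M) = (\<integral>\<^sup>+x. liminf (%j. ennreal ((u n x - v j x)^2)) \<partial>M)"
   by (intro nn_integral_cong_AE)
  also have "... <= liminf (%j. \<integral>\<^sup>+x. ennreal ((u n x - v j x)^2) \<partial>M)"
   by (intro nn_integral_liminf) auto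
  also have "... <= ennreal ((1/4)^k)"
  proof -
   have "\<forall>\<^sub>F j in sequentially. (\<integral>\<^sup>+x. ennreal ((u n x - v j x)^2) \<partial>M) <= ennreal ((1/4)^k)"
    using eventually_ge_at_top[of k]
   proof eventually_elim
    case (elim j)
    have "r k <= r j" using elim r(1) strict_mono_less_eq by blast
    hence "sqi M (%x. u n x - v j x) <= (1/4)^k"
     using r(2)[of k n "r j"] n by (simp add: v_def less_imp_le)
    thus ?case
     using L2_integrable_sq[OF L2_diff[OF u[of n] v[of j]]]
     by (simp add: nn_integral_eq_integral sqi_def ennreal_leI)
   qed
   thus ?thesis by (intro Liminf_le) auto
  qed
  finally show ?thesis .
 qed
 have gL: "g \<in> L2 M"
 proof -
  have "integrable M (%x. (u (r 0) x - g x)^2)"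
   using fatou[of 0 "r 0"] u[of "r 0"] by (intro integrableI_bounded) (auto simp: L2_def top.not_eq_extremum intro: le_less_trans)
  hence "(%x. u (r 0) x - g x) \<in> L2 M" using u[of "r 0"] gm by (auto simp: L2_def)
  from L2_diff[OF u[of "r 0"] this] show ?thesis by simp
 qed
 moreover have "(%n. sqi M (%x. u n x - g x)) \<longlonglongrightarrow> 0"
 proof (rule LIMSEQ_I)
  fix e :: real assume "0 < e"
  then obtain k where k: "(1/4::real)^k < e" using real_arch_pow_inv[of e "1/4"] by auto
  have "sqi M (%x. u n x - g x) <= (1/4)^k" if "n >= r k" for n
   using fatou[OF that] L2_integrable_sq[OF L2_diff[OF u[of n] gL]]
   by (simp add: nn_integral_eq_integral sqi_def)
  thus "\<exists>no. \<forall>n\<ge>no. norm (sqi M (%x. u n x - g x) - 0) < e"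
   using k by (intro exI[of _ "r k"]) (auto intro: le_less_trans)
 qed
 ultimately show ?thesis using that by blast
qed

section \<open>Weak gradients\<close>

lemma is_weak_gradient_weak_grad: "is_weak_gradient Om f g ==> is_weak_gradient Om f (weak_grad Om f)"
 unfolding weak_grad_def by (rule someI[of "is_weak_gradient Om f"])

lemma weak_grad_AE: "open Om ==> is_weak_gradient Om f g ==> AE x in leb Om. weak_grad Om f x = g x"
 using weak_gradient_unique is_weak_gradient_weak_grad by blast

lemma H1D:
 assumes "f \<in> H1 Om" "open Om"
 shows "f \<in> L2 (leb Om)" "weak_grad Om f \<in> L2 (leb Om)" "is_weak_gradient Om f (weak_grad Om f)"
proof -
 obtain g where g: "is_weak_gradient Om f g" "g \<in> L2 (leb Om)" and "f \<in> L2 (leb Om)"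
  using assms by (auto simp: H1_def)
 moreover have "AE x in leb Om. g x = weak_grad Om f x"
  using weak_grad_AE[OF assms(2) g(1)] by eventually_elim simp
 ultimately show "f \<in> L2 (leb Om)" "weak_grad Om f \<in> L2 (leb Om)" "is_weak_gradient Om f (weak_grad Om f)"
  using L2_cong_AE(1)[of Om g "weak_grad Om f"] assms(2) is_weak_gradient_weak_grad by auto
qed

lemma is_weak_gradient_diff:
 assumes "open Om" "is_weak_gradient Om f g" "is_weak_gradient Om f' g'"
 shows "is_weak_gradient Om (%x. f x - f' x) (%x. g x - g' x)"
proof -
 have l: "locally_integrable Om f" "locally_integrable Om g" "locally_integrable Om f'" "locally_integrable Om g'"
  using assms by (auto simp: is_weak_gradient_def)
 show ?thesis
  unfolding is_weak_gradient_def
 proof (intro conjI ballI allI)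
  show "locally_integrable Om (%x. f x - f' x)" "locally_integrable Om (%x. g x - g' x)"
   using l by (auto simp: locally_integrable_def)
  fix phi i assume phi: "phi \<in> test_functions Om"
  have "(LINT x|leb Om. (f x - f' x) * partial i phi x) =
    (LINT x|leb Om. f x * partial i phi x) - (LINT x|leb Om. f' x * partial i phi x)"
   using integrable_test_mult[OF _ assms(1) phi] l by (simp add: left_diff_distrib)
  also have "... = - (LINT x|leb Om. g x $ i * phi x) + (LINT x|leb Om. g' x $ i * phi x)"
   using assms phi by (simp add: is_weak_gradient_def)
  also have "... = - (LINT x|leb Om. (g x - g' x) $ i * phi x)"
   using integrable_test_mult(1)[OF locally_integrable_nth assms(1) phi, OF l(2), of i]
    integrable_test_mult(1)[OF locally_integrable_nth assms(1) phi, OF l(4), of i]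
   by (simp add: left_diff_distrib)
  finally show "(LINT x|leb Om. (f x - f' x) * partial i phi x) = - (LINT x|leb Om. (g x - g' x) $ i * phi x)" .
 qed
qed

lemma H1_diff:
 assumes "open Om" "f \<in> H1 Om" "f' \<in> H1 Om"
 shows "(%x. f x - f' x) \<in> H1 Om"
  "AE x in leb Om. weak_grad Om (%x. f x - f' x) x = weak_grad Om f x - weak_grad Om f' x"
proof -
 note w = is_weak_gradient_diff[OF assms(1) H1D(3)[OF assms(2,1)] H1D(3)[OF assms(3,1)]]
 show "(%x. f x - f' x) \<in> H1 Om"
  using w H1D[OF assms(2,1)] H1D[OF assms(3,1)] by (auto simp: H1_def intro!: L2_diff)
 show "AE x in leb Om. weak_grad Om (%x. f x - f' x) x = weak_grad Om f x - weak_grad Om f' x"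
  using weak_grad_AE[OF assms(1) w] .
qed

section \<open>Affine changes of variables in the plane\<close>

text \<open>The determinant with columns u and v; its modulus is twice the area of the triangle they
  span.\<close>

definition cross2 :: "pt => pt => real" where
 "cross2 u v = u $ 1 * v $ 2 - u $ 2 * v $ 1"

lemma Basis_pt: "(Basis :: pt set) = {axis 1 1, axis 2 1}" and axis_pt: "axis 1 (1::real) ~= (axis 2 1 :: pt)"
proof -
 show "(Basis :: pt set) = {axis 1 1, axis 2 1}"
  by (auto simp: Basis_vec_def) (metis exhaust_2)
 show "axis 1 (1::real) ~= (axis 2 1 :: pt)" by (simp add: axis_eq_axis)
qed

lemma prod_Basis_pt: "(\<Prod>b\<in>Basis. (w::pt) \<bullet> b) = w $ 1 * w $ 2"
 using axis_pt by (simp add: Basis_pt inner_axis)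

text \<open>Iterated integrals over the coordinates need the plane as a product measure; comparing
  the two measures on boxes suffices.\<close>

lemma lborel_pt: "(lborel :: pt measure) = distr (lborel \<Otimes>\<^sub>M lborel) borel (%(s, t). vector [s, t])"
proof (rule lborel_eqI)
 have meas: "(%(s, t). vector [s, t] :: pt) \<in> borel_measurable (lborel \<Otimes>\<^sub>M lborel)"
 proof -
  have "continuous_on UNIV (%p::real \<times> real. vector [fst p, snd p] :: pt)"
   by (subst continuous_on_componentwise) (auto simp: Basis_pt inner_axis intro!: continuous_intros)
  from borel_measurable_continuous_onI[OF this] show ?thesis
   by (simp add: borel_prod case_prod_beta' lborel_prod)
 qed
 fix l u :: pt assume lu: "!!b. b \<in> Basis ==> l \<bullet> b <= u \<bullet> b"
 have le: "l $ 1 <= u $ 1" "l $ 2 <= u $ 2"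
  using lu[of "axis 1 1"] lu[of "axis 2 1"] by (simp_all add: Basis_pt inner_axis)
 have "emeasure (distr (lborel \<Otimes>\<^sub>M lborel) borel (%(s, t). vector [s, t])) (box l u) =
   emeasure (lborel \<Otimes>\<^sub>M lborel) ((%(s, t). vector [s, t]) -` box l u \<inter> space (lborel \<Otimes>\<^sub>M lborel))"
  by (rule emeasure_distr[OF meas]) auto
 also have "(%(s, t). vector [s, t]) -` box l u \<inter> space (lborel \<Otimes>\<^sub>M lborel) = {l$1<..<u$1} \<times> {l$2<..<u$2}"
  by (auto simp: mem_box_cart forall_2 space_pair_measure)
 also have "emeasure (lborel \<Otimes>\<^sub>M lborel) ({l$1<..<u$1} \<times> {l$2<..<u$2}) = ennreal ((u - l) $ 1) * ennreal ((u - l) $ 2)"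
  using le by (subst lborel.emeasure_pair_measure_Times) auto
 also have "... = (\<Prod>b\<in>Basis. (u - l) \<bullet> b)"
  using le by (simp add: prod_Basis_pt ennreal_mult[symmetric])
 finally show "emeasure (distr (lborel \<Otimes>\<^sub>M lborel) borel (%(s, t). vector [s, t])) (box l u) = (\<Prod>b\<in>Basis. (u - l) \<bullet> b)" .
qed simp

lemma nn_integral_pt:
 assumes [measurable]: "f \<in> borel_measurable (borel :: pt measure)"
 shows "(\<integral>\<^sup>+s. \<integral>\<^sup>+t. f (vector [s, t]) \<partial>lborel \<partial>lborel) = (\<integral>\<^sup>+x. f x \<partial>lborel)"
proof -
 have meas: "(%p. vector [fst p, snd p] :: pt) \<in> borel_measurable (lborel \<Otimes>\<^sub>M lborel)"
 proof -
  have "continuous_on UNIV (%p::real \<times> real. vector [fst p, snd p] :: pt)"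
   by (subst continuous_on_componentwise) (auto simp: Basis_pt inner_axis intro!: continuous_intros)
  from borel_measurable_continuous_onI[OF this] show ?thesis
   by (simp add: borel_prod lborel_prod)
 qed
 have "(\<integral>\<^sup>+x. f x \<partial>lborel) = (\<integral>\<^sup>+p. f (vector [fst p, snd p]) \<partial>(lborel \<Otimes>\<^sub>M lborel))"
  by (subst lborel_pt, subst nn_integral_distr) (use meas in \<open>auto simp: case_prod_beta'\<close>)
 also have "... = (\<integral>\<^sup>+s. \<integral>\<^sup>+t. f (vector [s, t]) \<partial>lborel \<partial>lborel)"
  using measurable_compose[OF meas assms] by (subst lborel.nn_integral_fst[symmetric]) auto
 finally show ?thesis ..
qed

text \<open>By uniqueness of Lebesgue measure it is enough to measure preimages of boxes, which are
  images of translated boxes under the inverse linear map, of determinant 1 /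
  \<open>cross2 p q\<close>.\<close>

lemma nn_integral_affine_pt:
 assumes f: "f \<in> borel_measurable (borel :: pt measure)" and c: "cross2 p q ~= 0"
 shows "ennreal \<bar>cross2 p q\<bar> * (\<integral>\<^sup>+x. f (a + x $ 1 *\<^sub>R p + x $ 2 *\<^sub>R q) \<partial>(lborel :: pt measure)) = (\<integral>\<^sup>+x. f x \<partial>lborel)"
proof -
 define L where "L x = x $ 1 *\<^sub>R p + x $ 2 *\<^sub>R q" for x :: pt
 define L' where "L' y = (vector [cross2 y q / cross2 p q, cross2 p y / cross2 p q] :: pt)" for y
 have LL': "L (L' y) = y" for y
  using c by (simp add: L_def L'_def vec_eq_iff forall_2 field_simps) (simp add: cross2_def field_simps)
 have L'L: "L' (L x) = x" for x
  using c by (simp add: L_def L'_def vec_eq_iff forall_2 field_simps) (simp add: cross2_def field_simps)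
 have lin: "linear L'"
  by (rule linearI) (auto simp: L'_def vec_eq_iff forall_2 cross2_def algebra_simps add_divide_distrib diff_divide_distrib)
 have det: "det (matrix L') = 1 / cross2 p q"
  using c by (simp add: det_2 matrix_def L'_def cross2_def axis_def divide_simps)
 have contL: "continuous_on UNIV (%x. a + L x)" unfolding L_def by (intro continuous_intros)
 hence mL: "(%x. a + L x) \<in> borel_measurable borel" by (rule borel_measurable_continuous_onI)
 have eq: "lborel = density (distr lborel borel (%x. a + L x)) (%_. ennreal \<bar>cross2 p q\<bar>)"
 proof (rule lborel_eqI)
  fix l u :: pt assume lu: "!!b. b \<in> Basis ==> l \<bullet> b <= u \<bullet> b"
  have le: "l $ 1 <= u $ 1" "l $ 2 <= u $ 2"
  using lu[of "axis 1 1"] lu[of "axis 2 1"] by (simp_all add: Basis_pt inner_axis)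
  let ?V = "(%x. a + L x) -` box l u"
  have V: "?V = L' ` ((+) (- a) ` box l u)"
  proof (intro set_eqI iffI)
   fix x assume "x \<in> ?V"
   thus "x \<in> L' ` ((+) (- a) ` box l u)"
    using L'L[of x] by (intro image_eqI[of x L' "- a + (a + L x)"] imageI) auto
  qed (auto simp: LL')
  have lm: "(+) (- a) ` box l u \<in> lmeasurable" by (intro measurable_translation lmeasurable_box)
  have Vo: "open ?V" using continuous_on_open_vimage[OF open_UNIV] contL by auto
  have "measure lebesgue ?V = \<bar>det (matrix L')\<bar> * measure lebesgue ((+) (- a) ` box l u)"
   unfolding V by (rule measure_linear_image[OF lin lm])
  also have "measure lebesgue ((+) (- a) ` box l u) = measure lborel (box l u)"
   using measure_translation[of "- a" "box l u"] by simp
  finally have m: "\<bar>cross2 p q\<bar> * measure lebesgue ?V = measure lborel (box l u)"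
   using c by (simp add: det)
  have "?V \<in> lmeasurable" unfolding V by (rule measurable_linear_image[OF lin lm])
  hence "emeasure lebesgue ?V = ennreal (measure lebesgue ?V)" by (rule emeasure_eq_measure2)
  hence "emeasure lborel ?V = ennreal (measure lebesgue ?V)"
   using Vo emeasure_completion[of ?V lborel] by simp
  hence "ennreal \<bar>cross2 p q\<bar> * emeasure lborel ?V = ennreal (measure lborel (box l u))"
   using m by (simp add: ennreal_mult[symmetric])
  also have "... = emeasure lborel (box l u)"
   using lu by (simp add: emeasure_lborel_box measure_lborel_box)
  finally show "emeasure (density (distr lborel borel (%x. a + L x)) (%_. ennreal \<bar>cross2 p q\<bar>)) (box l u) =
    (\<Prod>b\<in>Basis. (u - l) \<bullet> b)"
   using mL lu by (simp add: emeasure_density_const emeasure_distr emeasure_lborel_box)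
 qed simp
 have "(\<integral>\<^sup>+x. f x \<partial>lborel) = (\<integral>\<^sup>+x. f x \<partial>density (distr lborel borel (%x. a + L x)) (%_. ennreal \<bar>cross2 p q\<bar>))"
  using eq by metis
 also have "... = ennreal \<bar>cross2 p q\<bar> * (\<integral>\<^sup>+x. f (a + L x) \<partial>lborel)"
  using f mL measurable_compose[OF mL f]
  by (subst nn_integral_density, simp, simp, subst nn_integral_distr, simp, simp, subst nn_integral_cmult) auto
 finally show ?thesis by (simp add: L_def add.assoc)
qed

lemma nn_integral_parallelogram:
 assumes f: "f \<in> borel_measurable (borel :: pt measure)" and c: "cross2 p q ~= 0"
 shows "ennreal \<bar>cross2 p q\<bar> * (\<integral>\<^sup>+s. \<integral>\<^sup>+t. f (a + s *\<^sub>R p + t *\<^sub>R q) \<partial>lborel \<partial>lborel) = (\<integral>\<^sup>+x. f x \<partial>lborel)"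
proof -
 have "continuous_on UNIV (%x::pt. a + x $ 1 *\<^sub>R p + x $ 2 *\<^sub>R q)" by (intro continuous_intros)
 from measurable_compose[OF borel_measurable_continuous_onI[OF this] f]
 have "(\<integral>\<^sup>+s. \<integral>\<^sup>+t. f (a + s *\<^sub>R p + t *\<^sub>R q) \<partial>lborel \<partial>lborel) = (\<integral>\<^sup>+x. f (a + x $ 1 *\<^sub>R p + x $ 2 *\<^sub>R q) \<partial>(lborel :: pt measure))"
  using nn_integral_pt[of "%x. f (a + x $ 1 *\<^sub>R p + x $ 2 *\<^sub>R q)"] by simp
 thus ?thesis using nn_integral_affine_pt[OF f c] by simp
qed

lemma nn_integral_scale_pt:
 assumes f: "f \<in> borel_measurable (borel :: pt measure)" and c: "c ~= 0"
 shows "ennreal (c^2) * (\<integral>\<^sup>+x. f (a + c *\<^sub>R x) \<partial>lborel) = (\<integral>\<^sup>+x. f x \<partial>lborel)"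
proof -
 have "x $ 1 *\<^sub>R axis 1 c + x $ 2 *\<^sub>R axis 2 c = c *\<^sub>R x" for x :: pt
  by (simp add: vec_eq_iff forall_2 axis_def)
 moreover have "cross2 (axis 1 c) (axis 2 c) = c^2" by (simp add: cross2_def axis_def power2_eq_square)
 ultimately show ?thesis using nn_integral_affine_pt[OF f, of "axis 1 c" "axis 2 c" a] c by (simp add: add.assoc)
qed

section \<open>Poincare and trace inequalities for continuously differentiable functions\<close>

text \<open>Cauchy-Schwarz in the fundamental theorem of calculus. The right side does not depend on
  \<open>tau\<close>, so it can be integrated over further variables.\<close>

lemma increment_sq_le:
 fixes phi phi' :: "real => real"
 assumes d: "!!t. t \<in> {0..T} ==> (phi has_real_derivative phi' t) (at t within {0..T})"
  and c: "continuous_on {0..T} phi'" and tau: "0 <= tau" "tau <= T"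
 shows "ennreal ((phi tau - phi 0)^2) <= ennreal T * (\<integral>\<^sup>+t. ennreal ((phi' t)^2) * indicator {0..T} t \<partial>lborel)"
proof -
 let ?M = "leb {0..tau}"
 have c': "continuous_on {0..tau} phi'" using c tau by (auto intro: continuous_on_subset)
 have fm: "finite_measure ?M" by (intro finite_measure_lebesgue_on) auto
 have L: "phi' \<in> L2 ?M"
  using c' by (auto simp: L2_def intro!: continuous_imp_measurable_on_sets_lebesgue continuous_imp_integrable_real continuous_intros)
 have "(phi' has_integral (phi tau - phi 0)) {0..tau}"
 proof (rule fundamental_theorem_of_calculus[OF tau(1)])
  fix x assume "x \<in> {0..tau}"
  thus "(phi has_vector_derivative phi' x) (at x within {0..tau})"
   using d[of x] tau by (auto simp: has_real_derivative_iff_has_vector_derivative intro: has_vector_derivative_within_subset)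
 qed
 moreover have "(phi' has_integral (LINT t|?M. phi' t)) {0..tau}"
  using L2_integrable[OF fm L] by (intro has_integral_integral_lebesgue_on) auto
 ultimately have "phi tau - phi 0 = (LINT t|?M. phi' t)" by (rule has_integral_unique)
 hence "(phi tau - phi 0)^2 <= measure ?M (space ?M) * sqi ?M phi'"
  using integral_sq_le_sqi[OF fm L] by simp
 also have "measure ?M (space ?M) = tau" using tau by (simp add: measure_restrict_space)
 also have "tau * sqi ?M phi' <= T * sqi ?M phi'" using tau by (intro mult_right_mono) auto
 finally have 1: "ennreal ((phi tau - phi 0)^2) <= ennreal T * ennreal (sqi ?M phi')"
  using tau by (simp add: ennreal_mult[symmetric] ennreal_leI)
 have "ennreal (sqi ?M phi') = (\<integral>\<^sup>+t. ennreal ((phi' t)^2) \<partial>?M)"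
  using L2_integrable_sq[OF L] by (simp add: sqi_def nn_integral_eq_integral)
 also have "... = (\<integral>\<^sup>+t. ennreal ((phi' t)^2) * indicator {0..tau} t \<partial>lebesgue)"
  by (rule nn_integral_restrict_space) auto
 also have "... = (\<integral>\<^sup>+t. ennreal ((phi' t)^2) * indicator {0..tau} t \<partial>lborel)"
  by (rule nn_integral_completion)
 also have "... <= (\<integral>\<^sup>+t. ennreal ((phi' t)^2) * indicator {0..T} t \<partial>lborel)"
  using tau by (intro nn_integral_mono) (auto simp: indicator_def)
 finally have 2: "ennreal (sqi ?M phi') <= (\<integral>\<^sup>+t. ennreal ((phi' t)^2) * indicator {0..T} t \<partial>lborel)" .
 show ?thesis by (rule order_trans[OF 1 mult_left_mono[OF 2]]) simp
qed

text \<open>Derivatives within K, up to its boundary: on the interfaces between elements a piecewise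
  C^1 function has no more than these.\<close>

definition C1_on :: "pt set => (pt => real) => (pt => pt) => bool" where
 "C1_on K v G \<longleftrightarrow> continuous_on K G \<and> (\<forall>x\<in>K. (v has_derivative (%d. G x \<bullet> d)) (at x within K))"

lemma C1_on_continuous: "C1_on K v G ==> continuous_on K v"
 by (auto simp: C1_on_def continuous_on_eq_continuous_within intro: has_derivative_continuous)

lemma C1_on_segment:
 assumes C: "C1_on K v G" and seg: "!!t. t \<in> {0..T} ==> x + t *\<^sub>R d \<in> K" and tau: "0 <= tau" "tau <= T"
 shows "ennreal ((v (x + tau *\<^sub>R d) - v x)^2) <=
  ennreal (T * (norm d)^2) * (\<integral>\<^sup>+t. ennreal ((norm (G (x + t *\<^sub>R d)))^2) * indicator {0..T} t \<partial>lborel)"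
proof -
 let ?gamma = "%t. x + t *\<^sub>R d"
 have cg: "continuous_on {0..T} ?gamma" by (intro continuous_intros)
 have im: "?gamma ` {0..T} \<subseteq> K" using seg by auto
 have cG: "continuous_on {0..T} (%t. G (?gamma t))"
  using C im by (auto simp: C1_on_def intro: continuous_on_compose2[OF _ cg])
 have "ennreal ((v (?gamma tau) - v (?gamma 0))^2) <= ennreal T * (\<integral>\<^sup>+t. ennreal ((G (?gamma t) \<bullet> d)^2) * indicator {0..T} t \<partial>lborel)"
 proof (rule increment_sq_le[where phi = "%t. v (?gamma t)" and phi' = "%t. G (?gamma t) \<bullet> d"])
  fix t assume t: "t \<in> {0..T}"
  have "(?gamma has_derivative (%h. h *\<^sub>R d)) (at t within {0..T})" by (auto intro!: derivative_eq_intros)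
  moreover have "(v has_derivative (%e. G (?gamma t) \<bullet> e)) (at (?gamma t) within ?gamma ` {0..T})"
   using C seg[OF t] im by (auto simp: C1_on_def intro: has_derivative_subset)
  ultimately have "((%t. v (?gamma t)) has_derivative (%h. G (?gamma t) \<bullet> (h *\<^sub>R d))) (at t within {0..T})"
   by (rule has_derivative_in_compose)
  thus "((%t. v (?gamma t)) has_real_derivative G (?gamma t) \<bullet> d) (at t within {0..T})"
   by (simp add: has_field_derivative_def mult.commute[of _ "G (?gamma t) \<bullet> d"] inner_scaleR_right)
 qed (use cG tau in \<open>auto intro!: continuous_intros\<close>)
 also have "(\<integral>\<^sup>+t. ennreal ((G (?gamma t) \<bullet> d)^2) * indicator {0..T} t \<partial>lborel) <=
   (\<integral>\<^sup>+t. ennreal ((norm d)^2) * (ennreal ((norm (G (?gamma t)))^2) * indicator {0..T} t) \<partial>lborel)"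
 proof (rule nn_integral_mono)
  fix t
  have "(G (?gamma t) \<bullet> d)^2 <= (norm d)^2 * (norm (G (?gamma t)))^2"
   using Cauchy_Schwarz_ineq[of "G (?gamma t)" d] by (simp add: power2_norm_eq_inner mult.commute)
  thus "ennreal ((G (?gamma t) \<bullet> d)^2) * indicator {0..T} t <= ennreal ((norm d)^2) * (ennreal ((norm (G (?gamma t)))^2) * indicator {0..T} t)"
   by (auto simp: indicator_def ennreal_mult[symmetric] ennreal_leI)
 qed
 also have "... = ennreal ((norm d)^2) * (\<integral>\<^sup>+t. ennreal ((norm (G (?gamma t)))^2) * indicator {0..T} t \<partial>lborel)"
 proof (rule nn_integral_cmult)
  have "(%t. indicator {0..T} t *\<^sub>R (norm (G (?gamma t)))^2) \<in> borel_measurable borel"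
   by (intro borel_measurable_continuous_on_indicator continuous_intros cG) auto
  hence "(%t. ennreal (indicator {0..T} t *\<^sub>R (norm (G (?gamma t)))^2)) \<in> borel_measurable lborel" by simp
  thus "(%t. ennreal ((norm (G (?gamma t)))^2) * indicator {0..T} t) \<in> borel_measurable lborel"
   by (rule measurable_cong[THEN iffD1, rotated]) (auto simp: indicator_def)
 qed
 finally show ?thesis using tau by (simp add: ennreal_mult mult.assoc mult_left_mono)
qed

lemma measurable_indicator_continuous:
 fixes f :: "pt => real"
 assumes "continuous_on K f" "compact K"
 shows "(%x. ennreal (f x) * indicator K x) \<in> borel_measurable borel"
proof -
 have "(%x. ennreal (indicator K x *\<^sub>R f x)) \<in> borel_measurable borel"
  using borel_measurable_continuous_on_indicator[OF _ assms(1)] compact_imp_closed[OF assms(2)] by simp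
 thus ?thesis by (rule measurable_cong[THEN iffD1, rotated]) (auto simp: indicator_def)
qed

lemma compact_finite_measure: "compact K ==> finite_measure (leb K)"
 by (intro finite_measure_lebesgue_on lmeasurable_compact)

lemma L2_continuous_compact:
 fixes f :: "pt => 'b::euclidean_space"
 assumes "continuous_on K f" "compact K"
 shows "f \<in> L2 (leb K)"
proof -
 have "bounded (f ` K)" using assms compact_continuous_image compact_imp_bounded by blast
 then obtain B where "!!x. x \<in> K ==> norm (f x) <= B" by (auto simp: bounded_iff)
 moreover have "f \<in> borel_measurable (leb K)"
  using assms by (intro continuous_imp_measurable_on_sets_lebesgue) (auto simp: compact_imp_closed)
 ultimately show ?thesis using L2_bounded(1)[OF compact_finite_measure[OF assms(2)], of f B] by simp
qed

lemma nn_integral_sqi: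
 fixes f :: "pt => 'b::euclidean_space"
 assumes "continuous_on K f" "compact K"
 shows "(\<integral>\<^sup>+x. ennreal ((norm (f x))^2) * indicator K x \<partial>lborel) = ennreal (sqi (leb K) f)"
proof -
 have "ennreal (sqi (leb K) f) = (\<integral>\<^sup>+x. ennreal ((norm (f x))^2) \<partial>leb K)"
  using L2_integrable_sq[OF L2_continuous_compact[OF assms]] by (simp add: sqi_def nn_integral_eq_integral)
 also have "... = (\<integral>\<^sup>+x. ennreal ((norm (f x))^2) * indicator K x \<partial>lebesgue)"
  using assms(2) by (intro nn_integral_restrict_space) (simp add: compact_imp_closed)
 also have "... = (\<integral>\<^sup>+x. ennreal ((norm (f x))^2) * indicator K x \<partial>lborel)"
  by (rule nn_integral_completion)
 finally show ?thesis ..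
qed

text \<open>The increment is integrated along the segment from x to y. The point x + t (y - x) is a
  dilation of y by t and of x by 1 - t; one of these factors is at least 1/2, and substituting in
  that variable costs a Jacobian of at most 4.\<close>

lemma poincare_double:
 assumes K: "compact K" "convex K" and D: "!!x y. x \<in> K ==> y \<in> K ==> norm (y - x) <= D" "D >= 0" and C: "C1_on K v G"
 shows "(\<integral>\<^sup>+x. \<integral>\<^sup>+y. ennreal ((v y - v x)^2) * indicator K y * indicator K x \<partial>lborel \<partial>lborel) <=
  ennreal (4 * D^2 * measure lebesgue K * sqi (leb K) G)"
proof -
 define F where "F x = ennreal ((norm (G x))^2) * indicator K x" for x
 have cG: "continuous_on K G" using C by (simp add: C1_on_def)
 have F [measurable]: "F \<in> borel_measurable borel"
  unfolding F_def using K cG by (intro measurable_indicator_continuous continuous_intros)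
 have Km [measurable]: "K \<in> sets borel" using K(1) by (simp add: compact_imp_closed)
 have FI: "(\<integral>\<^sup>+x. F x \<partial>lborel) = ennreal (sqi (leb K) G)"
  unfolding F_def by (rule nn_integral_sqi[OF cG K(1)])
 have KI: "(\<integral>\<^sup>+x. indicator K x \<partial>lborel) = ennreal (measure lebesgue K)"
  using emeasure_compact_finite[OF K(1)] K(1)
  by (subst nn_integral_indicator) (auto simp: emeasure_eq_ennreal_measure compact_imp_closed)
 have half: "(\<integral>\<^sup>+y. F (x + t *\<^sub>R (y - x)) * indicator K y \<partial>lborel) <= 4 * (\<integral>\<^sup>+x. F x \<partial>lborel)"
  if t: "1/2 <= t" for t x
 proof -
  have t0: "t ~= 0" using t by auto
  have "x + t *\<^sub>R (y - x) = (1 - t) *\<^sub>R x + t *\<^sub>R y" for y by (simp add: algebra_simps)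
  hence "(\<integral>\<^sup>+y. F (x + t *\<^sub>R (y - x)) * indicator K y \<partial>lborel) <= (\<integral>\<^sup>+y. F ((1 - t) *\<^sub>R x + t *\<^sub>R y) \<partial>lborel)"
   by (intro nn_integral_mono) (auto simp: indicator_def)
  also have "... = 1 * (\<integral>\<^sup>+y. F ((1 - t) *\<^sub>R x + t *\<^sub>R y) \<partial>lborel)" by simp
  also have "... <= ennreal (4 * t^2) * (\<integral>\<^sup>+y. F ((1 - t) *\<^sub>R x + t *\<^sub>R y) \<partial>lborel)"
  proof (rule mult_right_mono)
   have "(1/2)^2 <= t^2" using t by (intro power_mono) auto
   thus "1 <= ennreal (4 * t^2)" by (simp add: power2_eq_square flip: ennreal_1)
  qed simp
  also have "... = 4 * (ennreal (t^2) * (\<integral>\<^sup>+y. F ((1 - t) *\<^sub>R x + t *\<^sub>R y) \<partial>lborel))"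
   by (simp add: ennreal_mult mult.assoc)
  also have "... = 4 * (\<integral>\<^sup>+x. F x \<partial>lborel)" by (subst nn_integral_scale_pt[OF F t0]) simp
  finally show ?thesis .
 qed
 have It: "(\<integral>\<^sup>+x. \<integral>\<^sup>+y. F (x + t *\<^sub>R (y - x)) * indicator K y * indicator K x \<partial>lborel \<partial>lborel) <=
   4 * (\<integral>\<^sup>+x. F x \<partial>lborel) * ennreal (measure lebesgue K)" if t: "t \<in> {0..1}" for t
 proof (cases "1/2 <= t")
  case True
  have "(\<integral>\<^sup>+x. \<integral>\<^sup>+y. F (x + t *\<^sub>R (y - x)) * indicator K y * indicator K x \<partial>lborel \<partial>lborel) =
    (\<integral>\<^sup>+x. (\<integral>\<^sup>+y. F (x + t *\<^sub>R (y - x)) * indicator K y \<partial>lborel) * indicator K x \<partial>lborel)"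
   by (intro nn_integral_cong nn_integral_multc) measurable
  also have "... <= (\<integral>\<^sup>+x. 4 * (\<integral>\<^sup>+x. F x \<partial>lborel) * indicator K x \<partial>lborel)"
   by (intro nn_integral_mono mult_right_mono half True) auto
  finally show ?thesis by (simp add: nn_integral_cmult KI)
 next
  case False
  have "(\<integral>\<^sup>+x. \<integral>\<^sup>+y. F (x + t *\<^sub>R (y - x)) * indicator K y * indicator K x \<partial>lborel \<partial>lborel) =
    (\<integral>\<^sup>+y. \<integral>\<^sup>+x. F (x + t *\<^sub>R (y - x)) * indicator K y * indicator K x \<partial>lborel \<partial>lborel)"
   by (rule lborel_pair.Fubini') measurable
  also have "... = (\<integral>\<^sup>+y. (\<integral>\<^sup>+x. F (y + (1 - t) *\<^sub>R (x - y)) * indicator K x \<partial>lborel) * indicator K y \<partial>lborel)"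
  proof (rule nn_integral_cong)
   fix y
   have "(\<integral>\<^sup>+x. F (x + t *\<^sub>R (y - x)) * indicator K y * indicator K x \<partial>lborel) =
     (\<integral>\<^sup>+x. (F (y + (1 - t) *\<^sub>R (x - y)) * indicator K x) * indicator K y \<partial>lborel)"
    by (intro nn_integral_cong) (simp add: algebra_simps)
   also have "... = (\<integral>\<^sup>+x. F (y + (1 - t) *\<^sub>R (x - y)) * indicator K x \<partial>lborel) * indicator K y"
    by (rule nn_integral_multc) measurable
   finally show "(\<integral>\<^sup>+x. F (x + t *\<^sub>R (y - x)) * indicator K y * indicator K x \<partial>lborel) =
     (\<integral>\<^sup>+x. F (y + (1 - t) *\<^sub>R (x - y)) * indicator K x \<partial>lborel) * indicator K y" .
  qed
  also have "... <= (\<integral>\<^sup>+x. 4 * (\<integral>\<^sup>+x. F x \<partial>lborel) * indicator K x \<partial>lborel)"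
   using False by (intro nn_integral_mono mult_right_mono half) auto
  finally show ?thesis by (simp add: nn_integral_cmult KI)
 qed
 have "(\<integral>\<^sup>+x. \<integral>\<^sup>+y. ennreal ((v y - v x)^2) * indicator K y * indicator K x \<partial>lborel \<partial>lborel) <=
  (\<integral>\<^sup>+x. \<integral>\<^sup>+y. ennreal (D^2) * (\<integral>\<^sup>+t. F (x + t *\<^sub>R (y - x)) * indicator K y * indicator K x * indicator {0..1} t \<partial>lborel) \<partial>lborel \<partial>lborel)"
 proof (intro nn_integral_mono)
  fix x y :: pt
  show "ennreal ((v y - v x)^2) * indicator K y * indicator K x <=
   ennreal (D^2) * (\<integral>\<^sup>+t. F (x + t *\<^sub>R (y - x)) * indicator K y * indicator K x * indicator {0..(1::real)} t \<partial>lborel)"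
  proof (cases "x \<in> K \<and> y \<in> K")
   case True
   have sg: "x + t *\<^sub>R (y - x) \<in> K" if "t \<in> {0..1}" for t
    using convexD_alt[OF K(2), of x y t] True that by (simp add: algebra_simps)
   have "ennreal ((v (x + 1 *\<^sub>R (y - x)) - v x)^2) <= ennreal (1 * (norm (y - x))^2) *
     (\<integral>\<^sup>+t. ennreal ((norm (G (x + t *\<^sub>R (y - x))))^2) * indicator {0..1} t \<partial>lborel)"
    by (rule C1_on_segment[OF C]) (use sg in auto)
   also have "... <= ennreal (D^2) * (\<integral>\<^sup>+t. F (x + t *\<^sub>R (y - x)) * indicator {0..1} t \<partial>lborel)"
   proof (rule mult_mono)
    show "ennreal (1 * (norm (y - x))^2) <= ennreal (D^2)" using True D(1)[of x y] by (simp add: power_mono ennreal_leI)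
    have "ennreal ((norm (G (x + t *\<^sub>R (y - x))))^2) * indicator {0..1} t <= F (x + t *\<^sub>R (y - x)) * indicator {0..1} t" for t
     using sg[of t] by (cases "t \<in> {0..1}") (simp_all add: F_def)
    thus "(\<integral>\<^sup>+t. ennreal ((norm (G (x + t *\<^sub>R (y - x))))^2) * indicator {0..1} t \<partial>lborel) <=
      (\<integral>\<^sup>+t. F (x + t *\<^sub>R (y - x)) * indicator {0..1} t \<partial>lborel)" by (rule nn_integral_mono)
   qed auto
   finally show ?thesis using True by simp
  qed (auto simp: indicator_def)
 qed
 also have "... = ennreal (D^2) * (\<integral>\<^sup>+x. \<integral>\<^sup>+y. \<integral>\<^sup>+t. F (x + t *\<^sub>R (y - x)) * indicator K y * indicator K x * indicator {0..(1::real)} t \<partial>lborel \<partial>lborel \<partial>lborel)"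
  by (simp add: nn_integral_cmult)
 also have "(\<integral>\<^sup>+x. \<integral>\<^sup>+y. \<integral>\<^sup>+t. F (x + t *\<^sub>R (y - x)) * indicator K y * indicator K x * indicator {0..(1::real)} t \<partial>lborel \<partial>lborel \<partial>lborel) =
   (\<integral>\<^sup>+x. \<integral>\<^sup>+t. \<integral>\<^sup>+y. F (x + t *\<^sub>R (y - x)) * indicator K y * indicator K x * indicator {0..(1::real)} t \<partial>lborel \<partial>lborel \<partial>lborel)"
  by (intro nn_integral_cong lborel_pair.Fubini') measurable
 also have "... = (\<integral>\<^sup>+t. \<integral>\<^sup>+x. \<integral>\<^sup>+y. F (x + t *\<^sub>R (y - x)) * indicator K y * indicator K x * indicator {0..(1::real)} t \<partial>lborel \<partial>lborel \<partial>lborel)"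
  by (rule lborel_pair.Fubini') measurable
 also have "... <= (\<integral>\<^sup>+t. 4 * (\<integral>\<^sup>+x. F x \<partial>lborel) * ennreal (measure lebesgue K) * indicator {0..(1::real)} t \<partial>lborel)"
 proof (rule nn_integral_mono)
  fix t :: real
  show "(\<integral>\<^sup>+x. \<integral>\<^sup>+y. F (x + t *\<^sub>R (y - x)) * indicator K y * indicator K x * indicator {0..(1::real)} t \<partial>lborel \<partial>lborel) <=
   4 * (\<integral>\<^sup>+x. F x \<partial>lborel) * ennreal (measure lebesgue K) * indicator {0..(1::real)} t"
   using It[of t] by (cases "t \<in> {0..1}") auto
 qed
 also have "... = 4 * (\<integral>\<^sup>+x. F x \<partial>lborel) * ennreal (measure lebesgue K)" by (simp add: nn_integral_cmult)
 finally show ?thesis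
  unfolding FI by (simp add: ennreal_mult mult_ac mult_right_mono)
qed

lemma double_integral_sq:
 fixes v :: "'a => real"
 assumes M: "finite_measure M" and v: "v \<in> L2 M"
 shows "(LINT x|M. LINT y|M. (v y - v x)^2) = 2 * measure M (space M) * sqi M v - 2 * (LINT x|M. v x)^2"
proof -
 have i: "integrable M v" "integrable M (%x. (v x)^2)" using L2_integrable[OF M v] v by (auto simp: L2_def)
 interpret finite_measure M by (rule M)
 have "(LINT y|M. (v y - v x)^2) = sqi M v - 2 * v x * (LINT x|M. v x) + measure M (space M) * (v x)^2" for x
 proof -
  have "(LINT y|M. (v y - v x)^2) = (LINT y|M. (v y)^2 - 2 * v x * v y + (v x)^2)"
   by (rule Bochner_Integration.integral_cong) (auto simp: power2_eq_square algebra_simps)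
  thus ?thesis using i by (simp add: sqi_def)
 qed
 hence "(LINT x|M. LINT y|M. (v y - v x)^2) =
   (LINT x|M. sqi M v - (2 * (LINT x|M. v x)) * v x + measure M (space M) * (v x)^2)"
  by (simp add: mult_ac)
 also have "... = measure M (space M) * sqi M v - (2 * (LINT x|M. v x)) * (LINT x|M. v x) + measure M (space M) * sqi M v"
  using i by (simp add: sqi_def)
 finally show ?thesis by (simp add: power2_eq_square)
qed

text \<open>Expanding (v y - v x)^2 turns the double integral into 2 |K| times the squared norm of v
  minus twice the squared integral of v.\<close>

lemma poincare_C1:
 assumes K: "compact K" "convex K" and D: "!!x y. x \<in> K ==> y \<in> K ==> norm (y - x) <= D" "D >= 0" and C: "C1_on K v G"
 shows "measure lebesgue K * sqi (leb K) v - (LINT x|leb K. v x)^2 <=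
  2 * D^2 * measure lebesgue K * sqi (leb K) G"
proof -
 let ?M = "leb K"
 have cv: "continuous_on K v" by (rule C1_on_continuous[OF C])
 have fm: "finite_measure ?M" by (rule compact_finite_measure[OF K(1)])
 have Km: "K \<in> sets lebesgue" "K \<in> sets borel" using K(1) by (simp_all add: compact_imp_closed)
 have vL: "v \<in> L2 ?M" by (rule L2_continuous_compact[OF cv K(1)])
 have i: "integrable ?M v" "integrable ?M (%x. (v x)^2)" using L2_integrable[OF fm vL] vL by (auto simp: L2_def)
 interpret finite_measure ?M by (rule fm)
 have in1: "(\<integral>\<^sup>+y. ennreal ((v y - v x)^2) * indicator K y \<partial>lborel) = ennreal (LINT y|?M. (v y - v x)^2)" for x
 proof -
  have "continuous_on K (%y. v y - v x)" by (intro continuous_intros cv)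
  from nn_integral_sqi[OF this K(1)] show ?thesis by (simp add: sqi_def)
 qed
 have eqx: "(LINT y|?M. (v y - v x)^2) = sqi ?M v - 2 * v x * (LINT x|?M. v x) + measure ?M (space ?M) * (v x)^2" for x
 proof -
  have "(LINT y|?M. (v y - v x)^2) = (LINT y|?M. (v y)^2 - 2 * v x * v y + (v x)^2)"
   by (rule Bochner_Integration.integral_cong) (auto simp: power2_eq_square algebra_simps)
  thus ?thesis using i by (simp add: sqi_def)
 qed
 define h where "h x = (LINT y|?M. (v y - v x)^2)" for x
 have "h = (%x. sqi ?M v - 2 * v x * (LINT x|?M. v x) + measure ?M (space ?M) * (v x)^2)"
  unfolding h_def using eqx by (rule ext)
 hence hi: "integrable ?M h" using i by simp
 have h0: "0 <= h x" for x by (simp add: h_def)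
 have "(\<integral>\<^sup>+x. \<integral>\<^sup>+y. ennreal ((v y - v x)^2) * indicator K y * indicator K x \<partial>lborel \<partial>lborel) =
   (\<integral>\<^sup>+x. ennreal (h x) * indicator K x \<partial>lborel)"
 proof (rule nn_integral_cong)
  fix x
  show "(\<integral>\<^sup>+y. ennreal ((v y - v x)^2) * indicator K y * indicator K x \<partial>lborel) = ennreal (h x) * indicator K x"
   using in1[of x] by (cases "x \<in> K") (auto simp: h_def)
 qed
 also have "... = (\<integral>\<^sup>+x. ennreal (h x) * indicator K x \<partial>lebesgue)"
  by (rule nn_integral_completion[symmetric])
 also have "... = (\<integral>\<^sup>+x. ennreal (h x) \<partial>?M)" using Km by (intro nn_integral_restrict_space[symmetric]) simp
 also have "... = ennreal (LINT x|?M. h x)" by (rule nn_integral_eq_integral[OF hi]) (simp add: h0)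
 finally have "ennreal (LINT x|?M. h x) <= ennreal (4 * D^2 * measure lebesgue K * sqi ?M G)"
  using poincare_double[OF K D C] by simp
 hence "(LINT x|?M. h x) <= 4 * D^2 * measure lebesgue K * sqi ?M G"
  by (subst (asm) ennreal_le_iff) auto
 moreover have "(LINT x|?M. h x) = 2 * measure lebesgue K * sqi ?M v - 2 * (LINT x|?M. v x)^2"
  unfolding h_def using double_integral_sq[OF fm vL] Km by (simp add: measure_restrict_space)
 ultimately show ?thesis by simp
qed

text \<open>For x on the edge, v(x)^2 is at most 2 v(x + t q)^2 plus twice the squared increment.
  Averaging over t in [0,1/2] replaces the edge by the parallelogram spanned by p/2 and q/2, which
  lies in K.\<close>

lemma trace_half:
 assumes c: "cross2 p q ~= 0" and K: "compact K" and C: "C1_on K v G"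
  and sub: "!!s t. 0 <= s ==> s <= 1/2 ==> 0 <= t ==> t <= 1/2 ==> a + s *\<^sub>R p + t *\<^sub>R q \<in> K"
  and D: "norm q <= D"
 shows "(\<integral>\<^sup>+s. ennreal ((v (a + s *\<^sub>R p))^2) * indicator {0..1/2} s \<partial>lborel) <=
  ennreal (4 / \<bar>cross2 p q\<bar> * (sqi (leb K) v + D^2 * sqi (leb K) G))"
proof -
 define H where "H x = ennreal ((norm (v x))^2) * indicator K x" for x
 define F where "F x = ennreal ((norm (G x))^2) * indicator K x" for x
 have cG: "continuous_on K G" using C by (simp add: C1_on_def)
 have cv: "continuous_on K v" by (rule C1_on_continuous[OF C])
 have [measurable]: "F \<in> borel_measurable borel" "H \<in> borel_measurable borel"
  unfolding F_def H_def using K cG cv by (intro measurable_indicator_continuous continuous_intros; simp)+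
 have FI: "(\<integral>\<^sup>+x. F x \<partial>lborel) = ennreal (sqi (leb K) G)" "(\<integral>\<^sup>+x. H x \<partial>lborel) = ennreal (sqi (leb K) v)"
  unfolding F_def H_def by (rule nn_integral_sqi[OF cG K], rule nn_integral_sqi[OF cv K])
 let ?I = "indicator {0..1/2} :: real => ennreal"
 have Ih: "(\<integral>\<^sup>+t. ?I t \<partial>lborel) = ennreal (1/2)" by simp
 have pt: "ennreal ((v (a + s *\<^sub>R p))^2) * ?I s * ?I t <=
   (2 * H (a + s *\<^sub>R p + t *\<^sub>R q) + ennreal (D^2) * (\<integral>\<^sup>+t'. F (a + s *\<^sub>R p + t' *\<^sub>R q) * ?I t' \<partial>lborel) * ?I t) * ?I s" for s t
 proof (cases "s \<in> {0..1/2} \<and> t \<in> {0..1/2}")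
  case True
  let ?x = "a + s *\<^sub>R p"
  have xK: "?x + t' *\<^sub>R q \<in> K" if "t' \<in> {0..1/2}" for t' using sub[of s t'] True that by auto
  have "ennreal ((v (?x + t *\<^sub>R q) - v ?x)^2) <= ennreal (1/2 * (norm q)^2) *
    (\<integral>\<^sup>+t'. ennreal ((norm (G (?x + t' *\<^sub>R q)))^2) * indicator {0..1/2} t' \<partial>lborel)"
   by (rule C1_on_segment[OF C xK]) (use True in auto)
  also have "... <= ennreal (1/2 * D^2) * (\<integral>\<^sup>+t'. F (?x + t' *\<^sub>R q) * ?I t' \<partial>lborel)"
  proof (rule mult_mono)
   show "ennreal (1/2 * (norm q)^2) <= ennreal (1/2 * D^2)" using D by (simp add: power_mono ennreal_leI)
   have "ennreal ((norm (G (?x + t' *\<^sub>R q)))^2) * indicator {0..1/2} t' <= F (?x + t' *\<^sub>R q) * ?I t'" for t'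
    using xK[of t'] by (cases "t' \<in> {0..1/2}") (simp_all add: F_def)
   thus "(\<integral>\<^sup>+t'. ennreal ((norm (G (?x + t' *\<^sub>R q)))^2) * indicator {0..1/2} t' \<partial>lborel) <=
     (\<integral>\<^sup>+t'. F (?x + t' *\<^sub>R q) * ?I t' \<partial>lborel)" by (rule nn_integral_mono)
  qed auto
  finally have 1: "2 * ennreal ((v (?x + t *\<^sub>R q) - v ?x)^2) <= ennreal (D^2) * (\<integral>\<^sup>+t'. F (?x + t' *\<^sub>R q) * ?I t' \<partial>lborel)"
   using mult_left_mono[of _ _ "2::ennreal"] by (fastforce simp: mult.assoc[symmetric] ennreal_mult'[symmetric] simp flip: ennreal_numeral)
  have "(v ?x)^2 <= 2 * (v (?x + t *\<^sub>R q))^2 + 2 * (v (?x + t *\<^sub>R q) - v ?x)^2"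
   using norm_add_sq_le[of "v (?x + t *\<^sub>R q)" "v ?x - v (?x + t *\<^sub>R q)"] by (simp add: power2_commute)
  hence "ennreal ((v ?x)^2) <= 2 * H (?x + t *\<^sub>R q) + 2 * ennreal ((v (?x + t *\<^sub>R q) - v ?x)^2)"
   using xK[of t] True by (simp add: H_def ennreal_mult'[symmetric] ennreal_plus[symmetric] ennreal_leI del: ennreal_plus flip: ennreal_numeral)
  also have "... <= 2 * H (?x + t *\<^sub>R q) + ennreal (D^2) * (\<integral>\<^sup>+t'. F (?x + t' *\<^sub>R q) * ?I t' \<partial>lborel)"
   using 1 by (rule add_left_mono)
  finally show ?thesis using True by simp
 next
  case False
  thus ?thesis by (auto simp: indicator_def)
 qed
 have "ennreal (1/2) * (\<integral>\<^sup>+s. ennreal ((v (a + s *\<^sub>R p))^2) * ?I s \<partial>lborel) =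
   (\<integral>\<^sup>+s. \<integral>\<^sup>+t. ennreal ((v (a + s *\<^sub>R p))^2) * ?I s * ?I t \<partial>lborel \<partial>lborel)"
 proof -
  have m: "(%s. ennreal ((v (a + s *\<^sub>R p))^2) * ?I s) \<in> borel_measurable lborel"
  proof -
   have "continuous_on {0..1/2} (%s. (v (a + s *\<^sub>R p))^2)"
    by (intro continuous_intros continuous_on_compose2[OF cv]) (use sub[of _ 0] in auto)
   hence "(%s. indicator {0..1/2} s *\<^sub>R (v (a + s *\<^sub>R p))^2) \<in> borel_measurable borel"
    by (intro borel_measurable_continuous_on_indicator) auto
   hence "(%s. ennreal (indicator {0..1/2} s *\<^sub>R (v (a + s *\<^sub>R p))^2)) \<in> borel_measurable lborel" by simp
   thus ?thesis by (rule measurable_cong[THEN iffD1, rotated]) (auto simp: indicator_def)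
  qed
  thus ?thesis by (simp add: nn_integral_cmult Ih mult.commute nn_integral_multc)
 qed
 also have "... <= (\<integral>\<^sup>+s. \<integral>\<^sup>+t. (2 * H (a + s *\<^sub>R p + t *\<^sub>R q) + ennreal (D^2) * (\<integral>\<^sup>+t'. F (a + s *\<^sub>R p + t' *\<^sub>R q) * ?I t' \<partial>lborel) * ?I t) * ?I s \<partial>lborel \<partial>lborel)"
  by (intro nn_integral_mono pt)
 also have "... <= (\<integral>\<^sup>+s. \<integral>\<^sup>+t. (2 * H (a + s *\<^sub>R p + t *\<^sub>R q) + ennreal (D^2) * (\<integral>\<^sup>+t'. F (a + s *\<^sub>R p + t' *\<^sub>R q) \<partial>lborel) * ?I t) \<partial>lborel \<partial>lborel)"
  by (intro nn_integral_mono) (auto simp: indicator_def intro!: add_mono mult_left_mono nn_integral_mono)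
 also have "... = (\<integral>\<^sup>+s. 2 * (\<integral>\<^sup>+t. H (a + s *\<^sub>R p + t *\<^sub>R q) \<partial>lborel) + ennreal (D^2) * (\<integral>\<^sup>+t'. F (a + s *\<^sub>R p + t' *\<^sub>R q) \<partial>lborel) * ennreal (1/2) \<partial>lborel)"
  by (intro nn_integral_cong) (simp add: nn_integral_add nn_integral_cmult Ih)
 also have "... = 2 * (\<integral>\<^sup>+s. \<integral>\<^sup>+t. H (a + s *\<^sub>R p + t *\<^sub>R q) \<partial>lborel \<partial>lborel) +
   ennreal (D^2) * (\<integral>\<^sup>+s. \<integral>\<^sup>+t'. F (a + s *\<^sub>R p + t' *\<^sub>R q) \<partial>lborel \<partial>lborel) * ennreal (1/2)"
  by (simp add: nn_integral_add nn_integral_cmult nn_integral_multc)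
 finally have main: "ennreal (1/2) * (\<integral>\<^sup>+s. ennreal ((v (a + s *\<^sub>R p))^2) * ?I s \<partial>lborel) <= ..." .
 have cv2: "(\<integral>\<^sup>+s. \<integral>\<^sup>+t. f (a + s *\<^sub>R p + t *\<^sub>R q) \<partial>lborel \<partial>lborel) = ennreal (r / \<bar>cross2 p q\<bar>)"
  if "f \<in> borel_measurable borel" "(\<integral>\<^sup>+x. f x \<partial>lborel) = ennreal r" "r >= 0" for f r
 proof -
  let ?J = "\<integral>\<^sup>+s. \<integral>\<^sup>+t. f (a + s *\<^sub>R p + t *\<^sub>R q) \<partial>lborel \<partial>lborel"
  have "ennreal (1 / \<bar>cross2 p q\<bar>) * (ennreal \<bar>cross2 p q\<bar> * ?J) = ennreal (1 / \<bar>cross2 p q\<bar>) * ennreal r"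
   using nn_integral_parallelogram[OF that(1) c, of a] that(2) by simp
  thus ?thesis using c that(3) by (simp add: mult.assoc[symmetric] ennreal_mult[symmetric])
 qed
 have "ennreal (1/2) * (\<integral>\<^sup>+s. ennreal ((v (a + s *\<^sub>R p))^2) * ?I s \<partial>lborel) <=
  ennreal (2 * (sqi (leb K) v / \<bar>cross2 p q\<bar>) + D^2 * (sqi (leb K) G / \<bar>cross2 p q\<bar>) * (1/2))"
 proof -
  have "2 * ennreal X + ennreal (D^2) * ennreal Y * ennreal (1/2) = ennreal (2 * X + D^2 * Y * (1/2))"
   if "X >= 0" "Y >= 0" for X Y
  proof -
   have "ennreal (2 * X + D^2 * Y * (1/2)) = ennreal (2 * X) + ennreal (D^2 * Y * (1/2))"
    using that by (intro ennreal_plus) auto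
   moreover have "ennreal (2 * X) = 2 * ennreal X" by (simp add: ennreal_mult')
   moreover have "ennreal (D^2 * Y * (1/2)) = ennreal (D^2 * Y) * ennreal (1/2)" using that by (intro ennreal_mult) auto
   moreover have "ennreal (D^2 * Y) = ennreal (D^2) * ennreal Y" using that by (intro ennreal_mult) auto
   ultimately show ?thesis by simp
  qed
  from this[of "sqi (leb K) v / \<bar>cross2 p q\<bar>" "sqi (leb K) G / \<bar>cross2 p q\<bar>"] show ?thesis
   using main unfolding cv2[OF \<open>H \<in> _\<close> FI(2) sqi_nonneg] cv2[OF \<open>F \<in> _\<close> FI(1) sqi_nonneg] by simp
 qed
 hence "(\<integral>\<^sup>+s. ennreal ((v (a + s *\<^sub>R p))^2) * ?I s \<partial>lborel) <=
  ennreal (2 * (2 * (sqi (leb K) v / \<bar>cross2 p q\<bar>) + D^2 * (sqi (leb K) G / \<bar>cross2 p q\<bar>) * (1/2)))"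
 proof -
  have "ennreal 2 * ennreal (1/2) = 1" by (subst ennreal_mult[symmetric]) auto
  hence "ennreal 2 * (ennreal (1/2) * X) = X" for X by (simp only: mult.assoc[symmetric] mult_1_left)
  moreover have "ennreal 2 * ennreal r = ennreal (2 * r)" for r by (rule ennreal_mult'[symmetric]) simp
  ultimately show ?thesis
   using mult_left_mono[OF \<open>ennreal (1/2) * (\<integral>\<^sup>+s. ennreal ((v (a + s *\<^sub>R p))^2) * ?I s \<partial>lborel) <=
  ennreal (2 * (sqi (leb K) v / \<bar>cross2 p q\<bar>) + D^2 * (sqi (leb K) G / \<bar>cross2 p q\<bar>) * (1/2))\<close>, of "ennreal 2"]
   by (simp only: zero_le simp_thms)
 qed
 also have "... <= ennreal (4 / \<bar>cross2 p q\<bar> * (sqi (leb K) v + D^2 * sqi (leb K) G))"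
  using c by (intro ennreal_leI) (auto simp: field_simps)
 finally show ?thesis .
qed

text \<open>The parallelogram spanned at a corner by half of the two sides stays in the triangle,
  one over the whole edge does not. So the edge is cut at its midpoint and each half is treated from
  its own end point, whence 8 = 4 + 4.\<close>

lemma trace_C1:
 fixes a b c :: pt
 defines "K \<equiv> convex hull {a, b, c}"
 assumes cr: "cross2 (b - a) (c - a) ~= 0" and C: "C1_on K v G" and D: "!!x y. x \<in> K ==> y \<in> K ==> norm (y - x) <= D"
 shows "(\<integral>\<^sup>+s. ennreal ((v ((1 - s) *\<^sub>R a + s *\<^sub>R b))^2) * indicator {0..1} s \<partial>lborel) <=
  ennreal (8 / \<bar>cross2 (b - a) (c - a)\<bar> * (sqi (leb K) v + D^2 * sqi (leb K) G))"
proof -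
 have K: "compact K" unfolding K_def by (simp add: finite_imp_compact_convex_hull)
 have abc: "a \<in> K" "b \<in> K" "c \<in> K" unfolding K_def by (auto intro: hull_inc)
 \<comment> \<open>The point is the midpoint of two points, one on each side issuing from x.\<close>
 have mem: "x + s *\<^sub>R (y - x) + t *\<^sub>R (z - x) \<in> K" if "x \<in> K" "y \<in> K" "z \<in> K" "0 <= s" "s <= 1/2" "0 <= t" "t <= 1/2" for x y z s t
 proof -
  have "convex K" unfolding K_def by (rule convex_convex_hull)
  note cK = this
  have "(1 - 2 * s) *\<^sub>R x + (2 * s) *\<^sub>R y \<in> K" "(1 - 2 * t) *\<^sub>R x + (2 * t) *\<^sub>R z \<in> K"
   using convexD_alt[OF cK] that by auto
  from convexD[OF cK this, of "1/2" "1/2"]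
  have "(1/2) *\<^sub>R ((1 - 2 * s) *\<^sub>R x + (2 * s) *\<^sub>R y) + (1/2) *\<^sub>R ((1 - 2 * t) *\<^sub>R x + (2 * t) *\<^sub>R z) \<in> K" by simp
  also have "(1/2) *\<^sub>R ((1 - 2 * s) *\<^sub>R x + (2 * s) *\<^sub>R y) + (1/2) *\<^sub>R ((1 - 2 * t) *\<^sub>R x + (2 * t) *\<^sub>R z) =
   x + s *\<^sub>R (y - x) + t *\<^sub>R (z - x)"
   by (simp add: vec_eq_iff algebra_simps)
  finally show ?thesis .
 qed
 define R where "R = 4 / \<bar>cross2 (b - a) (c - a)\<bar> * (sqi (leb K) v + D^2 * sqi (leb K) G)"
 have R0: "R >= 0" unfolding R_def by (intro mult_nonneg_nonneg add_nonneg_nonneg) auto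
 have 1: "(\<integral>\<^sup>+s. ennreal ((v (a + s *\<^sub>R (b - a)))^2) * indicator {0..1/2} s \<partial>lborel) <= ennreal R"
  unfolding R_def using abc D[of a c] by (intro trace_half[OF cr K C]) (auto intro!: mem)
 have cr': "\<bar>cross2 (a - b) (c - b)\<bar> = \<bar>cross2 (b - a) (c - a)\<bar>" by (simp add: cross2_def algebra_simps abs_minus_commute)
 have 2: "(\<integral>\<^sup>+s. ennreal ((v (b + s *\<^sub>R (a - b)))^2) * indicator {0..1/2} s \<partial>lborel) <= ennreal R"
  unfolding R_def cr'[symmetric] using abc D[of b c] cr cr' by (intro trace_half[OF _ K C]) (auto intro!: mem)
 let ?f = "%s. ennreal ((v ((1 - s) *\<^sub>R a + s *\<^sub>R b))^2)"
 have cf: "continuous_on {0..1} (%s. (v ((1 - s) *\<^sub>R a + s *\<^sub>R b))^2)"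
 proof -
  have "(1 - s) *\<^sub>R a + s *\<^sub>R b \<in> K" if "s \<in> {0..1}" for s
   using that abc convexD_alt[of K a b s] unfolding K_def by (auto simp: convex_convex_hull)
  thus ?thesis
   by (intro continuous_intros continuous_on_compose2[OF C1_on_continuous[OF C]]) auto
 qed
 have m: "(%s. ?f s * indicator S s) \<in> borel_measurable lborel" if "S \<subseteq> {0..1}" "S \<in> sets borel" for S
 proof -
  have "(%s. indicator S s *\<^sub>R (v ((1 - s) *\<^sub>R a + s *\<^sub>R b))^2) \<in> borel_measurable borel"
   by (intro borel_measurable_continuous_on_indicator continuous_on_subset[OF cf] that)
  hence "(%s. ennreal (indicator S s *\<^sub>R (v ((1 - s) *\<^sub>R a + s *\<^sub>R b))^2)) \<in> borel_measurable lborel" by simp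
  thus ?thesis by (rule measurable_cong[THEN iffD1, rotated]) (auto simp: indicator_def)
 qed
 have "(\<integral>\<^sup>+s. ?f s * indicator {0..1} s \<partial>lborel) <= (\<integral>\<^sup>+s. ?f s * indicator {0..1/2} s + ?f s * indicator {1/2..1} s \<partial>lborel)"
  by (intro nn_integral_mono) (auto simp: indicator_def)
 also have "... = (\<integral>\<^sup>+s. ?f s * indicator {0..1/2} s \<partial>lborel) + (\<integral>\<^sup>+s. ?f s * indicator {1/2..1} s \<partial>lborel)"
  by (intro nn_integral_add m) auto
 also have "(\<integral>\<^sup>+s. ?f s * indicator {0..1/2} s \<partial>lborel) = (\<integral>\<^sup>+s. ennreal ((v (a + s *\<^sub>R (b - a)))^2) * indicator {0..1/2} s \<partial>lborel)"
  by (simp add: algebra_simps)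
 also have "(\<integral>\<^sup>+s. ?f s * indicator {1/2..1} s \<partial>lborel) = (\<integral>\<^sup>+s. ?f (1 + (-1) * s) * indicator {1/2..1} (1 + (-1) * s) \<partial>lborel)"
  using m[of "{1/2..1}"] by (subst nn_integral_real_affine[where c = "-1" and t = 1]) auto
 also have "... = (\<integral>\<^sup>+s. ennreal ((v (b + s *\<^sub>R (a - b)))^2) * indicator {0..1/2} s \<partial>lborel)"
  by (intro nn_integral_cong) (auto simp: indicator_def algebra_simps)
 finally have "(\<integral>\<^sup>+s. ?f s * indicator {0..1} s \<partial>lborel) <= ennreal R + ennreal R"
  using add_mono[OF 1 2] by (rule order_trans)
 also have "... = ennreal (8 / \<bar>cross2 (b - a) (c - a)\<bar> * (sqi (leb K) v + D^2 * sqi (leb K) G))"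
  using R0 by (simp add: ennreal_plus[symmetric] R_def del: ennreal_plus)
 finally show ?thesis .
qed

section \<open>Barycentric coordinates of triangles\<close>

abbreviation "verts K \<equiv> {x::pt. x extreme_point_of K}"

lemma cross2_eq_0_parallel:
 assumes "cross2 u v = 0" "u ~= 0" obtains c where "v = c *\<^sub>R u"
proof -
 have n: "u $ 1 * u $ 1 + u $ 2 * u $ 2 ~= 0"
  using assms(2) by (simp add: vec_eq_iff forall_2 sum_squares_eq_zero_iff)
 have "v = ((u $ 1 * v $ 1 + u $ 2 * v $ 2) / (u $ 1 * u $ 1 + u $ 2 * u $ 2)) *\<^sub>R u"
  using n assms(1) by (simp add: vec_eq_iff forall_2 cross2_def field_simps)
 thus ?thesis by (rule that)
qed

lemma triangle_obtain:
 assumes "2 simplex (K :: pt set)"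
 obtains a b c where "K = convex hull {a, b, c}" "a ~= b" "a ~= c" "b ~= c" "\<not> affine_dependent {a, b, c}"
  "cross2 (b - a) (c - a) ~= 0" "verts K = {a, b, c}"
proof -
 obtain C where C: "\<not> affine_dependent C" "int (card C) = 2 + 1" "K = convex hull C"
  using assms by (auto simp: simplex_def)
 hence "card C = 3" by simp
 then obtain a b c where abc: "C = {a, b, c}" "a ~= b" "a ~= c" "b ~= c"
  by (auto simp: card_3_iff)
 have "cross2 (b - a) (c - a) ~= 0"
 proof
  assume "cross2 (b - a) (c - a) = 0"
  moreover have "b - a ~= 0" using abc by simp
  ultimately obtain r where "c - a = r *\<^sub>R (b - a)" by (rule cross2_eq_0_parallel)
  hence "collinear {0, b - a, c - a}" by (auto simp: collinear_lemma)
  hence "collinear {b, a, c}" by (simp add: collinear_3[of b a c])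
  thus False using C abc collinear_3_eq_affine_dependent[of b a c] by (auto simp: insert_commute)
 qed
 moreover have "verts K = {a, b, c}"
  using C abc extreme_point_of_convex_hull_affine_independent[of C] by auto
 ultimately show ?thesis using that C abc by blast
qed

text \<open>Gradient of the barycentric coordinate of z, seen as an affine function on the whole
  plane. For a triangle K without the vertex z the conditions force the zero function, so sums over
  all mesh vertices reduce to the vertices of K.\<close>

definition lamG :: "pt set => pt => pt" where
 "lamG K z = fst (SOME p. \<forall>y\<in>verts K. fst p \<bullet> y + snd p = (if y = z then 1 else 0 :: real))"

definition lamC :: "pt set => pt => real" where
 "lamC K z = snd (SOME p. \<forall>y\<in>verts K. fst p \<bullet> y + snd p = (if y = z then 1 else 0 :: real))"

definition lam :: "pt set => pt => pt => real" where
 "lam K z x = lamG K z \<bullet> x + lamC K z"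

lemma inner_pt: "(u::pt) \<bullet> v = u $ 1 * v $ 1 + u $ 2 * v $ 2"
 by (simp add: inner_vec_def sum_2)

lemma lam_exists:
 assumes "cross2 (b - a) (c - a) ~= 0"
 obtains g k where "g \<bullet> a + k = (1::real)" "g \<bullet> b + k = 0" "g \<bullet> c + k = 0"
proof -
 let ?d = "cross2 (b - a) (c - a)"
 define g where "g = (1 / ?d) *\<^sub>R (vector [(b - c) $ 2, - (b - c) $ 1] :: pt)"
 define k where "k = cross2 b c / ?d"
 have "g \<bullet> a + k = 1" "g \<bullet> b + k = 0" "g \<bullet> c + k = 0"
  using assms by (simp_all add: g_def k_def inner_pt divide_simps) (simp_all add: cross2_def algebra_simps)
 thus ?thesis by (rule that)
qed

lemma lam_vertex:
 assumes "2 simplex K" "y \<in> verts K"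
 shows "lam K z y = (if y = z then 1 else 0)"
proof -
 obtain a b c where abc: "a ~= b" "a ~= c" "b ~= c" "cross2 (b - a) (c - a) ~= 0" "verts K = {a, b, c}"
  using triangle_obtain[OF assms(1)] by metis
 have cyc: "cross2 (c - b) (a - b) ~= 0" "cross2 (a - c) (b - c) ~= 0"
  using abc(4) by (auto simp: cross2_def algebra_simps)
 have "\<exists>p. \<forall>y\<in>verts K. fst p \<bullet> y + snd p = (if y = z then 1 else 0 :: real)"
 proof (cases "z \<in> verts K")
  case True
  then consider "z = a" | "z = b" | "z = c" using abc by auto
  thus ?thesis
  proof cases
   case 1
   obtain g k where "g \<bullet> a + k = (1::real)" "g \<bullet> b + k = 0" "g \<bullet> c + k = 0" using lam_exists[OF abc(4)] .
   thus ?thesis using 1 abc by (intro exI[of _ "(g, k)"]) auto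
  next
   case 2
   obtain g k where "g \<bullet> b + k = (1::real)" "g \<bullet> c + k = 0" "g \<bullet> a + k = 0" using lam_exists[OF cyc(1)] .
   thus ?thesis using 2 abc by (intro exI[of _ "(g, k)"]) auto
  next
   case 3
   obtain g k where "g \<bullet> c + k = (1::real)" "g \<bullet> a + k = 0" "g \<bullet> b + k = 0" using lam_exists[OF cyc(2)] .
   thus ?thesis using 3 abc by (intro exI[of _ "(g, k)"]) auto
  qed
 next
  case False
  thus ?thesis by (intro exI[of _ "(0, 0)"]) auto
 qed
 hence "\<forall>y\<in>verts K. fst (SOME p. \<forall>y\<in>verts K. fst p \<bullet> y + snd p = (if y = z then 1 else 0 :: real)) \<bullet> y +
  snd (SOME p. \<forall>y\<in>verts K. fst p \<bullet> y + snd p = (if y = z then 1 else 0 :: real)) = (if y = z then 1 else 0 :: real)"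
  by (rule someI_ex)
 thus ?thesis using assms(2) by (simp add: lam_def lamG_def lamC_def)
qed

lemma simplex_hull_verts:
 assumes "2 simplex (K :: pt set)"
 shows "K = convex hull (verts K)" "finite (verts K)" "card (verts K) = 3" "affine hull (verts K) = UNIV"
  "compact K" "convex K" "closed K"
proof -
 obtain a b c where abc: "K = convex hull {a, b, c}" "a ~= b" "a ~= c" "b ~= c" "\<not> affine_dependent {a, b, c}" "verts K = {a, b, c}"
  using triangle_obtain[OF assms] by metis
 show "K = convex hull (verts K)" "finite (verts K)" "card (verts K) = 3" using abc by auto
 have "aff_dim {a, b, c} = 2"
  using aff_dim_affine_independent[OF abc(5)] abc(2-4) by simp
 hence "affine hull {a, b, c} = UNIV" using aff_dim_eq_full[of "{a, b, c}"] by simp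
 thus "affine hull (verts K) = UNIV" using abc by simp
 show "compact K" "convex K" using abc by (auto simp: finite_imp_compact_convex_hull convex_convex_hull)
 thus "closed K" by (simp add: compact_imp_closed)
qed

lemma affine_eq_hull:
 assumes "!!y. y \<in> V ==> g \<bullet> y + k = g' \<bullet> y + (k'::real)" "x \<in> affine hull V"
 shows "g \<bullet> x + k = g' \<bullet> (x::pt) + k'"
proof -
 have "affine {x. (g - g') \<bullet> x = k' - k}" by (rule affine_hyperplane)
 moreover have "V \<subseteq> {x. (g - g') \<bullet> x = k' - k}" using assms(1) by (auto simp: inner_diff_left algebra_simps)
 ultimately have "affine hull V \<subseteq> {x. (g - g') \<bullet> x = k' - k}" by (simp add: hull_minimal)
 thus ?thesis using assms(2) by (auto simp: inner_diff_left algebra_simps)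
qed

text \<open>Both sides are affine in x and agree at the vertices, whose affine hull is the
  plane.\<close>

lemma lam_sum:
 assumes "2 simplex K"
 shows "(\<Sum>z\<in>verts K. lam K z x) = 1" "(\<Sum>z\<in>verts K. lam K z x *\<^sub>R z) = x"
  "(\<Sum>z\<in>verts K. lam K z x * (g \<bullet> z + k)) = g \<bullet> x + k"
proof -
 note h = simplex_hull_verts[OF assms]
 have gen: "(\<Sum>z\<in>verts K. lam K z x * (g \<bullet> z + k)) = g \<bullet> x + k" for g k x
 proof -
  have "(\<Sum>z\<in>verts K. lam K z x * (g \<bullet> z + k)) =
    (\<Sum>z\<in>verts K. (g \<bullet> z + k) *\<^sub>R lamG K z) \<bullet> x + (\<Sum>z\<in>verts K. (g \<bullet> z + k) * lamC K z)" for x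
   by (simp add: lam_def inner_sum_left sum.distrib[symmetric] algebra_simps)
  moreover have "(\<Sum>z\<in>verts K. (g \<bullet> z + k) *\<^sub>R lamG K z) \<bullet> x + (\<Sum>z\<in>verts K. (g \<bullet> z + k) * lamC K z) = g \<bullet> x + k"
  proof (rule affine_eq_hull[where V = "verts K"])
   fix y assume y: "y \<in> verts K"
   have "(\<Sum>z\<in>verts K. (g \<bullet> z + k) *\<^sub>R lamG K z) \<bullet> y + (\<Sum>z\<in>verts K. (g \<bullet> z + k) * lamC K z) = (\<Sum>z\<in>verts K. lam K z y * (g \<bullet> z + k))"
    by (simp add: lam_def inner_sum_left sum.distrib[symmetric] algebra_simps)
   also have "... = (\<Sum>z\<in>verts K. if z = y then g \<bullet> y + k else 0)"
    using y lam_vertex[OF assms] by (intro sum.cong) auto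
   also have "... = g \<bullet> y + k" using y h(2) by simp
   finally show "(\<Sum>z\<in>verts K. (g \<bullet> z + k) *\<^sub>R lamG K z) \<bullet> y + (\<Sum>z\<in>verts K. (g \<bullet> z + k) * lamC K z) = g \<bullet> y + k" .
  qed (use h in simp)
  ultimately show ?thesis by simp
 qed
 show "(\<Sum>z\<in>verts K. lam K z x) = 1" using gen[of x 0 1] by simp
 show "(\<Sum>z\<in>verts K. lam K z x * (g \<bullet> z + k)) = g \<bullet> x + k" by (rule gen)
 show "(\<Sum>z\<in>verts K. lam K z x *\<^sub>R z) = x"
 proof (rule vector_eq_ldot[THEN iffD1], rule allI)
  fix u show "u \<bullet> (\<Sum>z\<in>verts K. lam K z x *\<^sub>R z) = u \<bullet> x"
   using gen[of x u 0] by (simp add: inner_sum_right)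
 qed
qed

lemma lam_in_hull:
 assumes "2 simplex K" "W \<subseteq> verts K" "!!z. z \<in> verts K ==> 0 <= lam K z x" "!!z. z \<in> verts K - W ==> lam K z x = 0"
 shows "x \<in> convex hull W"
proof -
 have f: "finite W" using assms(2) simplex_hull_verts(2)[OF assms(1)] finite_subset by blast
 have "(\<Sum>z\<in>W. lam K z x) = 1" "(\<Sum>z\<in>W. lam K z x *\<^sub>R z) = x"
  using lam_sum[OF assms(1), of x] assms(2,4) sum.mono_neutral_left[OF simplex_hull_verts(2)[OF assms(1)] assms(2)]
  by (metis (no_types, lifting) scaleR_eq_0_iff)+
 moreover have "\<forall>z\<in>W. 0 <= lam K z x" using assms(2,3) by blast
 ultimately show ?thesis using f by (auto simp: convex_hull_finite)
qed

lemma mem_triangle: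
 assumes "2 simplex K" shows "x \<in> K \<longleftrightarrow> (\<forall>z\<in>verts K. 0 <= lam K z x)"
proof
 assume x: "x \<in> K"
 show "\<forall>z\<in>verts K. 0 <= lam K z x"
 proof
  fix z assume z: "z \<in> verts K"
  have "convex {x. (- lamG K z) \<bullet> x <= lamC K z}" by (rule convex_halfspace_le)
  moreover have "verts K \<subseteq> {x. (- lamG K z) \<bullet> x <= lamC K z}"
   using lam_vertex[OF assms] by (auto simp: lam_def) (smt (verit, best))
  ultimately have "convex hull (verts K) \<subseteq> {x. (- lamG K z) \<bullet> x <= lamC K z}" by (simp add: hull_minimal)
  thus "0 <= lam K z x" using x simplex_hull_verts(1)[OF assms] by (auto simp: lam_def)
 qed
next
 assume "\<forall>z\<in>verts K. 0 <= lam K z x"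
 hence "x \<in> convex hull (verts K)" by (intro lam_in_hull[OF assms]) auto
 thus "x \<in> K" using simplex_hull_verts(1)[OF assms] by simp
qed

lemma lam_le_1:
 assumes "2 simplex K" "x \<in> K" "z \<in> verts K" shows "lam K z x <= 1"
proof -
 have "lam K z x <= (\<Sum>z\<in>verts K. lam K z x)"
  using assms mem_triangle[OF assms(1)] simplex_hull_verts(2)[OF assms(1)] by (intro member_le_sum) auto
 thus ?thesis using lam_sum(1)[OF assms(1)] by simp
qed

lemma lam_add: "lam K z (x + v) = lam K z x + lamG K z \<bullet> v"
 by (simp add: lam_def inner_add_right)

lemma lam_convex: "s + t = 1 ==> lam K z (s *\<^sub>R x + t *\<^sub>R y) = s * lam K z x + t * lam K z y"
 by (simp add: lam_def inner_add_right algebra_simps flip: distrib_right)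

section \<open>Tangent cones\<close>

text \<open>The tangent cone of K at y: only the constraints that are active at y are kept.\<close>

definition coneK :: "pt set => pt => pt set" where
 "coneK K y = {v. \<forall>z\<in>verts K. lam K z y = 0 --> 0 <= lamG K z \<bullet> v}"

lemma coneK_closed: "closed (coneK K y)"
proof -
 have "coneK K y = (\<Inter>z\<in>{z\<in>verts K. lam K z y = 0}. {v::pt. 0 <= lamG K z \<bullet> v})" by (auto simp: coneK_def)
 moreover have "closed {v::pt. 0 <= lamG K z \<bullet> v}" for z :: pt
  by (rule closed_halfspace_ge)
 ultimately show ?thesis by (auto intro!: closed_INT)
qed

lemma coneK_scale: "v \<in> coneK K y ==> 0 <= c ==> c *\<^sub>R v \<in> coneK K y" by (auto simp: coneK_def)

text \<open>Coordinates that are positive at y stay nonnegative under small displacements, so only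
  the active ones decide membership.\<close>

lemma coneK_local:
 assumes K: "2 simplex K" and y: "y \<in> K"
 shows "\<exists>r>0. \<forall>v. norm v < r --> (y + v \<in> K \<longleftrightarrow> v \<in> coneK K y)"
proof -
 have fin: "finite (verts K)" by (rule simplex_hull_verts(2)[OF K])
 have "\<exists>r>0. \<forall>v::pt. norm v < r --> lam K z y > 0 --> 0 <= lam K z (y + v)" for z
 proof (intro exI conjI allI impI)
  show "0 < (if lam K z y > 0 then lam K z y / (norm (lamG K z) + 1) else 1)"
   by (auto simp: add_nonneg_pos)
  fix v :: pt assume v: "norm v < (if lam K z y > 0 then lam K z y / (norm (lamG K z) + 1) else 1)" and p: "lam K z y > 0"
  hence "norm v * (norm (lamG K z) + 1) < lam K z y" by (simp add: pos_less_divide_eq add_nonneg_pos)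
  moreover have "\<bar>lamG K z \<bullet> v\<bar> <= norm (lamG K z) * norm v" by (rule Cauchy_Schwarz_ineq2)
  moreover have "norm (lamG K z) * norm v <= norm v * (norm (lamG K z) + 1)" by (simp add: algebra_simps)
  ultimately show "0 <= lam K z (y + v)" unfolding lam_add by linarith
 qed
 then obtain r where r: "!!z. r z > 0" "!!z v. norm v < r z ==> lam K z y > 0 ==> 0 <= lam K z (y + v)" by metis
 define R where "R = Min (insert 1 (r ` verts K))"
 have R: "R > 0" "!!z. z \<in> verts K ==> R <= r z" using fin r(1) by (auto simp: R_def)
 have "y + v \<in> K \<longleftrightarrow> v \<in> coneK K y" if v: "norm v < R" for v
  unfolding mem_triangle[OF K] coneK_def
 proof safe
  fix z assume "\<forall>z\<in>verts K. 0 <= lam K z (y + v)" "z extreme_point_of K" "lam K z y = 0"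
  thus "0 <= lamG K z \<bullet> v" by (auto simp: lam_add dest!: bspec[of _ _ z])
 next
  fix z assume a: "\<forall>z\<in>verts K. lam K z y = 0 --> 0 <= lamG K z \<bullet> v" and z: "z extreme_point_of K"
  have "0 <= lam K z y" using mem_triangle[OF K] y z by auto
  then consider "lam K z y = 0" | "lam K z y > 0" by linarith
  thus "0 <= lam K z (y + v)"
   using a z r(2)[of v z] v R(2)[of z] by cases (auto simp: lam_add)
 qed
 thus ?thesis using R(1) by blast
qed

definition same_ray :: "pt => pt => bool" where "same_ray u v \<longleftrightarrow> (\<exists>c>0. v = c *\<^sub>R u)"

lemma same_ray_sym: "same_ray u v ==> same_ray v u"
 unfolding same_ray_def by (metis divideR_right less_numeral_extra(3) positive_imp_inverse_positive)

text \<open>Convexity is not demanded: at a reentrant corner the tangent cone of the domain is not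
  convex.\<close>

definition is_cone :: "pt set => bool" where
 "is_cone C \<longleftrightarrow> closed C \<and> 0 \<in> C \<and> (\<forall>v\<in>C. \<forall>c\<ge>0. c *\<^sub>R v \<in> C)"

lemma is_cone_interior:
 assumes C: "is_cone C" and v: "v \<in> interior C" and c: "c > 0" shows "c *\<^sub>R v \<in> interior C"
proof -
 obtain e where e: "e > 0" "ball v e \<subseteq> C" using v by (auto simp: mem_interior)
 have "ball (c *\<^sub>R v) (c * e) \<subseteq> C"
 proof
  fix w assume w: "w \<in> ball (c *\<^sub>R v) (c * e)"
  have "w = c *\<^sub>R ((1/c) *\<^sub>R w)" using c by simp
  moreover have "(1/c) *\<^sub>R w \<in> ball v e"
  proof -
   have "c *\<^sub>R v - w = c *\<^sub>R (v - (1/c) *\<^sub>R w)" using c by (simp add: scaleR_right_diff_distrib)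
   hence "norm (c *\<^sub>R v - w) = c * norm (v - (1/c) *\<^sub>R w)" using c by simp
   thus ?thesis using w c by (simp add: dist_norm)
  qed
  ultimately show "w \<in> C" using C c e by (metis is_cone_def less_imp_le subsetD)
 qed
 thus ?thesis using c e by (auto simp: mem_interior intro!: exI[of _ "c * e"])
qed

lemma is_cone_frontier:
 assumes "is_cone C" "v \<in> frontier C" "c > 0" shows "c *\<^sub>R v \<in> frontier C"
proof -
 have cl: "closure C = C" using assms(1) by (simp add: is_cone_def)
 have "c *\<^sub>R v \<notin> interior C"
 proof
  assume "c *\<^sub>R v \<in> interior C"
  from is_cone_interior[OF assms(1) this, of "1/c"] assms(2,3) show False by (auto simp: frontier_def)
 qed
 moreover have "c *\<^sub>R v \<in> C" using assms cl by (auto simp: frontier_def is_cone_def)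
 ultimately show ?thesis using cl by (simp add: frontier_def)
qed

text \<open>A connected set that meets both C and its complement meets the frontier of C. This is
  applied to the punctured plane and then to the complement of the first ray found.\<close>

lemma cone_two_frontier_rays:
 assumes C: "is_cone C" and i: "interior C ~= {}" and U: "C ~= UNIV"
 obtains e1 e2 where "e1 \<in> frontier C" "e2 \<in> frontier C" "e1 ~= 0" "e2 ~= 0" "\<not> same_ray e1 e2"
proof -
 obtain u where u: "u \<notin> C" using U by auto
 have u0: "u ~= 0" using u C by (auto simp: is_cone_def)
 have "connected (- {0::pt})" by (rule connected_punctured_universe) simp
 moreover have "- {0} \<inter> C ~= {}"
 proof -
  have "interior {0::pt} = {}" by simp
  hence "\<not> C \<subseteq> {0}" using i interior_mono[of C "{0}"] by auto
  thus ?thesis by auto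
 qed
 moreover have "- {0} - C ~= {}" using u u0 by auto
 ultimately have "- {0} \<inter> frontier C ~= {}" by (rule connected_Int_frontier)
 then obtain e1 where e1: "e1 \<in> frontier C" "e1 ~= 0" by auto
 define R where "R = {c *\<^sub>R e1 | c. c >= 0}"
 have iR: "interior R = {}"
 proof -
  have "R \<subseteq> span {e1}" by (auto simp: R_def span_mul span_base)
  hence "dim R <= dim {e1}" using dim_subset[of R "span {e1}"] by simp
  also have "dim {e1} <= 1" using dim_le_card'[of "{e1}"] by simp
  finally have "dim R <= 1" .
  thus ?thesis by (intro empty_interior_lowdim) simp
 qed
 \<comment> \<open>The complement of the ray is starlike about the opposite point -e1, hence
   connected.\<close>
 have "starlike (- R)"
  unfolding starlike_def
 proof (rule bexI[of _ "- e1"], rule ballI, rule subsetI)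
  show "- e1 \<in> - R"
  proof
   assume "- e1 \<in> R"
   then obtain c where c: "c >= 0" "- e1 = c *\<^sub>R e1" by (auto simp: R_def)
   hence "(1 + c) *\<^sub>R e1 = 0" by (simp add: algebra_simps) (metis add.commute ab_left_minus)
   thus False using e1(2) c(1) by simp
  qed
  fix x y assume x: "x \<in> - R" and y: "y \<in> closed_segment (- e1) x"
  then obtain t where t: "0 <= t" "t <= 1" "y = (1 - t) *\<^sub>R (- e1) + t *\<^sub>R x" by (auto simp: closed_segment_def)
  show "y \<in> - R"
  proof
   assume "y \<in> R"
   then obtain c where c: "c >= 0" "y = c *\<^sub>R e1" by (auto simp: R_def)
   have eq: "t *\<^sub>R x = (c + (1 - t)) *\<^sub>R e1" using t(3) c(2) by (simp add: algebra_simps)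
   have "t ~= 0"
   proof
    assume "t = 0"
    hence "(c + 1) *\<^sub>R e1 = 0" using eq by simp
    thus False using e1(2) c(1) by simp
   qed
   hence "x = ((c + (1 - t)) / t) *\<^sub>R e1"
    using eq by (metis (no_types, lifting) divide_inverse_commute eq_vector_fraction_iff scaleR_scaleR)
   hence "x \<in> R" using t c by (auto simp: R_def)
   thus False using x by simp
  qed
 qed
 hence "connected (- R)" by (rule starlike_imp_connected)
 moreover have "- R \<inter> C ~= {}" using i iR interior_mono[of C R] by auto
 \<comment> \<open>The complement of the ray is dense and C is closed, so C would otherwise be the
   whole plane.\<close>
 moreover have "- R - C ~= {}"
 proof
  assume "- R - C = {}"
  hence "closure (- R) \<subseteq> C" using C by (intro closure_minimal) (auto simp: is_cone_def)
  thus False using iR U by (auto simp: closure_complement)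
 qed
 ultimately have "- R \<inter> frontier C ~= {}" by (rule connected_Int_frontier)
 then obtain e2 where e2: "e2 \<in> frontier C" "e2 \<notin> R" by auto
 have "e2 ~= 0" "\<not> same_ray e1 e2"
  using e2(2) by (auto simp: R_def same_ray_def less_imp_le)
 thus ?thesis using that e1 e2 by blast
qed

text \<open>A whole neighbourhood of d must push C into its interior; this openness is what
  tolerates the variation of a continuous field.\<close>

definition inward_cone :: "pt set => pt => bool" where
 "inward_cone C d \<longleftrightarrow> (\<exists>eta>0. \<forall>x\<in>C. \<forall>tau>0. \<forall>d'. norm (d' - d) < eta --> x + tau *\<^sub>R d' \<in> interior C)"

lemma inward_cone_halfplanes:
 assumes C: "C = {x. n1 \<bullet> x >= 0 \<and> n2 \<bullet> x >= 0} \<or> C = {x. n1 \<bullet> x >= 0 \<or> n2 \<bullet> x >= (0::real)}"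
  and d: "n1 \<bullet> d > 0" "n2 \<bullet> d > 0"
 shows "inward_cone C d"
proof -
 have "\<exists>eta>0. \<forall>d'. norm (d' - d) < eta --> n \<bullet> d' > 0" if "n \<bullet> d > 0" for n
 proof (intro exI conjI allI impI)
  show "0 < n \<bullet> d / (norm n + 1)" using that by (simp add: add_nonneg_pos)
  fix d' assume "norm (d' - d) < n \<bullet> d / (norm n + 1)"
  hence "norm (d' - d) * (norm n + 1) < n \<bullet> d" by (simp add: pos_less_divide_eq add_nonneg_pos)
  moreover have "\<bar>n \<bullet> (d' - d)\<bar> <= norm n * norm (d' - d)" by (rule Cauchy_Schwarz_ineq2)
  ultimately show "n \<bullet> d' > 0"
   by (simp add: inner_diff_right algebra_simps) (smt (verit) norm_ge_zero)
 qed
 then obtain eta1 eta2 where eta: "eta1 > 0" "eta2 > 0" "!!d'. norm (d' - d) < eta1 ==> n1 \<bullet> d' > 0" "!!d'. norm (d' - d) < eta2 ==> n2 \<bullet> d' > 0"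
  using d by meson
 have oi: "{x. n1 \<bullet> x > 0 \<and> n2 \<bullet> x > 0} \<subseteq> interior {x. n1 \<bullet> x >= 0 \<and> n2 \<bullet> x >= 0}"
 proof (rule interior_maximal)
  have "{x. n1 \<bullet> x > 0 \<and> n2 \<bullet> x > 0} = {x. n1 \<bullet> x > 0} \<inter> {x. n2 \<bullet> x > 0}" by auto
  thus "open {x. n1 \<bullet> x > 0 \<and> n2 \<bullet> x > 0}" using open_halfspace_gt[of 0] by auto
 qed auto
 have ou: "{x. n1 \<bullet> x > 0 \<or> n2 \<bullet> x > 0} \<subseteq> interior {x. n1 \<bullet> x >= 0 \<or> n2 \<bullet> x >= 0}"
 proof (rule interior_maximal)
  have "{x. n1 \<bullet> x > 0 \<or> n2 \<bullet> x > 0} = {x. n1 \<bullet> x > 0} \<union> {x. n2 \<bullet> x > 0}" by auto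
  thus "open {x. n1 \<bullet> x > 0 \<or> n2 \<bullet> x > 0}" using open_halfspace_gt[of 0] by auto
 qed auto
 have "x + tau *\<^sub>R d' \<in> interior C" if x: "x \<in> C" and tau: "tau > 0" and d': "norm (d' - d) < min eta1 eta2" for x tau d'
 proof -
  have p: "tau * (n1 \<bullet> d') > 0" "tau * (n2 \<bullet> d') > 0" using eta(3)[of d'] eta(4)[of d'] d' tau by auto
  from C show ?thesis
  proof
   assume C: "C = {x. n1 \<bullet> x >= 0 \<and> n2 \<bullet> x >= 0}"
   thus ?thesis using x p oi by (auto simp: inner_add_right add_nonneg_pos)
  next
   assume C: "C = {x. n1 \<bullet> x >= 0 \<or> n2 \<bullet> x >= 0}"
   have "x + tau *\<^sub>R d' \<in> {x. n1 \<bullet> x > 0 \<or> n2 \<bullet> x > 0}"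
    using x p unfolding C by (auto simp: inner_add_right add_nonneg_pos)
   thus ?thesis using ou C by blast
  qed
 qed
 thus ?thesis unfolding inward_cone_def using eta(1,2) by (intro exI[of _ "min eta1 eta2"]) auto
qed

lemma connected_inside_or_outside:
 assumes "connected S" "S \<inter> frontier C = {}" shows "S \<subseteq> C \<or> S \<inter> C = {}"
 using connected_Int_frontier[OF assms(1), of C] assms(2) by auto

text \<open>Two frontier rays leave only three shapes: a half-plane, the intersection of two
  half-planes, or their union. For each of them an inward direction can be written down.\<close>

lemma cone_inward_exists:
 assumes C: "is_cone C" and i: "interior C ~= {}" and U: "C ~= UNIV"
  and two: "!!e1 e2 e3. {e1, e2, e3} \<subseteq> frontier C - {0} ==> same_ray e1 e2 \<or> same_ray e1 e3 \<or> same_ray e2 e3"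
 shows "\<exists>d. inward_cone C d"
proof -
 obtain e1 e2 where e: "e1 \<in> frontier C" "e2 \<in> frontier C" "e1 ~= 0" "e2 ~= 0" "\<not> same_ray e1 e2"
  using cone_two_frontier_rays[OF C i U] .
 have fr: "\<exists>c>0. w = c *\<^sub>R e1 \<or> w = c *\<^sub>R e2" if "w \<in> frontier C" "w ~= 0" for w
  using two[of e1 e2 w] that e by (auto simp: same_ray_def)
 have clC: "closed C" using C by (simp add: is_cone_def)
 have fr0: "w = 0 \<or> (\<exists>c>0. w = c *\<^sub>R e1 \<or> w = c *\<^sub>R e2)" if "w \<in> frontier C" for w
  using fr that by blast
 define k where "k = cross2 e1 e2"
 show ?thesis
 proof (cases "k = 0")
  case True
  then obtain c where c: "e2 = c *\<^sub>R e1" using cross2_eq_0_parallel[of e1 e2] e k_def by auto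
  \<comment> \<open>The two rays are opposite, so the frontier lies on the line with normal n, and
    each open side is either contained in C or disjoint from it.\<close>
  define n where "n = (vector [- e1 $ 2, e1 $ 1] :: pt)"
  have n: "n \<bullet> e1 = 0" "n \<bullet> e2 = 0" "n \<bullet> n > 0"
   using e(3) by (simp_all add: n_def c inner_pt vec_eq_iff forall_2 sum_squares_gt_zero_iff) (auto simp: add_nonneg_pos add_pos_nonneg zero_less_mult_iff)
  have fn: "n \<bullet> w = 0" if "w \<in> frontier C" for w using fr0[OF that] n by auto
  have P: "{x. n \<bullet> x > 0} \<subseteq> C \<or> {x. n \<bullet> x > 0} \<inter> C = {}"
   using fn by (intro connected_inside_or_outside convex_connected) (auto simp: convex_halfspace_gt)
  have N: "{x. n \<bullet> x < 0} \<subseteq> C \<or> {x. n \<bullet> x < 0} \<inter> C = {}"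
   using fn by (intro connected_inside_or_outside convex_connected) (auto simp: convex_halfspace_lt)
  have n0: "n ~= 0" using n by auto
  have cP: "closure {x. n \<bullet> x > 0} = {x. n \<bullet> x >= 0}" "closure {x. n \<bullet> x < 0} = {x. n \<bullet> x <= 0}"
   using closure_halfspace_gt[OF n0, of 0] closure_halfspace_lt[OF n0, of 0] by auto
  have cP': "{x. n \<bullet> x > 0} \<subseteq> C ==> {x. n \<bullet> x >= 0} \<subseteq> C" "{x. n \<bullet> x < 0} \<subseteq> C ==> {x. n \<bullet> x <= 0} \<subseteq> C"
   using closure_minimal[OF _ clC] cP by metis+
  have nU: "\<not> ({x. n \<bullet> x >= 0} \<subseteq> C \<and> {x. n \<bullet> x <= 0} \<subseteq> C)"
  proof
   assume "{x. n \<bullet> x >= 0} \<subseteq> C \<and> {x. n \<bullet> x <= 0} \<subseteq> C"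
   hence "x \<in> C" for x by (cases "n \<bullet> x >= 0") auto
   thus False using U by auto
  qed
  have nE: "\<not> ({x. n \<bullet> x > 0} \<inter> C = {} \<and> {x. n \<bullet> x < 0} \<inter> C = {})"
  proof
   assume a: "{x. n \<bullet> x > 0} \<inter> C = {} \<and> {x. n \<bullet> x < 0} \<inter> C = {}"
   hence "C \<subseteq> {x. n \<bullet> x = 0}" by (auto simp: set_eq_iff) (meson linorder_neqE_linordered_idom)
   thus False using interior_mono[of C "{x. n \<bullet> x = 0}"] i n0 by (simp add: interior_hyperplane)
  qed
  consider "{x. n \<bullet> x > 0} \<subseteq> C" "{x. n \<bullet> x < 0} \<inter> C = {}" | "{x. n \<bullet> x < 0} \<subseteq> C" "{x. n \<bullet> x > 0} \<inter> C = {}"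
   using P N cP' nU nE by argo
  thus ?thesis
  proof cases
   case 1
   hence "C = {x. n \<bullet> x >= 0 \<and> n \<bullet> x >= 0}" using cP'(1) by (auto simp: set_eq_iff) (meson not_le)
   thus ?thesis using inward_cone_halfplanes[of C n n n] n by auto
  next
   case 2
   hence "C = {x. (- n) \<bullet> x >= 0 \<and> (- n) \<bullet> x >= 0}" using cP'(2) by (auto simp: set_eq_iff) (meson not_le)
   thus ?thesis using inward_cone_halfplanes[of C "- n" "- n" "- n"] n by auto
  qed
 next
  case False
  \<comment> \<open>\<open>n1\<close>, \<open>n2\<close> form the basis dual to \<open>e2\<close>,
    \<open>e1\<close>: the sector between the rays is where both are nonnegative.\<close>
  define n1 where "n1 = (1 / k) *\<^sub>R (vector [- e1 $ 2, e1 $ 1] :: pt)"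
  define n2 where "n2 = (1 / k) *\<^sub>R (vector [e2 $ 2, - e2 $ 1] :: pt)"
  have n: "n1 \<bullet> e1 = 0" "n1 \<bullet> e2 = 1" "n2 \<bullet> e1 = 1" "n2 \<bullet> e2 = 0"
   using False by (auto simp: n1_def n2_def inner_pt k_def field_simps) (auto simp: cross2_def field_simps)
  have fn: "\<not> (n1 \<bullet> w > 0 \<and> n2 \<bullet> w > 0)" "\<not> (n1 \<bullet> w < 0 \<or> n2 \<bullet> w < 0)" if "w \<in> frontier C" for w
   using fr0[OF that] n by (auto simp: less_imp_le not_less)
  let ?Q = "{x. n1 \<bullet> x > 0 \<and> n2 \<bullet> x > 0}" and ?R = "{x. n1 \<bullet> x < 0 \<or> n2 \<bullet> x < 0}"
  have Qe: "?Q = {x. n1 \<bullet> x > 0} \<inter> {x. n2 \<bullet> x > 0}" and Re: "?R = {x. n1 \<bullet> x < 0} \<union> {x. n2 \<bullet> x < 0}" by auto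
  have Q: "?Q \<subseteq> C \<or> ?Q \<inter> C = {}"
  proof (rule connected_inside_or_outside)
   show "connected ?Q" unfolding Qe by (intro convex_connected convex_Int convex_halfspace_gt)
  qed (use fn in blast)
  have R: "?R \<subseteq> C \<or> ?R \<inter> C = {}"
  proof (rule connected_inside_or_outside)
   \<comment> \<open>This common point makes the union of the two half-planes connected.\<close>
   have "- (e1 + e2) \<in> {x. n1 \<bullet> x < 0} \<inter> {x. n2 \<bullet> x < 0}" using n by (simp add: inner_add_right inner_diff_right)
   thus "connected ?R"
    unfolding Re by (intro connected_Un convex_connected convex_halfspace_lt) blast
  qed (use fn in blast)
  have n0: "n1 ~= 0" "n2 ~= 0" using n by auto
  have cR: "{x. n1 \<bullet> x <= 0 \<or> n2 \<bullet> x <= 0} \<subseteq> C" if "?R \<subseteq> C"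
  proof -
   have "closure ?R \<subseteq> C" using closure_minimal[OF that clC] .
   thus ?thesis unfolding Re closure_Un
    using closure_halfspace_lt[OF n0(1), of 0] closure_halfspace_lt[OF n0(2), of 0] by auto
  qed
  have cQ: "{x. n1 \<bullet> x >= 0 \<and> n2 \<bullet> x >= 0} \<subseteq> C" if "?Q \<subseteq> C"
  proof
   fix x assume x: "x \<in> {x. n1 \<bullet> x >= 0 \<and> n2 \<bullet> x >= 0}"
   \<comment> \<open>Points of the closed sector are limits of points of the open one, approached
     along e1 + e2.\<close>
   have "(%m. x + (1 / real (Suc m)) *\<^sub>R (e1 + e2)) \<longlonglongrightarrow> x + 0 *\<^sub>R (e1 + e2)"
    by (intro tendsto_intros LIMSEQ_Suc lim_const_over_n)
   moreover have "x + (1 / real (Suc m)) *\<^sub>R (e1 + e2) \<in> C" for m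
   proof -
    have "x + (1 / real (Suc m)) *\<^sub>R (e1 + e2) \<in> ?Q" using x n by (auto simp: inner_add_right add_nonneg_pos)
    thus ?thesis using that by blast
   qed
   ultimately show "x \<in> C" using clC closed_sequentially[of C "%m. x + (1 / real (Suc m)) *\<^sub>R (e1 + e2)"] by auto
  qed
  have nU: "\<not> (?Q \<subseteq> C \<and> ?R \<subseteq> C)"
  proof
   assume "?Q \<subseteq> C \<and> ?R \<subseteq> C"
   hence "x \<in> C" for x using cQ cR by (cases "n1 \<bullet> x <= 0 \<or> n2 \<bullet> x <= 0") auto
   thus False using U by auto
  qed
  have nE: "\<not> (?Q \<inter> C = {} \<and> ?R \<inter> C = {})"
  proof
   assume a: "?Q \<inter> C = {} \<and> ?R \<inter> C = {}"
   hence "C \<subseteq> {x. n1 \<bullet> x = 0} \<union> {x. n2 \<bullet> x = 0}"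
    by (auto simp: set_eq_iff) (metis linorder_neqE_linordered_idom)
   moreover have "interior ({x. n1 \<bullet> x = 0} \<union> {x. n2 \<bullet> x = 0}) = {}"
    using n0 interior_closed_Un_empty_interior[OF closed_hyperplane[of n1 0], of "{x. n2 \<bullet> x = 0}"]
    by (simp add: interior_hyperplane)
   ultimately show False using interior_mono i by blast
  qed
  consider "?Q \<subseteq> C" "?R \<inter> C = {}" | "?R \<subseteq> C" "?Q \<inter> C = {}" using Q R nU nE by blast
  thus ?thesis
  proof cases
   case 1
   hence "C = {x. n1 \<bullet> x >= 0 \<and> n2 \<bullet> x >= 0}" using cQ by (auto simp: set_eq_iff) (meson not_le)+
   thus ?thesis using inward_cone_halfplanes[of C n1 n2 "e1 + e2"] n by (auto simp: inner_add_right)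
  next
   case 2
   hence "C = {x. (- n1) \<bullet> x >= 0 \<or> (- n2) \<bullet> x >= 0}" using cR by (auto simp: set_eq_iff) (meson not_le)
   thus ?thesis using inward_cone_halfplanes[of C "- n1" "- n2" "- (e1 + e2)"] n by (auto simp: inner_add_right inner_diff_right)
  qed
 qed
qed

section \<open>The boundary of a polygonal domain\<close>

text \<open>A simple closed curve minus a point is homeomorphic to the real line. Three segments
  issuing from that point would become three disjoint unbounded intervals, but the line has only two
  ends.\<close>

lemma no_triod:
 fixes g :: "real => pt"
 assumes g: "simple_path g" "pathfinish g = pathstart g" and y: "y \<in> path_image g"
  and S: "!!i. i < (3::nat) ==> a i ~= y \<and> closed_segment y (a i) \<subseteq> path_image g"
  and dis: "!!i j. i < 3 ==> j < 3 ==> i ~= j ==> closed_segment y (a i) \<inter> closed_segment y (a j) = {y}"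
 shows False
proof -
 let ?J = "path_image g"
 obtain f f' where f: "homeomorphism ?J (sphere (0::complex) 1) f f'"
  using homeomorphic_simple_path_image_circle[OF g, of 1 "0::complex"] by (auto simp: homeomorphic_def)
 have fy: "f y \<in> sphere 0 1" using f y by (auto simp: homeomorphism_def)
 have h1: "homeomorphism (?J - {y}) (sphere 0 1 - {f y}) f f'"
 proof (rule homeomorphism_of_subsets[OF f])
  show "f ` (?J - {y}) = sphere 0 1 - {f y}"
   using f y by (auto simp: homeomorphism_def image_iff) (metis)+
 qed auto
 have "sphere (0::complex) 1 - {f y} homeomorphic (UNIV :: real set)"
  using fy by (intro homeomorphic_punctured_sphere_affine) auto
 hence "?J - {y} homeomorphic (UNIV :: real set)"
  using h1 homeomorphic_trans[of "?J - {y}" "sphere 0 1 - {f y}" "UNIV :: real set"]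
  unfolding homeomorphic_def[of "?J - {y}" "sphere 0 1 - {f y}"] by blast
 then obtain k k' where k: "homeomorphism (?J - {y}) (UNIV :: real set) k k'" by (auto simp: homeomorphic_def)
 define P where "P i = closed_segment y (a i) - {y}" for i
 have P: "P i \<subseteq> ?J - {y}" if "i < 3" for i using S[OF that] by (auto simp: P_def)
 have Pc: "connected (P i)" if "i < 3" for i
 proof -
  have "P i = (%t. (1 - t) *\<^sub>R y + t *\<^sub>R a i) ` {0<..1}"
  proof safe
   fix x assume x: "x \<in> P i"
   then obtain t where t: "0 <= t" "t <= 1" "x = (1 - t) *\<^sub>R y + t *\<^sub>R a i" "x ~= y"
    by (auto simp: P_def closed_segment_def)
   hence "t ~= 0" by auto
   thus "x \<in> (%t. (1 - t) *\<^sub>R y + t *\<^sub>R a i) ` {0<..1}" using t by auto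
  next
   fix t :: real assume t: "t \<in> {0<..1}"
   have "(1 - t) *\<^sub>R y + t *\<^sub>R a i - y = t *\<^sub>R (a i - y)" by (simp add: algebra_simps)
   hence "(1 - t) *\<^sub>R y + t *\<^sub>R a i ~= y" using t S[OF that] by auto
   thus "(1 - t) *\<^sub>R y + t *\<^sub>R a i \<in> P i" using t by (auto simp: P_def closed_segment_def)
  qed
  thus ?thesis by (auto intro!: connected_continuous_image continuous_intros)
 qed
 define I where "I i = k ` P i" for i
 have Ic: "is_interval (I i)" if "i < 3" for i
  unfolding I_def is_interval_connected_1
  using k P[OF that] Pc[OF that] by (auto simp: homeomorphism_def intro!: connected_continuous_image continuous_on_subset[of "?J - {y}" k])
 \<comment> \<open>A bounded image would lie in a compact interval, whose preimage is a compact set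
   avoiding y; yet the points of the segment accumulate at y.\<close>
 have unb: "\<not> bounded (I i)" if i: "i < 3" for i
 proof
  assume "bounded (I i)"
  then obtain M where "!!x. x \<in> I i ==> norm x <= M" by (auto simp: bounded_iff)
  hence M: "I i \<subseteq> cball 0 M" by auto
  have "compact (k' ` cball 0 M)"
   using k by (intro compact_continuous_image) (auto simp: homeomorphism_def intro: continuous_on_subset)
  hence cl: "closed (k' ` cball 0 M)" by (rule compact_imp_closed)
  have sub: "P i \<subseteq> k' ` cball 0 M"
  proof
   fix x assume x: "x \<in> P i"
   hence "k' (k x) = x" using k P[OF i] by (auto simp: homeomorphism_def)
   thus "x \<in> k' ` cball 0 M" using x M by (auto simp: I_def image_iff) (metis subsetD imageI mem_cball_0)
  qed
  have lim: "(%n. (1 - 1 / real (Suc n)) *\<^sub>R y + (1 / real (Suc n)) *\<^sub>R a i) \<longlonglongrightarrow> (1 - 0) *\<^sub>R y + 0 *\<^sub>R a i"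
   by (intro tendsto_intros LIMSEQ_Suc lim_const_over_n)
  have mem: "(1 - 1 / real (Suc n)) *\<^sub>R y + (1 / real (Suc n)) *\<^sub>R a i \<in> k' ` cball 0 M" for n
  proof -
   have "(1 - 1 / real (Suc n)) *\<^sub>R y + (1 / real (Suc n)) *\<^sub>R a i ~= y"
    using S[OF i] by (auto simp: algebra_simps)
   hence "(1 - 1 / real (Suc n)) *\<^sub>R y + (1 / real (Suc n)) *\<^sub>R a i \<in> P i"
    by (auto simp: P_def closed_segment_def intro!: exI[of _ "1 / real (Suc n)"])
   thus ?thesis using sub by blast
  qed
  have "(1 - 0) *\<^sub>R y + 0 *\<^sub>R a i \<in> k' ` cball 0 M" by (rule closed_sequentially[OF cl mem lim])
  hence "y \<in> k' ` cball 0 M" by simp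
  thus False using k by (auto simp: homeomorphism_def)
 qed
 have disI: "I i \<inter> I j = {}" if "i < 3" "j < 3" "i ~= j" for i j
 proof -
  have "P i \<inter> P j = {}" using dis[OF that] by (auto simp: P_def)
  moreover have "inj_on k (?J - {y})" using k by (metis homeomorphism_def inj_on_inverseI)
  ultimately show ?thesis using P[OF that(1)] P[OF that(2)] unfolding I_def by (metis inj_on_image_Int image_empty)
 qed
 have ne: "\<exists>m. m \<in> I i" if "i < 3" for i using unb[OF that] by (metis bounded_empty ex_in_conv)
 have up: "\<not> (\<not> bdd_above (I i) \<and> \<not> bdd_above (I j))" if ij: "i < 3" "j < 3" "i ~= j" for i j
 proof
  assume u: "\<not> bdd_above (I i) \<and> \<not> bdd_above (I j)"
  obtain m where m: "m \<in> I i" using ne ij by blast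
  obtain x where x: "x \<in> I j" "m < x" using u by (meson bdd_above.I not_le)
  obtain w where w: "w \<in> I i" "x < w" using u by (meson bdd_above.I not_le)
  hence "x \<in> I i" using Ic[OF ij(1)] m x unfolding is_interval_1 by (meson less_imp_le)
  thus False using disI[OF ij] x by blast
 qed
 have dn: "\<not> (\<not> bdd_below (I i) \<and> \<not> bdd_below (I j))" if ij: "i < 3" "j < 3" "i ~= j" for i j
 proof
  assume u: "\<not> bdd_below (I i) \<and> \<not> bdd_below (I j)"
  obtain m where m: "m \<in> I i" using ne ij by blast
  obtain x where x: "x \<in> I j" "x < m" using u by (meson bdd_below.I not_le)
  obtain w where w: "w \<in> I i" "w < x" using u by (meson bdd_below.I not_le)
  hence "x \<in> I i" using Ic[OF ij(1)] m x unfolding is_interval_1 by (meson less_imp_le)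
  thus False using disI[OF ij] x by blast
 qed
 have "\<not> bdd_above (I i) \<or> \<not> bdd_below (I i)" if "i < 3" for i
 proof (rule ccontr)
  assume "\<not> (\<not> bdd_above (I i) \<or> \<not> bdd_below (I i))"
  then obtain l u where "!!x. x \<in> I i ==> l <= x \<and> x <= u" by (auto simp: bdd_above_def bdd_below_def)
  hence "I i \<subseteq> {l..u}" by auto
  thus False using unb[OF that] bounded_subset[OF bounded_closed_interval] by blast
 qed
 from this[of 0, simplified] this[of 1, simplified] this[of 2, simplified] show False
  using up[of 0 1, simplified] up[of 0 2, simplified] up[of 1 2, simplified]
   dn[of 0 1, simplified] dn[of 0 2, simplified] dn[of 1 2, simplified] by argo
qed

section \<open>Consequences of the Jordan curve theorem for polygonal domains\<close>

definition to_complex :: "pt => complex" where "to_complex v = Complex (v $ 1) (v $ 2)"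

lemma to_complex: "linear to_complex" "bij to_complex"
proof -
 show "linear to_complex" by (rule linearI) (auto simp: to_complex_def complex_eq_iff)
 show "bij to_complex"
 proof (rule bijI')
  show "\<exists>x. y = to_complex x" for y by (rule exI[of _ "vector [Re y, Im y]"]) (simp add: to_complex_def)
 qed (auto simp: to_complex_def vec_eq_iff forall_2)
qed

text \<open>A point of the interior of the closure outside the domain lies on some boundary polygon
  J. The connected domain stays on one side of J, and J is also the frontier of the other side, so
  points outside the closure accumulate there.\<close>

lemma polygonal_interior_closure:
 assumes "polygonal_domain Om"
 shows "interior (closure Om) = Om"
proof
 have op: "open Om" and con: "connected Om" using assms by (auto simp: polygonal_domain_def)
 thus "Om \<subseteq> interior (closure Om)" by (simp add: interior_maximal closure_subset)
 obtain \<J> where \<J>: "!!J. J \<in> \<J> ==> simple_polygon J" "frontier Om = \<Union>\<J>"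
  using assms by (auto simp: polygonal_domain_def)
 show "interior (closure Om) \<subseteq> Om"
 proof (rule ccontr)
  assume "\<not> interior (closure Om) \<subseteq> Om"
  then obtain x where x: "x \<in> interior (closure Om)" "x \<notin> Om" by auto
  hence "x \<in> frontier Om" using interior_subset op by (auto simp: frontier_def interior_open)
  then obtain J where J: "J \<in> \<J>" "x \<in> J" using \<J> by auto
  then obtain g where g: "simple_path g" "pathfinish g = pathstart g" "path_image g = J"
   using \<J>(1) by (auto simp: simple_polygon_def)
  \<comment> \<open>The Jordan curve theorem concerns the complex plane; this linear bijection
    carries it over.\<close>
  note lin = to_complex(1) and inj = bij_is_inj[OF to_complex(2)]
  let ?c = "to_complex \<circ> g" and ?J = "to_complex ` J" and ?O = "to_complex ` Om"
  have c: "simple_path ?c" "pathfinish ?c = pathstart ?c" "path_image ?c = ?J"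
   using g simple_path_linear_image_eq[OF lin inj] by (auto simp: pathfinish_def pathstart_def path_image_def image_comp)
  note jor = Jordan_inside_outside[OF c(1,2), unfolded c(3)]
  have "Om \<inter> J = {}" using J \<J>(2) op by (auto simp: frontier_def interior_open)
  hence OJ: "?O \<inter> ?J = {}" using inj by (auto simp: inj_on_def)
  have Ocon: "connected ?O" using con lin by (simp add: connected_linear_image)
  have "?O \<subseteq> inside ?J \<union> outside ?J" using OJ jor by auto
  hence "inside ?J \<inter> ?O = {} \<or> outside ?J \<inter> ?O = {}"
   using connectedD[OF Ocon, of "inside ?J" "outside ?J"] jor by auto
  then obtain N where N: "open N" "frontier N = ?J" "N \<inter> ?O = {}"
  proof
   assume "inside ?J \<inter> ?O = {}"
   thus thesis by (intro that[of "inside ?J"]) (simp_all add: jor)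
  next
   assume "outside ?J \<inter> ?O = {}"
   thus thesis by (intro that[of "outside ?J"]) (simp_all add: jor)
  qed
  have "N \<subseteq> - closure ?O" using N(1,3) by (metis Int_commute disjoint_eq_subset_Compl open_Int_closure_eq_empty)
  also have "- closure ?O = to_complex ` (- closure Om)"
   using closure_injective_linear_image[OF lin inj] to_complex(2) by (simp add: bij_image_Compl_eq)
  finally have "closure N \<subseteq> to_complex ` closure (- closure Om)"
   using closure_injective_linear_image[OF lin inj] closure_mono by metis
  moreover have "to_complex x \<in> closure N" using N(2) J(2) by (auto simp: frontier_def)
  ultimately have "x \<in> closure (- closure Om)" using inj by (auto simp: inj_on_def)
  thus False using x(1) by (simp add: closure_complement)
 qed
qed

text \<open>The boundary polygons are closed and disjoint, so a boundary segment starting at y stays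
  in the one polygon through y, a simple closed curve.\<close>

lemma polygonal_no_triod:
 assumes P: "polygonal_domain Om" and y: "y \<in> frontier Om"
  and seg: "!!i. i < (3::nat) ==> e i ~= 0 \<and> closed_segment y (y + e i) \<subseteq> frontier Om"
  and nr: "!!i j. i < 3 ==> j < 3 ==> i ~= j ==> \<not> same_ray (e i) (e j)"
 shows False
proof -
 obtain \<J> where \<J>: "finite \<J>" "pairwise disjnt \<J>" "!!J. J \<in> \<J> ==> simple_polygon J" "frontier Om = \<Union>\<J>"
  using P by (auto simp: polygonal_domain_def)
 obtain J where J: "J \<in> \<J>" "y \<in> J" using y \<J> by auto
 obtain g where g: "simple_path g" "pathfinish g = pathstart g" "path_image g = J"
  using \<J>(3)[OF J(1)] by (auto simp: simple_polygon_def)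
 have clo: "closed J'" if "J' \<in> \<J>" for J'
  using \<J>(3)[OF that] closed_simple_path_image by (auto simp: simple_polygon_def)
 have inJ: "closed_segment y (y + e i) \<subseteq> J" if "i < 3" for i
 proof -
  let ?S = "closed_segment y (y + e i)"
  have "closed J" "closed (\<Union>(\<J> - {J}))" using clo J \<J>(1) by (auto intro!: closed_Union)
  moreover have "?S \<subseteq> J \<union> \<Union>(\<J> - {J})" using seg[OF that] \<J>(4) by auto
  moreover have "J \<inter> \<Union>(\<J> - {J}) = {}" using \<J>(2) J by (auto simp: pairwise_def disjnt_def)
  moreover have "J \<inter> ?S ~= {}" using J by auto
  ultimately have "\<Union>(\<J> - {J}) \<inter> ?S = {}"
   using connected_closedD[of ?S J "\<Union>(\<J> - {J})"] by auto
  thus ?thesis using \<open>?S \<subseteq> J \<union> \<Union>(\<J> - {J})\<close> by blast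
 qed
 show False
 proof (rule no_triod[OF g(1,2), of y "%i. y + e i"])
  show "y \<in> path_image g" using J g by simp
  show "y + e i ~= y \<and> closed_segment y (y + e i) \<subseteq> path_image g" if "i < 3" for i
   using seg[OF that] inJ[OF that] g by auto
  fix i j :: nat assume ij: "i < 3" "j < 3" "i ~= j"
  show "closed_segment y (y + e i) \<inter> closed_segment y (y + e j) = {y}"
  proof safe
   fix x assume "x \<in> closed_segment y (y + e i)" "x \<in> closed_segment y (y + e j)"
   hence "\<exists>s\<ge>0. x = y + s *\<^sub>R e i" "\<exists>t\<ge>0. x = y + t *\<^sub>R e j"
    by (auto simp: closed_segment_def algebra_simps)
   then obtain s t where s: "0 <= s" "x = y + s *\<^sub>R e i" and t: "0 <= t" "x = y + t *\<^sub>R e j" by blast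
   show "x = y"
   proof (rule ccontr)
    assume "x ~= y"
    hence "s > 0" "t > 0" using s t by (auto simp: order_less_le)
    moreover have "s *\<^sub>R e i = t *\<^sub>R e j" using s t by simp
    hence "e j = (s / t) *\<^sub>R e i" using \<open>t > 0\<close> by (metis divideR_right divide_inverse_commute order_less_irrefl scaleR_scaleR)
    ultimately have "same_ray (e i) (e j)" unfolding same_ray_def by (metis divide_pos_pos)
    thus False using nr[OF ij] by simp
   qed
  qed
 qed
qed

section \<open>Triangulations of a polygonal domain\<close>

text \<open>An explicit form of the nodal basis function. The element picked does not matter, as the
  coordinates agree on common faces.\<close>

definition hat :: "pt set set => pt => pt => real" where
 "hat \<T> z x = (if x \<in> \<Union>\<T> then lam (SOME K. K \<in> \<T> \<and> x \<in> K) z x else 0)"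

locale mesh =
 fixes Om :: "pt set" and \<T> :: "pt set set"
 assumes P: "polygonal_domain Om" and tri: "triangulation \<T>" and simp2: "K \<in> \<T> ==> 2 simplex K"
  and cover: "\<Union>\<T> = closure Om"
begin

lemma opn: "open Om" and bdd: "bounded Om" and nonempty: "Om ~= {}" and Om_meas: "Om \<in> sets lebesgue"
 using P by (auto simp: polygonal_domain_def)

lemma fin: "finite \<T>" using tri by (simp add: triangulation_def)

lemma int_closure: "interior (closure Om) = Om" by (rule polygonal_interior_closure[OF P])

lemma T_ne: "\<T> ~= {}" using cover nonempty closure_subset[of Om] by auto

lemma face: "K \<in> \<T> ==> K' \<in> \<T> ==> K \<inter> K' face_of K"
 using tri by (simp add: triangulation_def)

lemma K_props:
 assumes "K \<in> \<T>"
 shows "K = convex hull (verts K)" "finite (verts K)" "card (verts K) = 3" "compact K" "convex K" "closed K"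
  "K \<subseteq> closure Om" "interior K \<subseteq> Om" "interior K ~= {}" "negligible (frontier K)" "closure (interior K) = K"
proof -
 note h = simplex_hull_verts[OF simp2[OF assms]]
 show "K = convex hull (verts K)" "finite (verts K)" "card (verts K) = 3" "compact K" "convex K" "closed K"
  using h by auto
 show sub: "K \<subseteq> closure Om" using assms cover by auto
 thus "interior K \<subseteq> Om" using interior_mono[OF sub] int_closure by simp
 have "affine hull K = UNIV" using h by (metis affine_hull_convex_hull)
 hence ri: "rel_interior K = interior K" by (rule rel_interior_interior)
 have "K ~= {}" using h(1,3) by (metis card.empty convex_hull_eq_empty zero_neq_numeral)
 thus ne: "interior K ~= {}" using ri h(6) rel_interior_eq_empty by metis
 show "negligible (frontier K)" using h(6) by (rule negligible_convex_frontier)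
 show "closure (interior K) = K" using convex_closure_interior[OF h(6) ne] h(7) by simp
qed

lemma vertices_eq: "vertices \<T> = (\<Union>K\<in>\<T>. verts K)" by (auto simp: vertices_def)

lemma finite_vertices: "finite (vertices \<T>)" unfolding vertices_eq using fin K_props(2) by auto

lemma vertex_of:
 assumes "y \<in> vertices \<T>" "K \<in> \<T>" "y \<in> K" shows "y \<in> verts K"
proof -
 obtain K' where K': "K' \<in> \<T>" "y extreme_point_of K'" using assms by (auto simp: vertices_def)
 have "K' \<inter> K face_of K'" "K \<inter> K' face_of K" using face assms K' by auto
 hence "y extreme_point_of (K \<inter> K')"
  using K' assms(3) extreme_point_of_face[of "K' \<inter> K" K' y] by (simp add: Int_commute extreme_point_of_def)
 thus ?thesis using extreme_point_of_face[OF \<open>K \<inter> K' face_of K\<close>] by simp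
qed

lemma verts_sub: "K \<in> \<T> ==> verts K \<subseteq> K" "K \<in> \<T> ==> verts K \<subseteq> vertices \<T>"
 by (auto simp: extreme_point_of_def vertices_def)

text \<open>A face of a simplex is spanned by some of its vertices, and these are vertices of K'
  too, because a mesh vertex lying in an element is a vertex of that element.\<close>

lemma Int_hull:
 assumes "K \<in> \<T>" "K' \<in> \<T>" shows "K \<inter> K' = convex hull (verts K \<inter> verts K')"
proof
 obtain C where C: "\<not> affine_dependent C" "K = convex hull C"
  using simp2[OF assms(1)] by (auto simp: simplex_def)
 have vC: "verts K = C" using C extreme_point_of_convex_hull_affine_independent by auto
 obtain c where c: "c \<subseteq> C" "K \<inter> K' = convex hull c"
  using face[OF assms] C face_of_convex_hull_affine_independent[OF C(1)] by auto
 have "c \<subseteq> verts K'"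
 proof
  fix y assume "y \<in> c"
  hence "y \<in> K \<inter> K'" "y \<in> verts K" using c vC by (auto intro: hull_inc)
  thus "y \<in> verts K'" using vertex_of[of y K'] verts_sub(2)[OF assms(1)] assms by auto
 qed
 thus "K \<inter> K' \<subseteq> convex hull (verts K \<inter> verts K')" using c vC by (simp add: hull_mono)
 have "convex hull (verts K \<inter> verts K') \<subseteq> convex hull verts K" "convex hull (verts K \<inter> verts K') \<subseteq> convex hull verts K'"
  by (auto intro!: hull_mono)
 thus "convex hull (verts K \<inter> verts K') \<subseteq> K \<inter> K'"
  using K_props(1)[OF assms(1)] K_props(1)[OF assms(2)] by auto
qed

lemma lam_agree:
 assumes "K \<in> \<T>" "K' \<in> \<T>" "x \<in> K" "x \<in> K'" shows "lam K z x = lam K' z x"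
proof -
 have "x \<in> affine hull (verts K \<inter> verts K')"
  using Int_hull[OF assms(1,2)] assms(3,4) convex_hull_subset_affine_hull by blast
 moreover have "lamG K z \<bullet> y + lamC K z = lamG K' z \<bullet> y + lamC K' z" if "y \<in> verts K \<inter> verts K'" for y
  using that lam_vertex[OF simp2[OF assms(1)], of y z] lam_vertex[OF simp2[OF assms(2)], of y z] by (simp add: lam_def)
 ultimately show ?thesis unfolding lam_def by (rule affine_eq_hull[rotated])
qed

lemma hat_eq: "K \<in> \<T> ==> x \<in> K ==> hat \<T> z x = lam K z x"
proof -
 assume K: "K \<in> \<T>" "x \<in> K"
 define K' where "K' = (SOME K. K \<in> \<T> \<and> x \<in> K)"
 have "K' \<in> \<T> \<and> x \<in> K'" unfolding K'_def by (rule someI[of "%K. K \<in> \<T> \<and> x \<in> K" K]) (use K in simp)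
 hence "lam K' z x = lam K z x" using lam_agree[of K' K x z] K by blast
 thus ?thesis using K unfolding hat_def K'_def[symmetric] by auto
qed

lemma nodal_basis_eq:
 assumes "z \<in> vertices \<T>" shows "nodal_basis \<T> z = hat \<T> z"
 unfolding nodal_basis_def
proof (rule the_equality)
 show "(\<forall>K\<in>\<T>. affine_fun_on K (hat \<T> z)) \<and> (\<forall>x. x \<notin> \<Union>\<T> --> hat \<T> z x = 0) \<and> (\<forall>y\<in>vertices \<T>. hat \<T> z y = (if y = z then 1 else 0))"
 proof (intro conjI ballI)
  fix K assume "K \<in> \<T>"
  thus "affine_fun_on K (hat \<T> z)" by (auto simp: affine_fun_on_def hat_eq lam_def)
 next
  fix y assume "y \<in> vertices \<T>"
  then obtain K where K: "K \<in> \<T>" "y \<in> verts K" by (auto simp: vertices_def)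
  hence "y \<in> K" using verts_sub by blast
  thus "hat \<T> z y = (if y = z then 1 else 0)"
   using K hat_eq[OF K(1)] lam_vertex[OF simp2[OF K(1)] K(2)] by simp
 qed (auto simp: hat_def)
next
 fix phi assume phi: "(\<forall>K\<in>\<T>. affine_fun_on K phi) \<and> (\<forall>x. x \<notin> \<Union>\<T> --> phi x = 0) \<and> (\<forall>y\<in>vertices \<T>. phi y = (if y = z then 1 else 0))"
 show "phi = hat \<T> z"
 proof
  fix x
  show "phi x = hat \<T> z x"
  proof (cases "x \<in> \<Union>\<T>")
   case True
   then obtain K where K: "K \<in> \<T>" "x \<in> K" by auto
   obtain a c where ac: "!!x. x \<in> K ==> phi x = a \<bullet> x + c" using phi K by (auto simp: affine_fun_on_def)
   have "a \<bullet> x + c = lamG K z \<bullet> x + lamC K z"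
   proof (rule affine_eq_hull)
    show "x \<in> affine hull (verts K)" using simplex_hull_verts(4)[OF simp2[OF K(1)]] by simp
    fix y assume y: "y \<in> verts K"
    hence "y \<in> K" "y \<in> vertices \<T>" using verts_sub[OF K(1)] by blast+
    thus "a \<bullet> y + c = lamG K z \<bullet> y + lamC K z"
     using ac[of y] phi lam_vertex[OF simp2[OF K(1)] y, of z] by (simp add: lam_def)
   qed
   thus ?thesis using ac K hat_eq[OF K] by (simp add: lam_def)
  qed (use phi in \<open>auto simp: hat_def\<close>)
 qed
qed

text \<open>A proper face misses the interior. The common face cannot be all of K, since both
  triangles would then have the same three vertices.\<close>

lemma interiors_disjoint:
 assumes "K \<in> \<T>" "K' \<in> \<T>" "K ~= K'" shows "interior K \<inter> K' = {}"
proof -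
 have "K \<inter> K' ~= K"
 proof
  assume a: "K \<inter> K' = K"
  hence "verts K \<subseteq> verts K'" using verts_sub[OF assms(1)] vertex_of[OF _ assms(2)] by blast
  hence "verts K = verts K'" using K_props(2,3)[OF assms(1)] K_props(2,3)[OF assms(2)] by (metis card_subset_eq)
  thus False using K_props(1)[OF assms(1)] K_props(1)[OF assms(2)] assms(3) by simp
 qed
 hence "(K \<inter> K') \<inter> interior K = {}" using face[OF assms(1,2)] face_of_disjoint_interior by blast
 thus ?thesis using interior_subset by blast
qed

section \<open>Stars of points and their tangent cones\<close>

definition star :: "pt => pt set set" where "star y = {K\<in>\<T>. y \<in> K}"

text \<open>For \<open>A = star y\<close> this is the tangent cone of the closed domain at y; proper
  parts of the star enter the connectedness argument.\<close>

definition Cone :: "pt set set => pt => pt set" where "Cone A y = (\<Union>K\<in>A. coneK K y)"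

lemma star_fin: "finite (star y)" "star y \<subseteq> \<T>" using fin by (auto simp: star_def)

lemma star_ne: "y \<in> closure Om ==> star y ~= {}" using cover by (auto simp: star_def)

lemma Cone_cone:
 assumes "A \<subseteq> star y" "A ~= {}" shows "is_cone (Cone A y)"
proof -
 have "finite A" using assms(1) star_fin finite_subset by blast
 thus ?thesis using assms(2) unfolding is_cone_def Cone_def
  by (auto intro!: closed_UN coneK_closed intro: coneK_scale) (auto simp: coneK_def)
qed

lemma Cone_local:
 assumes "A \<subseteq> star y" shows "\<exists>r>0. \<forall>v. norm v < r --> (y + v \<in> \<Union>A \<longleftrightarrow> v \<in> Cone A y)"
proof -
 have "\<forall>K\<in>A. \<exists>r>0. \<forall>v. norm v < r --> (y + v \<in> K \<longleftrightarrow> v \<in> coneK K y)"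
  using assms coneK_local simp2 by (auto simp: star_def)
 then obtain r where r: "!!K. K \<in> A ==> r K > 0" "!!K v. K \<in> A ==> norm v < r K ==> (y + v \<in> K \<longleftrightarrow> v \<in> coneK K y)" by metis
 have fA: "finite A" using assms star_fin finite_subset by blast
 define R where "R = Min (insert 1 (r ` A))"
 have R: "R > 0" "!!K. K \<in> A ==> R <= r K" using fA r(1) by (auto simp: R_def)
 have "y + v \<in> \<Union>A \<longleftrightarrow> v \<in> Cone A y" if "norm v < R" for v
  using r(2) R(2) that by (auto simp: Cone_def) (meson less_le_trans)+
 thus ?thesis using R by blast
qed

text \<open>The finitely many elements not containing y have positive distance from it.\<close>

lemma star_local: "\<exists>r>0. \<forall>v. norm v < r --> (y + v \<in> closure Om \<longleftrightarrow> v \<in> Cone (star y) y)"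
proof -
 obtain r where r: "r > 0" "!!v. norm v < r ==> (y + v \<in> \<Union>(star y) \<longleftrightarrow> v \<in> Cone (star y) y)"
  using Cone_local[of "star y" y] by blast
 have "closed (\<Union>(\<T> - star y))" using fin K_props(6) by (auto intro!: closed_Union)
 moreover have "y \<notin> \<Union>(\<T> - star y)" by (auto simp: star_def)
 ultimately obtain e where e: "e > 0" "ball y e \<inter> \<Union>(\<T> - star y) = {}"
  by (metis Compl_iff disjoint_eq_subset_Compl open_Compl open_contains_ball)
 have "y + v \<in> closure Om \<longleftrightarrow> v \<in> Cone (star y) y" if v: "norm v < min r e" for v
 proof -
  have "y + v \<in> ball y e" using v by (simp add: dist_norm)
  hence "y + v \<in> \<Union>\<T> \<longleftrightarrow> y + v \<in> \<Union>(star y)" using e(2) star_fin(2) by blast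
  thus ?thesis using r(2)[of v] v cover by simp
 qed
 thus ?thesis using r(1) e(1) by (intro exI[of _ "min r e"]) auto
qed

text \<open>Membership in the open domain is recovered from its closure, because the domain is the
  interior of its closure.\<close>

lemma star_local_interior:
 obtains r where "r > 0" "!!v. norm v < r ==> (y + v \<in> closure Om \<longleftrightarrow> v \<in> Cone (star y) y)"
  "!!v. norm v < r ==> (y + v \<in> Om \<longleftrightarrow> v \<in> interior (Cone (star y) y))"
proof -
 obtain r where r: "r > 0" "!!v. norm v < r ==> (y + v \<in> closure Om \<longleftrightarrow> v \<in> Cone (star y) y)"
  using star_local[of y] by blast
 let ?C = "Cone (star y) y"
 have "y + v \<in> Om \<longleftrightarrow> v \<in> interior ?C" if v: "norm v < r" for v
 proof
  assume "y + v \<in> Om"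
  then obtain e where e: "e > 0" "ball (y + v) e \<subseteq> Om" using opn open_contains_ball by blast
  have "ball v (min e (r - norm v)) \<subseteq> ?C"
  proof
   fix w assume w: "w \<in> ball v (min e (r - norm v))"
   hence "norm w < r" using norm_triangle_sub[of w v] by (simp add: dist_norm norm_minus_commute)
   moreover have "y + w \<in> ball (y + v) e" using w by (simp add: dist_norm)
   ultimately show "w \<in> ?C" using r(2) e(2) closure_subset by blast
  qed
  thus "v \<in> interior ?C" using e v by (auto simp: mem_interior intro!: exI[of _ "min e (r - norm v)"])
 next
  assume "v \<in> interior ?C"
  then obtain e where e: "e > 0" "ball v e \<subseteq> ?C" by (auto simp: mem_interior)
  have "ball (y + v) (min e (r - norm v)) \<subseteq> closure Om"
  proof
   fix x assume x: "x \<in> ball (y + v) (min e (r - norm v))"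
   define w where "w = x - y"
   have xw: "x = y + w" by (simp add: w_def)
   have "norm w < r" using x norm_triangle_sub[of w v] by (simp add: dist_norm norm_minus_commute xw)
   moreover have "w \<in> ball v e" using x by (simp add: dist_norm xw)
   ultimately show "x \<in> closure Om" using r(2) e(2) xw by blast
  qed
  hence "y + v \<in> interior (closure Om)" using e v by (auto simp: mem_interior intro!: exI[of _ "min e (r - norm v)"])
  thus "y + v \<in> Om" using int_closure by simp
 qed
 thus ?thesis using that r by blast
qed

lemma Cone_interior:
 assumes "A \<subseteq> star y" "A ~= {}" shows "interior (Cone A y) ~= {}"
proof -
 obtain K where K: "K \<in> A" using assms by auto
 hence KT: "K \<in> \<T>" "y \<in> K" using assms(1) by (auto simp: star_def)
 have "v \<in> coneK K y" if "y + v \<in> K" for v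
  using that mem_triangle[OF simp2[OF KT(1)]] by (auto simp: coneK_def lam_add dest!: bspec)
 have "(%x. - y + x) ` interior K \<subseteq> Cone A y"
 proof (rule image_subsetI)
  fix x assume "x \<in> interior K"
  hence "y + (- y + x) \<in> K" using interior_subset by auto
  thus "- y + x \<in> Cone A y" unfolding Cone_def using K \<open>!!v. y + v \<in> K ==> v \<in> coneK K y\<close> by blast
 qed
 moreover have "open ((%x. - y + x) ` interior K)" by (rule open_translation) simp
 ultimately have "(%x. - y + x) ` interior K \<subseteq> interior (Cone A y)" by (rule interior_maximal)
 thus ?thesis using K_props(9)[OF KT(1)] by blast
qed

text \<open>A cone with 0 in its interior is the whole plane.\<close>

lemma interior_iff_UNIV:
 assumes "y \<in> closure Om" shows "y \<in> Om \<longleftrightarrow> Cone (star y) y = UNIV"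
proof -
 obtain r where r: "r > 0" "!!v. norm v < r ==> (y + v \<in> Om \<longleftrightarrow> v \<in> interior (Cone (star y) y))"
  using star_local_interior[of y] by metis
 have c: "is_cone (Cone (star y) y)" using Cone_cone[OF _ star_ne[OF assms]] by simp
 show ?thesis
 proof
  assume "y \<in> Om"
  hence "0 \<in> interior (Cone (star y) y)" using r(2)[of 0] r(1) by simp
  then obtain e where e: "e > 0" "ball 0 e \<subseteq> Cone (star y) y" by (auto simp: mem_interior)
  have "v \<in> Cone (star y) y" for v
  proof -
   have "(e / 2 / (norm v + 1)) *\<^sub>R v \<in> ball 0 e"
    using e(1) by (auto simp: divide_simps) (smt (verit, ccfv_SIG) mult_pos_pos norm_ge_zero mult_nonneg_nonneg distrib_left mult.commute mult_cancel_left2)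
   hence "(e / 2 / (norm v + 1)) *\<^sub>R v \<in> Cone (star y) y" using e by blast
   hence "(2 * (norm v + 1) / e) *\<^sub>R (e / 2 / (norm v + 1)) *\<^sub>R v \<in> Cone (star y) y"
    using c e(1) unfolding is_cone_def by (meson add_nonneg_nonneg divide_nonneg_pos mult_nonneg_nonneg norm_ge_zero zero_le_numeral zero_le_one)
   moreover have "2 * (norm v + 1) / e * (e / 2 / (norm v + 1)) = 1"
   proof -
    have "2 * n / e * (e / 2 / n) = 1" if "n > 0" for n using that e(1) by (simp add: field_simps)
    show ?thesis by (rule \<open>!!n. n > 0 ==> 2 * n / e * (e / 2 / n) = 1\<close>) (simp add: add_nonneg_pos)
   qed
   ultimately show ?thesis by (metis scaleR_one scaleR_scaleR)
  qed
  thus "Cone (star y) y = UNIV" by auto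
 next
  assume "Cone (star y) y = UNIV"
  thus "y \<in> Om" using r(2)[of 0] r(1) by simp
 qed
qed

text \<open>Near y every frontier ray of the tangent cone is a segment in the boundary of the
  domain, so three different rays would form a triod.\<close>

lemma two_frontier_rays:
 assumes y: "y \<in> closure Om" and e: "{e1, e2, e3} \<subseteq> frontier (Cone (star y) y) - {0}"
 shows "same_ray e1 e2 \<or> same_ray e1 e3 \<or> same_ray e2 e3"
proof (rule ccontr)
 assume n: "\<not> ?thesis"
 let ?C = "Cone (star y) y"
 have c: "is_cone ?C" using Cone_cone[OF _ star_ne[OF y]] by simp
 hence clC: "closed ?C" by (simp add: is_cone_def)
 have yf: "y \<in> frontier Om"
  using y e interior_iff_UNIV[OF y] opn by (auto simp: frontier_def interior_open)
 obtain r where r: "r > 0" "!!v. norm v < r ==> (y + v \<in> closure Om \<longleftrightarrow> v \<in> ?C)"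
  "!!v. norm v < r ==> (y + v \<in> Om \<longleftrightarrow> v \<in> interior ?C)" using star_local_interior[of y] by metis
 define E where "E i = (if i = 0 then e1 else if i = 1 then e2 else e3)" for i :: nat
 have E: "E i \<in> frontier ?C" "E i ~= 0" for i using e by (auto simp: E_def)
 define eps where "eps i = r / (2 * norm (E i))" for i
 have eps: "eps i > 0" "norm (eps i *\<^sub>R E i) < r" for i using r(1) E(2)[of i] by (auto simp: eps_def)
 show False
 proof (rule polygonal_no_triod[OF P yf, of "%i. eps i *\<^sub>R E i"])
  fix i :: nat
  have "closed_segment y (y + eps i *\<^sub>R E i) \<subseteq> frontier Om"
  proof
   fix x assume "x \<in> closed_segment y (y + eps i *\<^sub>R E i)"
   then obtain t where t: "0 <= t" "t <= 1" "x = y + (t * eps i) *\<^sub>R E i" by (auto simp: closed_segment_def algebra_simps)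
   show "x \<in> frontier Om"
   proof (cases "t = 0")
    case False
    hence "(t * eps i) *\<^sub>R E i \<in> frontier ?C" using t eps(1)[of i] by (intro is_cone_frontier[OF c E(1)]) auto
    moreover have "norm ((t * eps i) *\<^sub>R E i) < r"
    proof -
     have "norm ((t * eps i) *\<^sub>R E i) = t * norm (eps i *\<^sub>R E i)" using t(1) by (simp add: abs_mult)
     also have "... <= 1 * norm (eps i *\<^sub>R E i)" using t(2) by (intro mult_right_mono) auto
     finally show ?thesis using eps(2)[of i] by simp
    qed
    ultimately have "x \<in> closure Om" "x \<notin> Om" using r(2,3)[of "(t * eps i) *\<^sub>R E i"] t(3) clC by (auto simp: frontier_def)
    thus ?thesis using opn by (simp add: frontier_def interior_open)
   qed (use t yf in simp)
  qed
  thus "eps i *\<^sub>R E i ~= 0 \<and> closed_segment y (y + eps i *\<^sub>R E i) \<subseteq> frontier Om" using eps(1)[of i] E(2)[of i] by simp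
 next
  fix i j :: nat assume ij: "i < 3" "j < 3" "i ~= j"
  show "\<not> same_ray (eps i *\<^sub>R E i) (eps j *\<^sub>R E j)"
  proof
   assume "same_ray (eps i *\<^sub>R E i) (eps j *\<^sub>R E j)"
   then obtain c where c: "c > 0" "eps j *\<^sub>R E j = c *\<^sub>R eps i *\<^sub>R E i" by (auto simp: same_ray_def)
   hence "E j = (c * eps i / eps j) *\<^sub>R E i" using eps(1)[of j]
    by (metis divideR_right divide_inverse_commute less_irrefl scaleR_scaleR)
   hence "same_ray (E i) (E j)" unfolding same_ray_def using c eps(1)[of i] eps(1)[of j] by (metis divide_pos_pos mult_pos_pos)
   moreover have "i = 0 \<or> i = 1 \<or> i = 2" "j = 0 \<or> j = 1 \<or> j = 2" using ij by linarith+
   ultimately show False using n ij(3) by (elim disjE) (simp_all add: E_def, auto dest: same_ray_sym)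
  qed
 qed
qed

text \<open>If A and the rest B of the star met only in z, their cones would meet only in 0, and the
  frontier rays of both would bound the tangent cone of the domain: two from A and a third from B,
  one too many. So some K in A and K' in B share more than z, that is, an edge.\<close>

lemma star_connected:
 assumes z: "z \<in> vertices \<T>" and A: "A \<subseteq> star z" "A ~= {}" "A ~= star z"
 obtains K K' y where "K \<in> A" "K' \<in> star z - A" "y ~= z" "verts K \<inter> verts K' = {z, y}"
proof -
 obtain K0 where K0: "K0 \<in> \<T>" "z \<in> verts K0" using z by (auto simp: vertices_def)
 have zc: "z \<in> closure Om" using K0 verts_sub K_props(7) by blast
 define B where "B = star z - A"
 have B: "B \<subseteq> star z" "B ~= {}" using A by (auto simp: B_def)
 have "\<exists>K\<in>A. \<exists>K'\<in>B. K \<inter> K' ~= {z}"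
 proof (rule ccontr)
  assume no: "\<not> (\<exists>K\<in>A. \<exists>K'\<in>B. K \<inter> K' ~= {z})"
  have AB: "Cone A z \<inter> Cone B z \<subseteq> {0}"
  proof
   fix v assume v: "v \<in> Cone A z \<inter> Cone B z"
   obtain r where r: "r > 0" "!!v. norm v < r ==> (z + v \<in> \<Union>A \<longleftrightarrow> v \<in> Cone A z)" using Cone_local[OF A(1)] by blast
   obtain s where s: "s > 0" "!!v. norm v < s ==> (z + v \<in> \<Union>B \<longleftrightarrow> v \<in> Cone B z)" using Cone_local[OF B(1)] by blast
   show "v \<in> {0}"
   proof (rule ccontr)
    assume v0: "v \<notin> {0}"
    define t where "t = min r s / (2 * norm v)"
    have t: "t > 0" "norm (t *\<^sub>R v) < min r s" using r(1) s(1) v0 by (auto simp: t_def)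
    have "t *\<^sub>R v \<in> Cone A z" "t *\<^sub>R v \<in> Cone B z"
     using v t(1) Cone_cone[OF A(1,2)] Cone_cone[OF B] by (auto simp: is_cone_def)
    hence "z + t *\<^sub>R v \<in> \<Union>A" "z + t *\<^sub>R v \<in> \<Union>B" using r(2) s(2) t(2) by auto
    hence "z + t *\<^sub>R v = z" using no by blast
    thus False using t(1) v0 by simp
   qed
  qed
  have st: "Cone (star z) z = Cone A z \<union> Cone B z" using A(1) by (auto simp: Cone_def B_def)
  \<comment> \<open>The other cone is closed and does not contain e, so it is absent near e, and a
    frontier point of one part is one of the union.\<close>
  have fr: "e \<in> frontier (Cone (star z) z)" if "X = Cone A z \<and> Y = Cone B z \<or> X = Cone B z \<and> Y = Cone A z" "e \<in> frontier X" "e ~= 0" for e X Y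
  proof -
   have cl: "closed X" "closed Y" using that(1) Cone_cone[OF A(1,2)] Cone_cone[OF B] by (auto simp: is_cone_def)
   have eX: "e \<in> X" "e \<notin> interior X" using that(2) cl by (auto simp: frontier_def)
   have eY: "e \<notin> Y" using AB eX that by auto
   have U: "Cone (star z) z = X \<union> Y" using st that(1) by auto
   have "e \<notin> interior (X \<union> Y)"
   proof
    assume "e \<in> interior (X \<union> Y)"
    moreover have "interior (X \<union> Y) \<inter> (- Y) \<subseteq> interior X"
    proof (rule interior_maximal)
     show "interior (X \<union> Y) \<inter> - Y \<subseteq> X" using interior_subset by blast
     show "open (interior (X \<union> Y) \<inter> - Y)" using cl by auto
    qed
    ultimately show False using eY eX by auto
   qed
   thus ?thesis using eX U cl by (simp add: frontier_def)
  qed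
  have nU: "Cone A z ~= UNIV" "Cone B z ~= UNIV"
  proof -
   have "interior {0::pt} = {}" by simp
   hence "\<not> Cone A z \<subseteq> {0}" "\<not> Cone B z \<subseteq> {0}"
    using Cone_interior[OF A(1,2)] Cone_interior[OF B] interior_mono[of _ "{0::pt}"] by (metis subset_empty)+
   thus "Cone A z ~= UNIV" "Cone B z ~= UNIV" using AB by auto
  qed
  obtain e1 e2 where e12: "e1 \<in> frontier (Cone A z)" "e2 \<in> frontier (Cone A z)" "e1 ~= 0" "e2 ~= 0" "\<not> same_ray e1 e2"
   using cone_two_frontier_rays[OF Cone_cone[OF A(1,2)] Cone_interior[OF A(1,2)] nU(1)] .
  obtain e3 e4 where e3: "e3 \<in> frontier (Cone B z)" "e3 ~= 0"
   using cone_two_frontier_rays[OF Cone_cone[OF B] Cone_interior[OF B] nU(2)] by metis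
  have "{e1, e2, e3} \<subseteq> frontier (Cone (star z) z) - {0}"
   using fr[of "Cone A z" "Cone B z"] fr[of "Cone B z" "Cone A z"] e12 e3 by auto
  from two_frontier_rays[OF zc this] e12(5) have "same_ray e1 e3 \<or> same_ray e2 e3" by blast
  then obtain e c where "e \<in> frontier (Cone A z)" "c > 0" "e3 = c *\<^sub>R e" using e12 by (auto simp: same_ray_def)
  hence "e3 \<in> frontier (Cone A z)" using is_cone_frontier[OF Cone_cone[OF A(1,2)]] by blast
  moreover have "closed (Cone A z)" "closed (Cone B z)" using Cone_cone[OF A(1,2)] Cone_cone[OF B] by (auto simp: is_cone_def)
  ultimately have "e3 \<in> Cone A z \<inter> Cone B z" using e3(1) by (simp add: frontier_def)
  thus False using AB e3(2) by blast
 qed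
 then obtain K K' where K: "K \<in> A" "K' \<in> B" "K \<inter> K' ~= {z}" by blast
 have KT: "K \<in> \<T>" "K' \<in> \<T>" "z \<in> K" "z \<in> K'" "K ~= K'" using K A(1) by (auto simp: B_def star_def)
 let ?W = "verts K \<inter> verts K'"
 have zW: "z \<in> ?W" using vertex_of[OF z] KT by auto
 have fW: "finite ?W" using K_props(2)[OF KT(1)] by simp
 have "?W ~= {z}" using K(3) Int_hull[OF KT(1,2)] by auto
 moreover have "card ?W <= 2"
 proof (rule ccontr)
  assume "\<not> card ?W <= 2"
  hence "card ?W >= card (verts K)" using K_props(3)[OF KT(1)] by simp
  hence "?W = verts K" using card_seteq[of "verts K" ?W] K_props(2)[OF KT(1)] by auto
  moreover have "?W = verts K'" using calculation \<open>\<not> card ?W <= 2\<close> card_seteq[of "verts K'" ?W] K_props(2,3)[OF KT(2)] by auto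
  ultimately have "verts K = verts K'" by simp
  thus False using K_props(1)[OF KT(1)] K_props(1)[OF KT(2)] KT(5) by simp
 qed
 moreover obtain y where y: "y \<in> ?W" "y ~= z" using zW \<open>?W ~= {z}\<close> by blast
 ultimately have "?W = {z, y}" using zW fW card_seteq[of ?W "{z, y}"] by auto
 thus ?thesis using that[of K K' y] K y by (auto simp: B_def)
qed

lemma lam_nonvertex: "K \<in> \<T> ==> z \<notin> verts K ==> lam K z x = 0"
proof -
 assume K: "K \<in> \<T>" "z \<notin> verts K"
 have "lamG K z \<bullet> x + lamC K z = 0 \<bullet> x + 0"
 proof (rule affine_eq_hull[where V = "verts K"])
  fix y assume "y \<in> verts K"
  thus "lamG K z \<bullet> y + lamC K z = 0 \<bullet> y + 0"
   using lam_vertex[OF simp2[OF K(1)], of y z] K(2) by (auto simp: lam_def)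
 qed (use simplex_hull_verts(4)[OF simp2[OF K(1)]] in simp)
 thus ?thesis by (simp add: lam_def)
qed

lemma hat_sum:
 assumes "K \<in> \<T>" "x \<in> K"
 shows "(\<Sum>z\<in>vertices \<T>. hat \<T> z x *\<^sub>R (f z :: 'b::real_vector)) = (\<Sum>z\<in>verts K. lam K z x *\<^sub>R f z)"
proof -
 have "(\<Sum>z\<in>vertices \<T>. hat \<T> z x *\<^sub>R f z) = (\<Sum>z\<in>vertices \<T>. lam K z x *\<^sub>R f z)"
  using hat_eq[OF assms] by simp
 also have "... = (\<Sum>z\<in>verts K. lam K z x *\<^sub>R f z)"
  using verts_sub(2)[OF assms(1)] finite_vertices lam_nonvertex[OF assms(1)]
  by (intro sum.mono_neutral_right) auto
 finally show ?thesis .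
qed

section \<open>A continuous field pointing into the domain\<close>

definition inward :: "pt => pt => bool" where "inward y d = inward_cone (Cone (star y) y) d"

lemma inward_exists:
 assumes y: "y \<in> closure Om" shows "\<exists>d. inward y d"
proof (cases "Cone (star y) y = UNIV")
 case True
 thus ?thesis by (auto simp: inward_def inward_cone_def intro!: exI[of _ 0] exI[of _ "1::real"])
next
 case False
 thus ?thesis unfolding inward_def
  using cone_inward_exists[OF Cone_cone[OF _ star_ne[OF y]] Cone_interior[OF _ star_ne[OF y]] False] two_frontier_rays[OF y]
  by blast
qed

text \<open>Moving from y towards z keeps the same barycentric coordinates positive, as that of z is
  positive at y already. Hence neither the elements containing the point nor the active constraints
  change.\<close>

lemma star_move:
 assumes K: "K \<in> \<T>" "y \<in> K" "z \<in> verts K" "lam K z y > 0" and e: "0 < e" "e < 1"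
 shows "star (z + e *\<^sub>R (y - z)) = star y" "K' \<in> star y ==> coneK K' (z + e *\<^sub>R (y - z)) = coneK K' y"
proof -
 let ?y = "z + e *\<^sub>R (y - z)"
 have yy: "?y = (1 - e) *\<^sub>R z + e *\<^sub>R y" by (simp add: algebra_simps)
 have l: "lam K' z' ?y = (1 - e) * lam K' z' z + e * lam K' z' y" for K' z'
  unfolding yy by (rule lam_convex) simp
 have zK: "z \<in> K" using K verts_sub by blast
 have yK: "?y \<in> K" unfolding yy using K_props(5)[OF K(1)] zK K(2) e by (simp add: convexD_alt)
 have lz: "lam K z ?y > 0" unfolding l using lam_vertex[OF simp2[OF K(1)] K(3), of z] K(4) e by (simp add: add_pos_pos)
 have pos_in: "z' \<in> verts K'" if "K' \<in> \<T>" "x \<in> K" "x \<in> K'" "lam K z' x > 0" for K' x z'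
  using that lam_nonvertex[of K' z' x] lam_agree[OF K(1) that(1-3), of z'] by (cases "z' \<in> verts K'") auto
 show st: "star ?y = star y"
 proof (intro set_eqI iffI)
  fix K' assume "K' \<in> star y"
  hence K': "K' \<in> \<T>" "y \<in> K'" by (auto simp: star_def)
  hence "z \<in> verts K'" using pos_in K by blast
  hence "z \<in> K'" using verts_sub K' by blast
  hence "?y \<in> K'" unfolding yy using K_props(5)[OF K'(1)] K'(2) e by (simp add: convexD_alt)
  thus "K' \<in> star ?y" using K' by (simp add: star_def)
 next
  fix K' assume "K' \<in> star ?y"
  hence K': "K' \<in> \<T>" "?y \<in> K'" by (auto simp: star_def)
  have "y \<in> convex hull (verts K \<inter> verts K')"
  proof (rule lam_in_hull[OF simp2[OF K(1)]])
   show "0 <= lam K z' y" if "z' \<in> verts K" for z' using that mem_triangle[OF simp2[OF K(1)]] K(2) by blast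
   fix z' assume z': "z' \<in> verts K - verts K \<inter> verts K'"
   have "lam K z' ?y = 0"
    using lam_agree[OF K(1) K'(1) yK K'(2), of z'] lam_nonvertex[OF K'(1), of z'] z' by auto
   moreover have "z ~= z'" using pos_in[OF K'(1) yK K'(2) lz] z' K(3) by auto
   hence "lam K z' z = 0" using lam_vertex[OF simp2[OF K(1)] K(3)] by simp
   ultimately show "lam K z' y = 0" using l[of K z'] e by simp
  qed auto
  hence "y \<in> K'" using Int_hull[OF K(1) K'(1)] by blast
  thus "K' \<in> star y" using K' by (simp add: star_def)
 qed
 show "coneK K' ?y = coneK K' y" if "K' \<in> star y"
 proof -
  have K': "K' \<in> \<T>" "y \<in> K'" using that by (auto simp: star_def)
  have zK': "z \<in> verts K'" using pos_in[OF K'(1) K(2) K'(2)] K(4) by blast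
  have "lam K' z' ?y = 0 \<longleftrightarrow> lam K' z' y = 0" if "z' \<in> verts K'" for z'
  proof (cases "z' = z")
   case True
   have "lam K' z y > 0" using lam_agree[OF K(1) K'(1) K(2) K'(2)] K(4) by simp
   moreover have "lam K' z ?y > 0" unfolding l using lam_vertex[OF simp2[OF K'(1)] zK', of z] calculation e by (simp add: add_pos_pos)
   ultimately show ?thesis using True by simp
  next
   case False
   hence "lam K' z' z = 0" using lam_vertex[OF simp2[OF K'(1)] zK'] by simp
   thus ?thesis using l[of K' z'] e by simp
  qed
  thus ?thesis by (auto simp: coneK_def)
 qed
qed

text \<open>The point y is moved close to z, where it keeps its tangent cone and where the domain
  coincides with the cone at z. There a push along an inward direction of z ends in the domain;
  scaling turns this into the claim for the cone at y.\<close>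

lemma inward_transfer:
 assumes K: "K \<in> \<T>" "y \<in> K" "z \<in> verts K" "lam K z y > 0" and d: "inward z d"
 shows "inward y d"
proof -
 obtain eta where eta: "eta > 0" "!!x tau d'. x \<in> Cone (star z) z ==> tau > 0 ==> norm (d' - d) < eta ==> x + tau *\<^sub>R d' \<in> interior (Cone (star z) z)"
  using d by (auto simp: inward_def inward_cone_def)
 obtain r where r: "r > 0" "!!v. norm v < r ==> (z + v \<in> closure Om \<longleftrightarrow> v \<in> Cone (star z) z)"
  "!!v. norm v < r ==> (z + v \<in> Om \<longleftrightarrow> v \<in> interior (Cone (star z) z))" using star_local_interior[of z] by metis
 \<comment> \<open>Small enough to place the moved point within r / 2 of z; the other half of r is
   left for the scaled vectors.\<close>
 define e where "e = min (1/2) (r / (2 * (norm (y - z) + 1)))"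
 have e: "0 < e" "e < 1" using r(1) by (auto simp: e_def add_nonneg_pos)
 define w where "w = e *\<^sub>R (y - z)"
 have w: "norm w <= r / 2"
 proof -
  have "norm w = e * norm (y - z)" using e by (simp add: w_def)
  also have "... <= r / (2 * (norm (y - z) + 1)) * (norm (y - z) + 1)" using e by (intro mult_mono) (auto simp: e_def)
  also have "... = r / 2"
   using add_nonneg_pos[OF norm_ge_zero[of "y - z"] zero_less_one] by (simp add: field_simps)
  finally show ?thesis .
 qed
 let ?y = "z + w"
 have st: "star ?y = star y" "Cone (star ?y) ?y = Cone (star y) y"
  using star_move[OF K e] unfolding w_def[symmetric] by (auto simp: Cone_def)
 obtain s where s: "s > 0" "!!v. norm v < s ==> (?y + v \<in> closure Om \<longleftrightarrow> v \<in> Cone (star y) y)"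
  "!!v. norm v < s ==> (?y + v \<in> Om \<longleftrightarrow> v \<in> interior (Cone (star y) y))"
  using star_local_interior[of ?y] unfolding st(2) by metis
 have cy: "is_cone (Cone (star y) y)" using Cone_cone[of "star y" y] K by (auto simp: star_def)
 have "x + tau *\<^sub>R d' \<in> interior (Cone (star y) y)" if x: "x \<in> Cone (star y) y" and tau: "tau > 0" and d': "norm (d' - d) < eta" for x tau d'
 proof -
  define B where "B = norm x + norm (tau *\<^sub>R d') + 1"
  have B: "B > 0" "norm x < B" "norm (x + tau *\<^sub>R d') < B"
   using norm_triangle_ineq[of x "tau *\<^sub>R d'"] by (auto simp: B_def add_nonneg_pos)
  \<comment> \<open>Shrinks both x and x + tau d' into the radius within which the cones describe
    the domain.\<close>
  define theta where "theta = min s (r / 2) / B"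
  have theta: "theta > 0" "theta * B = min s (r / 2)" using s(1) r(1) B by (auto simp: theta_def)
  have nx: "norm (theta *\<^sub>R x) < min s (r / 2)" "norm (theta *\<^sub>R (x + tau *\<^sub>R d')) < min s (r / 2)"
   using mult_strict_left_mono[OF B(2) theta(1)] mult_strict_left_mono[OF B(3) theta(1)] theta by auto
  have "theta *\<^sub>R x \<in> Cone (star y) y" using x theta cy by (simp add: is_cone_def)
  hence "z + (w + theta *\<^sub>R x) \<in> closure Om" using s(2)[of "theta *\<^sub>R x"] nx by (simp add: add.assoc)
  moreover have "norm (w + theta *\<^sub>R x) < r" using w nx norm_triangle_ineq[of w "theta *\<^sub>R x"] by simp
  ultimately have "w + theta *\<^sub>R x \<in> Cone (star z) z" using r(2) by blast
  from eta(2)[OF this, of "theta * tau" d'] theta tau d'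
  have "w + theta *\<^sub>R x + (theta * tau) *\<^sub>R d' \<in> interior (Cone (star z) z)" by simp
  hence "w + theta *\<^sub>R (x + tau *\<^sub>R d') \<in> interior (Cone (star z) z)" by (simp add: scaleR_right_distrib add.assoc)
  moreover have "norm (w + theta *\<^sub>R (x + tau *\<^sub>R d')) < r" using w nx norm_triangle_ineq[of w "theta *\<^sub>R (x + tau *\<^sub>R d')"] by simp
  ultimately have "z + (w + theta *\<^sub>R (x + tau *\<^sub>R d')) \<in> Om" using r(3) by blast
  hence "theta *\<^sub>R (x + tau *\<^sub>R d') \<in> interior (Cone (star y) y)" using s(3) nx by (simp add: add.assoc)
  from is_cone_interior[OF cy this, of "1 / theta"] theta show ?thesis by simp
 qed
 thus ?thesis unfolding inward_def inward_cone_def using eta(1) by blast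
qed

lemma inward_scale: "inward y d ==> s > 0 ==> inward y (s *\<^sub>R d)"
proof -
 assume d: "inward y d" and s: "s > 0"
 obtain eta where eta: "eta > 0" "!!x tau d'. x \<in> Cone (star y) y ==> tau > 0 ==> norm (d' - d) < eta ==> x + tau *\<^sub>R d' \<in> interior (Cone (star y) y)"
  using d by (auto simp: inward_def inward_cone_def)
 have "x + tau *\<^sub>R d' \<in> interior (Cone (star y) y)" if x: "x \<in> Cone (star y) y" "tau > 0" "norm (d' - s *\<^sub>R d) < s * eta" for x tau d'
 proof -
  have "d' - s *\<^sub>R d = s *\<^sub>R ((1 / s) *\<^sub>R d' - d)" using s by (simp add: scaleR_right_diff_distrib)
  hence "norm ((1 / s) *\<^sub>R d' - d) < eta" using x(3) s by simp
  from eta(2)[OF x(1) _ this, of "tau * s"] x(2) s show ?thesis by simp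
 qed
 thus ?thesis unfolding inward_def inward_cone_def using eta(1) s by (intro exI[of _ "s * eta"]) auto
qed

text \<open>Inward directions can be added even if the tangent cone is not convex: the push by d' is
  split into one along d' - d2, which is near d1, followed by one along d2.\<close>

lemma inward_add: "inward y d1 ==> inward y d2 ==> inward y (d1 + d2)"
proof -
 assume d: "inward y d1" "inward y d2"
 obtain eta where eta: "eta > 0" "!!x tau d'. x \<in> Cone (star y) y ==> tau > 0 ==> norm (d' - d1) < eta ==> x + tau *\<^sub>R d' \<in> interior (Cone (star y) y)"
  using d by (auto simp: inward_def inward_cone_def)
 have 2: "!!x tau. x \<in> Cone (star y) y ==> tau > 0 ==> x + tau *\<^sub>R d2 \<in> interior (Cone (star y) y)"
  using d(2) by (auto simp: inward_def inward_cone_def)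
 have "x + tau *\<^sub>R d' \<in> interior (Cone (star y) y)" if x: "x \<in> Cone (star y) y" "tau > 0" "norm (d' - (d1 + d2)) < eta" for x tau d'
 proof -
  have "norm ((d' - d2) - d1) < eta" using x(3) by (simp add: algebra_simps)
  from eta(2)[OF x(1,2) this] have "x + tau *\<^sub>R (d' - d2) \<in> Cone (star y) y" using interior_subset by blast
  from 2[OF this x(2)] show ?thesis by (simp add: algebra_simps)
 qed
 thus ?thesis unfolding inward_def inward_cone_def using eta(1) by blast
qed

definition field :: "(pt => pt) => pt => pt" where "field d x = (\<Sum>z\<in>vertices \<T>. hat \<T> z x *\<^sub>R d z)"

text \<open>Only vertices whose coordinate is positive at y contribute; their directions are inward
  at y, and so is every positive combination of them.\<close>

lemma field_inward:
 assumes d: "!!z. z \<in> vertices \<T> ==> inward z (d z)" and y: "y \<in> closure Om"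
 shows "inward y (field d y)"
proof -
 obtain K where K: "K \<in> \<T>" "y \<in> K" using y cover by auto
 let ?S = "{z\<in>verts K. lam K z y > 0}"
 have fV: "finite (verts K)" using K_props(2)[OF K(1)] .
 have nn: "z \<in> verts K ==> 0 <= lam K z y" for z using mem_triangle[OF simp2[OF K(1)]] K(2) by blast
 have "field d y = (\<Sum>z\<in>verts K. lam K z y *\<^sub>R d z)" unfolding field_def by (rule hat_sum[OF K])
 also have "... = (\<Sum>z\<in>?S. lam K z y *\<^sub>R d z)"
 proof (rule sum.mono_neutral_right)
  show "\<forall>i\<in>verts K - ?S. lam K i y *\<^sub>R d i = 0"
  proof
   fix i assume "i \<in> verts K - ?S"
   hence "lam K i y = 0" using nn[of i] by auto
   thus "lam K i y *\<^sub>R d i = 0" by simp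
  qed
 qed (use fV in auto)
 finally have eq: "field d y = (\<Sum>z\<in>?S. lam K z y *\<^sub>R d z)" .
 have "?S ~= {}"
 proof
  assume "?S = {}"
  hence "lam K z y = 0" if "z \<in> verts K" for z using nn[OF that] that by (auto simp: order_less_le)
  thus False using lam_sum(1)[OF simp2[OF K(1)], of y] by simp
 qed
 moreover have "inward y (lam K z y *\<^sub>R d z)" if "z \<in> ?S" for z
 proof -
  have "inward z (d z)" using that d verts_sub(2)[OF K(1)] by blast
  thus ?thesis using that inward_transfer[OF K] by (intro inward_scale) auto
 qed
 moreover have sumI: "inward y (\<Sum>z\<in>S. f z)" if "finite S" "S ~= {}" "!!z. z \<in> S ==> inward y (f z)" for S :: "pt set" and f
  using that by (induction S rule: finite_ne_induct) (auto intro: inward_add)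
 ultimately show ?thesis unfolding eq using fV by (intro sumI) auto
qed

lemma continuous_pw:
 fixes f :: "pt => 'b::topological_space"
 assumes "!!K. K \<in> \<T> ==> continuous_on K f" shows "continuous_on (closure Om) f"
 using continuous_on_closed_Union[OF fin, of "%K. K" f] assms K_props(6) cover by auto

lemma field_affine:
 assumes "K \<in> \<T>" "x \<in> K"
 shows "field d x = (\<Sum>z\<in>verts K. (lamG K z \<bullet> x) *\<^sub>R d z) + (\<Sum>z\<in>verts K. lamC K z *\<^sub>R d z)"
 unfolding field_def hat_sum[OF assms] by (simp add: lam_def scaleR_left_distrib sum.distrib)

lemma field_continuous: "continuous_on (closure Om) (field d)"
proof (rule continuous_pw)
 fix K assume K: "K \<in> \<T>"
 have "continuous_on K (%x. (\<Sum>z\<in>verts K. (lamG K z \<bullet> x) *\<^sub>R d z) + (\<Sum>z\<in>verts K. lamC K z *\<^sub>R d z))"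
  by (intro continuous_intros)
 thus "continuous_on K (field d)" using field_affine[OF K] by (simp cong: continuous_on_cong)
qed

text \<open>Near y the field stays within the tolerance \<open>eta\<close> of its value at y, and
  the displacements stay where the cone describes the domain. Compactness of the closure makes the
  admissible step uniform.\<close>

lemma inward_field_exists:
 obtains d t0 where "t0 > 0" "!!t x. 0 < t ==> t < t0 ==> x \<in> closure Om ==> x + t *\<^sub>R field d x \<in> Om"
proof -
 have "\<forall>z\<in>vertices \<T>. \<exists>d. inward z d"
  using inward_exists verts_sub(1) K_props(7) by (auto simp: vertices_eq) blast
 then obtain d where d: "!!z. z \<in> vertices \<T> ==> inward z (d z)" by metis
 have "\<exists>rho>0. \<forall>x\<in>closure Om \<inter> ball y rho. \<forall>t. 0 < t \<and> t < rho --> x + t *\<^sub>R field d x \<in> Om" if y: "y \<in> closure Om" for y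
 proof -
  let ?V = "field d"
  obtain eta where eta: "eta > 0" "!!x tau d'. x \<in> Cone (star y) y ==> tau > 0 ==> norm (d' - ?V y) < eta ==> x + tau *\<^sub>R d' \<in> interior (Cone (star y) y)"
   using field_inward[OF d y] by (auto simp: inward_def inward_cone_def)
  obtain r where r: "r > 0" "!!v. norm v < r ==> (y + v \<in> closure Om \<longleftrightarrow> v \<in> Cone (star y) y)"
   "!!v. norm v < r ==> (y + v \<in> Om \<longleftrightarrow> v \<in> interior (Cone (star y) y))" using star_local_interior[of y] by metis
  obtain delta where delta: "delta > 0" "!!x. x \<in> closure Om ==> dist x y < delta ==> dist (?V x) (?V y) < eta"
   using field_continuous[of d] y eta(1) unfolding continuous_on_iff by blast
  define M where "M = norm (?V y) + eta"
  have M: "M > 0" using eta by (simp add: M_def add_nonneg_pos)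
  define rho where "rho = min delta (min (r / 2) (r / 2 / M))"
  have "x + t *\<^sub>R ?V x \<in> Om" if x: "x \<in> closure Om" "dist x y < rho" and t: "0 < t" "t < rho" for x t
  proof -
   have "norm (x - y) < r" using x r(1) by (simp add: rho_def dist_norm)
   hence c: "x - y \<in> Cone (star y) y" using r(2)[of "x - y"] x(1) by simp
   have Vx: "norm (?V x - ?V y) < eta" using delta(2)[OF x(1)] x(2) by (simp add: rho_def dist_norm)
   hence "norm (?V x) <= M" using norm_triangle_sub[of "?V x" "?V y"] by (simp add: M_def)
   hence "t * norm (?V x) <= t * M" using t(1) by (intro mult_left_mono) auto
   also have "... < (r / 2 / M) * M" using t M by (intro mult_strict_right_mono) (auto simp: rho_def)
   finally have "norm (t *\<^sub>R ?V x) < r / 2" using t M by simp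
   moreover have "norm (x - y) < r / 2" using x(2) by (simp add: rho_def dist_norm)
   ultimately have "norm (x - y + t *\<^sub>R ?V x) < r" using norm_triangle_ineq[of "x - y" "t *\<^sub>R ?V x"] by simp
   from r(3)[OF this] eta(2)[OF c t(1) Vx] show ?thesis by simp
  qed
  moreover have "rho > 0" using delta r M by (simp add: rho_def)
  ultimately show ?thesis by (intro exI[of _ rho]) (auto simp: dist_commute)
 qed
 then obtain rho where rho: "!!y. y \<in> closure Om ==> rho y > 0"
  "!!y x t. y \<in> closure Om ==> x \<in> closure Om ==> x \<in> ball y (rho y) ==> 0 < t ==> t < rho y ==> x + t *\<^sub>R field d x \<in> Om"
  by (metis IntI)
 have "compact (closure Om)" using bdd by simp
 then obtain F where F: "F \<subseteq> closure Om" "finite F" "closure Om \<subseteq> (\<Union>y\<in>F. ball y (rho y))"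
  by (rule compactE_image[of _ "closure Om" "%y. ball y (rho y)"]) (use rho(1) in auto)
 define t0 where "t0 = Min (insert 1 (rho ` F))"
 have t0: "t0 > 0" "!!y. y \<in> F ==> t0 <= rho y" using F rho(1) by (auto simp: t0_def)
 show ?thesis
 proof (rule that[OF t0(1)])
  fix t x assume t: "0 < t" "t < t0" "x \<in> closure Om"
  then obtain y where y: "y \<in> F" "x \<in> ball y (rho y)" using F(3) by blast
  have "t < rho y" using t0(2)[OF y(1)] t(2) by simp
  thus "x + t *\<^sub>R field d x \<in> Om" using rho(2)[OF _ t(3) y(2) t(1)] y(1) F(1) by blast
 qed
qed

end

section \<open>Piecewise continuously differentiable functions\<close>

lemma C1_on_mult:
 assumes "C1_on K f F" "C1_on K g G" shows "C1_on K (%x. f x * g x) (%x. f x *\<^sub>R G x + g x *\<^sub>R F x)"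
 using assms C1_on_continuous[OF assms(1)] C1_on_continuous[OF assms(2)] unfolding C1_on_def
 by (auto intro!: continuous_intros derivative_eq_intros simp: inner_add_left algebra_simps)

lemma C1_on_lipschitz:
 assumes C: "C1_on K f F" and K: "compact K" "convex K"
 obtains L where "L >= 0" "L-lipschitz_on K f"
proof -
 have "bounded (F ` K)" using C K by (auto simp: C1_on_def intro: compact_imp_bounded compact_continuous_image)
 then obtain B where B: "!!x. x \<in> K ==> norm (F x) <= B" by (auto simp: bounded_iff)
 have "(max B 0)-lipschitz_on K f"
 proof (rule bounded_derivative_imp_lipschitz[OF _ K(2)])
  fix x assume x: "x \<in> K"
  show "(f has_derivative (%d. F x \<bullet> d)) (at x within K)" using C x by (simp add: C1_on_def)
  show "onorm (%d. F x \<bullet> d) <= max B 0"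
  proof (rule onorm_le)
   fix d
   have "norm (F x \<bullet> d) <= norm (F x) * norm d" using Cauchy_Schwarz_ineq2 by simp
   also have "... <= max B 0 * norm d" using B[OF x] by (intro mult_right_mono) auto
   finally show "norm (F x \<bullet> d) <= max B 0 * norm d" .
  qed
 qed simp
 thus ?thesis using that[of "max B 0"] by simp
qed

lemma difference_quotient:
 fixes F :: "pt => real"
 assumes "(F has_derivative D) (at x)"
 shows "(%n. (F (x + (1 / real (Suc n)) *\<^sub>R e) - F x) * real (Suc n)) \<longlonglongrightarrow> D e"
proof -
 have lin: "linear D" using assms by (rule has_derivative_linear)
 have g: "((%t::real. x + t *\<^sub>R e) has_derivative (%h. h *\<^sub>R e)) (at 0)" by (auto intro!: derivative_eq_intros)
 have "(F has_derivative D) (at (x + 0 *\<^sub>R e))" using assms by simp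
 from has_derivative_compose[OF g this]
 have "((%t. F (x + t *\<^sub>R e)) has_derivative (%h. D (h *\<^sub>R e))) (at 0)" .
 hence "((%t. F (x + t *\<^sub>R e)) has_real_derivative D e) (at 0)"
  using lin by (simp add: has_field_derivative_def linear_cmul mult.commute[of _ "D e"])
 hence "((%h. (F (x + h *\<^sub>R e) - F x) / h) \<longlongrightarrow> D e) (at 0)" by (simp add: DERIV_def)
 moreover have "filterlim (%n. 1 / real (Suc n)) (at 0) sequentially"
 proof -
  have "(%n. 1 / real (Suc n)) \<longlonglongrightarrow> 0" by (intro LIMSEQ_Suc lim_const_over_n)
  thus ?thesis by (simp add: filterlim_at del: of_nat_Suc)
 qed
 ultimately have "(%n. (F (x + (1 / real (Suc n)) *\<^sub>R e) - F x) / (1 / real (Suc n))) \<longlonglongrightarrow> D e"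
  by (rule filterlim_compose)
 thus ?thesis by simp
qed

lemma integral_translate:
 fixes F :: "pt => real"
 assumes "F \<in> borel_measurable borel"
 shows "(LINT x|lborel. F (x + a)) = (LINT x|lborel. F x)"
proof -
 have "(LINT x|lborel. F x) = (LINT x|distr lborel borel ((+) a). F x)" by (simp add: lborel_distr_plus)
 also have "... = (LINT x|lborel. F (a + x))" using assms by (subst integral_distr) auto
 finally show ?thesis by (simp add: add.commute)
qed

lemma integrable_continuous_support:
 fixes F :: "pt => real"
 assumes "continuous_on UNIV F" "!!x. x \<notin> cball 0 R ==> F x = 0"
 shows "integrable lborel F"
proof -
 have "integrable lborel (%x. indicator (cball 0 R) x *\<^sub>R F x)"
  using assms(1) by (intro borel_integrable_compact) (auto intro: continuous_on_subset)
 moreover have "indicator (cball 0 R) x *\<^sub>R F x = F x" for x using assms(2)[of x] by (auto simp: indicator_def)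
 ultimately show ?thesis by (simp only:)
qed

context mesh
begin

text \<open>The values come from a single function on all closed elements, hence are continuous
  across edges; the gradients may differ from element to element.\<close>

definition pwC1 :: "(pt => real) => (pt set => pt => pt) => bool" where
 "pwC1 f G \<longleftrightarrow> (\<forall>K\<in>\<T>. C1_on K f (G K))"

definition pwgrad :: "(pt set => pt => pt) => pt => pt" where
 "pwgrad G x = G (SOME K. K \<in> \<T> \<and> x \<in> K) x"

lemma pwgrad_eq: "K \<in> \<T> ==> x \<in> interior K ==> pwgrad G x = G K x"
proof -
 assume K: "K \<in> \<T>" "x \<in> interior K"
 have "(SOME K. K \<in> \<T> \<and> x \<in> K) = K"
 proof (rule some_equality)
  show "K \<in> \<T> \<and> x \<in> K" using K interior_subset by blast
  show "K' = K" if "K' \<in> \<T> \<and> x \<in> K'" for K' using that K interiors_disjoint[of K K'] by blast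
 qed
 thus ?thesis by (simp add: pwgrad_def)
qed

lemma frontiers_negligible: "negligible (\<Union>K\<in>\<T>. frontier K)"
 using fin K_props(10) by (intro negligible_Union) auto

lemma AE_in_interior: "AE x in lebesgue. x \<in> closure Om --> (\<exists>K\<in>\<T>. x \<in> interior K)"
proof -
 have "AE x in lebesgue. x \<notin> (\<Union>K\<in>\<T>. frontier K)"
  using frontiers_negligible by (intro AE_not_in) (simp add: negligible_iff_null_sets)
 thus ?thesis
 proof eventually_elim
  case (elim x)
  show ?case
  proof
   assume "x \<in> closure Om"
   then obtain K where "K \<in> \<T>" "x \<in> K" using cover by auto
   thus "\<exists>K\<in>\<T>. x \<in> interior K" using elim K_props(6)[of K] by (auto simp: frontier_def)
  qed
 qed
qed

lemma AE_interior_on: "AE x in leb Om. \<exists>K\<in>\<T>. x \<in> interior K"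
proof -
 have "AE x in lebesgue. x \<in> Om --> (\<exists>K\<in>\<T>. x \<in> interior K)"
  using AE_in_interior by eventually_elim (use closure_subset in blast)
 thus ?thesis using Om_meas by (simp add: AE_restrict_space_iff)
qed

lemma fm: "finite_measure (leb Om)" "K \<in> \<T> ==> finite_measure (leb (interior K))"
proof -
 show "finite_measure (leb Om)" by (rule finite_measure_lebesgue_on[OF lmeasurable_open[OF bdd opn]])
 show "K \<in> \<T> ==> finite_measure (leb (interior K))"
  using bounded_subset[OF compact_imp_bounded[OF K_props(4)] interior_subset]
  by (intro finite_measure_lebesgue_on lmeasurable_open) auto
qed

text \<open>The frontiers of the elements are null sets; open elements are used so that the pieces
  are disjoint.\<close>

lemma integral_split:
 fixes f :: "pt => real"
 assumes f: "integrable (leb Om) f"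
 shows "(LINT x|leb Om. f x) = (\<Sum>K\<in>\<T>. LINT x|leb (interior K). f x)"
  "K \<in> \<T> ==> integrable (leb (interior K)) f"
proof -
 have i: "integrable lebesgue (%x. indicator Om x *\<^sub>R f x)" using f Om_meas by (simp add: integrable_restrict_space)
 have iK: "integrable lebesgue (%x. indicator (interior K) x *\<^sub>R f x)" if "K \<in> \<T>" for K
 proof -
  have "integrable lebesgue (%x. indicator (interior K) x *\<^sub>R (indicator Om x *\<^sub>R f x))"
   by (rule integrable_mult_indicator[OF _ i]) simp
  moreover have "indicator (interior K) x *\<^sub>R (indicator Om x *\<^sub>R f x) = indicator (interior K) x *\<^sub>R f x" for x
   using K_props(8)[OF that] by (auto simp: indicator_def)
  ultimately show ?thesis by (simp only:)
 qed
 thus "K \<in> \<T> ==> integrable (leb (interior K)) f" by (simp add: integrable_restrict_space)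
 have "AE x in lebesgue. indicator Om x *\<^sub>R f x = (\<Sum>K\<in>\<T>. indicator (interior K) x *\<^sub>R f x)"
  using AE_in_interior
 proof eventually_elim
  case (elim x)
  show ?case
  proof (cases "x \<in> Om")
   case True
   then obtain K where K: "K \<in> \<T>" "x \<in> interior K" using elim closure_subset by blast
   have "(\<Sum>K'\<in>\<T>. indicator (interior K') x *\<^sub>R f x) = (\<Sum>K'\<in>\<T>. if K' = K then f x else 0)"
   proof (rule sum.cong)
    fix K' assume "K' \<in> \<T>"
    thus "indicator (interior K') x *\<^sub>R f x = (if K' = K then f x else 0)"
     using K interiors_disjoint[of K K'] interior_subset[of K'] by (auto simp: indicator_def)
   qed simp
   thus ?thesis using True K fin by simp
  next
   case False
   hence "indicator (interior K) x *\<^sub>R f x = 0" if "K \<in> \<T>" for K using K_props(8)[OF that] by (auto simp: indicator_def)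
   hence "(\<Sum>K\<in>\<T>. indicator (interior K) x *\<^sub>R f x) = 0" by (intro sum.neutral) blast
   thus ?thesis using False by simp
  qed
 qed
 hence "(LINT x|lebesgue. indicator Om x *\<^sub>R f x) = (LINT x|lebesgue. (\<Sum>K\<in>\<T>. indicator (interior K) x *\<^sub>R f x))"
  using i iK by (intro integral_cong_AE) (auto intro!: borel_measurable_integrable)
 also have "... = (\<Sum>K\<in>\<T>. LINT x|lebesgue. indicator (interior K) x *\<^sub>R f x)" using iK by (intro Bochner_Integration.integral_sum)
 finally show "(LINT x|leb Om. f x) = (\<Sum>K\<in>\<T>. LINT x|leb (interior K). f x)"
  using Om_meas by (simp add: integral_restrict_space)
qed

lemma sqi_split:
 assumes "f \<in> L2 (leb Om)"
 shows "sqi (leb Om) f = (\<Sum>K\<in>\<T>. sqi (leb (interior K)) f)"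
 unfolding sqi_def using integral_split(1)[OF L2_integrable_sq[OF assms]] .

lemma sqi_K_le:
 fixes f :: "pt => 'b::euclidean_space"
 assumes "f \<in> L2 (leb Om)" "K \<in> \<T>"
 shows "f \<in> L2 (leb (interior K))" "sqi (leb (interior K)) f <= sqi (leb Om) f"
 using L2_subset[OF assms(1) K_props(8)[OF assms(2)]] Om_meas by auto

lemma AE_interior_closed: "K \<in> \<T> ==> AE x in lebesgue. x \<in> K \<longleftrightarrow> x \<in> interior K"
proof -
 assume K: "K \<in> \<T>"
 have "AE x in lebesgue. x \<notin> frontier K" using K_props(10)[OF K] by (intro AE_not_in) (simp add: negligible_iff_null_sets)
 thus ?thesis by eventually_elim (use K_props(6)[OF K] interior_subset[of K] in \<open>auto simp: frontier_def\<close>)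
qed

lemma integral_interior_eq:
 fixes f :: "pt => real"
 assumes K: "K \<in> \<T>" and f: "integrable (leb K) f"
 shows "(LINT x|leb (interior K). f x) = (LINT x|leb K. f x)"
proof -
 have Km: "K \<in> sets lebesgue" using K_props(6)[OF K] by simp
 have i: "integrable lebesgue (%x. indicator K x *\<^sub>R f x)" using f Km by (simp add: integrable_restrict_space)
 have "integrable lebesgue (%x. indicator (interior K) x *\<^sub>R (indicator K x *\<^sub>R f x))"
  by (rule integrable_mult_indicator[OF _ i]) simp
 moreover have "indicator (interior K) x *\<^sub>R (indicator K x *\<^sub>R f x) = indicator (interior K) x *\<^sub>R f x" for x
  using interior_subset[of K] by (auto simp: indicator_def)
 ultimately have i2: "integrable lebesgue (%x. indicator (interior K) x *\<^sub>R f x)" by (simp only:)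
 have "AE x in lebesgue. indicator (interior K) x *\<^sub>R f x = indicator K x *\<^sub>R f x"
  using AE_interior_closed[OF K] by eventually_elim (auto simp: indicator_def)
 hence "(LINT x|lebesgue. indicator (interior K) x *\<^sub>R f x) = (LINT x|lebesgue. indicator K x *\<^sub>R f x)"
  using i i2 by (intro integral_cong_AE) (auto intro: borel_measurable_integrable)
 thus ?thesis using Km by (simp add: integral_restrict_space)
qed

lemma sqi_interior_eq:
 fixes f :: "pt => 'b::euclidean_space"
 assumes "K \<in> \<T>" "continuous_on K f" shows "sqi (leb (interior K)) f = sqi (leb K) f"
 unfolding sqi_def using integral_interior_eq[OF assms(1) L2_integrable_sq[OF L2_continuous_compact[OF assms(2) K_props(4)[OF assms(1)]]]] .

lemma measure_interior_eq: "K \<in> \<T> ==> measure lebesgue (interior K) = measure lebesgue K"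
 using integral_interior_eq[of K "%x. 1"] K_props(4,6)[of K] compact_finite_measure[of K]
 by (simp add: finite_measure.integrable_const measure_restrict_space)

lemma pwC1_continuous: "pwC1 f G ==> continuous_on (closure Om) f"
 by (intro continuous_pw) (auto simp: pwC1_def intro: C1_on_continuous)

lemma L2_continuous_closure:
 fixes f :: "pt => 'b::euclidean_space"
 assumes "continuous_on (closure Om) f"
 shows "f \<in> L2 (leb Om)"
proof -
 have "compact (closure Om)" using bdd by simp
 from L2_subset(1)[OF L2_continuous_compact[OF assms this] closure_subset] show ?thesis using Om_meas by simp
qed

lemma pwgrad_L2:
 assumes "pwC1 f G" shows "pwgrad G \<in> L2 (leb Om)"
proof -
 let ?T = "%x. \<Sum>K\<in>\<T>. indicator (interior K) x *\<^sub>R G K x"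
 have L: "(%x. indicator (interior K) x *\<^sub>R G K x) \<in> L2 (leb Om)" if K: "K \<in> \<T>" for K
 proof -
  have c: "continuous_on K (G K)" using assms K by (simp add: pwC1_def C1_on_def)
  have "G K \<in> L2 (leb K)" using L2_continuous_compact[OF c K_props(4)[OF K]] .
  hence m: "G K \<in> borel_measurable (leb K)" "integrable (leb K) (%x. (norm (G K x))^2)" by (auto simp: L2_def)
  have Km: "K \<in> sets lebesgue" using K_props(6)[OF K] by simp
  have "(%x. if x \<in> K then G K x else 0) \<in> borel_measurable lebesgue" using m(1) Km by (simp add: borel_measurable_if)
  hence "(%x. indicator (interior K) x *\<^sub>R (if x \<in> K then G K x else 0)) \<in> borel_measurable lebesgue"
   by (intro borel_measurable_scaleR borel_measurable_indicator) auto
  moreover have eq: "indicator (interior K) x *\<^sub>R (if x \<in> K then G K x else 0) = indicator (interior K) x *\<^sub>R G K x" for x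
   using interior_subset[of K] by (auto simp: indicator_def)
  ultimately have mm: "(%x. indicator (interior K) x *\<^sub>R G K x) \<in> borel_measurable lebesgue" by (simp only:)
  have "bounded (G K ` K)" using c K_props(4)[OF K] compact_continuous_image compact_imp_bounded by blast
  then obtain B where B: "!!x. x \<in> K ==> norm (G K x) <= B" by (auto simp: bounded_iff)
  show ?thesis
  proof (rule L2_bounded(1)[OF fm(1), where B = "max B 0"])
   show "(%x. indicator (interior K) x *\<^sub>R G K x) \<in> borel_measurable (leb Om)" using mm by (rule measurable_restrict_space1)
   fix x show "norm (indicator (interior K) x *\<^sub>R G K x) <= max B 0"
    using B[of x] interior_subset[of K] by (cases "x \<in> interior K") auto
  qed
 qed
 have sum: "(%x. \<Sum>K\<in>A. indicator (interior K) x *\<^sub>R G K x) \<in> L2 (leb Om)" if "A \<subseteq> \<T>" "finite A" for A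
  using that(2,1)
 proof (induction A)
  case empty
  thus ?case using L2_const[OF fm(1), of 0] by simp
 next
  case (insert K A)
  hence "(%x. indicator (interior K) x *\<^sub>R G K x + (\<Sum>K\<in>A. indicator (interior K) x *\<^sub>R G K x)) \<in> L2 (leb Om)"
   by (intro L2_add L) auto
  thus ?case by (simp only: sum.insert[OF insert.hyps(1,2)])
 qed
 have "AE x in leb Om. ?T x = pwgrad G x"
  using AE_interior_on
 proof eventually_elim
  case (elim x)
  then obtain K where K: "K \<in> \<T>" "x \<in> interior K" by blast
  have "?T x = (\<Sum>K'\<in>\<T>. if K' = K then G K x else 0)"
  proof (rule sum.cong)
   fix K' assume "K' \<in> \<T>"
   thus "indicator (interior K') x *\<^sub>R G K' x = (if K' = K then G K x else 0)"
    using K interiors_disjoint[of K K'] interior_subset[of K'] by (auto simp: indicator_def)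
  qed simp
  thus ?case using K fin pwgrad_eq[OF K] by simp
 qed
 thus ?thesis by (rule L2_cong_AE(1)[OF Om_meas sum[OF order_refl fin]])
qed

lemma test_C1: "phi \<in> test_functions Om ==> C1_on K phi (%x. \<chi> i. partial i phi x)"
proof -
 assume phi: "phi \<in> test_functions Om"
 have "continuous_on K (partial i phi)" for i using test_function_smooth(3)[OF phi] continuous_on_subset by blast
 hence "continuous_on K (%x. \<chi> i. partial i phi x)" by (rule continuous_on_vec_lambda)
 moreover have "(phi has_derivative (%d. (\<chi> i. partial i phi x) \<bullet> d)) (at x within K)" for x
  using test_function_smooth(8)[OF phi, of x] by (auto simp: inner_vec_def mult.commute intro: has_derivative_at_withinI)
 ultimately show ?thesis by (simp add: C1_on_def)
qed

text \<open>The product is Lipschitz with a common constant on every closed element and, being zero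
  there, on the complement of the domain. Each segment is covered by finitely many of these closed
  sets, so the constant holds on the whole plane.\<close>

lemma pwC1_times_test_lipschitz:
 assumes f: "pwC1 f G" and phi: "phi \<in> test_functions Om"
 obtains L where "L >= 0" "L-lipschitz_on UNIV (%x. if x \<in> closure Om then f x * phi x else 0)"
proof -
 define F where "F = (%x. if x \<in> closure Om then f x * phi x else 0)"
 have "\<exists>L\<ge>0. L-lipschitz_on K F" if K: "K \<in> \<T>" for K
 proof -
  have "C1_on K f (G K)" using f K by (simp add: pwC1_def)
  from C1_on_mult[OF this test_C1[OF phi]]
  obtain L where L: "L >= 0" "L-lipschitz_on K (%x. f x * phi x)"
   using C1_on_lipschitz[OF _ K_props(4,5)[OF K]] by blast
  moreover have "F x = f x * phi x" if "x \<in> K" for x using that K_props(7)[OF K] by (auto simp: F_def)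
  ultimately have "L-lipschitz_on K F"
   by (intro lipschitz_onI) (use lipschitz_onD[OF L(2)] in auto)
  thus ?thesis using L(1) by blast
 qed
 then obtain LK where LK: "!!K. K \<in> \<T> ==> LK K >= 0" "!!K. K \<in> \<T> ==> (LK K)-lipschitz_on K F" by metis
 define L where "L = Max (insert 0 (LK ` \<T>))"
 have L: "L >= 0" "!!K. K \<in> \<T> ==> LK K <= L" using fin by (auto simp: L_def)
 have LF: "L-lipschitz_on K F" if "K \<in> \<T>" for K using lipschitz_on_mono[OF LK(2)[OF that] order_refl L(2)[OF that]] .
 have L0: "L-lipschitz_on (- Om) F"
 proof -
  have "F x = 0" if "x \<in> - Om" for x using that test_function_smooth(4)[OF phi, of x] test_function_smooth(7)[OF phi] by (auto simp: F_def)
  thus ?thesis using L(1) by (auto simp: lipschitz_on_def)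
 qed
 have "L-lipschitz_on UNIV F"
 proof (rule lipschitz_onI[OF _ L(1)])
  fix x y :: pt
  let ?gamma = "%t::real. x + t *\<^sub>R (y - x)"
  have "(L * norm (y - x))-lipschitz_on {0..1} (%t. F (?gamma t))"
  proof (rule lipschitz_on_closed_Union[where I = "insert (- Om) \<T>" and U = "%S. ?gamma -` S"])
   fix S assume S: "S \<in> insert (- Om) \<T>"
   have "L-lipschitz_on S F" using S LF L0 by auto
   thus "(L * norm (y - x))-lipschitz_on (?gamma -` S) (%t. F (?gamma t))"
   proof (intro lipschitz_onI)
    fix s t assume "s \<in> ?gamma -` S" "t \<in> ?gamma -` S"
    hence "dist (F (?gamma s)) (F (?gamma t)) <= L * dist (?gamma s) (?gamma t)" by (intro lipschitz_onD[OF \<open>L-lipschitz_on S F\<close>]) auto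
    also have "dist (?gamma s) (?gamma t) = norm (y - x) * dist s t"
    proof -
     have "?gamma s - ?gamma t = (s - t) *\<^sub>R (y - x)" by (simp add: scaleR_left_diff_distrib)
     thus ?thesis by (simp add: dist_norm)
    qed
    finally show "dist (F (?gamma s)) (F (?gamma t)) <= L * norm (y - x) * dist s t" by (simp add: mult.assoc)
   qed (use L in auto)
   have "closed S" using S opn K_props(6) by auto
   thus "closed (?gamma -` S)" by (intro continuous_closed_vimage) (auto intro!: continuous_intros)
  next
   have "UNIV = Om \<union> (- Om)" by auto
   also have "... \<subseteq> \<Union>(insert (- Om) \<T>)" using cover closure_subset[of Om] by auto
   finally have "UNIV \<subseteq> \<Union>(insert (- Om) \<T>)" .
   thus "{0..1} \<subseteq> (\<Union>S\<in>insert (- Om) \<T>. ?gamma -` S)" by blast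
  qed (use fin L in auto)
  from lipschitz_onD[OF this, of 0 1] show "dist (F x) (F y) <= L * dist x y"
   by (simp add: dist_norm norm_minus_commute)
 qed
 thus ?thesis using that L unfolding F_def by blast
qed

text \<open>This avoids integrating by parts on each element. The product F of f and phi is
  Lipschitz with compact support; its difference quotients have integral zero by translation
  invariance, are bounded by the Lipschitz constant and converge almost everywhere to the classical
  derivative, so dominated convergence gives the identity.\<close>

lemma pwC1_weak_gradient:
 assumes f: "pwC1 f G" shows "is_weak_gradient Om f (pwgrad G)"
proof -
 have fL: "f \<in> L2 (leb Om)" by (rule L2_continuous_closure[OF pwC1_continuous[OF f]])
 have lf: "locally_integrable Om f" by (rule L2_locally_integrable[OF fL opn])
 have lg: "locally_integrable Om (pwgrad G)" by (rule L2_locally_integrable[OF pwgrad_L2[OF f] opn])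
 show ?thesis
  unfolding is_weak_gradient_def
 proof (intro conjI lf lg ballI allI)
  fix phi i assume phi: "phi \<in> test_functions Om"
  define S where "S = closure {x. phi x ~= 0}"
  have S: "compact S" "S \<subseteq> Om" using test_function_smooth(6,7)[OF phi] by (auto simp: S_def)
  define F where "F = (%x. if x \<in> closure Om then f x * phi x else 0)"
  obtain L where L: "L >= 0" "L-lipschitz_on UNIV F" using pwC1_times_test_lipschitz[OF f phi] unfolding F_def by blast
  have F0: "F x = 0" if "x \<notin> S" for x using that test_function_smooth(4)[OF phi, of x] by (auto simp: F_def S_def)
  obtain R where R: "R > 0" "S \<subseteq> cball 0 R"
  proof -
   obtain b where "b > 0" "\<forall>x\<in>S. norm x <= b" using compact_imp_bounded[OF S(1)] by (auto simp: bounded_pos)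
   hence "S \<subseteq> cball 0 b" by auto
   thus ?thesis using that[of b] \<open>b > 0\<close> by blast
  qed
  have cF: "continuous_on UNIV F" using lipschitz_on_continuous_on[OF L(2)] .
  have Fm: "F \<in> borel_measurable borel" using borel_measurable_continuous_onI[OF cF] .
  have Fi: "integrable lborel F" using integrable_continuous_support[OF cF, of R] F0 R by blast
  define e where "e = (axis i 1 :: pt)"
  have ne: "norm e = 1" by (simp add: e_def)
  define Q where "Q n x = (F (x + (1 / real (Suc n)) *\<^sub>R e) - F x) * real (Suc n)" for n x
  have Qm: "Q n \<in> borel_measurable borel" for n
   unfolding Q_def using cF by (intro borel_measurable_continuous_onI continuous_intros continuous_on_compose2[OF cF]) auto
  have Q0: "(LINT x|lborel. Q n x) = 0" for n
  proof -
   have c2: "continuous_on UNIV (%x. F (x + (1 / real (Suc n)) *\<^sub>R e))"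
    by (intro continuous_on_compose2[OF cF] continuous_intros) auto
   have "integrable lborel (%x. F (x + (1 / real (Suc n)) *\<^sub>R e))"
   \<comment> \<open>The step length is at most 1, so the translated support stays in the ball of
     radius R + 1.\<close>
   proof (rule integrable_continuous_support[OF c2, of "R + 1"])
    fix x :: pt assume x: "x \<notin> cball 0 (R + 1)"
    have "norm x <= norm (x + (1 / real (Suc n)) *\<^sub>R e) + norm ((1 / real (Suc n)) *\<^sub>R e)"
     using norm_triangle_ineq4[of "x + (1 / real (Suc n)) *\<^sub>R e" "(1 / real (Suc n)) *\<^sub>R e"] by simp
    also have "norm ((1 / real (Suc n)) *\<^sub>R e) <= 1" using ne by (simp add: field_simps)
    finally have "x + (1 / real (Suc n)) *\<^sub>R e \<notin> S" using x R by auto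
    thus "F (x + (1 / real (Suc n)) *\<^sub>R e) = 0" by (rule F0)
   qed
   hence "(LINT x|lborel. Q n x) = ((LINT x|lborel. F (x + (1 / real (Suc n)) *\<^sub>R e)) - (LINT x|lborel. F x)) * real (Suc n)"
    unfolding Q_def using Fi by simp
   thus ?thesis using integral_translate[OF Fm] by simp
  qed
  define H where "H x = indicator Om x *\<^sub>R (pwgrad G x $ i * phi x + f x * partial i phi x)" for x
  have i1: "integrable (leb Om) (%x. pwgrad G x $ i * phi x)"
   by (rule integrable_test_mult(1)[OF locally_integrable_nth[OF lg] opn phi])
  have i2: "integrable (leb Om) (%x. f x * partial i phi x)" by (rule integrable_test_mult(2)[OF lf opn phi])
  have Hi: "integrable lebesgue H"
   unfolding H_def using Bochner_Integration.integrable_add[OF i1 i2] Om_meas by (simp add: integrable_restrict_space)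
  have "(%n. LINT x|lebesgue. Q n x) \<longlonglongrightarrow> (LINT x|lebesgue. H x)"
  proof (rule integral_dominated_convergence[where w = "%x. L * indicator (cball 0 (R + 1)) x"])
   show "H \<in> borel_measurable lebesgue" using Hi by (rule borel_measurable_integrable)
   show "Q n \<in> borel_measurable lebesgue" for n using Qm by (simp add: measurable_completion)
   have "integrable lebesgue (indicator (cball (0::pt) (R + 1)) :: pt => real)"
    by (rule integrable_real_indicator) (use emeasure_compact_finite[OF compact_cball, of 0 "R + 1"] in auto)
   thus "integrable lebesgue (%x. L * indicator (cball (0::pt) (R + 1)) x)" by (rule integrable_mult_right)
   show "AE x in lebesgue. norm (Q n x) <= L * indicator (cball 0 (R + 1)) x" for n
   proof (rule AE_I2)
    fix x :: pt
    let ?x = "x + (1 / real (Suc n)) *\<^sub>R e"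
    have nn: "norm ((1 / real (Suc n)) *\<^sub>R e) = 1 / real (Suc n)" using ne by simp
    show "norm (Q n x) <= L * indicator (cball 0 (R + 1)) x"
    proof (cases "x \<in> cball 0 (R + 1)")
     case True
     have "dist (F ?x) (F x) <= L * dist ?x x" using lipschitz_onD[OF L(2)] by blast
     also have "dist ?x x = 1 / real (Suc n)" using nn by (simp add: dist_norm)
     finally have "\<bar>F ?x - F x\<bar> * real (Suc n) <= L" by (simp add: dist_real_def field_simps)
     thus ?thesis using True by (simp add: Q_def abs_mult)
    next
     case False
     have "norm x <= norm ?x + norm ((1 / real (Suc n)) *\<^sub>R e)"
      using norm_triangle_ineq4[of ?x "(1 / real (Suc n)) *\<^sub>R e"] by simp
     also have "... <= norm ?x + 1" unfolding nn by simp
     finally have "?x \<notin> S" "x \<notin> S" using False R by auto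
     thus ?thesis using F0 False by (simp add: Q_def)
    qed
   qed
   show "AE x in lebesgue. (%n. Q n x) \<longlonglongrightarrow> H x"
    using AE_in_interior
   proof eventually_elim
    case (elim x)
    show ?case
    proof (cases "x \<in> S")
     case False
     have o: "open (- S)" using S(1) by (simp add: compact_imp_closed open_Compl)
     have e0: "0 = F y" if "y \<in> - S" for y using F0 that by simp
     have "((%y. 0) has_derivative (%d. 0)) (at x)" by (rule has_derivative_const)
     from has_derivative_transform_within_open[OF this o _ e0] False
     have "(F has_derivative (%d. 0)) (at x)" by simp
     from difference_quotient[OF this, of e] have "(%n. Q n x) \<longlonglongrightarrow> 0" by (simp add: Q_def)
     moreover have "H x = 0" using False test_function_smooth(4,5)[OF phi, of x] by (simp add: H_def S_def)
     ultimately show ?thesis by simp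
    next
     case True
     hence xOm: "x \<in> Om" using S by blast
     then obtain K where K: "K \<in> \<T>" "x \<in> interior K" using elim closure_subset by blast
     have "C1_on K f (G K)" using f K by (simp add: pwC1_def)
     from C1_on_mult[OF this test_C1[OF phi]]
     have "((%x. f x * phi x) has_derivative (%d. (f x *\<^sub>R (\<chi> i. partial i phi x) + phi x *\<^sub>R G K x) \<bullet> d)) (at x within K)"
      using K interior_subset by (auto simp: C1_on_def)
     hence "((%x. f x * phi x) has_derivative (%d. (f x *\<^sub>R (\<chi> i. partial i phi x) + phi x *\<^sub>R G K x) \<bullet> d)) (at x)"
      unfolding at_within_interior[OF K(2)] .
     moreover have "f y * phi y = F y" if "y \<in> interior K" for y
      using that interior_subset K_props(7)[OF K(1)] by (auto simp: F_def)
     ultimately have "(F has_derivative (%d. (f x *\<^sub>R (\<chi> i. partial i phi x) + phi x *\<^sub>R G K x) \<bullet> d)) (at x)"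
      by (rule has_derivative_transform_within_open[OF _ open_interior K(2)])
     from difference_quotient[OF this, of e]
     have "(%n. Q n x) \<longlonglongrightarrow> f x * partial i phi x + phi x * G K x $ i"
      by (simp add: Q_def e_def inner_add_left inner_axis)
     thus ?thesis using xOm pwgrad_eq[OF K, of G] by (simp add: H_def algebra_simps)
    qed
   qed
  qed
  moreover have "(LINT x|lebesgue. Q n x) = 0" for n using Q0 Qm by (simp add: integral_completion)
  ultimately have "(LINT x|lebesgue. H x) = 0" by (simp add: LIMSEQ_const_iff)
  hence "(LINT x|leb Om. pwgrad G x $ i * phi x + f x * partial i phi x) = 0"
   unfolding H_def using Om_meas by (simp add: integral_restrict_space)
  thus "(LINT x|leb Om. f x * partial i phi x) = - (LINT x|leb Om. pwgrad G x $ i * phi x)"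
   using i1 i2 by simp
 qed
qed

lemma pwC1_H1:
 assumes "pwC1 f G"
 shows "f \<in> H1 Om" "AE x in leb Om. weak_grad Om f x = pwgrad G x"
  "K \<in> \<T> ==> AE x in leb (interior K). weak_grad Om f x = G K x"
proof -
 show "f \<in> H1 Om"
  using pwC1_weak_gradient[OF assms] pwgrad_L2[OF assms] L2_continuous_closure[OF pwC1_continuous[OF assms]] by (auto simp: H1_def)
 show ae: "AE x in leb Om. weak_grad Om f x = pwgrad G x" by (rule weak_grad_AE[OF opn pwC1_weak_gradient[OF assms]])
 assume K: "K \<in> \<T>"
 have "AE x in lebesgue. x \<in> Om --> weak_grad Om f x = pwgrad G x" using ae Om_meas by (simp add: AE_restrict_space_iff)
 hence "AE x in lebesgue. x \<in> interior K --> weak_grad Om f x = G K x"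
  by eventually_elim (use K_props(8)[OF K] pwgrad_eq[OF K] in auto)
 thus "AE x in leb (interior K). weak_grad Om f x = G K x" by (simp add: AE_restrict_space_iff)
qed

lemma AE_interior_sub:
 assumes "K \<in> \<T>" "AE x in leb Om. P x" shows "AE x in leb (interior K). P x"
proof -
 have "AE x in lebesgue. x \<in> Om --> P x" using assms(2) Om_meas by (simp add: AE_restrict_space_iff)
 hence "AE x in lebesgue. x \<in> interior K --> P x" by eventually_elim (use K_props(8)[OF assms(1)] in auto)
 thus ?thesis by (simp add: AE_restrict_space_iff)
qed

end

section \<open>Mollification\<close>

definition mollifier :: "real => (pt => real) => bool" where
 "mollifier delta eta \<longleftrightarrow> smooth eta \<and> (\<forall>x. 0 <= eta x) \<and> (\<forall>x. eta x ~= 0 --> norm x < delta) \<and> (\<integral>\<^sup>+x. ennreal (eta x) \<partial>lborel) = 1"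

lemma smooth_continuous: "smooth f ==> continuous_on UNIV f" "smooth f ==> continuous_on UNIV (partial i f)"
 using smooth_C_k[of f 0] smooth_partial[of f] smooth_C_k[of "partial i f" 0] by auto

lemma mollifier_exists:
 assumes "delta > 0" obtains eta where "mollifier delta eta"
proof -
 \<comment> \<open>The box of half side delta / 2 lies in the open disc of radius delta, and with
   parameter 4 / delta the arguments of \<open>flat\<close> at the origin equal 1.\<close>
 define c where "c = ((delta / 2) *\<^sub>R 1 :: pt)"
 define b where "b = bump (4 / delta) (- c) c"
 have sm: "smooth b" unfolding b_def by (rule smooth_bump)
 have nn: "0 <= b x" for x unfolding b_def by (rule bump_bounds)
 have b0: "b 0 > 0"
  using assms by (auto simp: b_def bump_def c_def flat_def)
 have supp: "norm x < delta" if "b x ~= 0" for x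
 proof -
  have "x \<in> cbox (- c + (1 / (4 / delta)) *\<^sub>R 1) (c - (1 / (4 / delta)) *\<^sub>R 1)"
   using that assms unfolding b_def by (intro bump_support) auto
  hence "x \<in> box (- c) c" using cbox_shrink_subset_box[of "4 / delta" "- c" c] assms by auto
  hence "- (delta / 2) < x $ i \<and> x $ i < delta / 2" for i by (simp add: mem_box_cart c_def)
  hence "\<bar>x $ i\<bar> < delta / 2" for i by (simp only: abs_less_iff) (metis minus_less_iff)
  from this[of 1] this[of 2] have "(\<Sum>i\<in>UNIV. \<bar>x $ i\<bar>) < delta" unfolding sum_2 by linarith
  thus ?thesis using norm_le_l1_cart[of x] by simp
 qed
 have cont: "continuous_on UNIV b" using smooth_continuous(1)[OF sm] .
 have int: "integrable lborel b" using supp by (intro integrable_continuous_support[OF cont, of delta]) (auto simp: not_le less_imp_le, force)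
 define I where "I = (LINT x|lborel. b x)"
 have "I > 0"
 proof -
  have "I ~= 0"
  proof
   assume "I = 0"
   hence "AE x in lborel. b x = 0" using int nn integral_nonneg_eq_0_iff_AE[OF int] by (simp add: I_def)
   hence "AE x in lebesgue. b x = 0" by (rule AE_completion)
   have op: "open {x. b x ~= 0}" using open_Collect_neq[OF cont continuous_on_const[of _ 0]] by simp
   hence "negligible {x. b x ~= 0}"
    using AE_iff_null_sets[of "{x. b x ~= 0}" lebesgue] \<open>AE x in lebesgue. b x = 0\<close> by (simp add: negligible_iff_null_sets)
   moreover have "0 \<in> {x. b x ~= 0}" using b0 by simp
   ultimately show False using op open_not_negligible[of "{x. b x ~= 0}"] by blast
  qed
  moreover have "I >= 0" using nn by (simp add: I_def)
  ultimately show ?thesis by simp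
 qed
 have "mollifier delta (%x. (1 / I) * b x)"
  unfolding mollifier_def
 proof (intro conjI allI impI)
  show "smooth (%x. 1 / I * b x)" by (intro smooth.intros sm)
  show "0 <= 1 / I * b x" for x using nn \<open>I > 0\<close> by simp
  show "norm x < delta" if "1 / I * b x ~= 0" for x using supp that by auto
  have "(\<integral>\<^sup>+x. ennreal (1 / I * b x) \<partial>lborel) = ennreal (LINT x|lborel. 1 / I * b x)"
   using int nn \<open>I > 0\<close> by (intro nn_integral_eq_integral) auto
  also have "(LINT x|lborel. 1 / I * b x) = 1" using \<open>I > 0\<close> by (simp add: I_def)
  finally show "(\<integral>\<^sup>+x. ennreal (1 / I * b x) \<partial>lborel) = 1" by simp
 qed
 thus ?thesis by (rule that)
qed

lemma smooth_derivative: "smooth f ==> (f has_derivative (%v. \<Sum>i\<in>UNIV. v $ i * partial i f x)) (at x)"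
proof -
 assume f: "smooth f"
 define D where "D = frechet_derivative f (at x)"
 have D: "(f has_derivative D) (at x)" using smooth_partial[OF f] by (simp add: D_def frechet_derivative_works[symmetric])
 hence lin: "linear D" by (rule has_derivative_linear)
 have "D v = (\<Sum>i\<in>UNIV. v $ i * partial i f x)" for v
 proof -
  have "D v = D (\<Sum>i\<in>UNIV. v $ i *\<^sub>R axis i 1)" using basis_expansion[of v] by (simp add: scalar_mult_eq_scaleR)
  also have "... = (\<Sum>i\<in>UNIV. v $ i * D (axis i 1))" using lin by (simp add: linear_sum linear_cmul)
  finally show ?thesis by (simp add: partial_def D_def)
 qed
 hence "D = (%v. \<Sum>i\<in>UNIV. v $ i * partial i f x)" by (rule ext)
 with D show ?thesis by simp
qed

lemma compact_support_uniform:
 fixes f :: "pt => real"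
 assumes c: "continuous_on UNIV f" and s: "!!x. norm x > R ==> f x = 0" and e: "e > 0"
 obtains d where "d > 0" "!!x y. norm (x - y) < d ==> \<bar>f x - f y\<bar> < e"
proof -
 have "uniformly_continuous_on (cball 0 (R + 2)) f"
  using c by (intro compact_uniformly_continuous) (auto intro: continuous_on_subset)
 then obtain d where d: "d > 0" "!!x y. x \<in> cball 0 (R + 2) ==> y \<in> cball 0 (R + 2) ==> dist y x < d ==> dist (f y) (f x) < e"
  using e unfolding uniformly_continuous_on_def by metis
 have "\<bar>f x - f y\<bar> < e" if xy: "norm (x - y) < min d 1" for x y
 proof (cases "norm x <= R + 1")
  case True
  hence "norm y <= R + 2" using xy norm_triangle_sub[of y x] by (simp add: norm_minus_commute)
  thus ?thesis using d(2)[of y x] True xy by (simp add: dist_norm dist_real_def)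
 next
  case False
  hence "norm x > R" "norm y > R" using xy norm_triangle_sub[of x y] by auto
  thus ?thesis using s e by simp
 qed
 thus ?thesis using that[of "min d 1"] d by simp
qed

lemma mollifier_props:
 assumes "mollifier delta eta"
 shows "continuous_on UNIV eta" "smooth eta" "0 <= eta x" "norm x >= delta ==> eta x = 0" "norm x > delta ==> partial i eta x = 0"
  "continuous_on UNIV (partial i eta)" "(\<integral>\<^sup>+x. ennreal (eta (x - y)) \<partial>lborel) = 1" "(\<integral>\<^sup>+x. ennreal (eta (y - x)) \<partial>lborel) = 1"
  "eta \<in> borel_measurable borel"
proof -
 have sm: "smooth eta" using assms by (simp add: mollifier_def)
 show c: "continuous_on UNIV eta" "smooth eta" "continuous_on UNIV (partial i eta)" using smooth_continuous[OF sm] sm by auto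
 show "0 <= eta x" using assms by (simp add: mollifier_def)
 show z: "norm x >= delta ==> eta x = 0" for x using assms by (force simp: mollifier_def)
 show "partial i eta x = 0" if "norm x > delta"
 proof -
  have o: "open (- cball (0::pt) delta)" by auto
  have e: "0 = eta y" if "y \<in> - cball 0 delta" for y using that z[of y] by auto
  have "((%y. 0) has_derivative (%v. 0)) (at x)" by (rule has_derivative_const)
  from has_derivative_transform_within_open[OF this o _ e] that
  have "(eta has_derivative (%v. 0)) (at x)" by simp
  thus ?thesis by (rule partial_eqI)
 qed
 show m: "eta \<in> borel_measurable borel" using borel_measurable_continuous_onI[OF c(1)] .
 have I: "(\<integral>\<^sup>+x. ennreal (eta x) \<partial>lborel) = 1" using assms by (simp add: mollifier_def)
 have em: "(%x. ennreal (eta x)) \<in> borel_measurable borel" using m by simp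
 show "(\<integral>\<^sup>+x. ennreal (eta (x - y)) \<partial>lborel) = 1"
  using nn_integral_scale_pt[OF em, of 1 "- y"] I by simp
 show "(\<integral>\<^sup>+x. ennreal (eta (y - x)) \<partial>lborel) = 1"
  using nn_integral_scale_pt[OF em, of "-1" y] I by simp
qed

context mesh
begin

text \<open>The integral runs over the domain alone, so f need not be extended; the usual rules for
  averages and derivatives hold at x when the ball of radius delta about x lies in the
  domain.\<close>

definition moll :: "(pt => real) => (pt => real) => pt => real" where
 "moll eta f x = (LINT y|leb Om. f y * eta (x - y))"

lemma moll_integrable:
 fixes k :: "pt => real"
 assumes "f \<in> L2 (leb Om)" "continuous_on UNIV k" "!!x. norm x > R ==> k x = 0"
 shows "integrable (leb Om) (%y. f y * k (x - y))"
proof -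
 have "bounded (k ` cball 0 R)"
  using assms(2) by (intro compact_imp_bounded compact_continuous_image) (auto intro: continuous_on_subset)
 then obtain B where "\<forall>y\<in>k ` cball 0 R. norm y <= B" unfolding bounded_iff by blast
 hence B: "x \<in> cball 0 R ==> \<bar>k x\<bar> <= B" for x by (metis imageI real_norm_def)
 show ?thesis
 proof (rule integrable_mult_continuous_bounded[where B = "max B 0"])
  show "integrable (leb Om) f" by (rule L2_integrable[OF fm(1) assms(1)])
  have "continuous_on UNIV (%y. k (x - y))" by (intro continuous_on_compose2[OF assms(2)] continuous_intros) auto
  thus "(%y. k (x - y)) \<in> borel_measurable (leb Om)"
   by (intro measurable_restrict_space1 continuous_imp_measurable_lebesgue)
  show "\<bar>k (x - y)\<bar> <= max B 0" for y
   using B[of "x - y"] assms(3)[of "x - y"] by (cases "norm (x - y) <= R") auto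
 qed
qed

lemma moll_lip:
 fixes f k :: "pt => real"
 assumes f: "f \<in> L2 (leb Om)" and k: "integrable (leb Om) (%y. f y * k y)" and b: "!!y. \<bar>k y\<bar> <= e"
 shows "\<bar>LINT y|leb Om. f y * k y\<bar> <= e * (LINT y|leb Om. \<bar>f y\<bar>)"
proof -
 have i: "integrable (leb Om) f" by (rule L2_integrable[OF fm(1) f])
 have "\<bar>LINT y|leb Om. f y * k y\<bar> <= (LINT y|leb Om. \<bar>f y * k y\<bar>)" using integral_norm_bound[of "leb Om" "%y. f y * k y"] unfolding real_norm_def .
 also have "... <= (LINT y|leb Om. e * \<bar>f y\<bar>)"
 proof (rule integral_mono)
  show "integrable (leb Om) (%y. \<bar>f y * k y\<bar>)" using k by (rule integrable_abs)
  show "integrable (leb Om) (%y. e * \<bar>f y\<bar>)" using i by simp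
  show "\<bar>f y * k y\<bar> <= e * \<bar>f y\<bar>" for y
   using mult_left_mono[OF b[of y] abs_ge_zero[of "f y"]] by (simp add: abs_mult mult.commute)
 qed
 finally show ?thesis by simp
qed

lemma moll_continuous:
 assumes "f \<in> L2 (leb Om)" "mollifier delta eta"
 shows "continuous_on UNIV (moll eta f)"
 unfolding continuous_on_iff
proof (intro ballI allI impI)
 fix x :: pt and e :: real assume e: "0 < e"
 note p = mollifier_props[OF assms(2)]
 define B where "B = (LINT y|leb Om. \<bar>f y\<bar>) + 1"
 have B: "B > 0" by (simp add: B_def add_nonneg_pos)
 have z: "eta x = 0" if "norm x > delta" for x using p(4)[of x] that by simp
 obtain d where d: "d > 0" "!!x y. norm (x - y) < d ==> \<bar>eta x - eta y\<bar> < e / B"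
  using compact_support_uniform[OF p(1) z divide_pos_pos[OF e B]] by metis
 have "dist (moll eta f x') (moll eta f x) < e" if "dist x' x < d" for x'
 proof -
  have i: "integrable (leb Om) (%y. f y * eta (x - y))" for x by (rule moll_integrable[OF assms(1) p(1) z])
  have "moll eta f x' - moll eta f x = (LINT y|leb Om. f y * (eta (x' - y) - eta (x - y)))"
   unfolding moll_def using i by (simp add: right_diff_distrib)
  moreover have "\<bar>LINT y|leb Om. f y * (eta (x' - y) - eta (x - y))\<bar> <= e / B * (LINT y|leb Om. \<bar>f y\<bar>)"
  proof (rule moll_lip[OF assms(1)])
   show "integrable (leb Om) (%y. f y * (eta (x' - y) - eta (x - y)))" using i by (simp add: right_diff_distrib)
   show "\<bar>eta (x' - y) - eta (x - y)\<bar> <= e / B" for y using d(2)[of "x' - y" "x - y"] that by (simp add: dist_norm less_imp_le)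
  qed
  moreover have "e / B * (LINT y|leb Om. \<bar>f y\<bar>) < e / B * B" using e B by (intro mult_strict_left_mono) (auto simp: B_def)
  ultimately show ?thesis using B by (simp add: dist_real_def)
 qed
 thus "\<exists>d>0. \<forall>x'\<in>UNIV. dist x' x < d --> dist (moll eta f x') (moll eta f x) < e" using d by blast
qed

text \<open>If the ball lies in the domain, the reflected mollifier is a test function, so the
  derivative passes to the weak gradient. Differentiation under the integral holds because the
  remainder of \<open>eta\<close> is uniformly small and f is integrable.\<close>

lemma moll_derivative:
 assumes f: "f \<in> L2 (leb Om)" and g: "is_weak_gradient Om f g" and eta: "mollifier delta eta" and x: "cball x delta \<subseteq> Om"
 shows "(moll eta f has_derivative (%d. (\<chi> i. moll eta (%y. g y $ i) x) \<bullet> d)) (at x)"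
proof -
 note p = mollifier_props[OF eta]
 have z: "eta x = 0" if "norm x > delta" for x using p(4)[of x] that by simp
 have test: "(%y. eta (x - y)) \<in> test_functions Om"
 proof -
  have "{y. eta (x - y) ~= 0} \<subseteq> cball x delta" using p(4) by (force simp: dist_norm not_le)
  hence "closure {y. eta (x - y) ~= 0} \<subseteq> cball x delta" by (rule closure_minimal) simp
  moreover from this have "compact (closure {y. eta (x - y) ~= 0})"
   using bounded_subset[OF bounded_cball] compact_eq_bounded_closed by blast
  ultimately show ?thesis using x smooth_C_k[OF smooth_reflect[OF p(2)]] by (auto simp: test_functions_def)
 qed
 have part: "partial i (%y. eta (x - y)) y = - partial i eta (x - y)" for i y
 proof -
  have g: "((%y. x - y) has_derivative (%v. - v)) (at y)" by (auto intro!: derivative_eq_intros)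
  note partial_eqI[OF has_derivative_compose[OF g smooth_derivative[OF p(2)]], of i]
  then
  have "partial i (%y. eta (x - y)) y = (\<Sum>j\<in>UNIV. (- axis i 1 :: pt) $ j * partial j eta (x - y))" by simp
  also have "... = (\<Sum>j\<in>UNIV. if j = i then - partial i eta (x - y) else 0)"
   by (intro sum.cong) (auto simp: axis_def)
  finally show ?thesis by simp
 qed
 have gi: "(LINT y|leb Om. f y * partial i eta (x - y)) = moll eta (%y. g y $ i) x" for i
 proof -
  have "(LINT y|leb Om. f y * partial i (%y. eta (x - y)) y) = - (LINT y|leb Om. g y $ i * eta (x - y))"
   using g test by (simp add: is_weak_gradient_def)
  thus ?thesis by (simp add: part moll_def)
 qed
 have pi: "integrable (leb Om) (%y. f y * partial i eta (x - y))" for i x by (rule moll_integrable[OF f p(6) p(5)])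
 have etai: "integrable (leb Om) (%y. f y * eta (x - y))" for x by (rule moll_integrable[OF f p(1) z])
 define B where "B = (LINT y|leb Om. \<bar>f y\<bar>) + 1"
 have B: "B > 0" by (simp add: B_def add_nonneg_pos)
 show ?thesis
  unfolding has_derivative_within_alt2
 proof (intro conjI allI impI)
  show "bounded_linear (%d. (\<chi> i. moll eta (%y. g y $ i) x) \<bullet> d)" by (rule bounded_linear_inner_right)
  fix e :: real assume e: "0 < e"
  \<comment> \<open>Half of the tolerance for each of the two partial derivatives.\<close>
  have "\<exists>d>0. \<forall>x y. norm (x - y) < d --> \<bar>partial i eta x - partial i eta y\<bar> < e / B / 2" for i
  proof -
   have "e / B / 2 > 0" using e B by simp
   from compact_support_uniform[OF p(6)[of i] p(5)[of _ i] this] show ?thesis by metis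
  qed
  then obtain D where D: "!!i. D i > 0" "!!i x y. norm (x - y) < D i ==> \<bar>partial i eta x - partial i eta y\<bar> < e / B / 2" by metis
  define d where "d = min (D 1) (D 2)"
  have d: "d > 0" "norm (x - y) < d ==> \<bar>partial i eta x - partial i eta y\<bar> <= e / B / 2" for i x y
   using D(1) D(2)[of x y i] exhaust_2[of i] by (auto simp: d_def less_imp_le)
  have rem: "\<bar>eta (u + v) - eta u - (\<Sum>i\<in>UNIV. v $ i * partial i eta u)\<bar> <= e / B * norm v" if v: "norm v < d" for u v
  proof -
   have "norm (eta (u + v) - eta u - (%v. \<Sum>i\<in>UNIV. v $ i * partial i eta u) (u + v - u)) <= norm (u + v - u) * (e / B)"
   proof (rule differentiable_bound_linearization[where S = "ball u d" and f' = "%w v. \<Sum>i\<in>UNIV. v $ i * partial i eta w" and ?x0.0 = u])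
    show "u + t *\<^sub>R (u + v - u) \<in> ball u d" if "t \<in> {0..1}" for t
    proof -
     have "norm (t *\<^sub>R v) <= 1 * norm v" using that by (simp add: mult_left_le_one_le)
     thus ?thesis using v by (simp add: dist_norm)
    qed
    show "(eta has_derivative (%v. \<Sum>i\<in>UNIV. v $ i * partial i eta w)) (at w within ball u d)" for w
     using smooth_derivative[OF p(2)] has_derivative_at_withinI by blast
    show "onorm ((%va. \<Sum>i\<in>UNIV. va $ i * partial i eta w) - (%va. \<Sum>i\<in>UNIV. va $ i * partial i eta u)) <= e / B" if w: "w \<in> ball u d" for w
     unfolding fun_diff_def
    proof (rule onorm_le)
     fix va :: pt
     have "norm ((\<Sum>i\<in>UNIV. va $ i * partial i eta w) - (\<Sum>i\<in>UNIV. va $ i * partial i eta u)) =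
       \<bar>\<Sum>i\<in>UNIV. va $ i * (partial i eta w - partial i eta u)\<bar>" by (simp add: sum_subtractf right_diff_distrib)
     also have "... <= (\<Sum>i\<in>UNIV. \<bar>va $ i * (partial i eta w - partial i eta u)\<bar>)" by (rule sum_abs)
     also have "... <= (\<Sum>i\<in>(UNIV::2 set). norm va * (e / B / 2))"
     proof (rule sum_mono)
      fix i :: 2
      have "\<bar>partial i eta w - partial i eta u\<bar> <= e / B / 2" using d(2)[of w u i] w by (simp add: dist_norm norm_minus_commute)
      thus "\<bar>va $ i * (partial i eta w - partial i eta u)\<bar> <= norm va * (e / B / 2)"
       unfolding abs_mult by (intro mult_mono component_le_norm_cart) auto
     qed
     also have "... = e / B * norm va" by (simp add: sum_2)
     finally show "norm ((\<Sum>i\<in>UNIV. va $ i * partial i eta w) - (\<Sum>i\<in>UNIV. va $ i * partial i eta u)) <= e / B * norm va" .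
    qed
    show "u \<in> ball u d" using d by simp
   qed
   thus ?thesis by (simp add: mult.commute)
  qed
  have "norm (moll eta f y - moll eta f x - (\<chi> i. moll eta (%y. g y $ i) x) \<bullet> (y - x)) <= e * norm (y - x)"
   if y: "norm (y - x) < d" for y
  proof -
   let ?v = "y - x"
   have eq: "moll eta f y - moll eta f x - (\<chi> i. moll eta (%y. g y $ i) x) \<bullet> ?v =
     (LINT w|leb Om. f w * (eta ((x - w) + ?v) - eta (x - w) - (\<Sum>i\<in>UNIV. ?v $ i * partial i eta (x - w))))"
   proof -
    have "f w * (eta ((x - w) + ?v) - eta (x - w) - (\<Sum>i\<in>UNIV. ?v $ i * partial i eta (x - w))) =
     f w * eta (y - w) - f w * eta (x - w) - (?v $ 1 * (f w * partial 1 eta (x - w)) + ?v $ 2 * (f w * partial 2 eta (x - w)))" for w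
     by (simp add: sum_2 algebra_simps)
    hence "(LINT w|leb Om. f w * (eta ((x - w) + ?v) - eta (x - w) - (\<Sum>i\<in>UNIV. ?v $ i * partial i eta (x - w)))) =
     moll eta f y - moll eta f x - (?v $ 1 * (LINT w|leb Om. f w * partial 1 eta (x - w)) + ?v $ 2 * (LINT w|leb Om. f w * partial 2 eta (x - w)))"
     using etai pi by (simp add: moll_def)
    thus ?thesis by (simp add: gi inner_pt mult.commute)
   qed
   have "\<bar>LINT w|leb Om. f w * (eta ((x - w) + ?v) - eta (x - w) - (\<Sum>i\<in>UNIV. ?v $ i * partial i eta (x - w)))\<bar>
    <= (e / B * norm ?v) * (LINT w|leb Om. \<bar>f w\<bar>)"
   proof (rule moll_lip[OF f])
    have "f w * (eta ((x - w) + ?v) - eta (x - w) - (\<Sum>i\<in>UNIV. ?v $ i * partial i eta (x - w))) =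
     f w * eta (y - w) - f w * eta (x - w) - (?v $ 1 * (f w * partial 1 eta (x - w)) + ?v $ 2 * (f w * partial 2 eta (x - w)))" for w
     by (simp add: sum_2 algebra_simps)
    thus "integrable (leb Om) (%w. f w * (eta ((x - w) + ?v) - eta (x - w) - (\<Sum>i\<in>UNIV. ?v $ i * partial i eta (x - w))))"
     using etai pi by simp
    show "\<bar>eta ((x - w) + ?v) - eta (x - w) - (\<Sum>i\<in>UNIV. ?v $ i * partial i eta (x - w))\<bar> <= e / B * norm ?v" for w
     by (rule rem[OF y])
   qed
   also have "... <= (e / B * norm ?v) * B" using e B by (intro mult_left_mono) (auto simp: B_def)
   also have "... = e * norm ?v" using B by simp
   finally show ?thesis unfolding eq by simp
  qed
  thus "\<forall>\<^sub>F y in at x. norm (moll eta f y - moll eta f x - (\<chi> i. moll eta (%y. g y $ i) x) \<bullet> (y - x)) <= e * norm (y - x)"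
   unfolding eventually_at using d(1) by (intro exI[of _ d]) (auto simp: dist_norm)
 qed
qed

lemma moll_const:
 assumes "mollifier delta eta" "cball x delta \<subseteq> Om"
 shows "integrable (leb Om) (%y. eta (x - y))" "(LINT y|leb Om. eta (x - y)) = 1"
proof -
 note p = mollifier_props[OF assms(1)]
 have m: "(%y. eta (x - y)) \<in> borel_measurable borel" using p(9) by measurable
 have "(\<integral>\<^sup>+y. ennreal (eta (x - y)) \<partial>leb Om) = (\<integral>\<^sup>+y. ennreal (eta (x - y)) * indicator Om y \<partial>lebesgue)"
  using Om_meas by (intro nn_integral_restrict_space) simp
 also have "... = (\<integral>\<^sup>+y. ennreal (eta (x - y)) \<partial>lebesgue)"
 proof (rule nn_integral_cong)
  fix y
  show "ennreal (eta (x - y)) * indicator Om y = ennreal (eta (x - y))"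
  proof (cases "y \<in> Om")
   case False
   hence "y \<notin> cball x delta" using assms(2) by blast
   hence "eta (x - y) = 0" using p(4)[of "x - y"] by (simp add: dist_norm)
   thus ?thesis by simp
  qed simp
 qed
 also have "... = (\<integral>\<^sup>+y. ennreal (eta (x - y)) \<partial>lborel)" by (rule nn_integral_completion)
 also have "... = 1" by (rule p(8))
 finally have I: "(\<integral>\<^sup>+y. ennreal (eta (x - y)) \<partial>leb Om) = 1" .
 have mm: "(%y. eta (x - y)) \<in> borel_measurable (leb Om)" using m by (intro measurable_restrict_space1 measurable_completion) simp
 show "integrable (leb Om) (%y. eta (x - y))"
  using mm I p(3) by (intro integrableI_bounded) auto
 show "(LINT y|leb Om. eta (x - y)) = 1"
  using integral_eq_nn_integral[OF mm] I p(3) by simp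
qed

text \<open>Jensen's inequality: with \<open>eta\<close> split into two square roots, Cauchy-Schwarz
  leaves one factor with integral 1.\<close>

lemma moll_sq_le:
 assumes r: "r \<in> L2 (leb Om)" and eta: "mollifier delta eta" and x: "cball x delta \<subseteq> Om"
 shows "ennreal ((moll eta r x)^2) <= (\<integral>\<^sup>+y. ennreal ((r y)^2) * ennreal (eta (x - y)) \<partial>leb Om)"
proof -
 note p = mollifier_props[OF eta]
 let ?s = "%y. sqrt (eta (x - y))"
 have z: "eta x = 0" if "norm x > delta" for x using p(4)[of x] that by simp
 have bd: "bounded (eta ` cball 0 delta)" using p(1) by (intro compact_imp_bounded compact_continuous_image) (auto intro: continuous_on_subset)
 then obtain B where "\<forall>y\<in>eta ` cball 0 delta. norm y <= B" unfolding bounded_iff by blast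
 hence B: "x \<in> cball 0 delta ==> \<bar>eta x\<bar> <= B" for x by (metis imageI real_norm_def)
 have B': "\<bar>eta x\<bar> <= max B 0" for x using B[of x] z[of x] by (cases "norm x <= delta") auto
 have r2: "integrable (leb Om) (%y. (r y)^2)" using r by (simp add: L2_def)
 have em: "(%y. eta (x - y)) \<in> borel_measurable (leb Om)"
  using moll_const(1)[OF eta x] by (rule borel_measurable_integrable)
 have i1: "integrable (leb Om) (%y. (r y)^2 * eta (x - y))"
  by (rule integrable_mult_continuous_bounded[OF r2 em]) (rule B')
 have rs: "(%y. r y * ?s y) \<in> L2 (leb Om)"
  using r em i1 p(3) by (auto simp: L2_def power_mult_distrib)
 have s: "?s \<in> L2 (leb Om)" using em moll_const(1)[OF eta x] p(3) by (auto simp: L2_def)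
 have "moll eta r x = (LINT y|leb Om. (r y * ?s y) * ?s y)"
  using p(3) by (simp add: moll_def mult.assoc)
 hence "(moll eta r x)^2 <= sqi (leb Om) (%y. r y * ?s y) * sqi (leb Om) ?s"
  using Cauchy_Schwarz_L2[OF rs s] by simp
 also have "sqi (leb Om) ?s = 1" using moll_const(2)[OF eta x] p(3) by (simp add: sqi_def)
 also have "sqi (leb Om) (%y. r y * ?s y) = (LINT y|leb Om. (r y)^2 * eta (x - y))"
  using p(3) by (simp add: sqi_def power_mult_distrib)
 finally have "ennreal ((moll eta r x)^2) <= ennreal (LINT y|leb Om. (r y)^2 * eta (x - y))" by (simp add: ennreal_leI)
 also have "... = (\<integral>\<^sup>+y. ennreal ((r y)^2 * eta (x - y)) \<partial>leb Om)"
  using i1 p(3) by (intro nn_integral_eq_integral[symmetric]) auto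
 finally show ?thesis using p(3) by (simp add: ennreal_mult)
qed

text \<open>Young's inequality after an affine change of variables: Fubini moves the integral over x
  onto the mollifier, and undoing the affine map costs the inverse determinant, at most 4.\<close>

lemma moll_affine_bound:
 assumes r: "r \<in> L2 (leb Om)" and eta: "mollifier delta eta" and K: "K \<in> \<T>"
  and A: "!!x. x \<in> K ==> A x = b + x $ 1 *\<^sub>R p + x $ 2 *\<^sub>R q" "cross2 p q >= 1/4" and AOm: "!!x. x \<in> K ==> cball (A x) delta \<subseteq> Om"
  and m: "(%x. moll eta r (A x)) \<in> L2 (leb (interior K))"
 shows "sqi (leb (interior K)) (%x. moll eta r (A x)) <= 4 * sqi (leb Om) r"
proof -
 note pp = mollifier_props[OF eta]
 let ?M = "leb (interior K)" and ?N = "leb Om"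
 let ?A = "%x::pt. b + x $ 1 *\<^sub>R p + x $ 2 *\<^sub>R q"
 interpret M: finite_measure ?M by (rule fm(2)[OF K])
 interpret N: finite_measure ?N by (rule fm(1))
 interpret pair_sigma_finite ?M ?N by unfold_locales
 have cA: "continuous_on UNIV ?A" by (intro continuous_intros)
 have [measurable]: "?A \<in> borel_measurable borel" by (rule borel_measurable_continuous_onI[OF cA])
 have [measurable]: "eta \<in> borel_measurable borel" by (rule pp(9))
 have idM: "(%x. x) \<in> ?M \<rightarrow>\<^sub>M borel" "(%x. x) \<in> ?N \<rightarrow>\<^sub>M borel"
  by (auto intro!: measurable_restrict_space1 measurable_completion)
 have f1: "fst \<in> ?M \<Otimes>\<^sub>M ?N \<rightarrow>\<^sub>M borel" "snd \<in> ?M \<Otimes>\<^sub>M ?N \<rightarrow>\<^sub>M borel"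
  using measurable_compose[OF measurable_fst idM(1)] measurable_compose[OF measurable_snd idM(2)] by auto
 have rm: "r \<in> borel_measurable ?N" using r by (simp add: L2_def)
 have rm2: "(%p. r (snd p)) \<in> borel_measurable (?M \<Otimes>\<^sub>M ?N)" using measurable_compose[OF measurable_snd rm] .
 have jm: "(%p. ennreal ((r (snd p))^2) * ennreal (eta (?A (fst p) - snd p))) \<in> borel_measurable (?M \<Otimes>\<^sub>M ?N)"
  using rm2 f1 by measurable
 have "ennreal (sqi ?M (%x. moll eta r (A x))) = (\<integral>\<^sup>+x. ennreal ((moll eta r (A x))^2) \<partial>?M)"
  unfolding sqi_def using nn_integral_eq_integral[OF L2_integrable_sq[OF m]] by simp
 also have "... <= (\<integral>\<^sup>+x. \<integral>\<^sup>+y. ennreal ((r y)^2) * ennreal (eta (?A x - y)) \<partial>?N \<partial>?M)"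
 proof (rule nn_integral_mono)
  fix x assume "x \<in> space ?M"
  hence x: "x \<in> K" using interior_subset by (auto simp: space_restrict_space)
  show "ennreal ((moll eta r (A x))^2) <= (\<integral>\<^sup>+y. ennreal ((r y)^2) * ennreal (eta (?A x - y)) \<partial>?N)"
   using moll_sq_le[OF r eta AOm[OF x]] A(1)[OF x] by simp
 qed
 also have "... = (\<integral>\<^sup>+y. \<integral>\<^sup>+x. ennreal ((r y)^2) * ennreal (eta (?A x - y)) \<partial>?M \<partial>?N)"
  using jm by (intro Fubini'[symmetric]) (simp add: case_prod_beta')
 also have "... <= (\<integral>\<^sup>+y. ennreal ((r y)^2) * 4 \<partial>?N)"
 proof (rule nn_integral_mono)
  fix y
  have em: "(%x. ennreal (eta (?A x - y))) \<in> borel_measurable borel" by measurable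
  have em2: "(%x. ennreal (eta (x - y))) \<in> borel_measurable borel" by measurable
  have c0: "cross2 p q ~= 0" using A(2) by auto
  have "(\<integral>\<^sup>+x. ennreal (eta (?A x - y)) \<partial>?M) = (\<integral>\<^sup>+x. ennreal (eta (?A x - y)) * indicator (interior K) x \<partial>lebesgue)"
   by (intro nn_integral_restrict_space) simp
  also have "... <= (\<integral>\<^sup>+x. ennreal (eta (?A x - y)) \<partial>lebesgue)" by (intro nn_integral_mono) (auto simp: indicator_def)
  also have "... = (\<integral>\<^sup>+x. ennreal (eta (?A x - y)) \<partial>lborel)" by (rule nn_integral_completion)
  also have "... = 1 * (\<integral>\<^sup>+x. ennreal (eta (?A x - y)) \<partial>lborel)" by simp
  also have "... <= ennreal (4 * \<bar>cross2 p q\<bar>) * (\<integral>\<^sup>+x. ennreal (eta (?A x - y)) \<partial>lborel)"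
   using A(2) by (intro mult_right_mono) (auto simp flip: ennreal_1)
  also have "... = 4 * (ennreal \<bar>cross2 p q\<bar> * (\<integral>\<^sup>+x. ennreal (eta (?A x - y)) \<partial>lborel))"
   by (simp add: ennreal_mult' mult.assoc)
  also have "... = 4" using nn_integral_affine_pt[OF em2 c0, of b] pp(7)[of y] by simp
  finally have le: "(\<integral>\<^sup>+x. ennreal (eta (?A x - y)) \<partial>?M) <= 4" .
  have "(\<integral>\<^sup>+x. ennreal ((r y)^2) * ennreal (eta (?A x - y)) \<partial>?M) = ennreal ((r y)^2) * (\<integral>\<^sup>+x. ennreal (eta (?A x - y)) \<partial>?M)"
   using em by (intro nn_integral_cmult measurable_restrict_space1 measurable_completion) simp
  also have "... <= ennreal ((r y)^2) * 4" using le by (rule mult_left_mono) simp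
  finally show "(\<integral>\<^sup>+x. ennreal ((r y)^2) * ennreal (eta (?A x - y)) \<partial>?M) <= ennreal ((r y)^2) * 4" .
 qed
 also have "... = (\<integral>\<^sup>+y. ennreal ((r y)^2) \<partial>?N) * 4" using rm by (intro nn_integral_multc) simp
 also have "(\<integral>\<^sup>+y. ennreal ((r y)^2) \<partial>?N) = ennreal (sqi ?N r)"
  unfolding sqi_def using nn_integral_eq_integral[OF L2_integrable_sq[OF r]] by simp
 also have "ennreal (sqi ?N r) * 4 = ennreal (4 * sqi ?N r)" by (simp add: ennreal_mult' mult.commute)
 finally show ?thesis by (subst (asm) ennreal_le_iff) auto
qed

text \<open>Truncation makes f bounded. The continuous functions that converge to f almost
  everywhere are truncated as well, so dominated convergence applies on the finite measure
  space.\<close>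

lemma L2_dense_continuous:
 assumes f: "f \<in> L2 (leb Om)" and e: "e > 0"
 obtains psi :: "pt => real" where "continuous_on UNIV psi" "sqi (leb Om) (%x. f x - psi x) < e"
proof -
 let ?M = "leb Om"
 define clip where "clip M t = max (- M) (min M t)" for M t :: real
 have clipb: "\<bar>clip M t\<bar> <= M" "(t - clip M t)^2 <= t^2" if "M >= 0" for M t
 proof -
  show "\<bar>clip M t\<bar> <= M" using that by (auto simp: clip_def)
  have "\<bar>t - clip M t\<bar> <= \<bar>t\<bar>" using that by (auto simp: clip_def)
  thus "(t - clip M t)^2 <= t^2" using abs_le_square_iff by blast
 qed
 have clc: "continuous_on UNIV (clip M)" for M unfolding clip_def by (intro continuous_intros)
 have fmeas: "f \<in> borel_measurable ?M" using f by (simp add: L2_def)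
 have cm: "(%x. clip M (u x)) \<in> borel_measurable ?M" if "u \<in> borel_measurable ?M" for M u
  using measurable_compose[OF that borel_measurable_continuous_onI[OF clc]] .
 have "(%n. LINT x|?M. (f x - clip (real n) (f x))^2) \<longlonglongrightarrow> (LINT x|?M. 0)"
 proof (rule integral_dominated_convergence[where w = "%x. (f x)^2"])
  show "AE x in ?M. (%n. (f x - clip (real n) (f x))^2) \<longlonglongrightarrow> 0"
  proof (rule AE_I2)
   fix x
   obtain N :: nat where N: "\<bar>f x\<bar> <= N" using real_arch_simple by blast
   have "\<forall>\<^sub>F n in sequentially. 0 = (f x - clip (real n) (f x))^2"
    using eventually_ge_at_top[of N] by eventually_elim (use N in \<open>auto simp: clip_def\<close>)
   thus "(%n. (f x - clip (real n) (f x))^2) \<longlonglongrightarrow> 0" using Lim_transform_eventually[OF tendsto_const] by fast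
  qed
  show "AE x in ?M. norm ((f x - clip (real n) (f x))^2) <= (f x)^2" for n using clipb(2)[of "real n"] by (intro AE_I2) simp
  show "(%x. (f x - clip (real n) (f x))^2) \<in> borel_measurable ?M" for n using fmeas cm[OF fmeas] by simp
 qed (use f in \<open>auto simp: L2_def\<close>)
 hence "\<forall>\<^sub>F n in sequentially. (LINT x|?M. (f x - clip (real n) (f x))^2) < e / 4"
  using e by (intro order_tendstoD(2)[where a = "e/4"]) auto
 then obtain n where n: "(LINT x|?M. (f x - clip (real n) (f x))^2) < e / 4" by (auto simp: eventually_sequentially)
 define M where "M = real n"
 have "f measurable_on Om" using fmeas Om_meas by (simp add: measurable_on_iff_borel_measurable)
 then obtain Z g where Z: "negligible Z" and g: "!!k. continuous_on UNIV (g k)" "!!x. x \<notin> Z ==> (%k. g k x) \<longlonglongrightarrow> (if x \<in> Om then f x else 0)"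
  by (auto simp: measurable_on_def)
 have gm: "g k \<in> borel_measurable ?M" for k
  using continuous_imp_measurable_lebesgue[OF g(1)] by (rule measurable_restrict_space1)
 have "(%k. LINT x|?M. (clip M (f x) - clip M (g k x))^2) \<longlonglongrightarrow> (LINT x|?M. 0)"
 proof (rule integral_dominated_convergence[where w = "%x. (2 * M)^2"])
  have "AE x in lebesgue. x \<notin> Z" using Z by (intro AE_not_in) (simp add: negligible_iff_null_sets)
  hence "AE x in lebesgue. x \<in> Om --> x \<notin> Z" by eventually_elim simp
  hence "AE x in ?M. x \<in> Om \<and> x \<notin> Z" using Om_meas by (simp add: AE_restrict_space_iff)
  thus "AE x in ?M. (%k. (clip M (f x) - clip M (g k x))^2) \<longlonglongrightarrow> 0"
  proof eventually_elim
   case (elim x)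
   hence "(%k. g k x) \<longlonglongrightarrow> f x" using g(2)[of x] by simp
   hence "(%k. clip M (g k x)) \<longlonglongrightarrow> clip M (f x)"
    using continuous_on_tendsto_compose[OF clc] by simp
   hence "(%k. (clip M (f x) - clip M (g k x))^2) \<longlonglongrightarrow> (clip M (f x) - clip M (f x))^2" by (intro tendsto_intros)
   thus ?case by simp
  qed
  show "AE x in ?M. norm ((clip M (f x) - clip M (g k x))^2) <= (2 * M)^2" for k
  proof (rule AE_I2)
   fix x
   have "\<bar>clip M (f x) - clip M (g k x)\<bar> <= 2 * M"
    using clipb(1)[of M "f x"] clipb(1)[of M "g k x"] by (simp add: M_def)
   thus "norm ((clip M (f x) - clip M (g k x))^2) <= (2 * M)^2" using power_mono[of "\<bar>clip M (f x) - clip M (g k x)\<bar>" "2 * M" 2] by simp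
  qed
  show "(%x. (clip M (f x) - clip M (g k x))^2) \<in> borel_measurable ?M" for k using cm[OF fmeas, of M] cm[OF gm, of M k] by simp
 qed (use finite_measure.integrable_const[OF fm(1)] in auto)
 hence "\<forall>\<^sub>F k in sequentially. (LINT x|?M. (clip M (f x) - clip M (g k x))^2) < e / 4"
  using e by (intro order_tendstoD(2)[where a = "e/4"]) auto
 then obtain k where k: "(LINT x|?M. (clip M (f x) - clip M (g k x))^2) < e / 4" by (auto simp: eventually_sequentially)
 let ?psi = "%x. clip M (g k x)"
 have c: "continuous_on UNIV ?psi" using continuous_on_compose2[OF clc g(1)] by simp
 have L1: "(%x. clip M (f x)) \<in> L2 ?M" by (rule L2_bounded(1)[OF fm(1) cm[OF fmeas], where B = M]) (use clipb(1) M_def in auto)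
 have L2: "?psi \<in> L2 ?M" by (rule L2_bounded(1)[OF fm(1) cm[OF gm], where B = M]) (use clipb(1) M_def in auto)
 have "sqi ?M (%x. f x - ?psi x) < e"
  using sqi_triangle[OF f L1 L2] n k by (simp add: sqi_def M_def)
 thus ?thesis using that c by blast
qed

section \<open>Density of piecewise continuously differentiable functions\<close>

text \<open>Moving points inwards along the field before mollifying keeps the argument of the mollification
 in the domain. As the field is affine on each element, the result is piecewise \<open>C\<^sup>1\<close>, although
 it need not be \<open>C\<^sup>1\<close>.\<close>

definition shift :: "(pt => pt) => real => pt => pt" where "shift d t x = x + t *\<^sub>R field d x"

lemma shift_continuous: "continuous_on (closure Om) (shift d t)"
 unfolding shift_def by (intro continuous_intros field_continuous)

lemma field_bounded: obtains B where "B >= 0" "!!x. x \<in> closure Om ==> norm (field d x) <= B"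
proof -
 have "compact (closure Om)" using bdd by simp
 hence "bounded (field d ` closure Om)" using field_continuous compact_continuous_image compact_imp_bounded by blast
 then obtain B where "\<forall>y\<in>field d ` closure Om. norm y <= B" unfolding bounded_iff by blast
 thus ?thesis using that[of "max B 0"] by fastforce
qed

text \<open>\<open>delta <= t\<close> keeps the total displacement proportional to t.\<close>

definition admissible :: "(pt => pt) => real => real => (pt => real) => bool" where
 "admissible d t delta eta \<longleftrightarrow> 0 < t \<and> 0 < delta \<and> delta <= t \<and> mollifier delta eta \<and> (\<forall>x\<in>closure Om. cball (shift d t x) delta \<subseteq> Om)"

lemma moll_shift_continuous:
 assumes "f \<in> L2 (leb Om)" "mollifier delta eta"
 shows "continuous_on (closure Om) (%x. moll eta f (shift d t x))"
 using continuous_on_compose2[OF moll_continuous[OF assms] shift_continuous] by simp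

text \<open>All points contributing to the average at x lie within t (1 + B) of x, where B bounds
  the field; there uniform continuity applies.\<close>

lemma moll_shift_uniform:
 assumes c: "continuous_on (closure Om) f" and e: "e > 0"
 obtains t1 where "t1 > 0" "!!t delta eta x. admissible d t delta eta ==> t < t1 ==> x \<in> closure Om ==> \<bar>moll eta f (shift d t x) - f x\<bar> <= e"
proof -
 have "compact (closure Om)" using bdd by simp
 from compact_uniformly_continuous[OF c this] e
 obtain d0 where d0: "d0 > 0" "!!x y. x \<in> closure Om ==> y \<in> closure Om ==> dist y x < d0 ==> dist (f y) (f x) < e"
  unfolding uniformly_continuous_on_def by metis
 obtain B where B: "B >= 0" "!!x. x \<in> closure Om ==> norm (field d x) <= B" using field_bounded[of d] by blast
 have fL: "f \<in> L2 (leb Om)" by (rule L2_continuous_closure[OF c])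
 show ?thesis
 proof (rule that[of "d0 / (1 + B)"])
  show "d0 / (1 + B) > 0" using d0 B by simp
  fix t delta eta x assume a: "admissible d t delta eta" and t: "t < d0 / (1 + B)" and x: "x \<in> closure Om"
  have eta: "mollifier delta eta" and delta: "delta <= t" "0 < t" and cb: "cball (shift d t x) delta \<subseteq> Om" using a x by (auto simp: admissible_def)
  note p = mollifier_props[OF eta]
  let ?X = "shift d t x"
  have z: "eta x = 0" if "norm x > delta" for x using p(4)[of x] that by simp
  have i1: "integrable (leb Om) (%y. f y * eta (?X - y))" by (rule moll_integrable[OF fL p(1) z])
  note i2 = moll_const[OF eta cb]
  have "moll eta f ?X - f x = (LINT y|leb Om. f y * eta (?X - y)) - f x * (LINT y|leb Om. eta (?X - y))"
   using i2(2) by (simp add: moll_def)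
  also have "... = (LINT y|leb Om. (f y - f x) * eta (?X - y))" using i1 i2(1) by (simp add: left_diff_distrib)
  finally have eq: "moll eta f ?X - f x = (LINT y|leb Om. (f y - f x) * eta (?X - y))" .
  have pt: "\<bar>(f y - f x) * eta (?X - y)\<bar> <= e * eta (?X - y)" if y: "y \<in> Om" for y
  proof (cases "eta (?X - y) = 0")
   case False
   hence "norm (?X - y) < delta" using p(4)[of "?X - y"] by (meson not_le)
   moreover have "norm (x - y) <= norm (?X - y) + norm (t *\<^sub>R field d x)"
    using norm_triangle_ineq4[of "?X - y" "t *\<^sub>R field d x"] by (simp add: shift_def algebra_simps)
   moreover have "norm (t *\<^sub>R field d x) <= t * B" using B(2)[OF x] delta by (simp add: mult_left_mono)
   moreover have "t * (1 + B) < d0" using t B by (simp add: pos_less_divide_eq)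
   ultimately have "norm (x - y) < d0" using delta by (simp only: distrib_left mult_1_right)
   hence "\<bar>f y - f x\<bar> < e" using d0(2)[OF x, of y] y closure_subset by (auto simp: dist_norm norm_minus_commute dist_real_def)
   thus ?thesis using p(3)[of "?X - y"] by (simp add: abs_mult mult_right_mono less_imp_le)
  qed simp
  have "\<bar>LINT y|leb Om. (f y - f x) * eta (?X - y)\<bar> <= (LINT y|leb Om. \<bar>(f y - f x) * eta (?X - y)\<bar>)"
   using integral_norm_bound[of "leb Om" "%y. (f y - f x) * eta (?X - y)"] unfolding real_norm_def .
  also have "... <= (LINT y|leb Om. e * eta (?X - y))"
  proof (rule integral_mono)
   show "integrable (leb Om) (%y. \<bar>(f y - f x) * eta (?X - y)\<bar>)" using i1 i2(1) by (simp add: left_diff_distrib)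
   show "integrable (leb Om) (%y. e * eta (?X - y))" using i2(1) by simp
  qed (use pt in \<open>auto simp: space_restrict_space\<close>)
  also have "... = e" using i2(2) by simp
  finally show "\<bar>moll eta f ?X - f x\<bar> <= e" unfolding eq .
 qed
qed

definition linpart :: "(pt => pt) => pt set => pt => pt" where
 "linpart d K v = (\<Sum>z\<in>verts K. (lamG K z \<bullet> v) *\<^sub>R d z)"

lemma linpart_linear: "linear (linpart d K)"
 by (rule linearI) (auto simp: linpart_def inner_add_right scaleR_left_distrib sum.distrib scaleR_sum_right)

lemma shift_affine:
 assumes "K \<in> \<T>" "x \<in> K"
 shows "shift d t x = x + t *\<^sub>R linpart d K x + t *\<^sub>R (\<Sum>z\<in>verts K. lamC K z *\<^sub>R d z)"
 unfolding shift_def field_affine[OF assms] linpart_def by (simp add: scaleR_right_distrib)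

lemma shift_coords:
 assumes "K \<in> \<T>" "x \<in> K"
 shows "shift d t x = t *\<^sub>R (\<Sum>z\<in>verts K. lamC K z *\<^sub>R d z) +
  x $ 1 *\<^sub>R (axis 1 1 + t *\<^sub>R linpart d K (axis 1 1)) + x $ 2 *\<^sub>R (axis 2 1 + t *\<^sub>R linpart d K (axis 2 1))"
proof -
 have x: "x = x $ 1 *\<^sub>R axis 1 1 + x $ 2 *\<^sub>R axis 2 1" by (simp add: vec_eq_iff forall_2 axis_def)
 have "linpart d K x = x $ 1 *\<^sub>R linpart d K (axis 1 1) + x $ 2 *\<^sub>R linpart d K (axis 2 1)"
  by (subst x) (simp add: linear_add[OF linpart_linear] linear_cmul[OF linpart_linear])
 thus ?thesis unfolding shift_affine[OF assms]
  by (subst (1) x) (simp add: algebra_simps)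
qed

text \<open>The determinant tends to 1 as t tends to 0, and there are finitely many
  elements.\<close>

lemma shift_det:
 obtains t2 where "t2 > 0" "!!t K. 0 < t ==> t < t2 ==> K \<in> \<T> ==>
  cross2 (axis 1 1 + t *\<^sub>R linpart d K (axis 1 1)) (axis 2 1 + t *\<^sub>R linpart d K (axis 2 1)) >= 1/4"
proof -
 have "\<forall>\<^sub>F t in at_right 0. 1/4 <= cross2 (axis 1 1 + t *\<^sub>R linpart d K (axis 1 1)) (axis 2 1 + t *\<^sub>R linpart d K (axis 2 1))" for K
 proof -
  have "((%t. cross2 (axis 1 1 + t *\<^sub>R linpart d K (axis 1 1)) (axis 2 1 + t *\<^sub>R linpart d K (axis 2 1))) \<longlongrightarrow>
    cross2 (axis 1 1 + 0 *\<^sub>R linpart d K (axis 1 1)) (axis 2 1 + 0 *\<^sub>R linpart d K (axis 2 1))) (at_right 0)"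
   unfolding cross2_def by (intro tendsto_intros)
  moreover have "cross2 (axis 1 1 + 0 *\<^sub>R linpart d K (axis 1 1)) (axis 2 1 + 0 *\<^sub>R linpart d K (axis 2 1)) = 1"
   by (simp add: cross2_def axis_def)
  ultimately have "\<forall>\<^sub>F t in at_right 0. 1/4 < cross2 (axis 1 1 + t *\<^sub>R linpart d K (axis 1 1)) (axis 2 1 + t *\<^sub>R linpart d K (axis 2 1))"
   by (intro order_tendstoD(1)) auto
  thus ?thesis by eventually_elim simp
 qed
 hence "\<forall>\<^sub>F t in at_right 0. \<forall>K\<in>\<T>. 1/4 <= cross2 (axis 1 1 + t *\<^sub>R linpart d K (axis 1 1)) (axis 2 1 + t *\<^sub>R linpart d K (axis 2 1))"
  using fin by (simp add: eventually_ball_finite_distrib)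
 thus ?thesis using that unfolding eventually_at_right_field by blast
qed

text \<open>f is split into a continuous part, for which the convergence is uniform, and a part
  small in L^2, on which shifted mollification is bounded. That bound is summed over the elements
  and grows with their number, which is harmless because the second part is taken correspondingly
  small.\<close>

lemma moll_shift_L2:
 assumes f: "f \<in> L2 (leb Om)" and e: "e > 0"
 obtains t1 where "t1 > 0" "!!t delta eta. admissible d t delta eta ==> t < t1 ==> sqi (leb Om) (%x. moll eta f (shift d t x) - f x) < e"
proof -
 define N where "N = real (card \<T>)"
 \<comment> \<open>Makes (8 N + 4) e' = e / 4 in the final sum.\<close>
 define e' where "e' = e / (4 * (8 * N + 4))"
 have N: "N >= 0" by (simp add: N_def)
 hence e': "e' > 0" using e by (simp add: e'_def add_nonneg_pos)
 obtain psi where psi: "continuous_on UNIV psi" "sqi (leb Om) (%x. f x - psi x) < e'"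
  using L2_dense_continuous[OF f e'] .
 define mu where "mu = measure (leb Om) (space (leb Om))"
 define omega where "omega = sqrt (e / (16 * (mu + 1)))"
 have mu: "mu >= 0" by (simp add: mu_def)
 have omega: "omega > 0" "omega^2 * mu <= e / 16" using e mu by (auto simp: omega_def field_simps)
 have cpsi: "continuous_on (closure Om) psi" using psi(1) continuous_on_subset by blast
 have psiL: "psi \<in> L2 (leb Om)" by (rule L2_continuous_closure[OF cpsi])
 have rL: "(%x. f x - psi x) \<in> L2 (leb Om)" by (rule L2_diff[OF f psiL])
 obtain t1 where t1: "t1 > 0" "!!t delta eta x. admissible d t delta eta ==> t < t1 ==> x \<in> closure Om ==> \<bar>moll eta psi (shift d t x) - psi x\<bar> <= omega"
  using moll_shift_uniform[OF cpsi omega(1), of d] by blast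
 obtain t2 where t2: "t2 > 0" "!!t K. 0 < t ==> t < t2 ==> K \<in> \<T> ==>
  cross2 (axis 1 1 + t *\<^sub>R linpart d K (axis 1 1)) (axis 2 1 + t *\<^sub>R linpart d K (axis 2 1)) >= 1/4" using shift_det[of d] by blast
 show ?thesis
 proof (rule that[of "min t1 t2"])
  show "min t1 t2 > 0" using t1 t2 by simp
  fix t delta eta assume a: "admissible d t delta eta" and t: "t < min t1 t2"
  have eta: "mollifier delta eta" and tp: "0 < t" and cb: "!!x. x \<in> closure Om ==> cball (shift d t x) delta \<subseteq> Om" using a by (auto simp: admissible_def)
  let ?M = "leb Om" and ?r = "%x. f x - psi x"
  have mL: "(%x. moll eta v (shift d t x)) \<in> L2 ?M" if "v \<in> L2 ?M" for v
   by (rule L2_continuous_closure[OF moll_shift_continuous[OF that eta]])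
  have mr: "sqi ?M (%x. moll eta ?r (shift d t x)) <= 4 * N * e'"
  proof -
   have "sqi (leb (interior K)) (%x. moll eta ?r (shift d t x)) <= 4 * sqi ?M ?r" if K: "K \<in> \<T>" for K
   proof (rule moll_affine_bound[OF rL eta K])
    show "shift d t x = t *\<^sub>R (\<Sum>z\<in>verts K. lamC K z *\<^sub>R d z) +
     x $ 1 *\<^sub>R (axis 1 1 + t *\<^sub>R linpart d K (axis 1 1)) + x $ 2 *\<^sub>R (axis 2 1 + t *\<^sub>R linpart d K (axis 2 1))"
     if "x \<in> K" for x by (rule shift_coords[OF K that])
    show "1/4 <= cross2 (axis 1 1 + t *\<^sub>R linpart d K (axis 1 1)) (axis 2 1 + t *\<^sub>R linpart d K (axis 2 1))"
     using t2(2)[OF tp _ K] t by simp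
    show "cball (shift d t x) delta \<subseteq> Om" if "x \<in> K" for x using cb K_props(7)[OF K] that by blast
    show "(%x. moll eta ?r (shift d t x)) \<in> L2 (leb (interior K))" by (rule sqi_K_le(1)[OF mL[OF rL] K])
   qed
   hence "sqi ?M (%x. moll eta ?r (shift d t x)) <= (\<Sum>K\<in>\<T>. 4 * sqi ?M ?r)"
    unfolding sqi_split[OF mL[OF rL]] by (rule sum_mono)
   also have "... = 4 * N * sqi ?M ?r" by (simp add: N_def)
   also have "... <= 4 * N * e'" using psi(2) N by (intro mult_left_mono) auto
   finally show ?thesis .
  qed
  have mpsi: "sqi ?M (%x. moll eta psi (shift d t x) - psi x) <= e / 16"
  proof -
   have "sqi ?M (%x. moll eta psi (shift d t x) - psi x) <= omega^2 * mu"
    unfolding mu_def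
   proof (rule L2_bounded(2)[OF fm(1)])
    show "(%x. moll eta psi (shift d t x) - psi x) \<in> borel_measurable ?M" using L2_diff[OF mL[OF psiL] psiL] by (simp add: L2_def)
    fix x assume "x \<in> space ?M"
    hence "x \<in> closure Om" using closure_subset by (auto simp: space_restrict_space)
    thus "norm (moll eta psi (shift d t x) - psi x) <= omega" using t1(2)[OF a] t by simp
   qed
   thus ?thesis using omega(2) by simp
  qed
  have split: "moll eta f y = moll eta ?r y + moll eta psi y" for y
  proof -
   note p = mollifier_props[OF eta]
   have z: "eta x = 0" if "norm x > delta" for x using p(4)[of x] that by simp
   show ?thesis unfolding moll_def
    using moll_integrable[OF rL p(1) z, where x = y] moll_integrable[OF psiL p(1) z, where x = y]
    by (subst Bochner_Integration.integral_add[symmetric]) (auto intro!: Bochner_Integration.integral_cong simp: algebra_simps)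
  qed
  have "sqi ?M (%x. moll eta f (shift d t x) - f x) =
    sqi ?M (%x. moll eta ?r (shift d t x) + ((moll eta psi (shift d t x) - psi x) + (psi x - f x)))"
   unfolding split by (simp add: algebra_simps)
  also have "... <= 2 * sqi ?M (%x. moll eta ?r (shift d t x)) + 2 * sqi ?M (%x. (moll eta psi (shift d t x) - psi x) + (psi x - f x))"
   by (intro sqi_add_le L2_add L2_diff mL psiL f rL)
  also have "sqi ?M (%x. (moll eta psi (shift d t x) - psi x) + (psi x - f x)) <=
    2 * sqi ?M (%x. moll eta psi (shift d t x) - psi x) + 2 * sqi ?M (%x. psi x - f x)"
   by (intro sqi_add_le L2_add L2_diff mL psiL f)
  finally have "sqi ?M (%x. moll eta f (shift d t x) - f x) <= 2 * (4 * N * e') + 2 * (2 * (e / 16) + 2 * e')"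
   using mr mpsi psi(2) sqi_commute[of ?M psi f] by simp
  also have "... = (8 * N + 4) * e' + e / 4" by (simp add: algebra_simps)
  also have "(8 * N + 4) * e' = e / 4" using N by (simp add: e'_def field_simps)
  finally show "sqi ?M (%x. moll eta f (shift d t x) - f x) < e" using e by simp
 qed
qed

lemma sqi_vec:
 assumes "g \<in> L2 M" shows "sqi M g = (\<Sum>i\<in>UNIV. sqi M (%x. (g x :: pt) $ i))"
proof -
 have "(norm (g x))^2 = (\<Sum>i\<in>UNIV. (g x $ i)^2)" for x by (simp add: norm_vec_def L2_set_def sum_nonneg)
 thus ?thesis unfolding sqi_def using sqi_nth[OF assms]
  by (simp add: L2_def)
qed

text \<open>The uniform closeness for continuous f serves the traces, where the approximation is
  compared with the restriction of f to an edge.\<close>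

lemma density_pwC1:
 assumes f: "f \<in> H1 Om" and e: "e > 0"
 obtains u G where "pwC1 u G" "sqi (leb Om) (%x. u x - f x) < e"
  "sqi (leb Om) (%x. pwgrad G x - weak_grad Om f x) < e"
  "continuous_on (closure Om) f ==> (!!x. x \<in> closure Om ==> \<bar>u x - f x\<bar> < e)"
proof -
 let ?M = "leb Om"
 define g where "g = weak_grad Om f"
 note h = H1D[OF f opn, folded g_def]
 obtain d t0 where t0: "t0 > 0" "!!t x. 0 < t ==> t < t0 ==> x \<in> closure Om ==> x + t *\<^sub>R field d x \<in> Om" using inward_field_exists by metis
 have gi: "(%x. g x $ i) \<in> L2 ?M" for i using sqi_nth[OF h(2)] by blast
 obtain t1 where t1: "t1 > 0" "!!t delta eta. admissible d t delta eta ==> t < t1 ==> sqi ?M (%x. moll eta f (shift d t x) - f x) < e"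
  using moll_shift_L2[OF h(1) e, of d] by blast
 define e2 where "e2 = min 1 (e / 8)"
 have e2: "e2 > 0" using e by (simp add: e2_def)
 have "\<exists>t2>0. \<forall>t delta eta. admissible d t delta eta --> t < t2 --> sqi ?M (%x. moll eta (%y. g y $ i) (shift d t x) - g x $ i) < e2" for i
  by (rule moll_shift_L2[OF gi[of i] e2, of d]) blast
 then obtain t2 where t2: "!!i. t2 i > 0" "!!i t delta eta. admissible d t delta eta ==> t < t2 i ==> sqi ?M (%x. moll eta (%y. g y $ i) (shift d t x) - g x $ i) < e2"
 proof -
  assume "!!i. \<exists>t2>0. \<forall>t delta eta. admissible d t delta eta --> t < t2 --> sqi ?M (%x. moll eta (%y. g y $ i) (shift d t x) - g x $ i) < e2"
  hence "\<forall>i. \<exists>t2. t2 > 0 \<and> (\<forall>t delta eta. admissible d t delta eta --> t < t2 --> sqi ?M (%x. moll eta (%y. g y $ i) (shift d t x) - g x $ i) < e2)" by blast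
  from choice[OF this] show ?thesis using that by blast
 qed
 have "\<exists>t3>0. continuous_on (closure Om) f --> (\<forall>t delta eta x. admissible d t delta eta --> t < t3 --> x \<in> closure Om --> \<bar>moll eta f (shift d t x) - f x\<bar> <= e / 2)"
 proof (cases "continuous_on (closure Om) f")
  case True
  have e2: "e / 2 > 0" using e by simp
  show ?thesis by (rule moll_shift_uniform[OF True e2, of d]) blast
 next
  case False
  thus ?thesis by (auto intro: exI[of _ 1])
 qed
 then obtain t3 where t3: "t3 > 0" "!!t delta eta x. continuous_on (closure Om) f ==> admissible d t delta eta ==> t < t3 ==> x \<in> closure Om ==> \<bar>moll eta f (shift d t x) - f x\<bar> <= e / 2"
  by blast
 define Q where "Q = (\<Sum>K\<in>\<T>. \<Sum>z\<in>verts K. norm (d z) * norm (lamG K z))"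
 have Q: "Q >= 0" unfolding Q_def by (intro sum_nonneg) auto
 define S where "S = 4 + 2 * sqi ?M g"
 have S: "S > 0" by (simp add: S_def add_pos_nonneg)
 \<comment> \<open>Below this t, the term of order t in the chain rule contributes at most e /
   4.\<close>
 define t4 where "t4 = sqrt (e / (8 * S * (Q^2 + 1)))"
 have Q2: "Q^2 + 1 > 0" by (simp add: add_nonneg_pos)
 have t4: "t4 > 0" using e S Q2 by (simp add: t4_def)
 define m where "m = min (min t0 t1) (min (min (t2 1) (t2 2)) (min t3 t4))"
 define t where "t = m / 2"
 have m: "m > 0" "m <= t0" "m <= t1" "m <= t2 1" "m <= t2 2" "m <= t3" "m <= t4"
  using t0(1) t1(1) t2(1) t3(1) t4 by (auto simp: m_def)
 have m2: "m <= t2 i" for i using m(4,5) exhaust_2[of i] by metis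
 have t: "0 < t" "t < t0" "t < t1" "t < t2 i" "t < t3" "t < t4" for i
  using m m2[of i] unfolding t_def by linarith+
 have "compact (shift d t ` closure Om)" using shift_continuous bdd by (intro compact_continuous_image) auto
 moreover have "shift d t ` closure Om \<subseteq> Om" using t0(2)[OF t(1,2)] by (auto simp: shift_def)
 ultimately obtain delta0 where delta0: "delta0 > 0" "(\<Union>x\<in>shift d t ` closure Om. cball x delta0) \<subseteq> Om"
  using compact_subset_open_imp_cball_epsilon_subset opn by metis
 define delta where "delta = min delta0 t"
 have delta: "delta > 0" "delta <= t" using delta0 t by (auto simp: delta_def)
 obtain eta where eta: "mollifier delta eta" using mollifier_exists[OF delta(1)] .
 have cb: "cball (shift d t x) delta \<subseteq> Om" if "x \<in> closure Om" for x
 proof -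
  have "cball (shift d t x) delta \<subseteq> cball (shift d t x) delta0" by (auto simp: delta_def)
  thus ?thesis using delta0(2) that by blast
 qed
 have adm: "admissible d t delta eta" using t delta eta cb by (auto simp: admissible_def)
 define u where "u x = moll eta f (shift d t x)" for x
 define M where "M x = (\<chi> i. moll eta (%y. g y $ i) (shift d t x))" for x
 \<comment> \<open>Chain rule: the second term is t times the transposed linear part of the field,
   applied to M.\<close>
 define G where "G K x = M x + t *\<^sub>R (\<Sum>z\<in>verts K. (M x \<bullet> d z) *\<^sub>R lamG K z)" for K x
 have cM: "continuous_on (closure Om) M"
  unfolding M_def by (intro continuous_on_vec_lambda moll_shift_continuous[OF gi eta])
 have pw: "pwC1 u G"
  unfolding pwC1_def C1_on_def
 proof (intro ballI conjI)
  fix K assume K: "K \<in> \<T>"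
  have "continuous_on K M" using cM K_props(7)[OF K] continuous_on_subset by blast
  thus "continuous_on K (G K)" unfolding G_def by (intro continuous_intros)
  fix x assume x: "x \<in> K"
  let ?A = "%x. x + t *\<^sub>R linpart d K x + t *\<^sub>R (\<Sum>z\<in>verts K. lamC K z *\<^sub>R d z)"
  have bl: "bounded_linear (linpart d K)" using linpart_linear by (simp add: linear_conv_bounded_linear)
  have dA: "(?A has_derivative (%v. v + t *\<^sub>R linpart d K v)) (at x within K)"
   by (auto intro!: derivative_eq_intros bounded_linear.has_derivative[OF bl])
  have sA: "shift d t y = ?A y" if "y \<in> K" for y by (rule shift_affine[OF K that])
  have "cball (?A x) delta \<subseteq> Om" using cb[of x] x K_props(7)[OF K] sA[OF x] by auto
  from moll_derivative[OF h(1) h(3) eta this]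
  have "(moll eta f has_derivative (%v. M x \<bullet> v)) (at (?A x))" using sA[OF x] by (simp add: M_def)
  from has_derivative_compose[OF dA this]
  have D: "((%x. moll eta f (?A x)) has_derivative (%v. M x \<bullet> (v + t *\<^sub>R linpart d K v))) (at x within K)" .
  have "M x \<bullet> (v + t *\<^sub>R linpart d K v) = G K x \<bullet> v" for v
   by (simp add: G_def linpart_def inner_add_left inner_add_right inner_sum_left inner_sum_right algebra_simps)
  hence "((%x. moll eta f (?A x)) has_derivative (%v. G K x \<bullet> v)) (at x within K)" using D by simp
  thus "(u has_derivative (%v. G K x \<bullet> v)) (at x within K)"
   by (rule has_derivative_transform[OF x, rotated]) (simp add: u_def sA)
 qed
 have MmL: "M \<in> L2 ?M" by (rule L2_continuous_closure[OF cM])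
 have Mg: "sqi ?M (%x. M x - g x) < 2 * e2"
 proof -
  have "sqi ?M (%x. M x - g x) = (\<Sum>i\<in>UNIV. sqi ?M (%x. (M x - g x) $ i))" by (rule sqi_vec[OF L2_diff[OF MmL h(2)]])
  also have "... < 2 * e2" using t2(2)[OF adm t(4), of 1] t2(2)[OF adm t(4), of 2] by (simp add: sum_2 M_def)
  finally show ?thesis .
 qed
 have MM: "sqi ?M M <= S"
  using sqi_add_le[OF L2_diff[OF MmL h(2)] h(2)] Mg by (simp add: S_def e2_def)
 have "sqi ?M (%x. pwgrad G x - g x) < e"
 proof -
  have iL: "integrable ?M (%x. (norm (M x - g x))^2)" "integrable ?M (%x. (norm (M x))^2)"
   using L2_integrable_sq[OF L2_diff[OF MmL h(2)]] L2_integrable_sq[OF MmL] by auto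
  have "sqi ?M (%x. pwgrad G x - g x) <= (LINT x|?M. 2 * (norm (M x - g x))^2 + 2 * (t^2 * Q^2) * (norm (M x))^2)"
   unfolding sqi_def
  proof (rule integral_mono_AE)
   show "integrable ?M (%x. (norm (pwgrad G x - g x))^2)" by (rule L2_integrable_sq[OF L2_diff[OF pwgrad_L2[OF pw] h(2)]])
   show "integrable ?M (%x. 2 * (norm (M x - g x))^2 + 2 * (t^2 * Q^2) * (norm (M x))^2)" using iL by simp
   show "AE x in ?M. (norm (pwgrad G x - g x))^2 <= 2 * (norm (M x - g x))^2 + 2 * (t^2 * Q^2) * (norm (M x))^2"
    using AE_interior_on
   proof eventually_elim
    case (elim x)
    then obtain K where K: "K \<in> \<T>" "x \<in> interior K" by blast
    let ?w = "\<Sum>z\<in>verts K. (M x \<bullet> d z) *\<^sub>R lamG K z"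
    have "norm ?w <= (\<Sum>z\<in>verts K. norm ((M x \<bullet> d z) *\<^sub>R lamG K z))" by (rule norm_sum)
    also have "... <= (\<Sum>z\<in>verts K. norm (M x) * (norm (d z) * norm (lamG K z)))"
     using Cauchy_Schwarz_ineq2[of "M x"] by (intro sum_mono) (auto simp flip: mult.assoc intro!: mult_right_mono)
    also have "... = norm (M x) * (\<Sum>z\<in>verts K. norm (d z) * norm (lamG K z))" by (simp add: sum_distrib_left)
    also have "... <= norm (M x) * Q"
     unfolding Q_def using fin K(1)
     by (intro mult_left_mono member_le_sum[of K \<T> "%K. \<Sum>z\<in>verts K. norm (d z) * norm (lamG K z)"]) (auto intro!: sum_nonneg)
    finally have "norm (t *\<^sub>R ?w) <= t * (norm (M x) * Q)" using t by (simp add: mult_left_mono)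
    hence "(norm (t *\<^sub>R ?w))^2 <= (t * (norm (M x) * Q))^2" by (intro power_mono) auto
    hence b: "(norm (t *\<^sub>R ?w))^2 <= (t^2 * Q^2) * (norm (M x))^2" by (simp add: power_mult_distrib mult_ac)
    have e: "pwgrad G x - g x = (M x - g x) + t *\<^sub>R ?w" using pwgrad_eq[OF K, of G] by (simp add: G_def)
    show ?case unfolding e using norm_add_sq_le[of "M x - g x" "t *\<^sub>R ?w"] b by linarith
   qed
  qed
  also have "... = 2 * sqi ?M (%x. M x - g x) + 2 * (t^2 * Q^2) * sqi ?M M" using iL by (simp add: sqi_def)
  also have "... <= 2 * (2 * e2) + 2 * (t^2 * Q^2) * S" using Mg MM by (intro add_mono mult_left_mono) auto
  also have "... < e"
  proof -
   have "t^2 <= t4^2" using t(1,6) by (intro power_mono) auto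
   also have "t4^2 = e / (8 * S * (Q^2 + 1))" using e S Q2 by (simp add: t4_def)
   finally have "t^2 * (8 * S * (Q^2 + 1)) <= e" using S Q2 by (simp add: pos_le_divide_eq)
   moreover have "t^2 * (8 * S * Q^2) <= t^2 * (8 * S * (Q^2 + 1))" using S by (intro mult_left_mono) auto
   ultimately have "2 * (t^2 * Q^2) * S <= e / 4" by (simp add: algebra_simps)
   moreover have "2 * (2 * e2) <= e / 2" by (simp add: e2_def)
   ultimately show ?thesis using e by linarith
  qed
  finally show ?thesis .
 qed
 moreover have "sqi ?M (%x. u x - f x) < e" unfolding u_def using t1(2)[OF adm t(3)] .
 moreover have "\<bar>u x - f x\<bar> < e" if "continuous_on (closure Om) f" "x \<in> closure Om" for x
  using t3(2)[OF that(1) adm t(5) that(2)] e by (simp add: u_def)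
 ultimately show ?thesis using that pw unfolding g_def by blast
qed

end

section \<open>The Poincare inequality on the elements\<close>

lemma sqi_minus_mean:
 fixes v :: "'a => real"
 assumes M: "finite_measure M" and v: "v \<in> L2 M" and m: "measure M (space M) > 0"
 shows "sqi M (%x. v x - (LINT x|M. v x) / measure M (space M)) = sqi M v - (LINT x|M. v x)^2 / measure M (space M)"
proof -
 let ?m = "measure M (space M)" and ?I = "LINT x|M. v x"
 have i: "integrable M v" "integrable M (%x. (v x)^2)" using L2_integrable[OF M v] v by (auto simp: L2_def)
 interpret finite_measure M by (rule M)
 have "sqi M (%x. v x - ?I / ?m) = (LINT x|M. (v x)^2 - (2 * (?I / ?m)) * v x + (?I / ?m)^2)"
  unfolding sqi_def by (rule Bochner_Integration.integral_cong) (auto simp: power2_eq_square algebra_simps)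
 also have "... = sqi M v - (2 * (?I / ?m)) * ?I + ?m * (?I / ?m)^2" using i by (simp add: sqi_def)
 also have "... = sqi M v - ?I^2 / ?m" using m by (simp add: power2_eq_square field_simps)
 finally show ?thesis .
qed

context mesh
begin

definition mean :: "pt set => (pt => real) => real" where
 "mean K v = (LINT x|leb (interior K). v x) / measure lebesgue K"

lemma measure_K_pos: "K \<in> \<T> ==> measure lebesgue K > 0"
proof -
 assume K: "K \<in> \<T>"
 have "\<not> negligible (interior K)" using open_not_negligible[of "interior K"] K_props(9)[OF K] by simp
 moreover have "interior K \<in> lmeasurable"
  using bounded_subset[OF compact_imp_bounded[OF K_props(4)[OF K]] interior_subset] by (intro lmeasurable_open) auto
 ultimately have "measure lebesgue (interior K) ~= 0" using negligible_iff_measure0 by blast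
 thus ?thesis using measure_interior_eq[OF K] by (simp add: order_less_le)
qed

lemma space_measure_K: "K \<in> \<T> ==> measure (leb (interior K)) (space (leb (interior K))) = measure lebesgue K"
 using measure_interior_eq[of K] by (simp add: measure_restrict_space)

lemma sqi_mean_le:
 assumes K: "K \<in> \<T>" and v: "v \<in> L2 (leb (interior K))"
 shows "sqi (leb (interior K)) (%x. v x - mean K v) <= sqi (leb (interior K)) v"
 using sqi_minus_mean[OF fm(2)[OF K] v, unfolded space_measure_K[OF K], OF measure_K_pos[OF K]] measure_K_pos[OF K]
 by (simp add: mean_def)

lemma mean_diff:
 assumes K: "K \<in> \<T>" and v: "v \<in> L2 (leb (interior K))" "u \<in> L2 (leb (interior K))"
 shows "mean K (%x. v x - u x) = mean K v - mean K u"
 using L2_integrable[OF fm(2)[OF K] v(1)] L2_integrable[OF fm(2)[OF K] v(2)] by (simp add: mean_def diff_divide_distrib)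

lemma mean_sq_le:
 assumes K: "K \<in> \<T>" and v: "v \<in> L2 (leb (interior K))"
 shows "(mean K v)^2 * measure lebesgue K <= sqi (leb (interior K)) v"
proof -
 have "(LINT x|leb (interior K). v x)^2 <= measure lebesgue K * sqi (leb (interior K)) v"
  using integral_sq_le_sqi[OF fm(2)[OF K] v] unfolding space_measure_K[OF K] .
 thus ?thesis using measure_K_pos[OF K] by (simp add: mean_def power2_eq_square field_simps)
qed

text \<open>Subtracting the mean does not increase the norm, so replacing w by an approximation
  changes the deviation from the mean by no more than the L^2 distance. The factor 8 instead of 2
  comes from two squared triangle inequalities.\<close>

lemma poincare_H1:
 assumes w: "w \<in> H1 Om" and K: "K \<in> \<T>" and D: "!!x y. x \<in> K ==> y \<in> K ==> norm (y - x) <= D" "D >= 0"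
 shows "sqi (leb (interior K)) (%x. w x - mean K w) <= 8 * D^2 * sqi (leb (interior K)) (weak_grad Om w)"
proof -
 let ?M = "leb (interior K)" and ?g = "weak_grad Om w"
 note h = H1D[OF w opn]
 have wL: "w \<in> L2 ?M" and gL: "?g \<in> L2 ?M" using sqi_K_le(1)[OF _ K] h by auto
 have m: "measure lebesgue K > 0" by (rule measure_K_pos[OF K])
 have "sqi ?M (%x. w x - mean K w) <= 8 * D^2 * sqi ?M ?g + r" if r: "r > 0" for r
 proof -
  define e where "e = r / (2 + 8 * D^2)"
  have "2 + 8 * D^2 > 0" by (simp add: add_pos_nonneg)
  hence e: "e > 0" "(2 + 8 * D^2) * e = r" using r by (simp_all add: e_def)
  obtain u G where u: "pwC1 u G" "sqi (leb Om) (%x. u x - w x) < e" "sqi (leb Om) (%x. pwgrad G x - ?g x) < e"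
   by (rule density_pwC1[OF w e(1)]) blast
  have C: "C1_on K u (G K)" using u(1) K by (simp add: pwC1_def)
  have cu: "continuous_on K u" by (rule C1_on_continuous[OF C])
  have uOm: "u \<in> L2 (leb Om)" by (rule L2_continuous_closure[OF pwC1_continuous[OF u(1)]])
  have uL: "u \<in> L2 ?M" using sqi_K_le(1)[OF uOm K] .
  have pgL: "pwgrad G \<in> L2 ?M" using sqi_K_le(1)[OF pwgrad_L2[OF u(1)] K] .
  have uw: "sqi ?M (%x. w x - u x) <= e"
   using sqi_K_le(2)[OF L2_diff[OF uOm h(1)] K] u(2) sqi_commute[of ?M w u] by simp
  have pg: "sqi ?M (%x. pwgrad G x - ?g x) <= e"
   using sqi_K_le(2)[OF L2_diff[OF pwgrad_L2[OF u(1)] h(2)] K] u(3) by simp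
  have GK: "sqi (leb K) (G K) = sqi ?M (pwgrad G)"
  proof -
   have "sqi (leb K) (G K) = sqi ?M (G K)" using C K by (intro sqi_interior_eq[symmetric]) (auto simp: C1_on_def)
   also have "... = sqi ?M (pwgrad G)" unfolding sqi_def
    by (intro Bochner_Integration.integral_cong) (auto simp: space_restrict_space pwgrad_eq[OF K])
   finally show ?thesis .
  qed
  have Iu: "(LINT x|leb K. u x) = (LINT x|?M. u x)"
   using integral_interior_eq[OF K L2_integrable[OF compact_finite_measure[OF K_props(4)[OF K]] L2_continuous_compact[OF cu K_props(4)[OF K]]]] by simp
  have "measure lebesgue K * sqi ?M u - (LINT x|?M. u x)^2 <= 2 * D^2 * measure lebesgue K * sqi ?M (pwgrad G)"
   using poincare_C1[OF K_props(4,5)[OF K] D C] unfolding GK Iu sqi_interior_eq[OF K cu] by simp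
  hence "sqi ?M u - (LINT x|?M. u x)^2 / measure lebesgue K <= 2 * D^2 * sqi ?M (pwgrad G)"
   using m by (simp add: field_simps)
  hence pu: "sqi ?M (%x. u x - mean K u) <= 2 * D^2 * sqi ?M (pwgrad G)"
   using sqi_minus_mean[OF fm(2)[OF K] uL, unfolded space_measure_K[OF K], OF m] by (simp add: mean_def)
  have "sqi ?M (pwgrad G) <= 2 * e + 2 * sqi ?M ?g"
   using sqi_add_le[OF L2_diff[OF pgL gL] gL] pg by simp
  hence pu2: "sqi ?M (%x. u x - mean K u) <= 2 * D^2 * (2 * e + 2 * sqi ?M ?g)"
   using pu by (smt (verit) mult_left_mono zero_le_power2 mult_nonneg_nonneg)
  have "sqi ?M (%x. w x - mean K w) = sqi ?M (%x. ((w x - u x) - mean K (%x. w x - u x)) + (u x - mean K u))"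
   unfolding mean_diff[OF K wL uL] by (simp add: algebra_simps)
  also have "... <= 2 * sqi ?M (%x. (w x - u x) - mean K (%x. w x - u x)) + 2 * sqi ?M (%x. u x - mean K u)"
   by (intro sqi_add_le L2_diff wL uL L2_const fm(2)[OF K])
  also have "... <= 2 * e + 2 * (2 * D^2 * (2 * e + 2 * sqi ?M ?g))"
   using sqi_mean_le[OF K L2_diff[OF wL uL]] uw pu2 by simp
  also have "... = 8 * D^2 * sqi ?M ?g + (2 + 8 * D^2) * e" by (simp add: algebra_simps)
  finally show ?thesis using e(2) by simp
 qed
 thus ?thesis by (rule field_le_epsilon)
qed

end

section \<open>Arc length\<close>

text \<open>The parametrised form in which \<open>trace_C1\<close> bounds the trace, without the
  length factor.\<close>

definition segsq :: "pt => pt => (pt => real) => ennreal" where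
 "segsq a b v = (\<integral>\<^sup>+s. ennreal ((v ((1 - s) *\<^sub>R a + s *\<^sub>R b))^2) * indicator {0..1} s \<partial>lborel)"

lemma seg_param_measurable:
 "(%t::real. (1 - t) *\<^sub>R a + t *\<^sub>R (b::pt)) \<in> restrict_space lborel {0..1} \<rightarrow>\<^sub>M restrict_space borel (closed_segment a b)"
proof (rule measurable_restrict_space2)
 show "(%t::real. (1 - t) *\<^sub>R a + t *\<^sub>R b) \<in> space (restrict_space lborel {0..1}) \<rightarrow> closed_segment a b"
  by (auto simp: space_restrict_space closed_segment_def)
 have "continuous_on UNIV (%t::real. (1 - t) *\<^sub>R a + t *\<^sub>R b)" by (intro continuous_intros)
 thus "(%t::real. (1 - t) *\<^sub>R a + t *\<^sub>R b) \<in> restrict_space lborel {0..1} \<rightarrow>\<^sub>M borel"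
  by (intro measurable_restrict_space1) (simp add: borel_measurable_continuous_onI)
qed

lemma nn_integral_arclength_ends:
 assumes f: "f \<in> borel_measurable (restrict_space borel (closed_segment a b))"
 shows "(\<integral>\<^sup>+x. f x \<partial>arclength_ends a b) = ennreal (dist a b) * (\<integral>\<^sup>+s. f ((1 - s) *\<^sub>R a + s *\<^sub>R b) * indicator {0..1} s \<partial>lborel)"
  "(%s. f ((1 - s) *\<^sub>R a + s *\<^sub>R b) * indicator {0..1} s :: ennreal) \<in> borel_measurable borel"
proof -
 note m = seg_param_measurable[of a b]
 show "(\<integral>\<^sup>+x. f x \<partial>arclength_ends a b) = ennreal (dist a b) * (\<integral>\<^sup>+s. f ((1 - s) *\<^sub>R a + s *\<^sub>R b) * indicator {0..1} s \<partial>lborel)"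
  unfolding arclength_ends_def using f m
  by (simp add: nn_integral_scale_measure nn_integral_distr nn_integral_restrict_space)
 have "(%s. f ((1 - s) *\<^sub>R a + s *\<^sub>R b)) \<in> borel_measurable (restrict_space lborel {0..1})"
  using measurable_compose[OF m f] .
 thus "(%s. f ((1 - s) *\<^sub>R a + s *\<^sub>R b) * indicator {0..1} s) \<in> borel_measurable borel"
  by (subst (asm) borel_measurable_restrict_space_iff_ennreal) auto
qed

lemma arclength_cases:
 obtains "arclength (closed_segment a b) = arclength_ends a b" | "arclength (closed_segment a b) = arclength_ends b a"
proof -
 define p where "p = (SOME (c, d). closed_segment a b = closed_segment c d)"
 have "case p of (c, d) => closed_segment a b = closed_segment c d"
  unfolding p_def by (rule someI_ex) auto
 hence "{a, b} = {fst p, snd p}" by (cases p) (auto simp: closed_segment_eq)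
 hence "p = (a, b) \<or> p = (b, a)" by (cases p) (auto simp: doubleton_eq_iff)
 moreover have "arclength (closed_segment a b) = arclength_ends (fst p) (snd p)"
  by (simp only: arclength_def p_def Let_def case_prod_beta)
 ultimately show ?thesis using that by fastforce
qed

lemma sets_arclength: "sets (arclength (closed_segment a b)) = sets (restrict_space borel (closed_segment a b))"
 by (rule arclength_cases[of a b]) (auto simp: arclength_ends_def closed_segment_commute)

lemma space_arclength: "space (arclength (closed_segment a b)) = closed_segment a b"
 using sets_eq_imp_space_eq[OF sets_arclength[of a b]] by (simp add: space_restrict_space)

lemma measurable_arclength: "f \<in> borel_measurable (arclength (closed_segment a b)) \<longleftrightarrow> f \<in> borel_measurable (restrict_space borel (closed_segment a b))"
 by (simp add: measurable_cong_sets[OF sets_arclength refl])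

text \<open>If the choice returned the end points in reverse order, the substitution s -> 1 - s
  restores the parametrisation.\<close>

lemma nn_integral_arclength:
 assumes f: "f \<in> borel_measurable (arclength (closed_segment a b))"
 shows "(\<integral>\<^sup>+x. f x \<partial>arclength (closed_segment a b)) = ennreal (dist a b) * (\<integral>\<^sup>+s. f ((1 - s) *\<^sub>R a + s *\<^sub>R b) * indicator {0..1} s \<partial>lborel)"
proof (rule arclength_cases[of a b])
 assume "arclength (closed_segment a b) = arclength_ends a b"
 moreover have "f \<in> borel_measurable (restrict_space borel (closed_segment a b))" using f measurable_arclength by blast
 ultimately show ?thesis by (simp add: nn_integral_arclength_ends(1))
next
 assume e: "arclength (closed_segment a b) = arclength_ends b a"
 have f': "f \<in> borel_measurable (restrict_space borel (closed_segment b a))" using f measurable_arclength closed_segment_commute by metis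
 note n = nn_integral_arclength_ends[OF f']
 have "(\<integral>\<^sup>+s. f ((1 - s) *\<^sub>R b + s *\<^sub>R a) * indicator {0..1} s \<partial>lborel) =
   (\<integral>\<^sup>+s. f ((1 - (1 + (-1) * s)) *\<^sub>R b + (1 + (-1) * s) *\<^sub>R a) * indicator {0..1} (1 + (-1) * s) \<partial>lborel)"
  using n(2) by (subst nn_integral_real_affine[where c = "-1" and t = 1]) auto
 also have "... = (\<integral>\<^sup>+s. f ((1 - s) *\<^sub>R a + s *\<^sub>R b) * indicator {0..1} s \<partial>lborel)"
  by (intro nn_integral_cong) (auto simp: indicator_def add.commute)
 finally show ?thesis unfolding e n(1) by (simp add: dist_commute)
qed

lemma finite_measure_arclength: "finite_measure (arclength (closed_segment a b))"
 and measure_arclength: "measure (arclength (closed_segment a b)) (closed_segment a b) = dist a b"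
proof -
 have "emeasure (arclength (closed_segment a b)) (space (arclength (closed_segment a b))) =
   (\<integral>\<^sup>+x. 1 \<partial>arclength (closed_segment a b))" by simp
 also have "... = ennreal (dist a b) * (\<integral>\<^sup>+s. 1 * indicator {0..1} (s::real) \<partial>lborel)" by (rule nn_integral_arclength) simp
 also have "... = ennreal (dist a b)" by simp
 finally have e: "emeasure (arclength (closed_segment a b)) (space (arclength (closed_segment a b))) = ennreal (dist a b)" .
 thus "finite_measure (arclength (closed_segment a b))" by (intro finite_measureI) simp
 show "measure (arclength (closed_segment a b)) (closed_segment a b) = dist a b"
  using e by (simp add: measure_def space_arclength)
qed

lemma measurable_arclength_continuous:
 "continuous_on (closed_segment a b) f ==> f \<in> borel_measurable (arclength (closed_segment a b))"
 by (simp add: measurable_arclength borel_measurable_continuous_on_restrict)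

lemma L2_arclength_continuous:
 fixes f :: "pt => 'b::euclidean_space"
 assumes "continuous_on (closed_segment a b) f"
 shows "f \<in> L2 (arclength (closed_segment a b))"
proof -
 have "bounded (f ` closed_segment a b)" using assms by (intro compact_imp_bounded compact_continuous_image) auto
 then obtain B where "\<forall>y\<in>f ` closed_segment a b. norm y <= B" unfolding bounded_iff by blast
 thus ?thesis
  by (intro L2_bounded(1)[OF finite_measure_arclength measurable_arclength_continuous[OF assms], of B]) (auto simp: space_arclength)
qed

lemma sqi_arclength_segsq:
 assumes "f \<in> L2 (arclength (closed_segment a b))"
 shows "ennreal (sqi (arclength (closed_segment a b)) f) = ennreal (dist a b) * segsq a b f"
proof -
 have "ennreal (sqi (arclength (closed_segment a b)) f) = (\<integral>\<^sup>+x. ennreal ((f x)^2) \<partial>arclength (closed_segment a b))"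
  using nn_integral_eq_integral[OF L2_integrable_sq[OF assms]] by (simp add: sqi_def)
 also have "... = ennreal (dist a b) * segsq a b f" unfolding segsq_def
  using assms by (intro nn_integral_arclength) (auto simp: L2_def)
 finally show ?thesis .
qed

section \<open>Traces\<close>

lemma facet_obtain:
 assumes K: "2 simplex (K :: pt set)" and E: "E facet_of K"
 obtains a b c where "verts K = {a, b, c}" "a ~= b" "a ~= c" "b ~= c" "E = closed_segment a b" "K = convex hull {a, b, c}"
  "cross2 (b - a) (c - a) ~= 0"
proof -
 obtain a b c where abc: "K = convex hull {a, b, c}" "a ~= b" "a ~= c" "b ~= c" "\<not> affine_dependent {a, b, c}"
  "cross2 (b - a) (c - a) ~= 0" "verts K = {a, b, c}" using triangle_obtain[OF K] .
 obtain u where u: "u \<in> {a, b, c}" "E = convex hull ({a, b, c} - {u})"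
  using E abc(1) facet_of_convex_hull_affine_independent[OF abc(5)] by blast
 have cyc: "cross2 (c - b) (a - b) ~= 0" "cross2 (a - c) (b - c) ~= 0"
  using abc(6) by (auto simp: cross2_def algebra_simps)
 from u(1) consider "u = a" | "u = b" | "u = c" by auto
 thus ?thesis
 proof cases
  case 1
  hence "{a, b, c} - {u} = {b, c}" using abc by auto
  thus ?thesis using that[of b c a] abc u cyc by (simp add: segment_convex_hull insert_commute)
 next
  case 2
  hence "{a, b, c} - {u} = {c, a}" using abc by auto
  thus ?thesis using that[of c a b] abc u cyc by (simp add: segment_convex_hull insert_commute)
 next
  case 3
  hence "{a, b, c} - {u} = {a, b}" using abc by auto
  thus ?thesis using that[of a b c] abc u by (simp add: segment_convex_hull)
 qed
qed

context mesh
begin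

lemma affine_pwC1: "pwC1 (%x. q \<bullet> x + k) (%K x. q)"
 unfolding pwC1_def C1_on_def by (auto intro!: derivative_eq_intros)

text \<open>The C^1 approximation is uniformly close to w on the closure, in particular on the edge,
  which transfers the inequality to the restriction of w. The factor 32 = 4 * 8 again comes from two
  squared triangle inequalities.\<close>

lemma trace_continuous:
 assumes w: "w \<in> H1 Om" and c: "continuous_on (closure Om) w" and K: "K \<in> \<T>" "K = convex hull {a, b, c}"
  and cr: "cross2 (b - a) (c - a) ~= 0" and D: "!!x y. x \<in> K ==> y \<in> K ==> norm (y - x) <= D"
 shows "sqi (arclength (closed_segment a b)) w <= 32 * dist a b / \<bar>cross2 (b - a) (c - a)\<bar> *
  (sqi (leb (interior K)) w + D^2 * sqi (leb (interior K)) (weak_grad Om w))"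
proof -
 let ?M = "leb (interior K)" and ?g = "weak_grad Om w" and ?E = "closed_segment a b"
 define R where "R = 8 / \<bar>cross2 (b - a) (c - a)\<bar>"
 have R: "R > 0" using cr by (simp add: R_def)
 note h = H1D[OF w opn]
 have wL: "w \<in> L2 ?M" and gL: "?g \<in> L2 ?M" using sqi_K_le(1)[OF _ K(1)] h by auto
 have EK: "?E \<subseteq> K" unfolding K(2) segment_convex_hull by (rule hull_mono) auto
 have EOm: "?E \<subseteq> closure Om" using EK K_props(7)[OF K(1)] by blast
 have cE: "continuous_on ?E w" using c EOm continuous_on_subset by blast
 have wE: "w \<in> L2 (arclength ?E)" by (rule L2_arclength_continuous[OF cE])
 have "sqi (arclength ?E) w <= 4 * R * dist a b * (sqi ?M w + D^2 * sqi ?M ?g) + r" if r: "r > 0" for r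
 proof -
  define C where "C = 4 * R * dist a b * (1 + D^2) + 2 * dist a b + 1"
  have C: "C > 0" unfolding C_def using R by (intro add_nonneg_pos add_nonneg_nonneg mult_nonneg_nonneg) auto
  \<comment> \<open>As e <= 1, e^2 may be replaced by e, and the total error is at most C e <=
    r.\<close>
  define e where "e = min 1 (r / C)"
  have e: "e > 0" "e <= 1" "C * e <= r" using r C by (auto simp: e_def min_def field_simps)
  obtain u G where u: "pwC1 u G" "sqi (leb Om) (%x. u x - w x) < e" "sqi (leb Om) (%x. pwgrad G x - ?g x) < e"
   "!!x. x \<in> closure Om ==> \<bar>u x - w x\<bar> < e"
   by (rule density_pwC1[OF w e(1)]) (use c in blast)
  have CK: "C1_on K u (G K)" using u(1) K by (simp add: pwC1_def)
  have cu: "continuous_on K u" by (rule C1_on_continuous[OF CK])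
  have uOm: "u \<in> L2 (leb Om)" by (rule L2_continuous_closure[OF pwC1_continuous[OF u(1)]])
  have uL: "u \<in> L2 ?M" using sqi_K_le(1)[OF uOm K(1)] .
  have pgL: "pwgrad G \<in> L2 ?M" using sqi_K_le(1)[OF pwgrad_L2[OF u(1)] K(1)] .
  have su: "sqi (leb K) u <= 2 * e + 2 * sqi ?M w"
   using sqi_add_le[OF L2_diff[OF uL wL] wL] sqi_K_le(2)[OF L2_diff[OF uOm h(1)] K(1)] u(2) sqi_interior_eq[OF K(1) cu] by simp
  have sG: "sqi (leb K) (G K) <= 2 * e + 2 * sqi ?M ?g"
  proof -
   have "sqi (leb K) (G K) = sqi ?M (G K)" using CK K by (intro sqi_interior_eq[symmetric]) (auto simp: C1_on_def)
   also have "... = sqi ?M (pwgrad G)" unfolding sqi_def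
    by (intro Bochner_Integration.integral_cong) (auto simp: space_restrict_space pwgrad_eq[OF K(1)])
   finally show ?thesis
    using sqi_add_le[OF L2_diff[OF pgL gL] gL] sqi_K_le(2)[OF L2_diff[OF pwgrad_L2[OF u(1)] h(2)] K(1)] u(3) by simp
  qed
  have cuE: "continuous_on ?E u" using cu EK continuous_on_subset by blast
  have uE: "u \<in> L2 (arclength ?E)" by (rule L2_arclength_continuous[OF cuE])
  have "segsq a b u <= ennreal (R * (sqi (leb K) u + D^2 * sqi (leb K) (G K)))"
   unfolding segsq_def R_def K(2) by (rule trace_C1[OF cr]) (use CK D K(2) in auto)
  hence "ennreal (dist a b) * segsq a b u <= ennreal (dist a b) * ennreal (R * (sqi (leb K) u + D^2 * sqi (leb K) (G K)))"
   by (rule mult_left_mono) simp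
  hence "ennreal (sqi (arclength ?E) u) <= ennreal (dist a b * (R * (sqi (leb K) u + D^2 * sqi (leb K) (G K))))"
   unfolding sqi_arclength_segsq[OF uE] by (simp add: ennreal_mult')
  hence "sqi (arclength ?E) u <= dist a b * (R * (sqi (leb K) u + D^2 * sqi (leb K) (G K)))"
   using R by (subst (asm) ennreal_le_iff) (auto intro!: mult_nonneg_nonneg add_nonneg_nonneg)
  also have "... <= dist a b * (R * ((2 * e + 2 * sqi ?M w) + D^2 * (2 * e + 2 * sqi ?M ?g)))"
   using su sG R by (intro mult_left_mono add_mono) auto
  finally have 1: "sqi (arclength ?E) u <= dist a b * (R * ((2 * e + 2 * sqi ?M w) + D^2 * (2 * e + 2 * sqi ?M ?g)))" .
  have 2: "sqi (arclength ?E) (%x. w x - u x) <= e^2 * dist a b"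
  proof -
   have "sqi (arclength ?E) (%x. w x - u x) <= e^2 * measure (arclength ?E) (space (arclength ?E))"
   proof (rule L2_bounded(2)[OF finite_measure_arclength])
    show "(%x. w x - u x) \<in> borel_measurable (arclength ?E)" using L2_diff[OF wE uE] by (simp add: L2_def)
    fix x assume "x \<in> space (arclength ?E)"
    thus "norm (w x - u x) <= e" using u(4)[of x] EOm by (auto simp: space_arclength abs_minus_commute less_imp_le)
   qed
   thus ?thesis by (simp add: space_arclength measure_arclength)
  qed
  have "e^2 <= e" using e by (simp add: power2_eq_square mult_left_le)
  hence 3: "e^2 * dist a b <= e * dist a b" by (intro mult_right_mono) auto
  have "sqi (arclength ?E) w <= 2 * sqi (arclength ?E) (%x. w x - u x) + 2 * sqi (arclength ?E) u"
   using sqi_add_le[OF L2_diff[OF wE uE] uE] by simp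
  also have "... <= 2 * (e * dist a b) + 2 * (dist a b * (R * ((2 * e + 2 * sqi ?M w) + D^2 * (2 * e + 2 * sqi ?M ?g))))"
   using 1 2 3 by linarith
  also have "... = 4 * R * dist a b * (sqi ?M w + D^2 * sqi ?M ?g) + (4 * R * dist a b * (1 + D^2) + 2 * dist a b) * e"
   by (simp add: algebra_simps)
  also have "... <= 4 * R * dist a b * (sqi ?M w + D^2 * sqi ?M ?g) + C * e"
   using e by (intro add_left_mono mult_right_mono) (auto simp: C_def)
  finally show ?thesis using e(3) by linarith
 qed
 hence "sqi (arclength ?E) w <= 4 * R * dist a b * (sqi ?M w + D^2 * sqi ?M ?g)" by (rule field_le_epsilon)
 thus ?thesis by (simp add: R_def mult.commute mult.left_commute)
qed

lemma L2_norm_tendsto_iff: "(%n. L2_norm M (f n)) \<longlonglongrightarrow> 0 \<longleftrightarrow> (%n. sqi M (f n)) \<longlonglongrightarrow> 0"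
proof
 assume "(%n. L2_norm M (f n)) \<longlonglongrightarrow> 0"
 hence "(%n. (L2_norm M (f n))^2) \<longlonglongrightarrow> 0^2" by (intro tendsto_intros)
 thus "(%n. sqi M (f n)) \<longlonglongrightarrow> 0" by (simp add: L2_norm_sq)
next
 assume "(%n. sqi M (f n)) \<longlonglongrightarrow> 0"
 hence "(%n. sqrt (sqi M (f n))) \<longlonglongrightarrow> sqrt 0" by (intro tendsto_intros)
 thus "(%n. L2_norm M (f n)) \<longlonglongrightarrow> 0" by (simp add: L2_norm_eq)
qed

lemma diam_bound: "K \<in> \<T> ==> x \<in> K ==> y \<in> K ==> norm (y - x) <= diameter K"
 using diameter_bounded_bound[OF compact_imp_bounded[OF K_props(4)], of K y x] by (simp add: dist_norm)

text \<open>The trace is a choice, so a witness is needed: the restrictions of the approximations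
  form a Cauchy sequence on the edge, by the trace inequality for their differences, and its limit
  serves.\<close>

lemma trace_exists:
 assumes v: "v \<in> H1 Om" and K: "K \<in> \<T>" and E: "E facet_of K"
 shows "is_trace Om E v (seg_trace Om E v)"
proof -
 obtain a b c where abc: "E = closed_segment a b" "K = convex hull {a, b, c}" "cross2 (b - a) (c - a) ~= 0"
  using facet_obtain[OF simp2[OF K] E] by metis
 let ?g = "weak_grad Om v" and ?M = "leb Om"
 note h = H1D[OF v opn]
 have "\<forall>n. \<exists>p. pwC1 (fst p) (snd p) \<and> sqi ?M (%x. fst p x - v x) < 1 / real (Suc n) \<and> sqi ?M (%x. pwgrad (snd p) x - ?g x) < 1 / real (Suc n)"
 proof
  fix n
  have "1 / real (Suc n) > 0" by simp
  then obtain u G where "pwC1 u G \<and> sqi ?M (%x. u x - v x) < 1 / real (Suc n) \<and> sqi ?M (%x. pwgrad G x - ?g x) < 1 / real (Suc n)"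
   by (rule density_pwC1[OF v]) blast
  thus "\<exists>p. pwC1 (fst p) (snd p) \<and> sqi ?M (%x. fst p x - v x) < 1 / real (Suc n) \<and> sqi ?M (%x. pwgrad (snd p) x - ?g x) < 1 / real (Suc n)"
   by (intro exI[of _ "(u, G)"]) simp
 qed
 from choice[OF this] obtain p where p: "!!n. pwC1 (fst (p n)) (snd (p n)) \<and> sqi ?M (%x. fst (p n) x - v x) < 1 / real (Suc n) \<and>
  sqi ?M (%x. pwgrad (snd (p n)) x - ?g x) < 1 / real (Suc n)" by blast
 define u G where "u n = fst (p n)" and "G n = snd (p n)" for n
 have u: "!!n. pwC1 (u n) (G n)" "!!n. sqi ?M (%x. u n x - v x) < 1 / real (Suc n)"
  "!!n. sqi ?M (%x. pwgrad (G n) x - ?g x) < 1 / real (Suc n)" using p unfolding u_def G_def by blast+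
 have uH: "u n \<in> H1 Om" and uc: "continuous_on (closure Om) (u n)" for n using pwC1_H1(1)[OF u(1)] pwC1_continuous[OF u(1)] by auto
 have ug: "AE x in ?M. weak_grad Om (u n) x = pwgrad (G n) x" for n by (rule pwC1_H1(2)[OF u(1)])
 have uL: "u n \<in> L2 ?M" "weak_grad Om (u n) \<in> L2 ?M" for n using H1D[OF uH opn] by auto
 have lim: "(%n. 1 / real (Suc n)) \<longlonglongrightarrow> 0" by (intro LIMSEQ_Suc lim_const_over_n)
 have l1: "(%n. sqi ?M (%x. u n x - v x)) \<longlonglongrightarrow> 0"
  by (rule tendsto_sandwich[OF _ _ tendsto_const lim]) (use u(2) in \<open>auto intro!: always_eventually simp: less_imp_le simp del: of_nat_Suc\<close>)
 have gs: "sqi ?M (%x. weak_grad Om (u n) x - ?g x) = sqi ?M (%x. pwgrad (G n) x - ?g x)" for n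
 proof (rule sqi_cong_AE)
  show "AE x in ?M. weak_grad Om (u n) x - ?g x = pwgrad (G n) x - ?g x" using ug by eventually_elim simp
 qed (use L2_diff[OF uL(2) h(2)] L2_diff[OF pwgrad_L2[OF u(1)] h(2)] in \<open>auto simp: L2_def\<close>)
 have l2: "(%n. sqi ?M (%x. weak_grad Om (u n) x - ?g x)) \<longlonglongrightarrow> 0"
  unfolding gs by (rule tendsto_sandwich[OF _ _ tendsto_const lim]) (use u(3) in \<open>auto intro!: always_eventually simp: less_imp_le simp del: of_nat_Suc\<close>)
 define CE where "CE = 32 * dist a b / \<bar>cross2 (b - a) (c - a)\<bar> * (1 + (diameter K)^2)"
 have CE: "CE >= 0" unfolding CE_def by (intro mult_nonneg_nonneg) auto
 have EOm: "E \<subseteq> closure Om"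
  using facet_of_imp_subset[OF E] K_props(7)[OF K] by blast
 have uE: "u n \<in> L2 (arclength E)" for n
  unfolding abc(1) by (rule L2_arclength_continuous) (use uc EOm abc(1) continuous_on_subset in metis)
 have cau: "sqi (arclength E) (%x. u m x - u n x) <= CE * (2 * (sqi ?M (%x. u m x - v x) + sqi ?M (%x. u n x - v x)) +
  2 * (sqi ?M (%x. weak_grad Om (u m) x - ?g x) + sqi ?M (%x. weak_grad Om (u n) x - ?g x)))" for m n
 proof -
  let ?w = "%x. u m x - u n x"
  have wH: "?w \<in> H1 Om" and wg: "AE x in ?M. weak_grad Om ?w x = weak_grad Om (u m) x - weak_grad Om (u n) x"
   using H1_diff[OF opn uH uH] by auto
  have wL: "?w \<in> L2 ?M" "weak_grad Om ?w \<in> L2 ?M" using H1D[OF wH opn] by auto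
  have s1: "sqi ?M ?w <= 2 * sqi ?M (%x. u m x - v x) + 2 * sqi ?M (%x. u n x - v x)"
   using sqi_triangle[OF uL(1) h(1) uL(1), of m n] sqi_commute[of ?M v "u n"] by simp
  have s2: "sqi ?M (weak_grad Om ?w) <= 2 * sqi ?M (%x. weak_grad Om (u m) x - ?g x) + 2 * sqi ?M (%x. weak_grad Om (u n) x - ?g x)"
  proof -
   have "sqi ?M (weak_grad Om ?w) = sqi ?M (%x. weak_grad Om (u m) x - weak_grad Om (u n) x)"
    using wg wL(2) L2_diff[OF uL(2)[of m] uL(2)[of n]] by (intro sqi_cong_AE) (auto simp: L2_def)
   thus ?thesis using sqi_triangle[OF uL(2) h(2) uL(2), of m n] sqi_commute[of ?M ?g "weak_grad Om (u n)"] by simp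
  qed
  have "sqi (arclength E) ?w <= 32 * dist a b / \<bar>cross2 (b - a) (c - a)\<bar> *
   (sqi (leb (interior K)) ?w + (diameter K)^2 * sqi (leb (interior K)) (weak_grad Om ?w))"
   unfolding abc(1) by (rule trace_continuous[OF wH _ K abc(2,3)]) (auto intro!: continuous_intros uc diam_bound[OF K])
  also have "... <= 32 * dist a b / \<bar>cross2 (b - a) (c - a)\<bar> * ((1 + (diameter K)^2) * (sqi ?M ?w + sqi ?M (weak_grad Om ?w)))"
  proof (rule mult_left_mono)
   have "sqi (leb (interior K)) ?w <= sqi ?M ?w" "sqi (leb (interior K)) (weak_grad Om ?w) <= sqi ?M (weak_grad Om ?w)"
    using sqi_K_le(2)[OF wL(1) K] sqi_K_le(2)[OF wL(2) K] by auto
   hence "sqi (leb (interior K)) ?w + (diameter K)^2 * sqi (leb (interior K)) (weak_grad Om ?w) <=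
     sqi ?M ?w + (diameter K)^2 * sqi ?M (weak_grad Om ?w)" by (intro add_mono mult_left_mono) auto
   also have "... <= (1 + (diameter K)^2) * (sqi ?M ?w + sqi ?M (weak_grad Om ?w))"
    by (simp add: algebra_simps)
   finally show "sqi (leb (interior K)) ?w + (diameter K)^2 * sqi (leb (interior K)) (weak_grad Om ?w) <= (1 + (diameter K)^2) * (sqi ?M ?w + sqi ?M (weak_grad Om ?w))" .
  qed simp
  also have "... = CE * (sqi ?M ?w + sqi ?M (weak_grad Om ?w))" by (simp add: CE_def mult.assoc)
  also have "... <= CE * (2 * (sqi ?M (%x. u m x - v x) + sqi ?M (%x. u n x - v x)) +
   2 * (sqi ?M (%x. weak_grad Om (u m) x - ?g x) + sqi ?M (%x. weak_grad Om (u n) x - ?g x)))"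
   using s1 s2 CE by (intro mult_left_mono) auto
  finally show ?thesis .
 qed
 obtain g where g: "g \<in> L2 (arclength E)" "(%n. sqi (arclength E) (%x. u n x - g x)) \<longlonglongrightarrow> 0"
 proof (rule L2_complete[of "arclength E" u])
  show "finite_measure (arclength E)" unfolding abc(1) by (rule finite_measure_arclength)
  fix e :: real assume e: "e > 0"
  define e' where "e' = e / (8 * (CE + 1))"
  have e': "e' > 0" using e CE by (simp add: e'_def)
  have "\<forall>\<^sub>F n in sequentially. sqi ?M (%x. u n x - v x) < e'" "\<forall>\<^sub>F n in sequentially. sqi ?M (%x. weak_grad Om (u n) x - ?g x) < e'"
   using order_tendstoD(2)[OF l1 e'] order_tendstoD(2)[OF l2 e'] by auto
  from eventually_conj[OF this] obtain N where N: "!!n. n >= N ==> sqi ?M (%x. u n x - v x) < e'" "!!n. n >= N ==> sqi ?M (%x. weak_grad Om (u n) x - ?g x) < e'"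
   by (auto simp: eventually_sequentially)
  have "sqi (arclength E) (%x. u m x - u n x) < e" if mn: "m >= N" "n >= N" for m n
  proof -
   have "2 * (sqi ?M (%x. u m x - v x) + sqi ?M (%x. u n x - v x)) +
     2 * (sqi ?M (%x. weak_grad Om (u m) x - ?g x) + sqi ?M (%x. weak_grad Om (u n) x - ?g x)) <= 2 * (e' + e') + 2 * (e' + e')"
    using N(1)[of m] N(1)[of n] N(2)[of m] N(2)[of n] mn by (intro add_mono mult_left_mono) (auto intro: less_imp_le)
   from order_trans[OF cau mult_left_mono[OF this CE]]
   have "sqi (arclength E) (%x. u m x - u n x) <= CE * (8 * e')" by simp
   also have "... < (CE + 1) * (8 * e')" using e' by (intro mult_strict_right_mono) auto
   also have "... = e" using CE by (simp add: e'_def add_nonneg_pos field_simps)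
   finally show ?thesis .
  qed
  thus "\<exists>N. \<forall>m\<ge>N. \<forall>n\<ge>N. sqi (arclength E) (%x. u m x - u n x) < e" by blast
 qed (use uE that in auto)
 have "is_trace Om E v g"
  unfolding is_trace_def L2_norm_tendsto_iff using g l1 l2 uH uc by blast
 thus ?thesis unfolding seg_trace_def by (rule someI[of "is_trace Om E v"])
qed

lemma seg_trace_L2: "v \<in> H1 Om ==> K \<in> \<T> ==> E facet_of K ==> seg_trace Om E v \<in> L2 (arclength E)"
 using trace_exists by (simp add: is_trace_def)

text \<open>Whatever function the choice returns, it comes with its own approximating sequence,
  along which the inequality for continuous functions passes to the limit. The factor 128 = 4 * 32
  comes from the triangle inequalities.\<close>

lemma trace_inequality:
 assumes v: "v \<in> H1 Om" and K: "K \<in> \<T>" "K = convex hull {a, b, c}" and E: "closed_segment a b facet_of K"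
  and cr: "cross2 (b - a) (c - a) ~= 0" and D: "!!x y. x \<in> K ==> y \<in> K ==> norm (y - x) <= D"
 shows "sqi (arclength (closed_segment a b)) (%x. seg_trace Om (closed_segment a b) v x - (q \<bullet> x + k)) <=
  128 * dist a b / \<bar>cross2 (b - a) (c - a)\<bar> *
  (sqi (leb (interior K)) (%x. v x - (q \<bullet> x + k)) + D^2 * sqi (leb (interior K)) (%x. weak_grad Om v x - q))"
proof -
 let ?E = "closed_segment a b" and ?p = "%x. q \<bullet> x + k" and ?M = "leb (interior K)" and ?t = "seg_trace Om (closed_segment a b) v"
 define R where "R = 32 * dist a b / \<bar>cross2 (b - a) (c - a)\<bar>"
 have R: "R >= 0" by (simp add: R_def)
 have tL: "?t \<in> L2 (arclength ?E)" by (rule seg_trace_L2[OF v K(1) E])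
 obtain u where u: "!!n. u n \<in> H1 Om" "!!n. continuous_on (closure Om) (u n)"
  "(%n. sqi (leb Om) (%x. u n x - v x)) \<longlonglongrightarrow> 0" "(%n. sqi (leb Om) (%x. weak_grad Om (u n) x - weak_grad Om v x)) \<longlonglongrightarrow> 0"
  "(%n. sqi (arclength ?E) (%x. u n x - ?t x)) \<longlonglongrightarrow> 0"
  using trace_exists[OF v K(1) E] unfolding is_trace_def L2_norm_tendsto_iff by blast
 note h = H1D[OF v opn]
 have pH: "?p \<in> H1 Om" and pc: "continuous_on (closure Om) ?p" using pwC1_H1(1)[OF affine_pwC1] pwC1_continuous[OF affine_pwC1] by auto
 have EOm: "?E \<subseteq> closure Om" using facet_of_imp_subset[OF E] K_props(7)[OF K(1)] by blast
 have pL: "?p \<in> L2 ?M" using sqi_K_le(1)[OF H1D(1)[OF pH opn] K(1)] .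
 have pE: "?p \<in> L2 (arclength ?E)" by (rule L2_arclength_continuous) (use pc EOm continuous_on_subset in blast)
 have vL: "v \<in> L2 ?M" "weak_grad Om v \<in> L2 ?M" using sqi_K_le(1)[OF h(1) K(1)] sqi_K_le(1)[OF h(2) K(1)] by auto
 have qL: "(%x. q) \<in> L2 ?M" by (rule L2_const[OF fm(2)[OF K(1)]])
 define X where "X = sqi ?M (%x. v x - ?p x) + D^2 * sqi ?M (%x. weak_grad Om v x - q)"
 define B where "B n = 2 * sqi (arclength ?E) (%x. u n x - ?t x) + 2 * (R * ((2 * sqi (leb Om) (%x. u n x - v x) +
  D^2 * (2 * sqi (leb Om) (%x. weak_grad Om (u n) x - weak_grad Om v x))) + 2 * X))" for n
 have le: "sqi (arclength ?E) (%x. ?t x - ?p x) <= B n" for n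
 proof -
  let ?w = "%x. u n x - ?p x"
  note hu = H1D[OF u(1) opn]
  have uL: "u n \<in> L2 ?M" "weak_grad Om (u n) \<in> L2 ?M" using sqi_K_le(1)[OF hu(1) K(1)] sqi_K_le(1)[OF hu(2) K(1)] by auto
  have uE: "u n \<in> L2 (arclength ?E)" by (rule L2_arclength_continuous) (use u(2) EOm continuous_on_subset in blast)
  have wH: "?w \<in> H1 Om" using H1_diff(1)[OF opn u(1) pH] .
  have "AE x in leb Om. weak_grad Om ?w x = weak_grad Om (u n) x - weak_grad Om ?p x" using H1_diff(2)[OF opn u(1) pH] .
  from AE_interior_sub[OF K(1) this] pwC1_H1(3)[OF affine_pwC1 K(1), of q k]
  have wg: "AE x in ?M. weak_grad Om ?w x = weak_grad Om (u n) x - q" by eventually_elim simp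
  have wgL: "weak_grad Om ?w \<in> L2 ?M" using sqi_K_le(1)[OF H1D(2)[OF wH opn] K(1)] .
  have s1: "sqi ?M ?w <= 2 * sqi (leb Om) (%x. u n x - v x) + 2 * sqi ?M (%x. v x - ?p x)"
   using sqi_triangle[OF uL(1) vL(1) pL] sqi_K_le(2)[OF L2_diff[OF hu(1) h(1)] K(1), of n] by simp
  have s2: "sqi ?M (weak_grad Om ?w) <= 2 * sqi (leb Om) (%x. weak_grad Om (u n) x - weak_grad Om v x) + 2 * sqi ?M (%x. weak_grad Om v x - q)"
  proof -
   have "sqi ?M (weak_grad Om ?w) = sqi ?M (%x. weak_grad Om (u n) x - q)"
    using wg wgL L2_diff[OF uL(2) qL] by (intro sqi_cong_AE) (auto simp: L2_def)
   thus ?thesis using sqi_triangle[OF uL(2) vL(2) qL] sqi_K_le(2)[OF L2_diff[OF hu(2) h(2)] K(1), of n] by simp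
  qed
  have "sqi (arclength ?E) ?w <= R * (sqi ?M ?w + D^2 * sqi ?M (weak_grad Om ?w))"
   unfolding R_def by (rule trace_continuous[OF wH _ K cr D]) (auto intro!: continuous_intros u(2))
  also have "... <= R * ((2 * sqi (leb Om) (%x. u n x - v x) + 2 * sqi ?M (%x. v x - ?p x)) +
   D^2 * (2 * sqi (leb Om) (%x. weak_grad Om (u n) x - weak_grad Om v x) + 2 * sqi ?M (%x. weak_grad Om v x - q)))"
   using s1 s2 R by (intro mult_left_mono add_mono) auto
  also have "... = R * ((2 * sqi (leb Om) (%x. u n x - v x) +
  D^2 * (2 * sqi (leb Om) (%x. weak_grad Om (u n) x - weak_grad Om v x))) + 2 * X)" by (simp add: X_def algebra_simps)
  finally have s3: "sqi (arclength ?E) ?w <= ..." .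
  have "sqi (arclength ?E) (%x. ?t x - ?p x) <= 2 * sqi (arclength ?E) (%x. u n x - ?t x) + 2 * sqi (arclength ?E) ?w"
   using sqi_triangle[OF tL uE pE] sqi_commute[of "arclength ?E" ?t "u n"] by simp
  thus ?thesis using s3 unfolding B_def by linarith
 qed
 have "B \<longlonglongrightarrow> 2 * 0 + 2 * (R * ((2 * 0 + D^2 * (2 * 0)) + 2 * X))" unfolding B_def by (intro tendsto_intros u(3-5))
 from LIMSEQ_le_const[OF this] le have "sqi (arclength ?E) (%x. ?t x - ?p x) <= 2 * 0 + 2 * (R * ((2 * 0 + D^2 * (2 * 0)) + 2 * X))" by blast
 also have "... = 4 * R * X" by simp
 finally show ?thesis by (simp add: R_def X_def)
qed

end

section \<open>Integrals of affine functions over an edge\<close>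

text \<open>For nonnegative functions the formula is that of the nonnegative integral; adding a
  bound B of F reduces the general case to it.\<close>

lemma LINT_arclength:
 fixes F :: "pt => real"
 assumes c: "continuous_on (closed_segment a b) F"
 shows "(LINT x|arclength (closed_segment a b). F x) = dist a b * (LINT s|lborel. indicator {0..1} s *\<^sub>R F ((1 - s) *\<^sub>R a + s *\<^sub>R b))"
proof -
 let ?E = "closed_segment a b" and ?gamma = "%s::real. (1 - s) *\<^sub>R a + s *\<^sub>R b"
 interpret finite_measure "arclength ?E" by (rule finite_measure_arclength)
 have cg: "continuous_on {0..1} (%s. H (?gamma s))" if "continuous_on ?E H" for H :: "pt => real"
  by (intro continuous_on_compose2[OF that] continuous_intros) (auto simp: closed_segment_def)
 have ig: "integrable lborel (%s. indicator {0..1} s *\<^sub>R H (?gamma s))" if "continuous_on ?E H" for H :: "pt => real"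
  using cg[OF that] by (intro borel_integrable_compact) auto
 have pos: "(LINT x|arclength ?E. H x) = dist a b * (LINT s|lborel. indicator {0..1} s *\<^sub>R H (?gamma s))"
  if H: "continuous_on ?E H" "!!x. x \<in> ?E ==> 0 <= H x" for H :: "pt => real"
 proof -
  have m: "H \<in> borel_measurable (arclength ?E)" by (rule measurable_arclength_continuous[OF H(1)])
  have "(LINT x|arclength ?E. H x) = enn2real (\<integral>\<^sup>+x. ennreal (H x) \<partial>arclength ?E)"
   using H(2) by (intro integral_eq_nn_integral m) (auto simp: space_arclength)
  also have "(\<integral>\<^sup>+x. ennreal (H x) \<partial>arclength ?E) = ennreal (dist a b) * (\<integral>\<^sup>+s. ennreal (H (?gamma s)) * indicator {0..1} s \<partial>lborel)"
   by (rule nn_integral_arclength) (use m in simp)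
  also have "(\<integral>\<^sup>+s. ennreal (H (?gamma s)) * indicator {0..1} s \<partial>lborel) = (\<integral>\<^sup>+s. ennreal (indicator {0..1} s *\<^sub>R H (?gamma s)) \<partial>lborel)"
   by (intro nn_integral_cong) (auto simp: indicator_def)
  also have "... = ennreal (LINT s|lborel. indicator {0..1} s *\<^sub>R H (?gamma s))"
   using H(2) by (intro nn_integral_eq_integral ig[OF H(1)]) (auto simp: indicator_def closed_segment_def)
  also have "enn2real (ennreal (dist a b) * ennreal (LINT s|lborel. indicator {0..1} s *\<^sub>R H (?gamma s))) =
    dist a b * (LINT s|lborel. indicator {0..1} s *\<^sub>R H (?gamma s))"
  proof -
   have "0 <= (LINT s|lborel. indicator {0..1} s *\<^sub>R H (?gamma s))"
    using H(2) by (intro Bochner_Integration.integral_nonneg) (auto simp: indicator_def closed_segment_def)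
   thus ?thesis by (simp add: ennreal_mult[symmetric])
  qed
  finally show ?thesis .
 qed
 have "bounded (F ` ?E)" using c by (intro compact_imp_bounded compact_continuous_image) auto
 then obtain B where B: "\<forall>y\<in>F ` ?E. norm y <= B" unfolding bounded_iff by blast
 have cB: "continuous_on ?E (%x. F x + B)" by (intro continuous_intros c)
 have iF: "integrable (arclength ?E) F" by (rule L2_integrable[OF finite_measure_arclength L2_arclength_continuous[OF c]])
 have "(LINT x|arclength ?E. F x + B) = dist a b * (LINT s|lborel. indicator {0..1} s *\<^sub>R (F (?gamma s) + B))"
  by (rule pos[OF cB]) (use B in fastforce)
 moreover have "(LINT x|arclength ?E. F x + B) = (LINT x|arclength ?E. F x) + B * dist a b"
  using iF by (simp add: space_arclength measure_arclength)
 moreover have "(LINT s|lborel. indicator {0..1} s *\<^sub>R (F (?gamma s) + B)) = (LINT s|lborel. indicator {0..1} s *\<^sub>R F (?gamma s)) + B"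
 proof -
  have "(LINT s|lborel. indicator {0..1} s *\<^sub>R (F (?gamma s) + B)) = (LINT s|lborel. indicator {0..1} s *\<^sub>R F (?gamma s) + indicator {0..1} s *\<^sub>R B)"
   by (intro Bochner_Integration.integral_cong) (auto simp: algebra_simps)
  also have "... = (LINT s|lborel. indicator {0..1} s *\<^sub>R F (?gamma s)) + (LINT s|lborel. indicator {0..(1::real)} s *\<^sub>R B)"
   using ig[OF c] by (intro Bochner_Integration.integral_add) auto
  finally show ?thesis by simp
 qed
 ultimately show ?thesis by (simp add: algebra_simps)
qed

text \<open>The entries 1/3 and 1/6 are those of the mass matrix of the two linear shape functions
  on [0,1].\<close>

lemma LINT_affine_product:
 fixes f g :: "pt => real"
 assumes f: "!!s. s \<in> {0..1} ==> f ((1 - s) *\<^sub>R a + s *\<^sub>R b) = (1 - s) * alpha + s * beta"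
  and g: "!!s. s \<in> {0..1} ==> g ((1 - s) *\<^sub>R a + s *\<^sub>R b) = (1 - s) * gamma + s * delta"
  and c: "continuous_on (closed_segment a b) (%x. f x * g x)"
 shows "(LINT x|arclength (closed_segment a b). f x * g x) = dist a b * (alpha * gamma / 3 + (alpha * delta + beta * gamma) / 6 + beta * delta / 3)"
proof -
 let ?q = "%s. ((1 - s) * alpha + s * beta) * ((1 - s) * gamma + s * delta)"
 let ?Q = "%s. alpha * gamma * (s - s^2 + s^3 / 3) + (alpha * delta + beta * gamma) * (s^2 / 2 - s^3 / 3) + beta * delta * (s^3 / 3)"
 have "(?q has_integral (?Q 1 - ?Q 0)) {0..1}"
 proof (rule fundamental_theorem_of_calculus)
  fix x :: real assume "x \<in> {0..1}"
  have "(?Q has_real_derivative ?q x) (at x within {0..1})"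
   by (auto intro!: derivative_eq_intros simp: field_simps power2_eq_square)
  thus "(?Q has_vector_derivative ?q x) (at x within {0..1})"
   by (simp add: has_real_derivative_iff_has_vector_derivative)
 qed simp
 hence I: "integral {0..1} ?q = ?Q 1 - ?Q 0" by (rule integral_unique)
 have si: "set_integrable lborel {0..1} ?q"
  unfolding set_integrable_def by (intro borel_integrable_compact continuous_intros) auto
 have "(LINT s|lborel. indicator {0..1} s *\<^sub>R (f ((1 - s) *\<^sub>R a + s *\<^sub>R b) * g ((1 - s) *\<^sub>R a + s *\<^sub>R b))) = (LINT s:{0..1}|lborel. ?q s)"
  unfolding set_lebesgue_integral_def
  by (intro Bochner_Integration.integral_cong) (use f g in \<open>auto simp: indicator_def\<close>)
 also have "... = integral {0..1} ?q" by (rule set_borel_integral_eq_integral(2)[OF si])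
 finally show ?thesis unfolding LINT_arclength[OF c] I by (simp add: field_simps)
qed

lemma affine_on_segment: "s \<in> {0..1} ==> q \<bullet> ((1 - s) *\<^sub>R a + s *\<^sub>R b) + k = (1 - s) * (q \<bullet> a + k) + s * (q \<bullet> (b::pt) + (k::real))"
 by (simp add: inner_add_right algebra_simps)

text \<open>The minimum of f^2 on the segment is at most its mean.\<close>

lemma exists_sq_le_sqi:
 fixes f :: "pt => real"
 assumes c: "continuous_on (closed_segment a b) f"
 obtains x where "x \<in> closed_segment a b" "dist a b * (f x)^2 <= sqi (arclength (closed_segment a b)) f"
proof -
 let ?E = "closed_segment a b"
 have "continuous_on ?E (%x. (f x)^2)" by (intro continuous_intros c)
 then obtain x where x: "x \<in> ?E" "!!y. y \<in> ?E ==> (f x)^2 <= (f y)^2"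
  using continuous_attains_inf[of ?E "%x. (f x)^2"] by auto
 interpret finite_measure "arclength ?E" by (rule finite_measure_arclength)
 have "(LINT y|arclength ?E. (f x)^2) <= (LINT y|arclength ?E. (f y)^2)"
  using L2_integrable_sq_real[OF L2_arclength_continuous[OF c]] x(2)
  by (intro integral_mono) (auto simp: space_arclength)
 hence "dist a b * (f x)^2 <= sqi (arclength ?E) f" by (simp add: sqi_def space_arclength measure_arclength mult.commute)
 thus ?thesis using that x(1) by blast
qed

section \<open>Shape regular quasi-uniform meshes\<close>

text \<open>The quantitative part sees the mesh only through h and mu, where mu h is the radius of a
  ball in every element; the constants below are functions of mu alone.\<close>

locale qmesh = mesh +
 fixes h mu :: real
 assumes h: "h > 0" and mu: "mu > 0" and diam: "K \<in> \<T> ==> diameter K <= h"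
  and inball: "K \<in> \<T> ==> \<exists>x. cball x (mu * h) \<subseteq> K"
begin

lemma diam_le: "K \<in> \<T> ==> x \<in> K ==> y \<in> K ==> norm (y - x) <= h"
 using diam_bound[of K x y] diam[of K] by simp

text \<open>Along a diameter of the inscribed ball in the gradient direction the coordinate changes
  by 2 mu h times the norm of its gradient, yet it stays in [0,1].\<close>

lemma lamG_bound:
 assumes K: "K \<in> \<T>" and z: "z \<in> verts K" shows "norm (lamG K z) <= 1 / (2 * mu * h)"
proof (cases "lamG K z = 0")
 case True
 thus ?thesis using h mu by simp
next
 case False
 obtain x where x: "cball x (mu * h) \<subseteq> K" using inball[OF K] by blast
 define u where "u = (mu * h / norm (lamG K z)) *\<^sub>R lamG K z"
 have nu: "norm u = mu * h" using False h mu by (simp add: u_def)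
 have xu: "x + u \<in> K" "x - u \<in> K" using x nu by (auto simp: dist_norm intro!: subsetD[OF x])
 have "lam K z (x + u) - lam K z (x + (- u)) = 2 * (lamG K z \<bullet> u)" unfolding lam_add by simp
 moreover have "lamG K z \<bullet> u = mu * h * norm (lamG K z)"
  using False by (simp add: u_def power2_norm_eq_inner[symmetric] power2_eq_square)
 moreover have "lam K z (x + u) <= 1" "0 <= lam K z (x + (- u))"
  using lam_le_1[OF simp2[OF K] xu(1) z] mem_triangle[OF simp2[OF K]] xu(2) z by auto
 ultimately have "2 * (mu * h * norm (lamG K z)) <= 1" by linarith
 thus ?thesis using h mu by (simp add: field_simps)
qed

text \<open>A barycentric coordinate passes from 0 to 1 along the edge, with a slope bounded from
  above.\<close>

lemma edge_length:
 assumes K: "K \<in> \<T>" "a \<in> verts K" "b \<in> verts K" "a ~= b"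
 shows "2 * mu * h <= dist a b" "dist a b <= h"
proof -
 have "1 = lam K b b - lam K b a" using lam_vertex[OF simp2[OF K(1)]] K by simp
 also have "... = lamG K b \<bullet> (b - a)" by (simp add: lam_def inner_diff_right)
 also have "... <= norm (lamG K b) * norm (b - a)" by (rule norm_cauchy_schwarz)
 also have "... <= 1 / (2 * mu * h) * norm (b - a)" using lamG_bound[OF K(1,3)] by (rule mult_right_mono) simp
 finally show "2 * mu * h <= dist a b" using h mu by (simp add: field_simps dist_norm norm_minus_commute)
 show "dist a b <= h" using diam_le[OF K(1), of b a] K verts_sub(1)[OF K(1)] by (auto simp: dist_norm)
qed

lemma measure_box_pt: "r >= 0 ==> measure lebesgue (cbox (x - r *\<^sub>R 1) (x + r *\<^sub>R 1 :: pt)) = (2 * r)^2"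
 by (simp, subst content_cbox_cart) (auto simp: UNIV_2 power2_eq_square interval_ne_empty_cart)

lemma measure_ball_ge:
 assumes "r >= 0" shows "r^2 <= measure lebesgue (cball (x::pt) r)"
proof -
 have "cbox (x - (r / 2) *\<^sub>R 1) (x + (r / 2) *\<^sub>R 1) \<subseteq> cball x r"
 proof
  fix y assume y: "y \<in> cbox (x - (r / 2) *\<^sub>R 1) (x + (r / 2) *\<^sub>R 1)"
  have "\<bar>(x - y) $ i\<bar> <= r / 2" for i
  proof -
   have "x $ i - r / 2 <= y $ i" "y $ i <= x $ i + r / 2" using y by (simp_all add: mem_box_cart)
   thus ?thesis unfolding abs_le_iff by simp
  qed
  from this[of 1] this[of 2] have "(\<Sum>i\<in>UNIV. \<bar>(x - y) $ i\<bar>) <= r" unfolding sum_2 by linarith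
  thus "y \<in> cball x r" using norm_le_l1_cart[of "x - y"] by (simp add: dist_norm)
 qed
 hence "measure lebesgue (cbox (x - (r / 2) *\<^sub>R 1) (x + (r / 2) *\<^sub>R 1)) <= measure lebesgue (cball x r)"
  by (intro measure_mono_fmeasurable) auto
 thus ?thesis using measure_box_pt[of "r / 2" x] assms by simp
qed

lemma measure_ball_le:
 assumes "r >= 0" shows "measure lebesgue (cball (x::pt) r) <= (2 * r)^2"
proof -
 have "cball x r \<subseteq> cbox (x - r *\<^sub>R 1) (x + r *\<^sub>R 1)"
 proof
  fix y assume "y \<in> cball x r"
  hence "\<bar>(y - x) $ i\<bar> <= r" for i using component_le_norm_cart[of "y - x" i] by (simp add: dist_norm norm_minus_commute)
  hence "x $ i - r <= y $ i \<and> y $ i <= x $ i + r" for i by (auto simp: abs_le_iff) (smt (verit))+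
  thus "y \<in> cbox (x - r *\<^sub>R 1) (x + r *\<^sub>R 1)" by (simp add: mem_box_cart)
 qed
 hence "measure lebesgue (cball x r) <= measure lebesgue (cbox (x - r *\<^sub>R 1) (x + r *\<^sub>R 1))"
  by (intro measure_mono_fmeasurable) auto
 thus ?thesis using measure_box_pt[of r x] assms by simp
qed

lemma area_bounds:
 assumes K: "K \<in> \<T>" shows "(mu * h)^2 <= measure lebesgue K" "measure lebesgue K <= 4 * h^2"
proof -
 have Km: "K \<in> lmeasurable" using K_props(4)[OF K] by (rule lmeasurable_compact)
 obtain x where x: "cball x (mu * h) \<subseteq> K" using inball[OF K] by blast
 have "measure lebesgue (cball x (mu * h)) <= measure lebesgue K" using x Km by (intro measure_mono_fmeasurable) auto
 thus "(mu * h)^2 <= measure lebesgue K" using measure_ball_ge[of "mu * h" x] h mu by simp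
 obtain y where y: "y \<in> K" using K_props(9)[OF K] interior_subset by blast
 have "K \<subseteq> cball y h" using diam_le[OF K _ y] by (auto simp: dist_norm)
 hence "measure lebesgue K <= measure lebesgue (cball y h)" using Km by (intro measure_mono_fmeasurable) (auto intro: fmeasurableD)
 also have "... <= (2 * h)^2" using h by (intro measure_ball_le) auto
 finally show "measure lebesgue K <= 4 * h^2" by (simp add: power_mult_distrib)
qed

lemma cross_bound:
 assumes K: "K \<in> \<T>" "K = convex hull {a, b, c}" shows "2 * (mu * h)^2 <= \<bar>cross2 (b - a) (c - a)\<bar>"
proof -
 have "compact (convex hull {a, b, c})" by (intro compact_convex_hull finite_imp_compact) simp
 hence "convex hull {a, b, c} \<in> sets borel" by (simp add: borel_compact)
 hence "measure lebesgue K = measure lborel (convex hull {a, b, c})" unfolding K(2) by simp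
 also have "... = \<bar>cross2 (b - a) (c - a)\<bar> / 2"
  unfolding content_triangle cross2_def by (subst abs_minus_cancel[symmetric]) (simp add: algebra_simps)
 finally have "measure lebesgue K = \<bar>cross2 (b - a) (c - a)\<bar> / 2" .
 thus ?thesis using area_bounds(1)[OF K(1)] by simp
qed

text \<open>An area count: disjoint interiors of area at least (mu h)^2 fit into a ball whose area
  is at most that of a square of side 8 h.\<close>

lemma card_bound:
 assumes S: "S \<subseteq> \<T>" "!!K. K \<in> S ==> K \<subseteq> cball y (4 * h)"
 shows "real (card S) <= 64 / mu^2"
proof -
 have fS: "finite S" using S(1) fin finite_subset by blast
 have im: "interior K \<in> lmeasurable" if "K \<in> S" for K
  using bounded_subset[OF compact_imp_bounded[OF K_props(4)] interior_subset] S(1) that by (intro lmeasurable_open) auto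
 have dis: "disjoint_family_on interior S"
  unfolding disjoint_family_on_def using interiors_disjoint S(1) interior_subset by blast
 have "real (card S) * (mu * h)^2 <= (\<Sum>K\<in>S. measure lebesgue (interior K))"
  using area_bounds(1) measure_interior_eq S(1) by (subst sum_constant[symmetric]) (intro sum_mono, auto)
 also have "... = measure lebesgue (\<Union>K\<in>S. interior K)"
  using im dis fS by (intro measure_finite_Union[symmetric]) (auto simp: fmeasurable_def top.not_eq_extremum)
 also have "... <= measure lebesgue (cball y (4 * h))"
 proof (rule measure_mono_fmeasurable)
  show "(\<Union>K\<in>S. interior K) \<subseteq> cball y (4 * h)" using S(2) interior_subset by blast
  show "(\<Union>K\<in>S. interior K) \<in> sets lebesgue" using im fS by (intro sets.finite_UN) (auto intro: fmeasurableD)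
 qed simp
 also have "... <= (2 * (4 * h))^2" using h by (intro measure_ball_le) auto
 finally show ?thesis using h mu by (simp add: power_mult_distrib field_simps power2_eq_square)
qed

text \<open>Neighbours are defined by distance rather than adjacency, so that the area count bounds
  their number. The radius covers the stars of all vertices that enter a nodal value at a vertex of
  K.\<close>

definition nbh :: "pt set => pt set set" where
 "nbh K = {K'\<in>\<T>. \<exists>x\<in>K. \<exists>y\<in>K'. dist x y <= 2 * h}"

lemma nbh_card:
 assumes K: "K \<in> \<T>" shows "real (card (nbh K)) <= 64 / mu^2" "finite (nbh K)" "nbh K \<subseteq> \<T>"
proof -
 obtain y where y: "y \<in> K" using K_props(9)[OF K] interior_subset by blast
 show "nbh K \<subseteq> \<T>" by (auto simp: nbh_def)
 thus "finite (nbh K)" using fin finite_subset by blast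
 show "real (card (nbh K)) <= 64 / mu^2"
 proof (rule card_bound[of _ y])
  fix K' assume "K' \<in> nbh K"
  then obtain x x' where x: "K' \<in> \<T>" "x \<in> K" "x' \<in> K'" "dist x x' <= 2 * h" by (auto simp: nbh_def)
  show "K' \<subseteq> cball y (4 * h)"
  proof
   fix w assume w: "w \<in> K'"
   have "dist y w <= dist y x + dist x x' + dist x' w" using dist_triangle[of y w x] dist_triangle[of x w x'] by linarith
   also have "dist y x <= h" using diam_le[OF K x(2) y] by (simp add: dist_norm)
   also have "dist x' w <= h" using diam_le[OF x(1) w x(3)] by (simp add: dist_norm)
   finally show "w \<in> cball y (4 * h)" using x(4) by simp
  qed
 qed (auto simp: nbh_def)
qed

lemma nbh_sym: "K \<in> \<T> ==> K' \<in> nbh K ==> K \<in> nbh K'"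
proof -
 assume K: "K \<in> \<T>" "K' \<in> nbh K"
 then obtain x y where "x \<in> K" "y \<in> K'" "dist x y <= 2 * h" by (auto simp: nbh_def)
 thus ?thesis unfolding nbh_def using K(1) dist_commute[of x y] by auto
qed

lemma star_nbh:
 assumes "K \<in> \<T>" "z \<in> K" "dist z y <= h" shows "star y \<subseteq> nbh K"
proof
 fix K' assume "K' \<in> star y"
 hence K': "K' \<in> \<T>" "y \<in> K'" by (auto simp: star_def)
 have "dist z y <= 2 * h" using assms(3) h by simp
 thus "K' \<in> nbh K" unfolding nbh_def using K' assms(2) by blast
qed

section \<open>Local affine approximations\<close>

definition locapp :: "(pt => real) => (pt set => pt) => pt set => pt => real" where
 "locapp w Gr K x = Gr K \<bullet> x + mean K (%x. w x - Gr K \<bullet> x)"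

text \<open>All three ranges of the smoothness parameter lead to such \<open>Gr\<close> and \<open>a\<close>, and the interpolation
 error is then at most a constant times \<open>h\<close> times the \<open>l^2\<close>-norm of \<open>a\<close>.\<close>

definition local_control :: "(pt => real) => (pt set => pt) => (pt set => real) => bool" where
 "local_control w Gr a \<longleftrightarrow> w \<in> H1 Om \<and> (\<forall>K\<in>\<T>. 0 <= a K \<and> sqi (leb (interior K)) (%x. weak_grad Om w x - Gr K) <= (a K)^2) \<and>
  (\<forall>K\<in>\<T>. \<forall>K'\<in>\<T>. \<forall>z y. z ~= y \<and> verts K \<inter> verts K' = {z, y} --> h * norm (Gr K - Gr K') <= a K + a K')"

lemma locapp_diff: "locapp w Gr K x - locapp w Gr K' x = (Gr K - Gr K') \<bullet> x + (mean K (%x. w x - Gr K \<bullet> x) - mean K' (%x. w x - Gr K' \<bullet> x))"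
 by (simp add: locapp_def inner_diff_left)

lemma locapp_L2:
 assumes "local_control w Gr a" "K \<in> \<T>"
 shows "sqi (leb (interior K)) (%x. w x - locapp w Gr K x) <= 8 * h^2 * (a K)^2"
proof -
 let ?M = "leb (interior K)" and ?p = "%x. Gr K \<bullet> x + 0"
 have w: "w \<in> H1 Om" using assms by (simp add: local_control_def)
 have p: "?p \<in> H1 Om" by (rule pwC1_H1(1)[OF affine_pwC1])
 let ?v = "%x. w x - ?p x"
 have v: "?v \<in> H1 Om" using H1_diff(1)[OF opn w p] .
 from AE_interior_sub[OF assms(2) H1_diff(2)[OF opn w p]] pwC1_H1(3)[OF affine_pwC1 assms(2), of "Gr K" 0]
 have ae: "AE x in ?M. weak_grad Om ?v x = weak_grad Om w x - Gr K" by eventually_elim simp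
 have gL: "weak_grad Om w \<in> L2 ?M" "weak_grad Om ?v \<in> L2 ?M"
  using sqi_K_le(1)[OF H1D(2)[OF w opn] assms(2)] sqi_K_le(1)[OF H1D(2)[OF v opn] assms(2)] by auto
 have "sqi ?M (weak_grad Om ?v) = sqi ?M (%x. weak_grad Om w x - Gr K)"
  using ae gL(2) L2_diff[OF gL(1) L2_const[OF fm(2)[OF assms(2)], of "Gr K"]] by (intro sqi_cong_AE) (auto simp: L2_def)
 also have "... <= (a K)^2" using assms by (simp add: local_control_def)
 finally have g: "sqi ?M (weak_grad Om ?v) <= (a K)^2" .
 have "sqi ?M (%x. w x - locapp w Gr K x) = sqi ?M (%x. ?v x - mean K ?v)" by (simp add: locapp_def algebra_simps)
 also have "... <= 8 * h^2 * sqi ?M (weak_grad Om ?v)"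
  using h by (intro poincare_H1[OF v assms(2)] diam_le[OF assms(2)]) auto
 also have "... <= 8 * h^2 * (a K)^2" using g by (intro mult_left_mono) auto
 finally show ?thesis .
qed

text \<open>576 = 128 * 9 / 2: the trace constant, the sum 8 + 1 of the Poincare and the gradient
  term, and the lower bound 2 (mu h)^2 of the determinant.\<close>

definition C1 :: real where "C1 = 576 / mu^2"

lemma C1_pos: "C1 > 0" using mu by (simp add: C1_def)

lemma locapp_trace:
 assumes lc: "local_control w Gr a" and K: "K \<in> \<T>" and E: "E facet_of K"
 shows "sqi (arclength E) (%x. seg_trace Om E w x - locapp w Gr K x) <= C1 * h * (a K)^2"
  "(%x. seg_trace Om E w x - locapp w Gr K x) \<in> L2 (arclength E)"
proof -
 obtain x y c where f: "verts K = {x, y, c}" "x ~= y" "E = closed_segment x y" "K = convex hull {x, y, c}" "cross2 (y - x) (c - x) ~= 0"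
  using facet_obtain[OF simp2[OF K] E] by metis
 have w: "w \<in> H1 Om" using lc by (simp add: local_control_def)
 let ?M = "leb (interior K)"
 define d where "d = \<bar>cross2 (y - x) (c - x)\<bar>"
 have d: "2 * (mu * h)^2 <= d" unfolding d_def by (rule cross_bound[OF K f(4)])
 have mh: "(mu * h)^2 > 0" using mu h by simp
 have l: "dist x y <= h" using edge_length(2)[OF K, of x y] f by auto
 have X: "sqi ?M (%x. w x - locapp w Gr K x) + h^2 * sqi ?M (%x. weak_grad Om w x - Gr K) <= 9 * h^2 * (a K)^2"
 proof -
  have "h^2 * sqi ?M (%x. weak_grad Om w x - Gr K) <= h^2 * (a K)^2" using lc K by (intro mult_left_mono) (auto simp: local_control_def)
  thus ?thesis using locapp_L2[OF lc K] by simp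
 qed
 have "sqi (arclength E) (%x. seg_trace Om E w x - locapp w Gr K x) <= 128 * dist x y / d *
   (sqi ?M (%x. w x - locapp w Gr K x) + h^2 * sqi ?M (%x. weak_grad Om w x - Gr K))"
  unfolding locapp_def f(3) d_def
  by (rule trace_inequality[OF w K f(4) _ f(5)]) (use E f(3) diam_le[OF K] in auto)
 also have "... <= 128 * h / (2 * (mu * h)^2) * (9 * h^2 * (a K)^2)"
  using X d mh l h by (intro mult_mono frac_le) (auto intro!: add_nonneg_nonneg mult_nonneg_nonneg)
 also have "... = C1 * h * (a K)^2" using h mu by (simp add: C1_def field_simps power2_eq_square)
 finally show "sqi (arclength E) (%x. seg_trace Om E w x - locapp w Gr K x) <= C1 * h * (a K)^2" .
 show "(%x. seg_trace Om E w x - locapp w Gr K x) \<in> L2 (arclength E)"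
 proof (rule L2_diff[OF seg_trace_L2[OF w K E]])
  show "locapp w Gr K \<in> L2 (arclength E)"
   unfolding f(3) locapp_def by (intro L2_arclength_continuous continuous_intros)
 qed
qed

text \<open>The root bounds the jump at one point of the edge; 5 stands for the distance 5 h over
  which the jump of the gradient then acts.\<close>

definition C2 :: real where "C2 = sqrt (C1 / mu) + 5"

lemma C2_ge: "C2 >= 5" using C1_pos mu by (simp add: C2_def)

lemma shared_edge_facet:
 assumes K: "K \<in> \<T>" "K' \<in> \<T>" "verts K \<inter> verts K' = {z, y}" "z ~= y"
 shows "closed_segment z y facet_of K" "closed_segment z y facet_of K'"
proof -
 have gen: "closed_segment z y facet_of K" if K: "K \<in> \<T>" "{z, y} \<subseteq> verts K" for K
 proof -
  obtain a b c where abc: "K = convex hull {a, b, c}" "a ~= b" "a ~= c" "b ~= c" "\<not> affine_dependent {a, b, c}" "verts K = {a, b, c}"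
   using triangle_obtain[OF simp2[OF K(1)]] by metis
  have zy: "z \<in> {a, b, c}" "y \<in> {a, b, c}" using K(2) abc(6) by auto
  have "card ({a, b, c} - {z, y}) = 1" using zy abc(2-4) \<open>z ~= y\<close> by (subst card_Diff_subset) auto
  then obtain u where "{a, b, c} - {z, y} = {u}" by (auto simp: card_1_singleton_iff)
  hence u: "u \<in> {a, b, c}" "{a, b, c} - {u} = {z, y}" using zy by auto
  show ?thesis
   unfolding abc(1) facet_of_convex_hull_affine_independent[OF abc(5)] segment_convex_hull
   by (intro conjI exI[of _ u] u(1)) (simp_all add: u(2))
 qed
 show "closed_segment z y facet_of K" "closed_segment z y facet_of K'" using gen[of K] gen[of K'] K by auto
qed

text \<open>On the common edge both affine functions are close to the same trace, hence close to
  each other at some point of it; the bound on the gradient jump carries this to every x near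
  z.\<close>

lemma locapp_jump:
 assumes lc: "local_control w Gr a" and K: "K \<in> \<T>" "K' \<in> \<T>" "verts K \<inter> verts K' = {z, y}" "z ~= y" and x: "dist x z <= 4 * h"
 shows "\<bar>locapp w Gr K x - locapp w Gr K' x\<bar> <= C2 * (a K + a K')"
proof -
 let ?E = "closed_segment z y" and ?q = "%x. locapp w Gr K x - locapp w Gr K' x"
 note fE = shared_edge_facet[OF K]
 have a0: "a K >= 0" "a K' >= 0" using lc K by (auto simp: local_control_def)
 have zy: "z \<in> verts K" "y \<in> verts K" using K(3) by auto
 have len: "2 * mu * h <= dist z y" "dist z y <= h" using edge_length[OF K(1) zy K(4)] by auto
 have cq: "continuous_on ?E ?q" unfolding locapp_def by (intro continuous_intros)
 have "sqi (arclength ?E) ?q = sqi (arclength ?E) (%x. (seg_trace Om ?E w x - locapp w Gr K' x) - (seg_trace Om ?E w x - locapp w Gr K x))" by simp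
 also have "... <= 2 * sqi (arclength ?E) (%x. seg_trace Om ?E w x - locapp w Gr K' x) + 2 * sqi (arclength ?E) (%x. seg_trace Om ?E w x - locapp w Gr K x)"
  by (rule sqi_diff_le[OF locapp_trace(2)[OF lc K(2) fE(2)] locapp_trace(2)[OF lc K(1) fE(1)]])
 also have "... <= 2 * (C1 * h * (a K')^2) + 2 * (C1 * h * (a K)^2)"
  using locapp_trace(1)[OF lc K(2) fE(2)] locapp_trace(1)[OF lc K(1) fE(1)] by simp
 also have "... <= 2 * C1 * h * (a K + a K')^2"
 proof -
  have "(a K')^2 + (a K)^2 <= (a K + a K')^2" using a0 by (simp add: power2_sum)
  hence "2 * C1 * h * ((a K')^2 + (a K)^2) <= 2 * C1 * h * (a K + a K')^2" using C1_pos h by (intro mult_left_mono) auto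
  thus ?thesis by (simp add: algebra_simps)
 qed
 finally have s: "sqi (arclength ?E) ?q <= 2 * C1 * h * (a K + a K')^2" .
 obtain e where e: "e \<in> ?E" "dist z y * (?q e)^2 <= sqi (arclength ?E) ?q" using exists_sq_le_sqi[OF cq] .
 have "2 * mu * h * (?q e)^2 <= dist z y * (?q e)^2" using len by (intro mult_right_mono) auto
 also have "... <= 2 * C1 * h * (a K + a K')^2" using e(2) s by simp
 finally have "(?q e)^2 <= (C1 / mu) * (a K + a K')^2" using h mu by (simp add: field_simps)
 also have "... = (sqrt (C1 / mu) * (a K + a K'))^2" using C1_pos mu by (simp add: power_mult_distrib)
 finally have "\<bar>?q e\<bar> <= \<bar>sqrt (C1 / mu) * (a K + a K')\<bar>" by (simp only: abs_le_square_iff)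
 also have "... = sqrt (C1 / mu) * (a K + a K')" using a0 C1_pos mu by simp
 finally have 1: "\<bar>?q e\<bar> <= sqrt (C1 / mu) * (a K + a K')" .
 have "dist z e <= dist z y" using dist_in_closed_segment(1)[OF e(1)] by (simp add: dist_commute)
 hence de: "norm (x - e) <= 5 * h" using x len(2) dist_triangle[of x e z] by (simp add: dist_norm)
 have "?q x - ?q e = (Gr K - Gr K') \<bullet> (x - e)" by (simp add: locapp_diff inner_diff_right)
 hence "\<bar>?q x - ?q e\<bar> <= norm (Gr K - Gr K') * norm (x - e)" using Cauchy_Schwarz_ineq2 by metis
 also have "... <= norm (Gr K - Gr K') * (5 * h)" using de by (intro mult_left_mono) auto
 also have "... = 5 * (h * norm (Gr K - Gr K'))" by simp
 also have "... <= 5 * (a K + a K')"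
 proof -
  have "h * norm (Gr K - Gr K') <= a K + a K'" using lc K unfolding local_control_def by blast
  thus ?thesis by simp
 qed
 finally have 2: "\<bar>?q x - ?q e\<bar> <= 5 * (a K + a K')" .
 have "\<bar>?q x\<bar> <= \<bar>?q e\<bar> + \<bar>?q x - ?q e\<bar>" by linarith
 also have "... <= sqrt (C1 / mu) * (a K + a K') + 5 * (a K + a K')" using 1 2 by (rule add_mono)
 finally show ?thesis by (simp add: C2_def algebra_simps)
qed

text \<open>One edge jump, with both \<open>a K\<close> and \<open>a K'\<close> bounded by the sum
  over the star, times the number of elements in the star.\<close>

definition C3 :: real where "C3 = 2 * C2 * (64 / mu^2)"

lemma C3_pos: "C3 >= 0" using C2_ge by (simp add: C3_def)

lemma star_card: "z \<in> closure Om ==> real (card (star z)) <= 64 / mu^2"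
proof (rule card_bound[of _ z])
 fix K assume "K \<in> star z"
 hence K: "K \<in> \<T>" "z \<in> K" by (auto simp: star_def)
 show "K \<subseteq> cball z (4 * h)" using diam_le[OF K(1) _ K(2)] h by (force simp: dist_norm)
qed (rule star_fin(2))

text \<open>The set of elements already compared with K grows by one element in each step, since a
  proper part of the star always shares an edge with the rest; each step costs one edge
  jump.\<close>

lemma locapp_star:
 assumes lc: "local_control w Gr a" and z: "z \<in> vertices \<T>" and K: "K \<in> star z" "K' \<in> star z" and x: "dist x z <= 4 * h"
 shows "\<bar>locapp w Gr K x - locapp w Gr K' x\<bar> <= C3 * (\<Sum>K\<in>star z. a K)"
proof -
 define B where "B = (\<Sum>K\<in>star z. a K)"
 have a0: "a K >= 0" if "K \<in> star z" for K using lc that star_fin(2) by (auto simp: local_control_def)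
 have aB: "a K <= B" if "K \<in> star z" for K unfolding B_def using that a0 star_fin(1) by (intro member_le_sum) auto
 have B0: "B >= 0" unfolding B_def using a0 by (rule sum_nonneg)
 have "\<exists>A. A \<subseteq> star z \<and> K \<in> A \<and> card A = Suc n \<and> (\<forall>K'\<in>A. \<bar>locapp w Gr K x - locapp w Gr K' x\<bar> <= real n * (2 * C2 * B))"
  if "Suc n <= card (star z)" for n
  using that
 proof (induction n)
  case 0
  thus ?case using K(1) by (intro exI[of _ "{K}"]) auto
 next
  case (Suc n)
  then obtain A where A: "A \<subseteq> star z" "K \<in> A" "card A = Suc n" "!!K'. K' \<in> A ==> \<bar>locapp w Gr K x - locapp w Gr K' x\<bar> <= real n * (2 * C2 * B)"
   by auto
  have "A ~= star z" using A(3) Suc.prems by auto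
  then obtain L L' y where L: "L \<in> A" "L' \<in> star z - A" "y ~= z" "verts L \<inter> verts L' = {z, y}"
   using star_connected[OF z A(1)] A(2) by (metis empty_iff)
  have LT: "L \<in> \<T>" "L' \<in> \<T>" "L \<in> star z" "L' \<in> star z" using L A(1) star_fin(2) by auto
  have "\<bar>locapp w Gr L x - locapp w Gr L' x\<bar> <= C2 * (a L + a L')"
   using locapp_jump[OF lc LT(1,2) L(4)] L(3) x by simp
  also have "... <= C2 * (B + B)" using aB[OF LT(3)] aB[OF LT(4)] C2_ge by (intro mult_left_mono) auto
  finally have j: "\<bar>locapp w Gr L x - locapp w Gr L' x\<bar> <= 2 * C2 * B" by simp
  have "\<bar>locapp w Gr K x - locapp w Gr L' x\<bar> <= real n * (2 * C2 * B) + 2 * C2 * B"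
   using A(4)[OF L(1)] j by linarith
  hence new: "\<bar>locapp w Gr K x - locapp w Gr L' x\<bar> <= real (Suc n) * (2 * C2 * B)" by (simp add: algebra_simps)
  have mono: "real n * (2 * C2 * B) <= real (Suc n) * (2 * C2 * B)" using C2_ge B0 by (intro mult_right_mono) auto
  show ?case
  proof (intro exI[of _ "insert L' A"] conjI ballI)
   show "insert L' A \<subseteq> star z" "K \<in> insert L' A" using A L by auto
   have "finite A" using A(1) star_fin(1) finite_subset by blast
   thus "card (insert L' A) = Suc (Suc n)" using A(3) L(2) by simp
   fix K' assume "K' \<in> insert L' A"
   thus "\<bar>locapp w Gr K x - locapp w Gr K' x\<bar> <= real (Suc n) * (2 * C2 * B)"
    using new order_trans[OF A(4) mono] by auto
  qed
 qed
 moreover obtain n where n: "card (star z) = Suc n" using K(1) star_fin(1) by (metis card_Suc_Diff1)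
 ultimately obtain A where A: "A \<subseteq> star z" "card A = card (star z)" "!!K'. K' \<in> A ==> \<bar>locapp w Gr K x - locapp w Gr K' x\<bar> <= real n * (2 * C2 * B)"
  by (metis order_refl)
 have "A = star z" using A(1,2) star_fin(1) by (simp add: card_subset_eq)
 hence "\<bar>locapp w Gr K x - locapp w Gr K' x\<bar> <= real n * (2 * C2 * B)" using A(3) K(2) by blast
 also have "real n <= 64 / mu^2"
 proof -
  have "z \<in> closure Om" using K(1) K_props(7) by (auto simp: star_def)
  thus ?thesis using star_card[of z] n by simp
 qed
 finally show ?thesis using C2_ge B0 unfolding C3_def B_def[symmetric] by (simp add: mult_right_mono mult_ac)
qed

end

context mesh begin

section \<open>Edges and dual bases\<close>

text \<open>The edge is oriented to start at z. The products with 0 and 1 are left unsimplified so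
  that they match the form required by \<open>LINT_affine_product\<close>.\<close>

lemma edge_at:
 assumes E: "E \<in> edges \<T>" and z: "z \<in> vertices \<T>" "z \<in> E"
 obtains K y where "K \<in> \<T>" "E facet_of K" "E = closed_segment z y" "z ~= y" "z \<in> verts K" "y \<in> verts K" "vertices \<T> \<inter> E = {z, y}"
  "!!s. s \<in> {0..1} ==> nodal_basis \<T> z ((1 - s) *\<^sub>R z + s *\<^sub>R y) = (1 - s) * 1 + s * 0"
  "!!s. s \<in> {0..1} ==> nodal_basis \<T> y ((1 - s) *\<^sub>R z + s *\<^sub>R y) = (1 - s) * 0 + s * 1"
  "continuous_on E (nodal_basis \<T> z)" "continuous_on E (nodal_basis \<T> y)"
proof -
 note result = that
 obtain K where K: "K \<in> \<T>" "E facet_of K" using E by (auto simp: edges_def)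
 obtain a b c where f: "verts K = {a, b, c}" "a ~= b" "a ~= c" "b ~= c" "E = closed_segment a b"
  using facet_obtain[OF simp2[OF K(1)] K(2)] by metis
 have EK: "E \<subseteq> K" using K(2) facet_of_imp_subset by blast
 have lv: "lam K v a = (if a = v then 1 else 0)" "lam K v b = (if b = v then 1 else 0)" "lam K v c = (if c = v then 1 else 0)" for v
  using lam_vertex[OF simp2[OF K(1)]] f(1) by auto
 have vs: "a \<in> vertices \<T>" "b \<in> vertices \<T>" using f(1) verts_sub(2)[OF K(1)] by auto
 have "c \<notin> E"
 proof
  assume "c \<in> E"
  then obtain s where "c = (1 - s) *\<^sub>R a + s *\<^sub>R b" unfolding f(5) in_segment by blast
  hence "lam K c c = (1 - s) * lam K c a + s * lam K c b" using lam_convex[of "1 - s" s K c a b] by simp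
  thus False using lv[of c] f(3,4) by auto
 qed
 hence vE: "vertices \<T> \<inter> E = {a, b}" using vertex_of[OF _ K(1)] EK f(1,5) vs by auto
 have nb: "nodal_basis \<T> v x = lam K v x" if "v \<in> {a, b}" "x \<in> E" for v x
  using nodal_basis_eq[of v] hat_eq[OF K(1), of x v] that EK vs by auto
 have cnb: "continuous_on E (nodal_basis \<T> v)" if "v \<in> {a, b}" for v
 proof -
  have "continuous_on E (lam K v)" unfolding lam_def by (intro continuous_intros)
  thus ?thesis using nb[OF that] continuous_on_cong[of E E] by (metis (no_types))
 qed
 have key: thesis if u: "{u, v} = {a, b}" "u ~= v" "u = z" for u v
 proof (rule result[of K v])
  show "E = closed_segment z v" using u f(2,5) by (auto simp: doubleton_eq_iff closed_segment_commute)
  have "z \<in> {a,b}" "v \<in> {a,b}" using u by auto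
  have seg: "(1 - s) *\<^sub>R z + s *\<^sub>R v \<in> E" if "s \<in> {0..1}" for s
   unfolding \<open>E = closed_segment z v\<close> in_segment using that by auto
  show "nodal_basis \<T> z ((1 - s) *\<^sub>R z + s *\<^sub>R v) = (1 - s) * 1 + s * 0" if "s \<in> {0..1}" for s
   using nb[OF \<open>z \<in> {a,b}\<close> seg[OF that]] lam_convex[of "1 - s" s K z z v] lv[of z] u by (auto simp: doubleton_eq_iff)
  show "nodal_basis \<T> v ((1 - s) *\<^sub>R z + s *\<^sub>R v) = (1 - s) * 0 + s * 1" if "s \<in> {0..1}" for s
   using nb[OF \<open>v \<in> {a,b}\<close> seg[OF that]] lam_convex[of "1 - s" s K v z v] lv[of v] u by (auto simp: doubleton_eq_iff)
  show "continuous_on E (nodal_basis \<T> z)" "continuous_on E (nodal_basis \<T> v)" using cnb \<open>z \<in> {a,b}\<close> \<open>v \<in> {a,b}\<close> by blast+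
 qed (use u K f(1) vE in auto)
 have "z \<in> {a, b}" using z vE by blast
 thus thesis using key[of a b] key[of b a] f(2) by auto
qed

lemma finite_edges: "finite (edges \<T>)"
proof (rule finite_subset)
 show "edges \<T> \<subseteq> (%(a, b). closed_segment a b) ` (vertices \<T> \<times> vertices \<T>)"
 proof
  fix E assume "E \<in> edges \<T>"
  then obtain K where K: "K \<in> \<T>" "E facet_of K" by (auto simp: edges_def)
  obtain a b c where "verts K = {a, b, c}" "E = closed_segment a b" using facet_obtain[OF simp2[OF K(1)] K(2)] by metis
  thus "E \<in> (%(a, b). closed_segment a b) ` (vertices \<T> \<times> vertices \<T>)" using verts_sub(2)[OF K(1)] by force
 qed
qed (simp add: finite_vertices)

text \<open>The mass matrix of the two hat functions on an edge of length d has diagonal d / 3 and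
  off-diagonal d / 6; its inverse yields the end point values 4 / d and -2 / d of the dual
  function.\<close>

lemma dual_basis:
 assumes E: "E = closed_segment z y" "z ~= y" "vertices \<T> \<inter> E = {z, y}"
  and nz: "!!s. s \<in> {0..1} ==> nodal_basis \<T> z ((1 - s) *\<^sub>R z + s *\<^sub>R y) = (1 - s) * 1 + s * 0"
  and ny: "!!s. s \<in> {0..1} ==> nodal_basis \<T> y ((1 - s) *\<^sub>R z + s *\<^sub>R y) = (1 - s) * 0 + s * 1"
  and c: "continuous_on E (nodal_basis \<T> z)" "continuous_on E (nodal_basis \<T> y)"
 shows "continuous_on E (dual_basis \<T> E z)"
  "s \<in> {0..1} ==> dual_basis \<T> E z ((1 - s) *\<^sub>R z + s *\<^sub>R y) = (1 - s) * (4 / dist z y) + s * (- 2 / dist z y)"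
proof -
 define d where "d = dist z y"
 have d: "d > 0" using E(2) by (simp add: d_def)
 \<comment> \<open>The values drop by 6 / d over the length d, which means a gradient of norm 6 /
   d^2 along y - z, a vector of norm d.\<close>
 define q where "q = (- 6 / d ^ 3) *\<^sub>R (y - z)"
 define k where "k = 4 / d - q \<bullet> z"
 define theta where "theta x = (if x \<in> E then q \<bullet> x + k else 0)" for x
 have seg: "(1 - s) *\<^sub>R z + s *\<^sub>R y \<in> E" if "s \<in> {0..1}" for s unfolding E(1) in_segment using that by auto
 have "(y - z) \<bullet> (y - z) = d^2" by (simp add: d_def dist_norm norm_minus_commute power2_norm_eq_inner)
 moreover have "q \<bullet> y - q \<bullet> z = (- 6 / d ^ 3) * ((y - z) \<bullet> (y - z))"
  unfolding q_def by (simp only: inner_scaleR_left inner_diff_right right_diff_distrib)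
 ultimately have "q \<bullet> y - q \<bullet> z = - 6 / d" using d by (simp add: power2_eq_square power3_eq_cube)
 hence qz: "q \<bullet> z + k = 4 / d" "q \<bullet> y + k = - 2 / d" by (simp_all add: k_def diff_divide_distrib[symmetric])
 have thetas: "theta ((1 - s) *\<^sub>R z + s *\<^sub>R y) = (1 - s) * (4 / d) + s * (- 2 / d)" if "s \<in> {0..1}" for s
  unfolding theta_def using seg[OF that] affine_on_segment[OF that, of q z y k] qz by simp
 have ctheta: "continuous_on E theta"
 proof -
  have "continuous_on E (%x. q \<bullet> x + k)" by (intro continuous_intros)
  thus ?thesis by (rule continuous_on_eq) (simp add: theta_def)
 qed
 have I: "(LINT x|arclength E. f x * nodal_basis \<T> z x) = d * (alpha / 3 + beta / 6)" "(LINT x|arclength E. f x * nodal_basis \<T> y x) = d * (alpha / 6 + beta / 3)"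
  if f: "!!s. s \<in> {0..1} ==> f ((1 - s) *\<^sub>R z + s *\<^sub>R y) = (1 - s) * alpha + s * beta" "continuous_on E f" for f alpha beta
  using LINT_affine_product[OF f(1) nz] LINT_affine_product[OF f(1) ny] f(2) c
  unfolding E(1) d_def by (auto intro!: continuous_intros)
 have "dual_basis \<T> E z = theta" unfolding dual_basis_def
 proof (rule the_equality, intro conjI ballI allI impI)
  show "affine_fun_on E theta" unfolding affine_fun_on_def theta_def by (intro exI[of _ q] exI[of _ k]) simp
  show "theta x = 0" if "x \<notin> E" for x using that by (simp add: theta_def)
  show "(LINT x|arclength E. theta x * nodal_basis \<T> v x) = (if v = z then 1 else 0)" if "v \<in> vertices \<T> \<inter> E" for v
   using I[OF thetas ctheta] d E(2) that unfolding E(3) by (auto simp: field_simps)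
  fix eta assume eta: "affine_fun_on E eta \<and> (\<forall>x. x \<notin> E --> eta x = 0) \<and>
   (\<forall>v\<in>vertices \<T> \<inter> E. (LINT x|arclength E. eta x * nodal_basis \<T> v x) = (if v = z then 1 else 0))"
  then obtain q' k' where q': "!!x. x \<in> E ==> eta x = q' \<bullet> x + k'" by (auto simp: affine_fun_on_def)
  have etas: "eta ((1 - s) *\<^sub>R z + s *\<^sub>R y) = (1 - s) * (q' \<bullet> z + k') + s * (q' \<bullet> y + k')" if "s \<in> {0..1}" for s
   using q'[OF seg[OF that]] affine_on_segment[OF that, of q' z y k'] by simp
  have "continuous_on E (%x. q' \<bullet> x + k')" by (intro continuous_intros)
  hence "continuous_on E eta" by (rule continuous_on_eq) (simp add: q')
  from I[OF etas this] have "d * ((q' \<bullet> z + k') / 3 + (q' \<bullet> y + k') / 6) = 1" "d * ((q' \<bullet> z + k') / 6 + (q' \<bullet> y + k') / 3) = 0"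
   using eta E(2) unfolding E(3) by auto
  hence "(q' \<bullet> z + k') / 6 + (q' \<bullet> y + k') / 3 = 0" "(q' \<bullet> z + k') / 3 + (q' \<bullet> y + k') / 6 = 1 / d"
   using d by (simp_all add: eq_divide_eq mult.commute)
  moreover have "P = 4 * R \<and> Q = - 2 * R" if "P / 6 + Q / 3 = 0" "P / 3 + Q / 6 = R" for P Q R :: real using that by auto
  ultimately have v: "q' \<bullet> z + k' = 4 / d" "q' \<bullet> y + k' = - 2 / d" by fastforce+
  show "eta = theta"
  proof
   fix x show "eta x = theta x"
   proof (cases "x \<in> E")
    case True
    then obtain s where "s \<in> {0..1}" "x = (1 - s) *\<^sub>R z + s *\<^sub>R y" unfolding E(1) in_segment by auto
    thus ?thesis using etas[of s] thetas[of s] v by simp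
   qed (use eta in \<open>auto simp: theta_def\<close>)
  qed
 qed
 thus "continuous_on E (dual_basis \<T> E z)"
  "s \<in> {0..1} ==> dual_basis \<T> E z ((1 - s) *\<^sub>R z + s *\<^sub>R y) = (1 - s) * (4 / dist z y) + s * (- 2 / dist z y)"
  using ctheta thetas unfolding d_def by auto
qed

end

context qmesh begin

section \<open>Nodal values of the interpolant\<close>

text \<open>Cauchy-Schwarz gives 16 / d times \<open>C1 * h * (a K)^2\<close>, and d >= 2 mu
  h.\<close>

definition C4 :: real where "C4 = sqrt (8 * C1 / mu)"

text \<open>The dual function reproduces affine functions at z, so only the trace minus the affine
  function is integrated against it; on an edge of length d it is bounded by 4 / d.\<close>

lemma SZ_local:
 assumes lc: "local_control w Gr a" and z: "z \<in> vertices \<T>" "z \<in> sg z" and E: "sg z \<in> edges \<T>"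
 obtains K where "K \<in> star z" "\<bar>SZ_value Om \<T> sg w z - locapp w Gr K z\<bar> <= C4 * a K"
proof -
 obtain K y where K: "K \<in> \<T>" "sg z facet_of K" and e: "sg z = closed_segment z y" "z ~= y" "z \<in> verts K" "y \<in> verts K"
  "vertices \<T> \<inter> sg z = {z, y}"
  "!!s. s \<in> {0..1} ==> nodal_basis \<T> z ((1 - s) *\<^sub>R z + s *\<^sub>R y) = (1 - s) * 1 + s * 0"
  "!!s. s \<in> {0..1} ==> nodal_basis \<T> y ((1 - s) *\<^sub>R z + s *\<^sub>R y) = (1 - s) * 0 + s * 1"
  "continuous_on (sg z) (nodal_basis \<T> z)" "continuous_on (sg z) (nodal_basis \<T> y)"
  using edge_at[OF E z] by metis
 define theta where "theta = dual_basis \<T> (sg z) z"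
 have theta: "continuous_on (sg z) theta" "!!s. s \<in> {0..1} ==> theta ((1 - s) *\<^sub>R z + s *\<^sub>R y) = (1 - s) * (4 / dist z y) + s * (- 2 / dist z y)"
  unfolding theta_def using dual_basis[OF e(1,2,5-9)] by auto
 let ?E = "closed_segment z y" and ?p = "locapp w Gr K"
 let ?t = "seg_trace Om ?E w"
 have len: "2 * mu * h <= dist z y" and d: "dist z y > 0" using edge_length(1)[OF K(1) e(3,4,2)] e(2) by auto
 have a0: "a K >= 0" using lc K by (auto simp: local_control_def)
 have w: "w \<in> H1 Om" using lc by (simp add: local_control_def)
 have thetaL: "theta \<in> L2 (arclength ?E)" using theta(1) unfolding e(1) by (rule L2_arclength_continuous)
 have tp: "(%x. ?t x - ?p x) \<in> L2 (arclength ?E)" "sqi (arclength ?E) (%x. ?t x - ?p x) <= C1 * h * (a K)^2"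
  using locapp_trace[OF lc K] unfolding e(1) by auto
 have cp: "continuous_on ?E ?p" unfolding locapp_def by (intro continuous_intros)
 have stheta: "sqi (arclength ?E) theta <= (4 / dist z y)^2 * dist z y"
 proof -
  have "norm (theta x) <= 4 / dist z y" if "x \<in> ?E" for x
  proof -
   obtain s where s: "s \<in> {0..1}" "x = (1 - s) *\<^sub>R z + s *\<^sub>R y" using \<open>x \<in> ?E\<close> unfolding in_segment by auto
   have "\<bar>(1 - s) * 4 + s * (- 2)\<bar> <= 4" using s(1) by (auto simp: abs_le_iff)
   moreover have "theta x = ((1 - s) * 4 + s * (- 2)) / dist z y" unfolding s(2) theta(2)[OF s(1)] by (simp add: add_divide_distrib diff_divide_distrib)
   ultimately show ?thesis using d by (simp add: divide_right_mono)
  qed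
  thus ?thesis
   using L2_bounded(2)[OF finite_measure_arclength measurable_arclength_continuous[OF theta(1)[unfolded e(1)]], of "4 / dist z y"]
   by (simp add: space_arclength measure_arclength)
 qed
 have "(LINT x|arclength ?E. theta x * ?p x) = ?p z"
 proof -
  have ps: "?p ((1 - s) *\<^sub>R z + s *\<^sub>R y) = (1 - s) * ?p z + s * ?p y" if "s \<in> {0..1}" for s
   unfolding locapp_def by (rule affine_on_segment[OF that])
  show ?thesis
   using LINT_affine_product[OF theta(2) ps continuous_on_mult[OF theta(1)[unfolded e(1)] cp]] d by (simp add: field_simps)
 qed
 moreover have "SZ_value Om \<T> sg w z = (LINT x|arclength ?E. theta x * ?t x)" unfolding SZ_value_def theta_def e(1) ..
 moreover have "(LINT x|arclength ?E. theta x * (?t x - ?p x)) = (LINT x|arclength ?E. theta x * ?t x) - (LINT x|arclength ?E. theta x * ?p x)"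
  unfolding right_diff_distrib
  by (intro Bochner_Integration.integral_diff L2_integrable_mult[OF thetaL] L2_arclength_continuous[OF cp])
   (use seg_trace_L2[OF w K] e(1) in simp)
 ultimately have "(SZ_value Om \<T> sg w z - ?p z)^2 = (LINT x|arclength ?E. theta x * (?t x - ?p x))^2" by simp
 also have "... <= sqi (arclength ?E) theta * sqi (arclength ?E) (%x. ?t x - ?p x)" by (rule Cauchy_Schwarz_L2[OF thetaL tp(1)])
 also have "... <= ((4 / dist z y)^2 * dist z y) * (C1 * h * (a K)^2)" using stheta tp(2) by (intro mult_mono) auto
 also have "... = 16 / dist z y * (C1 * h * (a K)^2)" using d by (simp add: power2_eq_square)
 also have "... <= 16 / (2 * mu * h) * (C1 * h * (a K)^2)" using len h mu C1_pos by (intro mult_right_mono frac_le) auto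
 also have "... = (C4 * a K)^2" using h mu C1_pos by (simp add: C4_def power_mult_distrib field_simps)
 finally have "\<bar>SZ_value Om \<T> sg w z - ?p z\<bar> <= \<bar>C4 * a K\<bar>" by (simp only: abs_le_square_iff)
 also have "... = C4 * a K" using a0 C1_pos mu by (simp add: C4_def)
 finally show thesis using that[of K] K e(3) verts_sub(1)[OF K(1)] by (auto simp: star_def)
qed

definition nsum :: "(pt set => real) => pt set => real" where "nsum a K = (\<Sum>K'\<in>nbh K. a K')"

lemma nsum_ge:
 assumes lc: "local_control w Gr a" and K: "K \<in> \<T>"
 shows "S \<subseteq> nbh K ==> sum a S <= nsum a K" "K' \<in> nbh K ==> a K' <= nsum a K" "0 <= nsum a K"
proof -
 have a0: "0 <= a K'" if "K' \<in> nbh K" for K' using lc that nbh_card(3)[OF K] by (auto simp: local_control_def)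
 thus "S \<subseteq> nbh K ==> sum a S <= nsum a K" unfolding nsum_def using nbh_card(2)[OF K] by (intro sum_mono2) auto
 show "K' \<in> nbh K ==> a K' <= nsum a K" unfolding nsum_def using nbh_card(2)[OF K] a0 by (intro member_le_sum) auto
 show "0 <= nsum a K" unfolding nsum_def using a0 by (rule sum_nonneg)
qed

text \<open>Both terms come from squared norms on one edge: \<open>C1 / mu\<close> from the trace
  and 8 C3^2 = 2 (2 C3)^2 from two comparisons within stars.\<close>

definition C8 :: real where "C8 = sqrt (C1 / mu + 8 * C3^2)"

text \<open>The edge E lies at y, whereas K is only known to lie at z. The comparison goes from K to
  an element with the edge E0, inside the star of z, and from there to an element with the edge E,
  inside the star of y. The bound is stated through the integral of the hat function so that it sums
  up to the mass of the patch.\<close>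

lemma patch_local:
 fixes u :: "pt => real"
 assumes lc: "local_control w Gr a" and K: "K \<in> star z" and z: "z \<in> vertices \<T>"
  and E0: "E0 \<in> edges \<T>" "z \<in> E0" "y \<in> E0" and y: "y \<in> vertices \<T>" and E: "E \<in> edges \<T>" "y \<in> E"
 shows "\<bar>LINT x|arclength E. (seg_trace Om E w x - locapp w Gr K x) * nodal_basis \<T> y x\<bar> <= C8 * nsum a K * (2 * (LINT x|arclength E. nodal_basis \<T> y x))"
  "0 < (LINT x|arclength E. nodal_basis \<T> y x)"
  "integrable (arclength E) (%x. seg_trace Om E w x * nodal_basis \<T> y x)"
  "f \<in> L2 (arclength E) ==> integrable (arclength E) (%x. nodal_basis \<T> y x * f x)"
  "continuous_on UNIV u ==> u \<in> L2 (arclength E)"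
proof -
 obtain L v where L: "L \<in> \<T>" "E facet_of L" and e: "E = closed_segment y v" "y ~= v" "y \<in> verts L" "v \<in> verts L"
  "!!s. s \<in> {0..1} ==> nodal_basis \<T> y ((1 - s) *\<^sub>R y + s *\<^sub>R v) = (1 - s) * 1 + s * 0"
  "continuous_on E (nodal_basis \<T> y)"
  using edge_at[OF E(1) y E(2)] by metis
 have KT: "K \<in> \<T>" "z \<in> K" using K by (auto simp: star_def)
 obtain K1 where K1: "K1 \<in> \<T>" "E0 \<subseteq> K1" using E0(1) facet_of_imp_subset by (auto simp: edges_def)
 have zy: "dist z y <= h" using diam_le[OF K1(1), of y z] K1(2) E0 by (auto simp: dist_norm)
 have st: "star z \<subseteq> nbh K" "star y \<subseteq> nbh K" using star_nbh[OF KT] zy h by auto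
 \<comment> \<open>\<open>K1\<close> contains both y and z and thus lies in both stars; it links K
   with L.\<close>
 have s1: "K1 \<in> star z" "K1 \<in> star y" "L \<in> star y" using K1 E0 L(1) e(3) verts_sub(1)[OF L(1)] by (auto simp: star_def)
 define A where "A = nsum a K"
 note ge = nsum_ge[OF lc KT(1), folded A_def]
 let ?phi = "nodal_basis \<T> y" and ?t = "seg_trace Om E w" and ?p = "locapp w Gr K" and ?q = "locapp w Gr L" and ?M = "arclength E"
 define d where "d = dist y v"
 have d: "2 * mu * h <= d" "d <= h" "d > 0" using edge_length[OF L(1) e(3,4,2)] e(2) by (auto simp: d_def)
 have dif: "\<bar>?q x - ?p x\<bar> <= 2 * C3 * A" if x: "x \<in> E" for x
 proof -
  have xy: "dist x y <= h" using x diam_le[OF L(1), of y x] facet_of_imp_subset[OF L(2)] E(2) by (auto simp: dist_norm)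
  have xz: "dist x z <= 4 * h" using xy zy h dist_triangle[of x z y] by (simp add: dist_commute)
  have "\<bar>?p x - locapp w Gr K1 x\<bar> <= C3 * A"
   using order_trans[OF locapp_star[OF lc z K s1(1) xz] mult_left_mono[OF ge(1)[OF st(1)] C3_pos]] .
  moreover have "\<bar>locapp w Gr K1 x - ?q x\<bar> <= C3 * A"
   using order_trans[OF locapp_star[OF lc y s1(2,3)] mult_left_mono[OF ge(1)[OF st(2)] C3_pos]] xy h by auto
  ultimately show ?thesis by linarith
 qed
 have cont: "u \<in> L2 ?M" if "continuous_on UNIV u" for u :: "pt => real" unfolding e(1)
  using that by (intro L2_arclength_continuous) (auto intro: continuous_on_subset)
 show "continuous_on UNIV u ==> u \<in> L2 (arclength E)" by (rule cont)
 have qL: "?q \<in> L2 ?M" "?p \<in> L2 ?M" unfolding locapp_def by (intro cont continuous_intros)+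
 have w: "w \<in> H1 Om" using lc by (simp add: local_control_def)
 have tL: "?t \<in> L2 ?M" by (rule seg_trace_L2[OF w L])
 have phiL: "?phi \<in> L2 ?M" using e(6) unfolding e(1) by (rule L2_arclength_continuous)
 show "f \<in> L2 (arclength E) ==> integrable (arclength E) (%x. nodal_basis \<T> y x * f x)" by (rule L2_integrable_mult[OF phiL])
 show "integrable (arclength E) (%x. ?t x * ?phi x)" by (rule L2_integrable_mult[OF tL phiL])
 have qp: "(%x. ?q x - ?p x) \<in> L2 ?M" by (rule L2_diff[OF qL])
 have fmE: "finite_measure ?M" and spE: "space ?M = E" "measure ?M E = d" unfolding e(1) d_def by (simp_all add: finite_measure_arclength space_arclength measure_arclength)
 have aA: "a L <= A" "0 <= a L" using ge(2)[of L] s1(3) st(2) lc L(1) by (auto simp: local_control_def)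
 have "sqi ?M (%x. ?t x - ?p x) <= 2 * sqi ?M (%x. ?t x - ?q x) + 2 * sqi ?M (%x. ?q x - ?p x)" by (rule sqi_triangle[OF tL qL])
 also have "... <= 2 * (C1 * h * A^2) + 2 * ((2 * C3 * A)^2 * d)"
 proof -
  have "C1 * h * (a L)^2 <= C1 * h * A^2" using aA C1_pos h by (intro mult_left_mono power_mono) auto
  hence "sqi ?M (%x. ?t x - ?q x) <= C1 * h * A^2" using locapp_trace(1)[OF lc L] by linarith
  moreover have "sqi ?M (%x. ?q x - ?p x) <= (2 * C3 * A)^2 * d"
   using L2_bounded(2)[OF fmE, of "%x. ?q x - ?p x" "2 * C3 * A"] dif qp spE by (simp add: L2_def)
  ultimately show ?thesis by linarith
 qed
 also have "... <= d * (C1 / mu + 8 * C3^2) * A^2"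
 proof -
  have "2 * h * (C1 * A^2) <= d / mu * (C1 * A^2)" using d(1) mu C1_pos by (intro mult_right_mono) (auto simp: field_simps)
  thus ?thesis by (simp add: algebra_simps)
 qed
 finally have s: "sqi ?M (%x. ?t x - ?p x) <= d * (C1 / mu + 8 * C3^2) * A^2" .
 have "norm (?phi x) <= 1" if "x \<in> E" for x
 proof -
  obtain s where s: "s \<in> {0..1}" "x = (1 - s) *\<^sub>R y + s *\<^sub>R v" using \<open>x \<in> E\<close> unfolding e(1) in_segment by auto
  thus ?thesis using e(5)[OF s(1)] by simp
 qed
 hence phi1: "sqi ?M ?phi <= d" using L2_bounded(2)[OF fmE, of ?phi 1] phiL spE by (simp add: L2_def)
 have "(LINT x|?M. (?t x - ?p x) * ?phi x)^2 <= sqi ?M (%x. ?t x - ?p x) * sqi ?M ?phi"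
  by (rule Cauchy_Schwarz_L2[OF L2_diff[OF tL qL(2)] phiL])
 also have "... <= (d * (C1 / mu + 8 * C3^2) * A^2) * d" using s phi1 by (intro mult_mono order_trans[OF sqi_nonneg s]) auto
 also have "... = (C8 * A * d)^2" using C1_pos mu by (simp add: C8_def power_mult_distrib power2_eq_square)
 finally have b: "\<bar>LINT x|?M. (?t x - ?p x) * ?phi x\<bar> <= \<bar>C8 * A * d\<bar>" by (simp only: abs_le_square_iff)
 have "C8 * A * d >= 0" using ge(3) d C1_pos mu by (auto simp: C8_def)
 \<comment> \<open>The hat function has integral d / 2, hence the factor 2 in the claim.\<close>
 moreover have I: "(LINT x|?M. ?phi x) = d / 2"
 proof -
  have c: "continuous_on (closed_segment y v) (%x. ?phi x * 1)" using e(1,6) by simp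
  show ?thesis using LINT_affine_product[OF e(5) _ c, of 1 1] unfolding e(1) d_def by simp
 qed
 ultimately show "\<bar>LINT x|?M. (?t x - ?p x) * ?phi x\<bar> <= C8 * nsum a K * (2 * (LINT x|arclength E. ?phi x))" using b by (simp add: A_def I)
 show "0 < (LINT x|arclength E. ?phi x)" using I d by simp
qed

text \<open>The weighted average of an affine p over the patch of y is p at the centroid, and the
  weights combine the centroids to z. So the nodal value formed from p is p z, and only the average
  of w - p is left to estimate.\<close>

lemma clement_average:
 assumes lc: "local_control w Gr a" and aw: "admissible_weights Om GmT \<T> alpha" and z: "z \<in> vertices \<T>" "z \<in> GmT" and K: "K \<in> star z"
 shows "\<bar>clement_value Om GmT \<T> alpha sg w z - locapp w Gr K z\<bar> <= 2 * C8 * nsum a K"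
proof -
 let ?V = "patch_vertices Om \<T> z" and ?p = "locapp w Gr K" and ?q = "Gr K"
 define k where "k = mean K (%x. w x - Gr K \<bullet> x)"
 have p: "?p x = ?q \<bullet> x + k" for x by (simp add: locapp_def k_def)
 define B where "B y = {E. E \<in> boundary_edges Om \<T> \<and> y \<in> E}" for y
 define m where "m = patch_mass Om \<T>"
 have al: "!!y. y \<in> ?V ==> 0 <= alpha z y" "(\<Sum>y\<in>?V. alpha z y) = 1" "(\<Sum>y\<in>?V. alpha z y *\<^sub>R patch_centroid Om \<T> y) = z"
  using aw z by (auto simp: admissible_weights_def)
 have fB: "finite (B y)" for y using finite_edges by (rule finite_subset[rotated]) (auto simp: B_def boundary_edges_def)
 have BE: "E \<in> edges \<T>" "y \<in> E" if "E \<in> B y" for E y using that by (auto simp: B_def boundary_edges_def)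
 have pi: "patch_integral Om \<T> y F = (\<Sum>E\<in>B y. LINT x|arclength E. F E x)" for y and F :: "pt set => pt => 'b::euclidean_space"
  by (simp add: patch_integral_def B_def)
 have key: "0 < m y" "\<bar>patch_integral Om \<T> y (%E x. seg_trace Om E w x * nodal_basis \<T> y x) / m y - ?p (patch_centroid Om \<T> y)\<bar> <= 2 * C8 * nsum a K"
  if y: "y \<in> ?V" for y
 proof -
  obtain E0 where E0: "E0 \<in> edges \<T>" "z \<in> E0" "y \<in> E0" "E0 \<in> B y" and yv: "y \<in> vertices \<T>"
   using y by (auto simp: patch_vertices_def boundary_edges_def B_def)
  note loc = patch_local[OF lc K z(1) E0(1-3) yv BE]
  let ?phi = "nodal_basis \<T> y"
  have mE: "m y = (\<Sum>E\<in>B y. LINT x|arclength E. ?phi x)" unfolding m_def patch_mass_def pi ..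
  show m0: "0 < m y" unfolding mE using loc(2) E0(4) fB by (intro sum_pos) auto
  have int1: "integrable (arclength E) (%x. ?phi x * (x \<bullet> b))" if "E \<in> B y" for E b
   using that by (intro loc(4)[OF that that] loc(5)[OF that that] continuous_intros)
  have int2: "integrable (arclength E) ?phi" if "E \<in> B y" for E
   using loc(4)[OF that that loc(5)[OF that that, of "%x. 1"]] by simp
  have int3: "integrable (arclength E) (%x. ?phi x * (?q \<bullet> x))" if "E \<in> B y" for E
   using that by (intro loc(4)[OF that that] loc(5)[OF that that] continuous_intros)
  have int4: "integrable (arclength E) (%x. ?phi x *\<^sub>R x)" if "E \<in> B y" for E
  proof -
   have "integrable (arclength E) (%x. \<Sum>b\<in>Basis. (?phi x * (x \<bullet> b)) *\<^sub>R b)"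
    using int1[OF that] by (intro Bochner_Integration.integrable_sum integrable_scaleR_left) auto
   moreover have "(\<Sum>b\<in>Basis. (?phi x * (x \<bullet> b)) *\<^sub>R b) = ?phi x *\<^sub>R x" for x :: pt
    by (subst (3) euclidean_representation[symmetric]) (simp add: scaleR_sum_right)
   ultimately show ?thesis by simp
  qed
  have Ip: "(LINT x|arclength E. ?p x * ?phi x) = ?q \<bullet> (LINT x|arclength E. ?phi x *\<^sub>R x) + k * (LINT x|arclength E. ?phi x)" if "E \<in> B y" for E
  proof -
   have "(LINT x|arclength E. ?p x * ?phi x) = (LINT x|arclength E. ?q \<bullet> (?phi x *\<^sub>R x) + k * ?phi x)" by (simp add: p algebra_simps)
   also have "... = (LINT x|arclength E. ?q \<bullet> (?phi x *\<^sub>R x)) + (LINT x|arclength E. k * ?phi x)"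
    using int2[OF that] int3[OF that] by (intro Bochner_Integration.integral_add) auto
   also have "(LINT x|arclength E. ?q \<bullet> (?phi x *\<^sub>R x)) = ?q \<bullet> (LINT x|arclength E. ?phi x *\<^sub>R x)"
    by (rule integral_inner_right) (use int4[OF that] in simp)
   finally show ?thesis by simp
  qed
  have "m y * ?p (patch_centroid Om \<T> y) = ?q \<bullet> (\<Sum>E\<in>B y. LINT x|arclength E. ?phi x *\<^sub>R x) + k * m y"
   using m0 unfolding p patch_centroid_def pi m_def[symmetric] by (simp add: algebra_simps)
  also have "... = (\<Sum>E\<in>B y. LINT x|arclength E. ?p x * ?phi x)"
   unfolding mE using Ip by (simp add: inner_sum_right sum_distrib_left sum.distrib)
  finally have c: "m y * ?p (patch_centroid Om \<T> y) = (\<Sum>E\<in>B y. LINT x|arclength E. ?p x * ?phi x)" .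
  have pL: "integrable (arclength E) (%x. ?p x * ?phi x)" if "E \<in> B y" for E
   using loc(4)[OF that that loc(5)[OF that that, of ?p]] unfolding p by (simp add: mult.commute continuous_intros)
  have "patch_integral Om \<T> y (%E x. seg_trace Om E w x * ?phi x) - m y * ?p (patch_centroid Om \<T> y) =
    (\<Sum>E\<in>B y. LINT x|arclength E. (seg_trace Om E w x - ?p x) * ?phi x)"
   unfolding c pi using loc(3) pL by (simp add: sum_subtractf[symmetric] left_diff_distrib)
  hence "\<bar>patch_integral Om \<T> y (%E x. seg_trace Om E w x * ?phi x) - m y * ?p (patch_centroid Om \<T> y)\<bar> <=
    (\<Sum>E\<in>B y. C8 * nsum a K * (2 * (LINT x|arclength E. ?phi x)))"
   using loc(1) by (auto intro!: order_trans[OF sum_abs] sum_mono)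
  also have "... = 2 * C8 * nsum a K * m y" unfolding mE sum_distrib_left by (simp add: mult_ac)
  finally have "\<bar>patch_integral Om \<T> y (%E x. seg_trace Om E w x * ?phi x) - m y * ?p (patch_centroid Om \<T> y)\<bar> / m y <= 2 * C8 * nsum a K"
   using m0 by (simp add: field_simps)
  moreover have "\<bar>u - m y * v\<bar> / m y = \<bar>u / m y - v\<bar>" for u v
  proof -
   have "u / m y - v = (u - m y * v) / m y" using m0 by (simp add: field_simps)
   thus ?thesis using m0 by simp
  qed
  ultimately show "\<bar>patch_integral Om \<T> y (%E x. seg_trace Om E w x * ?phi x) / m y - ?p (patch_centroid Om \<T> y)\<bar> <= 2 * C8 * nsum a K" by simp
 qed
 let ?I = "%y. patch_integral Om \<T> y (%E x. seg_trace Om E w x * nodal_basis \<T> y x)"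
 have "?p z = ?q \<bullet> (\<Sum>y\<in>?V. alpha z y *\<^sub>R patch_centroid Om \<T> y) + k * (\<Sum>y\<in>?V. alpha z y)" unfolding al(2,3) p by simp
 also have "... = (\<Sum>y\<in>?V. alpha z y * ?p (patch_centroid Om \<T> y))"
  unfolding p inner_sum_right sum_distrib_left sum.distrib[symmetric] by (simp add: algebra_simps)
 finally have "clement_value Om GmT \<T> alpha sg w z - ?p z = (\<Sum>y\<in>?V. alpha z y * (?I y / m y - ?p (patch_centroid Om \<T> y)))"
  using z(2) by (simp add: clement_value_def m_def sum_subtractf[symmetric] right_diff_distrib)
 also have "\<bar>...\<bar> <= (\<Sum>y\<in>?V. alpha z y * (2 * C8 * nsum a K))"
  using key(2) al(1) by (auto intro!: order_trans[OF sum_abs] sum_mono mult_left_mono simp: abs_mult)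
 also have "... = 2 * C8 * nsum a K" unfolding sum_distrib_right[symmetric] al(2) by simp
 finally show ?thesis .
qed

definition C9 :: real where "C9 = C3 + C4 + 2 * C8"

lemma C9_nonneg: "C9 >= 0" "C4 >= 0" "C8 >= 0" using C3_pos C1_pos mu by (auto simp: C9_def C4_def C8_def)

text \<open>A Scott-Zhang value is first compared on an element with the chosen edge and then,
  through the star of z, on K.\<close>

lemma clement_value_close:
 assumes lc: "local_control w Gr a" and aw: "admissible_weights Om GmT \<T> alpha" and sz: "SZ_edges Om GmD \<T> sg"
  and K: "K \<in> \<T>" and z: "z \<in> verts K"
 shows "\<bar>clement_value Om GmT \<T> alpha sg w z - locapp w Gr K z\<bar> <= C9 * nsum a K"
proof -
 have zv: "z \<in> vertices \<T>" "z \<in> K" "K \<in> star z" using verts_sub[OF K] z K by (auto simp: star_def)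
 note ge = nsum_ge[OF lc K]
 show ?thesis
 proof (cases "z \<in> GmT")
  case True
  have "2 * C8 * nsum a K <= C9 * nsum a K" using ge(3) C3_pos C9_nonneg by (intro mult_right_mono) (auto simp: C9_def)
  thus ?thesis using clement_average[OF lc aw zv(1) True zv(3), of sg] by linarith
 next
  case False
  have sz': "z \<in> sg z" "sg z \<in> edges \<T>" using sz zv(1) by (auto simp: SZ_edges_def)
  obtain L where L: "L \<in> star z" "\<bar>SZ_value Om \<T> sg w z - locapp w Gr L z\<bar> <= C4 * a L"
   by (rule SZ_local[of w Gr a z sg, OF lc zv(1) sz'])
  have st: "star z \<subseteq> nbh K" using star_nbh[OF K zv(2)] h by auto
  have "\<bar>SZ_value Om \<T> sg w z - locapp w Gr L z\<bar> <= C4 * nsum a K"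
   using order_trans[OF L(2) mult_left_mono[OF ge(2) C9_nonneg(2)]] L(1) st by auto
  moreover have "\<bar>locapp w Gr L z - locapp w Gr K z\<bar> <= C3 * nsum a K"
   using order_trans[OF locapp_star[OF lc zv(1) L(1) zv(3)] mult_left_mono[OF ge(1)[OF st] C3_pos]] h by auto
  ultimately have "\<bar>SZ_value Om \<T> sg w z - locapp w Gr K z\<bar> <= C4 * nsum a K + C3 * nsum a K" by linarith
  also have "... <= C9 * nsum a K" using ge(3) C9_nonneg(3) by (auto simp: C9_def algebra_simps)
  finally show ?thesis using False by (simp add: clement_value_def)
 qed
qed

section \<open>The global estimate\<close>

lemma clement_on:
 assumes "K \<in> \<T>" "x \<in> K"
 shows "clement Om GmT \<T> alpha sg w x = (\<Sum>z\<in>verts K. lam K z x * clement_value Om GmT \<T> alpha sg w z)"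
proof -
 have "vertices \<T> \<subseteq> Om \<union> frontier Om" using verts_sub(1) K_props(7) unfolding vertices_eq closure_Un_frontier[symmetric] by blast
 hence V: "interior_vertices Om \<T> \<union> boundary_vertices Om \<T> = vertices \<T>"
  unfolding interior_vertices_def boundary_vertices_def by blast
 have "clement Om GmT \<T> alpha sg w x = (\<Sum>z\<in>vertices \<T>. hat \<T> z x *\<^sub>R clement_value Om GmT \<T> alpha sg w z)"
  unfolding clement_def V by (intro sum.cong) (simp_all add: nodal_basis_eq mult.commute)
 thus ?thesis using hat_sum[OF assms, of "clement_value Om GmT \<T> alpha sg w"] by simp
qed

lemma lam_combination: "(\<Sum>z\<in>S. lam K z x * c z) = (\<Sum>z\<in>S. c z *\<^sub>R lamG K z) \<bullet> x + (\<Sum>z\<in>S. lamC K z * c z)"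
 by (simp add: lam_def inner_sum_left sum.distrib[symmetric] algebra_simps)

lemma clement_pwC1:
 "pwC1 (clement Om GmT \<T> alpha sg w) (%K x. \<Sum>z\<in>verts K. clement_value Om GmT \<T> alpha sg w z *\<^sub>R lamG K z)"
 unfolding pwC1_def
proof
 fix K assume K: "K \<in> \<T>"
 let ?G = "\<Sum>z\<in>verts K. clement_value Om GmT \<T> alpha sg w z *\<^sub>R lamG K z" and ?k = "\<Sum>z\<in>verts K. lamC K z * clement_value Om GmT \<T> alpha sg w z"
 have "((%x. ?G \<bullet> x + ?k) has_derivative (%d. ?G \<bullet> d)) (at x within K)" for x by (auto intro!: derivative_eq_intros)
 hence "(clement Om GmT \<T> alpha sg w has_derivative (%d. ?G \<bullet> d)) (at x within K)" if "x \<in> K" for x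
  by (rule has_derivative_transform[OF that, rotated]) (simp add: clement_on[OF K] lam_combination)
 thus "C1_on K (clement Om GmT \<T> alpha sg w) (%x. ?G)" unfolding C1_on_def by simp
qed

lemma clement_H1_P1: "clement Om GmT \<T> alpha sg w \<in> H1 Om \<inter> P1 \<T>"
proof
 show "clement Om GmT \<T> alpha sg w \<in> H1 Om" by (rule pwC1_H1(1)[OF clement_pwC1])
 show "clement Om GmT \<T> alpha sg w \<in> P1 \<T>" unfolding P1_def affine_fun_on_def
 proof (intro CollectI ballI exI)
  fix K x assume "K \<in> \<T>" "x \<in> interior K"
  thus "clement Om GmT \<T> alpha sg w x = (\<Sum>z\<in>verts K. clement_value Om GmT \<T> alpha sg w z *\<^sub>R lamG K z) \<bullet> x +
    (\<Sum>z\<in>verts K. lamC K z * clement_value Om GmT \<T> alpha sg w z)"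
   using clement_on[of K x] subsetD[OF interior_subset, of x K] lam_combination[of K x _ "verts K"] by simp
 qed
qed

lemma lamG_reproduce:
 assumes "K \<in> \<T>" shows "(\<Sum>z\<in>verts K. (q \<bullet> z + k) *\<^sub>R lamG K z) = q"
proof -
 have "(\<Sum>z\<in>verts K. (q \<bullet> z + k) *\<^sub>R lamG K z) \<bullet> x = q \<bullet> x" for x
  using lam_sum(3)[OF simp2[OF assms], of x q k] lam_sum(3)[OF simp2[OF assms], of 0 q k] unfolding lam_combination by simp
 thus ?thesis using vector_eq_rdot by blast
qed

text \<open>18 = 16 + 2 comes from w minus its local approximation and from the gradient of this
  difference; the other terms come from an affine function bounded by C9 A at the vertices, squared
  and multiplied by the area bound 4 h^2.\<close>

definition C10 :: real where "C10 = 18 + 8 * C9^2 + 18 * C9^2 / mu^2"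

text \<open>On K the interpolant differs from the comparison function by the affine function with
  vertex values \<open>delta\<close>, whose size and gradient follow from these three
  values.\<close>

lemma element_estimate:
 assumes lc: "local_control w Gr a" and aw: "admissible_weights Om GmT \<T> alpha" and sz: "SZ_edges Om GmD \<T> sg" and K: "K \<in> \<T>"
 defines "e \<equiv> %x. w x - clement Om GmT \<T> alpha sg w x"
 shows "sqi (leb (interior K)) e + h^2 * sqi (leb (interior K)) (weak_grad Om e) <= C10 * h^2 * (nsum a K)^2"
proof -
 let ?M = "leb (interior K)" and ?cv = "clement_value Om GmT \<T> alpha sg w" and ?p = "locapp w Gr K" and ?C = "clement Om GmT \<T> alpha sg w"
 define A where "A = nsum a K"
 obtain y where "y \<in> K" using K_props(9)[OF K] interior_subset by blast
 hence "K \<in> nbh K" unfolding nbh_def using K h by (auto intro!: bexI[of _ y])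
 hence A0: "0 <= A" and aA: "a K <= A" "0 <= a K"
  using nsum_ge(3)[OF lc K] nsum_ge(2)[OF lc K, of K] lc K by (auto simp: A_def local_control_def)
 have a2: "(a K)^2 <= A^2" using aA by (intro power_mono) auto
 define delta where "delta z = ?cv z - ?p z" for z
 have delta: "\<bar>delta z\<bar> <= C9 * A" if "z \<in> verts K" for z
  unfolding delta_def A_def by (rule clement_value_close[OF lc aw sz K that])
 have B0: "0 <= C9 * A" using C9_nonneg(1) A0 by simp
 have w: "w \<in> H1 Om" using lc by (simp add: local_control_def)
 have C: "?C \<in> H1 Om" using clement_H1_P1 by blast
 have wL: "w \<in> L2 ?M" "weak_grad Om w \<in> L2 ?M" using sqi_K_le(1)[OF _ K] H1D[OF w opn] by auto
 define r where "r x = (\<Sum>z\<in>verts K. lam K z x * delta z)" for x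
 have cr: "continuous_on UNIV r" unfolding r_def lam_def by (intro continuous_intros)
 have rb: "norm (r x) <= C9 * A" if "x \<in> interior K" for x
 proof -
  have x: "x \<in> K" using that interior_subset by blast
  have l0: "0 <= lam K z x" if "z \<in> verts K" for z using mem_triangle[OF simp2[OF K]] x that by blast
  have "\<bar>r x\<bar> <= (\<Sum>z\<in>verts K. lam K z x * (C9 * A))"
   unfolding r_def using l0 delta by (auto intro!: order_trans[OF sum_abs] sum_mono mult_left_mono simp: abs_mult)
  also have "... = C9 * A" unfolding sum_distrib_right[symmetric] lam_sum(1)[OF simp2[OF K]] by simp
  finally show ?thesis by simp
 qed
 have rm: "r \<in> borel_measurable ?M" by (rule measurable_restrict_space1[OF continuous_imp_measurable_lebesgue[OF cr]])
 have msp: "measure ?M (space ?M) <= 4 * h^2" using area_bounds(2)[OF K] space_measure_K[OF K] by simp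
 have rL: "r \<in> L2 ?M" "sqi ?M r <= (C9 * A)^2 * (4 * h^2)"
  using L2_bounded[OF fm(2)[OF K] rm, of "C9 * A"] rb mult_left_mono[OF msp, of "(C9 * A)^2"] by (auto intro: order_trans)
 have pL: "?p \<in> L2 ?M" unfolding locapp_def
  by (rule sqi_K_le(1)[OF L2_continuous_closure K]) (intro continuous_intros)
 have e_eq: "e x = (w x - ?p x) - r x" if "x \<in> interior K" for x
 proof -
  have x: "x \<in> K" using that interior_subset by blast
  have "?p x = (\<Sum>z\<in>verts K. lam K z x * ?p z)"
   using lam_sum(3)[OF simp2[OF K], of x "Gr K" "mean K (%x. w x - Gr K \<bullet> x)"] by (simp add: locapp_def)
  hence "r x = ?C x - ?p x" unfolding clement_on[OF K x] r_def delta_def by (simp add: right_diff_distrib sum_subtractf)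
  thus ?thesis by (simp add: e_def)
 qed
 have "sqi ?M e = sqi ?M (%x. (w x - ?p x) - r x)"
  unfolding sqi_def by (intro Bochner_Integration.integral_cong) (use e_eq in auto)
 also have "... <= 2 * sqi ?M (%x. w x - ?p x) + 2 * sqi ?M r" by (rule sqi_diff_le[OF L2_diff[OF wL(1) pL] rL(1)])
 also have "... <= 2 * (8 * h^2 * A^2) + 2 * ((C9 * A)^2 * (4 * h^2))"
  using order_trans[OF locapp_L2[OF lc K] mult_left_mono[OF a2, of "8 * h^2"]] rL(2) by simp
 also have "... = (16 + 8 * C9^2) * (h^2 * A^2)" by (simp add: algebra_simps power_mult_distrib)
 finally have 1: "sqi ?M e <= (16 + 8 * C9^2) * (h^2 * A^2)" .
 define g where "g = (\<Sum>z\<in>verts K. delta z *\<^sub>R lamG K z)"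
 have "norm g <= (\<Sum>z\<in>verts K. C9 * A * (1 / (2 * mu * h)))"
  unfolding g_def
 proof (rule order_trans[OF norm_sum], rule sum_mono)
  fix z assume "z \<in> verts K"
  thus "norm (delta z *\<^sub>R lamG K z) <= C9 * A * (1 / (2 * mu * h))"
   unfolding norm_scaleR real_norm_def by (intro mult_mono delta lamG_bound[OF K] B0) auto
 qed
 also have "... = 3 * (C9 * A) / (2 * mu * h)" using K_props(3)[OF K] by simp
 finally have g: "norm g <= 3 * (C9 * A) / (2 * mu * h)" .
 have G: "(\<Sum>z\<in>verts K. ?cv z *\<^sub>R lamG K z) = Gr K + g"
  using lamG_reproduce[OF K, of "Gr K" "mean K (%x. w x - Gr K \<bullet> x)"]
  unfolding g_def delta_def locapp_def by (simp add: scaleR_left_diff_distrib sum_subtractf)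
 from AE_interior_sub[OF K H1_diff(2)[OF opn w C]] pwC1_H1(3)[OF clement_pwC1 K, of GmT alpha sg w]
 have ae: "AE x in ?M. weak_grad Om e x = (weak_grad Om w x - Gr K) - g"
  unfolding e_def G by eventually_elim (simp add: algebra_simps)
 have eL: "weak_grad Om e \<in> L2 ?M" unfolding e_def using sqi_K_le(1)[OF H1D(2)[OF H1_diff(1)[OF opn w C] opn] K] .
 have dL: "(%x. weak_grad Om w x - Gr K) \<in> L2 ?M" by (rule L2_diff[OF wL(2) L2_const[OF fm(2)[OF K]]])
 have gL: "(%x. g) \<in> L2 ?M" "sqi ?M (%x. g) <= (3 * (C9 * A) / (2 * mu * h))^2 * (4 * h^2)"
  using L2_bounded[OF fm(2)[OF K], of "%x. g" "3 * (C9 * A) / (2 * mu * h)"] g mult_left_mono[OF msp, of "(3 * (C9 * A) / (2 * mu * h))^2"]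
  by (auto intro: order_trans)
 have "sqi ?M (weak_grad Om e) = sqi ?M (%x. (weak_grad Om w x - Gr K) - g)"
  using ae eL L2_diff[OF dL gL(1)] by (intro sqi_cong_AE) (auto simp: L2_def)
 also have "... <= 2 * sqi ?M (%x. weak_grad Om w x - Gr K) + 2 * sqi ?M (%x. g)" by (rule sqi_diff_le[OF dL gL(1)])
 also have "... <= 2 * A^2 + 2 * ((3 * (C9 * A) / (2 * mu * h))^2 * (4 * h^2))"
 proof -
  have "sqi ?M (%x. weak_grad Om w x - Gr K) <= (a K)^2" using lc K by (auto simp: local_control_def)
  thus ?thesis using a2 gL(2) by linarith
 qed
 also have "... = (2 + 18 * C9^2 / mu^2) * A^2" using h mu by (simp add: field_simps power2_eq_square)
 finally have 2: "sqi ?M (weak_grad Om e) <= (2 + 18 * C9^2 / mu^2) * A^2" .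
 have "sqi ?M e + h^2 * sqi ?M (weak_grad Om e) <= (16 + 8 * C9^2) * (h^2 * A^2) + h^2 * ((2 + 18 * C9^2 / mu^2) * A^2)"
  by (intro add_mono 1 mult_left_mono 2) simp
 also have "... = C10 * h^2 * A^2" unfolding C10_def by (simp add: algebra_simps)
 finally show ?thesis by (simp add: A_def)
qed

text \<open>Cauchy-Schwarz costs one factor \<open>card (nbh K)\<close>. After exchanging the sums,
  symmetry of the neighbour relation shows that each element is counted at most 64 / mu^2 times, the
  second factor.\<close>

lemma nsum_sq_sum:
 assumes "!!K. K \<in> \<T> ==> 0 <= a K"
 shows "(\<Sum>K\<in>\<T>. (nsum a K)^2) <= (64 / mu^2)^2 * (\<Sum>K\<in>\<T>. (a K)^2)"
proof -
 let ?N = "64 / mu^2"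
 have "(nsum a K)^2 <= ?N * (\<Sum>K'\<in>nbh K. (a K')^2)" if K: "K \<in> \<T>" for K
 proof -
  have "(nsum a K)^2 <= real (card (nbh K)) * (\<Sum>K'\<in>nbh K. (a K')^2)"
   using Cauchy_Schwarz_ineq_sum[of "%_. 1" a "nbh K"] by (simp add: nsum_def)
  also have "... <= ?N * (\<Sum>K'\<in>nbh K. (a K')^2)" using nbh_card(1)[OF K] by (intro mult_right_mono sum_nonneg) auto
  finally show ?thesis .
 qed
 hence 1: "(\<Sum>K\<in>\<T>. (nsum a K)^2) <= ?N * (\<Sum>K\<in>\<T>. \<Sum>K'\<in>nbh K. (a K')^2)"
  unfolding sum_distrib_left[of ?N _ \<T>] by (rule sum_mono)
 have "(\<Sum>K\<in>\<T>. \<Sum>K'\<in>nbh K. (a K')^2) = (\<Sum>K\<in>\<T>. \<Sum>K'\<in>\<T>. if K' \<in> nbh K then (a K')^2 else 0)"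
  using nbh_card(3) fin by (intro sum.cong[OF refl, of \<T>]) (simp add: sum.inter_restrict[symmetric] Int_absorb1)
 also have "... = (\<Sum>K'\<in>\<T>. \<Sum>K\<in>\<T>. if K' \<in> nbh K then (a K')^2 else 0)" by (rule sum.swap)
 also have "... = (\<Sum>K'\<in>\<T>. \<Sum>K\<in>\<T>. if K \<in> nbh K' then (a K')^2 else 0)"
  using nbh_sym by (intro sum.cong refl if_cong) auto
 also have "... = (\<Sum>K'\<in>\<T>. real (card (nbh K')) * (a K')^2)"
  using nbh_card(3) fin by (intro sum.cong[OF refl, of \<T>]) (simp add: sum.inter_restrict[symmetric] Int_absorb1)
 also have "... <= (\<Sum>K'\<in>\<T>. ?N * (a K')^2)" using nbh_card(1) by (intro sum_mono mult_right_mono) auto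
 finally have "(\<Sum>K\<in>\<T>. \<Sum>K'\<in>nbh K. (a K')^2) <= ?N * (\<Sum>K\<in>\<T>. (a K)^2)" unfolding sum_distrib_left .
 hence "?N * (\<Sum>K\<in>\<T>. \<Sum>K'\<in>nbh K. (a K')^2) <= ?N * (?N * (\<Sum>K\<in>\<T>. (a K)^2))" by (rule mult_left_mono) simp
 with 1 show ?thesis unfolding power2_eq_square[of ?N] mult.assoc by (rule order_trans)
qed

text \<open>The sum of the roots of X and Y is at most twice the root of X + Y, hence 128 = 2 *
  64.\<close>

lemma global_estimate:
 assumes lc: "local_control w Gr a" and aw: "admissible_weights Om GmT \<T> alpha" and sz: "SZ_edges Om GmD \<T> sg"
 defines "e \<equiv> %x. w x - clement Om GmT \<T> alpha sg w x"
 shows "L2_norm (leb Om) e + h * L2_norm (leb Om) (weak_grad Om e) <= 128 / mu^2 * sqrt C10 * h * sqrt (\<Sum>K\<in>\<T>. (a K)^2)"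
proof -
 have w: "w \<in> H1 Om" using lc by (simp add: local_control_def)
 have eH: "e \<in> H1 Om" unfolding e_def using H1_diff(1)[OF opn w] clement_H1_P1 by blast
 define S where "S = (\<Sum>K\<in>\<T>. (a K)^2)"
 have S0: "S >= 0" unfolding S_def by (intro sum_nonneg) auto
 have c0: "C10 >= 0" by (simp add: C10_def)
 define X where "X = sqi (leb Om) e"
 define Y where "Y = h^2 * sqi (leb Om) (weak_grad Om e)"
 have X0: "X >= 0" "Y >= 0" by (auto simp: X_def Y_def)
 have "X + Y = (\<Sum>K\<in>\<T>. sqi (leb (interior K)) e + h^2 * sqi (leb (interior K)) (weak_grad Om e))"
  unfolding X_def Y_def sqi_split[OF H1D(1)[OF eH opn]] sqi_split[OF H1D(2)[OF eH opn]] by (simp add: sum.distrib sum_distrib_left)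
 also have "... <= (\<Sum>K\<in>\<T>. C10 * h^2 * (nsum a K)^2)" unfolding e_def by (intro sum_mono element_estimate[OF lc aw sz])
 also have "... = C10 * h^2 * (\<Sum>K\<in>\<T>. (nsum a K)^2)" by (simp add: sum_distrib_left)
 also have "... <= C10 * h^2 * ((64 / mu^2)^2 * S)"
  unfolding S_def using lc c0 by (intro mult_left_mono nsum_sq_sum) (auto simp: local_control_def)
 also have "... = (64 / mu^2 * sqrt C10 * h * sqrt S)^2" using c0 S0 by (simp add: power_mult_distrib power_divide)
 finally have XY: "X + Y <= (64 / mu^2 * sqrt C10 * h * sqrt S)^2" .
 have "sqrt X <= sqrt (X + Y)" "sqrt Y <= sqrt (X + Y)" using X0 by auto
 moreover have "sqrt (X + Y) <= 64 / mu^2 * sqrt C10 * h * sqrt S"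
  using real_sqrt_le_mono[OF XY] h c0 S0 by simp
 moreover have "L2_norm (leb Om) e = sqrt X" "h * L2_norm (leb Om) (weak_grad Om e) = sqrt Y"
  using h by (auto simp: L2_norm_eq X_def Y_def real_sqrt_mult)
 ultimately show ?thesis unfolding S_def[symmetric] by linarith
qed

end

context qmesh begin

section \<open>Local control by Sobolev seminorms\<close>

text \<open>For s = 0 the gradient is compared with zero, which has no jumps.\<close>

lemma control_H1:
 assumes "w \<in> H1 Om"
 shows "local_control w (%_. 0) (%K. sqrt (sqi (leb (interior K)) (weak_grad Om w)))"
 using assms by (simp add: local_control_def)

lemma sum_control_H1:
 assumes "w \<in> H1 Om"
 shows "(\<Sum>K\<in>\<T>. (sqrt (sqi (leb (interior K)) (weak_grad Om w)))^2) = sqi (leb Om) (weak_grad Om w)"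
 using sqi_split[OF H1D(2)[OF assms opn]] by simp

text \<open>The oscillation of the gradient is bounded by the Poincare inequality for its
  components. The jumps are those of the element means, which are \<open>locapp\<close> with zero
  gradient, so \<open>locapp_jump\<close> bounds them component by component.\<close>

lemma control_H2:
 assumes w: "w \<in> H1 Om" and g: "!!i. (%x. weak_grad Om w x $ i) \<in> H1 Om"
 defines "b \<equiv> %K i. sqrt (sqi (leb (interior K)) (weak_grad Om (%x. weak_grad Om w x $ i)))"
 shows "local_control w (%K. \<chi> i. mean K (%x. weak_grad Om w x $ i)) (%K. h * C2 * (\<Sum>i\<in>UNIV. b K i))"
  "(\<Sum>K\<in>\<T>. (h * C2 * (\<Sum>i\<in>UNIV. b K i))^2) <= (2 * C2 * h)^2 * (\<Sum>i\<in>UNIV. sqi (leb Om) (weak_grad Om (%x. weak_grad Om w x $ i)))"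
proof -
 have b0: "0 <= b K i" for K i by (simp add: b_def)
 have bsq: "(b K i)^2 = sqi (leb (interior K)) (weak_grad Om (%x. weak_grad Om w x $ i))" for K i by (simp add: b_def)
 have c0: "0 <= C2" using C2_ge by simp
 have 1: "sqi (leb (interior K)) (%x. weak_grad Om w x - (\<chi> i. mean K (%x. weak_grad Om w x $ i))) <= (h * C2 * (\<Sum>i\<in>UNIV. b K i))^2"
  if K: "K \<in> \<T>" for K
 proof -
  let ?M = "leb (interior K)"
  have "(%x. weak_grad Om w x - (\<chi> i. mean K (%x. weak_grad Om w x $ i))) \<in> L2 ?M"
   by (rule L2_diff[OF sqi_K_le(1)[OF H1D(2)[OF w opn] K] L2_const[OF fm(2)[OF K]]])
  hence "sqi ?M (%x. weak_grad Om w x - (\<chi> i. mean K (%x. weak_grad Om w x $ i))) =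
    (\<Sum>i\<in>UNIV. sqi ?M (%x. weak_grad Om w x $ i - mean K (%x. weak_grad Om w x $ i)))"
   by (subst sqi_vec) simp_all
  also have "... <= (\<Sum>i\<in>UNIV. 8 * h^2 * (b K i)^2)"
   unfolding bsq using h by (intro sum_mono poincare_H1[OF g K] diam_le[OF K]) auto
  also have "... = 8 * h^2 * (\<Sum>i\<in>UNIV. (b K i)^2)" by (simp add: sum_distrib_left)
  also have "... <= (h * C2)^2 * (\<Sum>i\<in>UNIV. b K i)^2"
  proof (rule mult_mono)
   \<comment> \<open>C2 is at least 5, so the quantity chosen for the jumps also dominates the
     Poincare constant.\<close>
   have "8 <= C2^2" using power_mono[OF C2_ge, of 2] by simp
   hence "8 * h^2 <= C2^2 * h^2" by (rule mult_right_mono) simp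
   thus "8 * h^2 <= (h * C2)^2" by (simp add: power_mult_distrib mult.commute)
   show "(\<Sum>i\<in>UNIV. (b K i)^2) <= (\<Sum>i\<in>UNIV. b K i)^2" using b0 by (simp add: sum_2 power2_sum)
  qed (auto intro: sum_nonneg)
  finally show ?thesis by (simp add: power_mult_distrib)
 qed
 have 2: "h * norm ((\<chi> i. mean K (%x. weak_grad Om w x $ i)) - (\<chi> i. mean K' (%x. weak_grad Om w x $ i))) <=
   h * C2 * (\<Sum>i\<in>UNIV. b K i) + h * C2 * (\<Sum>i\<in>UNIV. b K' i)"
  if K: "K \<in> \<T>" "K' \<in> \<T>" "z ~= y" "verts K \<inter> verts K' = {z, y}" for K K' z y
 proof -
  have "\<bar>mean K (%x. weak_grad Om w x $ i) - mean K' (%x. weak_grad Om w x $ i)\<bar> <= C2 * (b K i + b K' i)" for i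
   using locapp_jump[OF control_H1[OF g[of i]] K(1,2,4,3), of z] h by (simp add: locapp_def b_def)
  hence "norm ((\<chi> i. mean K (%x. weak_grad Om w x $ i)) - (\<chi> i. mean K' (%x. weak_grad Om w x $ i))) <= (\<Sum>i\<in>UNIV. C2 * (b K i + b K' i))"
   by (intro order_trans[OF norm_le_l1_cart] sum_mono) simp
  hence "h * norm ((\<chi> i. mean K (%x. weak_grad Om w x $ i)) - (\<chi> i. mean K' (%x. weak_grad Om w x $ i))) <= h * (\<Sum>i\<in>UNIV. C2 * (b K i + b K' i))"
   using h by (intro mult_left_mono) auto
  thus ?thesis by (simp add: sum_distrib_left[symmetric] sum.distrib distrib_left mult.assoc)
 qed
 show "local_control w (%K. \<chi> i. mean K (%x. weak_grad Om w x $ i)) (%K. h * C2 * (\<Sum>i\<in>UNIV. b K i))"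
  unfolding local_control_def using w 1 2 b0 c0 h by (auto intro!: mult_nonneg_nonneg sum_nonneg)
 have "(h * C2 * (\<Sum>i\<in>UNIV. b K i))^2 <= (2 * C2 * h)^2 * (\<Sum>i\<in>UNIV. (b K i)^2)" for K
 proof -
  have "(\<Sum>i\<in>UNIV. b K i)^2 <= 4 * (\<Sum>i\<in>UNIV. (b K i)^2)"
   using norm_add_sq_le[of "b K 1" "b K 2"] zero_le_power2[of "b K 1"] zero_le_power2[of "b K 2"]
   unfolding sum_2 real_norm_def power2_abs distrib_left by linarith
  hence "(h * C2)^2 * (\<Sum>i\<in>UNIV. b K i)^2 <= (h * C2)^2 * (4 * (\<Sum>i\<in>UNIV. (b K i)^2))" by (rule mult_left_mono) simp
  thus ?thesis by (simp add: power_mult_distrib mult_ac)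
 qed
 hence "(\<Sum>K\<in>\<T>. (h * C2 * (\<Sum>i\<in>UNIV. b K i))^2) <= (2 * C2 * h)^2 * (\<Sum>K\<in>\<T>. \<Sum>i\<in>UNIV. (b K i)^2)"
  unfolding sum_distrib_left[of "(2 * C2 * h)^2" _ \<T>] by (intro sum_mono)
 also have "(\<Sum>K\<in>\<T>. \<Sum>i\<in>UNIV. (b K i)^2) = (\<Sum>i\<in>UNIV. sqi (leb Om) (weak_grad Om (%x. weak_grad Om w x $ i)))"
  unfolding b_def by (subst sum.swap) (intro sum.cong refl sum_control_H1 g)
 finally show "(\<Sum>K\<in>\<T>. (h * C2 * (\<Sum>i\<in>UNIV. b K i))^2) <= (2 * C2 * h)^2 * (\<Sum>i\<in>UNIV. sqi (leb Om) (weak_grad Om (%x. weak_grad Om w x $ i)))" .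
qed

text \<open>Points x in K and y in a touching element are at most 2 h apart, so the kernel bounds
  the squared difference of the gradients; averaging over y compares the gradient at x with a mean.
  Since \<open>b K\<close> integrates the kernel over K times the whole domain, the sum over K is
  exactly the squared seminorm.\<close>

lemma control_slobodeckij:
 assumes w: "w \<in> H1 Om" and s: "0 < s" "s < 1"
  and int: "integrable (leb Om \<Otimes>\<^sub>M leb Om) (slobodeckij_kernel s (weak_grad Om w))"
 obtains Gr a where "local_control w Gr a"
  "(\<Sum>K\<in>\<T>. (a K)^2) <= ((4 / mu + 8 / mu^2) * h powr s)^2 * (LINT z|(leb Om \<Otimes>\<^sub>M leb Om). slobodeckij_kernel s (weak_grad Om w) z)"
proof -
 let ?M = "leb Om"
 define g where "g = weak_grad Om w"
 define k where "k = slobodeckij_kernel s g"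
 define F where "F x = (LINT y|?M. k (x, y))" for x
 define Gr where "Gr K = (\<chi> i. mean K (%x. g x $ i))" for K
 define b where "b K = (LINT x|leb (interior K). F x)" for K
 define a where "a K = (4 / mu + 8 / mu^2) * h powr s * sqrt (b K)" for K
 interpret f1: finite_measure ?M by (rule fm(1))
 interpret pair_sigma_finite ?M ?M ..
 have int': "integrable (?M \<Otimes>\<^sub>M ?M) k" using int by (simp add: k_def g_def)
 have F: "integrable ?M F" "(LINT x|?M. F x) = (LINT z|(?M \<Otimes>\<^sub>M ?M). k z)"
  unfolding F_def by (rule integrable_fst'[OF int'], rule integral_fst'[OF int'])
 have k0: "0 <= k z" for z by (simp add: k_def slobodeckij_kernel_def split: prod.split)
 have F0: "0 <= F x" for x unfolding F_def using k0 by (rule Bochner_Integration.integral_nonneg)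
 have b0: "0 <= b K" for K unfolding b_def using F0 by (rule Bochner_Integration.integral_nonneg)
 have gL: "g \<in> L2 (leb (interior K))" if "K \<in> \<T>" for K unfolding g_def by (rule sqi_K_le(1)[OF H1D(2)[OF w opn] that])
 have giL: "(%x. g x $ i) \<in> L2 (leb (interior K))" if "K \<in> \<T>" for K i using sqi_nth[OF gL[OF that]] by blast
 \<comment> \<open>(2 h)^(2 + 2 s) is at most 16 h^2 h^(2 s), because 2 + 2 s <= 4.\<close>
 have pt: "(norm (g x - g y))^2 <= 16 * h^2 * h powr (2 * s) * k (x, y)" if "norm (x - y) <= 2 * h" for x y
 proof (cases "x = y")
  case False
  have "norm (x - y) powr (2 + 2 * s) <= (2 * h) powr (2 + 2 * s)" using that s by (intro powr_mono2) auto
  also have "... = 2 powr (2 + 2 * s) * (h^2 * h powr (2 * s))" using h by (simp add: powr_mult powr_add[of h])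
  also have "... <= 16 * (h^2 * h powr (2 * s))"
  proof (rule mult_right_mono)
   have "2 powr (2 + 2 * s) <= 2 powr (4::real)" using s by (intro powr_mono) auto
   thus "2 powr (2 + 2 * s) <= (16::real)" by simp
  qed simp
  finally have "k (x, y) * norm (x - y) powr (2 + 2 * s) <= k (x, y) * (16 * (h^2 * h powr (2 * s)))" using k0 by (rule mult_left_mono)
  moreover have "k (x, y) * norm (x - y) powr (2 + 2 * s) = (norm (g x - g y))^2" using False by (simp add: k_def slobodeckij_kernel_def)
  ultimately show ?thesis by (simp add: mult_ac)
 qed (simp add: k0)
 have dev: "sqi (leb (interior K)) (%x. g x - Gr K') <= 16 / mu^2 * h powr (2 * s) * b K"
  if K: "K \<in> \<T>" "K' \<in> \<T>" "K \<inter> K' ~= {}" for K K'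
 proof -
  let ?N = "leb (interior K)" and ?N' = "leb (interior K')"
  have d2: "norm (x - y) <= 2 * h" if "x \<in> interior K" "y \<in> interior K'" for x y
  proof -
   obtain v where v: "v \<in> K" "v \<in> K'" using K(3) by blast
   have "norm (x - v) <= h" "norm (v - y) <= h"
    using diam_le[OF K(1) v(1), of x] diam_le[OF K(2) _ v(2), of y] that interior_subset by blast+
   thus ?thesis using norm_triangle_ineq[of "x - v" "v - y"] by simp
  qed
  \<comment> \<open>Fubini provides integrable slices only for almost every x.\<close>
  have ae: "AE x in ?N. integrable ?M (%y. k (x, y))" by (rule AE_interior_sub[OF K(1) AE_integrable_fst'[OF int']])
  have step: "(norm (g x - Gr K'))^2 <= 16 / mu^2 * h powr (2 * s) * F x" if x: "x \<in> interior K" and i: "integrable ?M (%y. k (x, y))" for x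
  proof -
   have xL: "(%y. g x - g y) \<in> L2 ?N'" by (rule L2_diff[OF L2_const[OF fm(2)[OF K(2)]] gL[OF K(2)]])
   have comp: "(g x - Gr K') $ i = mean K' (%y. g x $ i - g y $ i)" for i
   proof -
    have "mean K' (%y. g x $ i - g y $ i) = mean K' (%y. g x $ i) - mean K' (%y. g y $ i)"
     by (rule mean_diff[OF K(2) L2_const[OF fm(2)[OF K(2)]] giL[OF K(2)]])
    moreover have "mean K' (%y. g x $ i) = g x $ i"
     using space_measure_K[OF K(2)] measure_K_pos[OF K(2)] by (simp add: mean_def)
    ultimately show ?thesis by (simp add: Gr_def)
   qed
   have "(mu * h)^2 * (norm (g x - Gr K'))^2 <= measure lebesgue K' * (norm (g x - Gr K'))^2"
    using area_bounds(1)[OF K(2)] by (rule mult_right_mono) simp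
   also have "... = (\<Sum>i\<in>UNIV. (mean K' (%y. g x $ i - g y $ i))^2 * measure lebesgue K')"
    by (simp add: norm_vec_def L2_set_def comp[symmetric] sum_nonneg sum_distrib_left mult.commute)
   also have "... <= (\<Sum>i\<in>UNIV. sqi ?N' (%y. (g x - g y) $ i))"
    using sqi_nth[OF xL] by (intro sum_mono) (use mean_sq_le[OF K(2)] in auto)
   also have "... = sqi ?N' (%y. g x - g y)" by (rule sqi_vec[OF xL, symmetric])
   also have "... <= (LINT y|?N'. 16 * h^2 * h powr (2 * s) * k (x, y))"
    unfolding sqi_def using integral_split(2)[OF i K(2)] pt d2[OF x] L2_integrable_sq[OF xL]
    by (intro integral_mono) auto
   also have "... = 16 * h^2 * h powr (2 * s) * (LINT y|?N'. k (x, y))" by simp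
   also have "... <= 16 * h^2 * h powr (2 * s) * F x"
   proof (rule mult_left_mono)
    show "(LINT y|?N'. k (x, y)) <= F x" unfolding F_def integral_split(1)[OF i]
     using k0 fin K(2) by (intro member_le_sum Bochner_Integration.integral_nonneg) auto
   qed simp
   finally show ?thesis using h mu by (simp add: field_simps power_mult_distrib)
  qed
  have GL: "(%x. g x - Gr K') \<in> L2 ?N" by (rule L2_diff[OF gL[OF K(1)] L2_const[OF fm(2)[OF K(1)]]])
  have "sqi ?N (%x. g x - Gr K') <= (LINT x|?N. 16 / mu^2 * h powr (2 * s) * F x)"
   unfolding sqi_def
  proof (rule integral_mono_AE[OF L2_integrable_sq[OF GL]])
   show "integrable ?N (%x. 16 / mu^2 * h powr (2 * s) * F x)" using integral_split(2)[OF F(1) K(1)] by simp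
   show "AE x in ?N. (norm (g x - Gr K'))^2 <= 16 / mu^2 * h powr (2 * s) * F x"
    using ae AE_space by eventually_elim (use step in auto)
  qed
  thus ?thesis by (simp add: b_def)
 qed
 have hs: "h powr (2 * s) = (h powr s)^2" using h by (simp add: powr_power)
 have "local_control w Gr a" unfolding local_control_def
 proof (intro conjI ballI allI impI)
  show "w \<in> H1 Om" by (rule w)
 next
  fix K assume K: "K \<in> \<T>"
  show "0 <= a K" using b0 mu by (simp add: a_def)
  have "sqi (leb (interior K)) (%x. g x - Gr K) <= 16 / mu^2 * h powr (2 * s) * b K" using dev[OF K K] K_props(9)[OF K] interior_subset by auto
  also have "... = (4 / mu * h powr s * sqrt (b K))^2" using b0 by (simp add: power_mult_distrib power_divide hs)
  also have "... <= (a K)^2" unfolding a_def using mu b0 by (intro power_mono mult_right_mono) auto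
  finally show "sqi (leb (interior K)) (%x. weak_grad Om w x - Gr K) <= (a K)^2" by (simp add: g_def)
 next
  fix K K' z y assume K: "K \<in> \<T>" "K' \<in> \<T>" and zy: "z ~= y \<and> verts K \<inter> verts K' = {z, y}"
  let ?N = "leb (interior K)"
  have ne: "K \<inter> K' ~= {}" "K \<inter> K ~= {}" using zy verts_sub(1)[OF K(1)] verts_sub(1)[OF K(2)] by blast+
  have L: "(%x. g x - Gr J) \<in> L2 ?N" for J by (rule L2_diff[OF gL[OF K(1)] L2_const[OF fm(2)[OF K(1)]]])
  \<comment> \<open>The difference of the two constants is measured on K, where g is close to both;
    the area bound supplies a second factor 1 / mu.\<close>
  have "(mu * h)^2 * (norm (Gr K - Gr K'))^2 <= measure lebesgue K * (norm (Gr K - Gr K'))^2"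
   using area_bounds(1)[OF K(1)] by (rule mult_right_mono) simp
  also have "... = sqi ?N (%x. (g x - Gr K') - (g x - Gr K))" using space_measure_K[OF K(1)] by (simp add: sqi_def)
  also have "... <= 2 * sqi ?N (%x. g x - Gr K') + 2 * sqi ?N (%x. g x - Gr K)" by (rule sqi_diff_le[OF L L])
  also have "... <= 64 / mu^2 * h powr (2 * s) * b K" using dev[OF K ne(1)] dev[OF K(1,1) ne(2)] by simp
  finally have "(h * norm (Gr K - Gr K'))^2 <= 64 / mu^2 * h powr (2 * s) * b K / mu^2"
   using mu by (simp add: field_simps power_mult_distrib)
  also have "... = (8 / mu^2 * h powr s * sqrt (b K))^2" using b0 by (simp add: power_mult_distrib power_divide hs power2_eq_square)
  finally have "\<bar>h * norm (Gr K - Gr K')\<bar> <= \<bar>8 / mu^2 * h powr s * sqrt (b K)\<bar>" by (simp only: abs_le_square_iff)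
  hence "h * norm (Gr K - Gr K') <= 8 / mu^2 * h powr s * sqrt (b K)" using h b0 by simp
  also have "... <= a K" unfolding a_def using mu b0 by (intro mult_right_mono) auto
  also have "... <= a K + a K'" using b0 mu by (simp add: a_def)
  finally show "h * norm (Gr K - Gr K') <= a K + a K'" .
 qed
 moreover have "(\<Sum>K\<in>\<T>. (a K)^2) = ((4 / mu + 8 / mu^2) * h powr s)^2 * (LINT z|(?M \<Otimes>\<^sub>M ?M). k z)"
  unfolding F(2)[symmetric] integral_split(1)[OF F(1)] a_def b_def[symmetric] power_mult_distrib sum_distrib_left
  using b0 by simp
 ultimately show thesis using that by (simp add: k_def g_def)
qed

text \<open>\<open>2 * C2\<close> serves s = 1 and the two following terms serve 0 < s < 1; for s =
  0 a factor of at least 1 is enough.\<close>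

definition C11 :: real where "C11 = 128 / mu^2 * sqrt C10 * (2 * C2 + 4 / mu + 8 / mu^2)"

lemma clement_estimate:
 assumes s: "0 <= s" "s <= 1" and w: "w \<in> H1plus s Om" and aw: "admissible_weights Om GmT \<T> alpha" and sz: "SZ_edges Om GmD \<T> sg"
 shows "L2_norm (leb Om) (%x. w x - clement Om GmT \<T> alpha sg w x) +
  h * L2_norm (leb Om) (weak_grad Om (%x. w x - clement Om GmT \<T> alpha sg w x)) <= C11 * h powr (1 + s) * H1plus_seminorm s Om w"
proof -
 define B where "B = 2 * C2 + 4 / mu + 8 / mu^2"
 have w1: "w \<in> H1 Om" using w by (simp add: H1plus_def)
 have sn: "0 <= H1plus_seminorm s Om w"
  by (auto simp: H1plus_seminorm_def L2_norm_eq slobodeckij_kernel_def intro!: sum_nonneg Bochner_Integration.integral_nonneg split: prod.split)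
 have "0 <= 4 / mu" "0 <= 8 / mu^2" using mu by auto
 moreover have "5 <= C2" by (rule C2_ge)
 ultimately have B: "1 <= B" "2 * C2 <= B" "4 / mu + 8 / mu^2 <= B" "0 <= 4 / mu + 8 / mu^2" unfolding B_def by linarith+
 obtain Gr a where lc: "local_control w Gr a" and a: "sqrt (\<Sum>K\<in>\<T>. (a K)^2) <= B * h powr s * H1plus_seminorm s Om w"
 proof -
  consider "s = 0" | "s = 1" | "0 < s" "s < 1" using s by linarith
  thus thesis
  proof cases
   case 1
   show thesis
   proof (rule that[OF control_H1[OF w1]])
    have "sqrt (\<Sum>K\<in>\<T>. (sqrt (sqi (leb (interior K)) (weak_grad Om w)))^2) = 1 * H1plus_seminorm s Om w"
     unfolding sum_control_H1[OF w1] using 1 by (simp add: H1plus_seminorm_def L2_norm_eq)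
    also have "... <= B * H1plus_seminorm s Om w" using B(1) sn by (rule mult_right_mono)
    finally show "sqrt (\<Sum>K\<in>\<T>. (sqrt (sqi (leb (interior K)) (weak_grad Om w)))^2) <= B * h powr s * H1plus_seminorm s Om w"
     using 1 h by simp
   qed
  next
   case 2
   have g: "(%x. weak_grad Om w x $ i) \<in> H1 Om" for i using w 2 by (simp add: H1plus_def)
   show thesis
   proof (rule that[OF control_H2(1)[OF w1 g]])
    note real_sqrt_le_mono[OF control_H2(2)[OF w1 g]]
    also have "sqrt ((2 * C2 * h)^2 * (\<Sum>i\<in>UNIV. sqi (leb Om) (weak_grad Om (%x. weak_grad Om w x $ i)))) = 2 * C2 * (h * H1plus_seminorm s Om w)"
     using 2 h C2_ge by (simp add: real_sqrt_mult H1plus_seminorm_def L2_norm_sq)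
    also have "... <= B * (h * H1plus_seminorm s Om w)" using B(2) sn h by (intro mult_right_mono) auto
    finally show "sqrt (\<Sum>K\<in>\<T>. (h * C2 * (\<Sum>i\<in>UNIV. sqrt (sqi (leb (interior K)) (weak_grad Om (%x. weak_grad Om w x $ i)))))^2) <= B * h powr s * H1plus_seminorm s Om w"
     using 2 h by (simp add: mult.assoc)
   qed
  next
   case 3
   have int: "integrable (leb Om \<Otimes>\<^sub>M leb Om) (slobodeckij_kernel s (weak_grad Om w))" using w 3 by (simp add: H1plus_def)
   show thesis
   proof (rule control_slobodeckij[OF w1 3 int], rule that)
    fix Gr a assume lc: "local_control w Gr a" and le: "(\<Sum>K\<in>\<T>. (a K)^2) <= ((4 / mu + 8 / mu^2) * h powr s)^2 *
     (LINT z|(leb Om \<Otimes>\<^sub>M leb Om). slobodeckij_kernel s (weak_grad Om w) z)"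
    show "local_control w Gr a" by (rule lc)
    note real_sqrt_le_mono[OF le]
    also have "sqrt (((4 / mu + 8 / mu^2) * h powr s)^2 * (LINT z|(leb Om \<Otimes>\<^sub>M leb Om). slobodeckij_kernel s (weak_grad Om w) z)) =
      (4 / mu + 8 / mu^2) * (h powr s * H1plus_seminorm s Om w)"
     using 3 B(4) by (simp add: real_sqrt_mult H1plus_seminorm_def)
    also have "... <= B * (h powr s * H1plus_seminorm s Om w)" using B(3) sn by (intro mult_right_mono) auto
    finally show "sqrt (\<Sum>K\<in>\<T>. (a K)^2) <= B * h powr s * H1plus_seminorm s Om w" by (simp add: mult.assoc)
   qed
  qed
 qed
 note global_estimate[OF lc aw sz]
 also have "128 / mu^2 * sqrt C10 * h * sqrt (\<Sum>K\<in>\<T>. (a K)^2) <= 128 / mu^2 * sqrt C10 * h * (B * h powr s * H1plus_seminorm s Om w)"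
  using a h by (intro mult_left_mono) (auto simp: C10_def)
 also have "... = C11 * h powr (1 + s) * H1plus_seminorm s Om w"
  using h by (simp add: C11_def B_def powr_add mult_ac)
 finally show ?thesis .
qed

end

section \<open>Mesh constants from shape regularity and quasi-uniformity\<close>

context mesh begin

text \<open>The inradius is a supremum, so balls are obtained for strictly smaller radii.\<close>

lemma inradius_ge:
 assumes K: "K \<in> \<T>" shows "0 <= inradius K" "r < inradius K ==> \<exists>x. cball x r \<subseteq> K"
proof -
 let ?S = "{r. \<exists>x. 0 <= r \<and> cball x r \<subseteq> K}"
 obtain x where x: "x \<in> K" using K_props(9)[OF K] interior_subset by blast
 hence 0: "0 \<in> ?S" by (auto intro!: exI[of _ x])
 have "r <= diameter K" if "r \<in> ?S" for r
 proof -
  obtain x where x: "0 <= r" "cball x r \<subseteq> K" using \<open>r \<in> ?S\<close> by blast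
  have "x \<in> cball x r" "x + r *\<^sub>R axis 1 1 \<in> cball x r" using x(1) by (auto simp: dist_norm)
  hence "norm ((x + r *\<^sub>R axis 1 1) - x) <= diameter K" using x(2) by (intro diam_bound[OF K]) auto
  thus ?thesis using x(1) by simp
 qed
 hence "bdd_above ?S" by (auto simp: bdd_above_def)
 thus "0 <= inradius K" unfolding inradius_def by (rule cSup_upper[OF 0])
 show "\<exists>x. cball x r \<subseteq> K" if "r < inradius K"
 proof -
  have "?S ~= {}" using 0 by blast
  from less_cSupD[OF this that[unfolded inradius_def]] obtain r' where r': "r' \<in> ?S" "r < r'" ..
  then obtain x where "cball x r' \<subseteq> K" by blast
  thus ?thesis using r'(2) subset_cball[of r r' x] by (meson less_imp_le order_trans)
 qed
qed

text \<open>The chain h <= rho diam K <= rho kappa inradius K bounds the inradius from below; the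
  factor 2 makes mu h strictly smaller than the inradius, so that a ball of that radius exists in
  K.\<close>

lemma mesh_size_props:
 assumes sr: "shape_regular kappa \<T>" and qu: "quasi_uniform rho \<T>"
 shows "qmesh Om \<T> (mesh_size \<T>) (1 / (2 * kappa * rho))"
proof -
 have dh: "diameter K <= mesh_size \<T>" if "K \<in> \<T>" for K unfolding mesh_size_def using fin that by (intro Max_ge) auto
 have d0: "0 < diameter K" if K: "K \<in> \<T>" for K
 proof -
  obtain a b c where "a \<in> verts K" "b \<in> verts K" "a ~= b" using triangle_obtain[OF simp2[OF K]] by (metis insertCI)
  hence "0 < norm (b - a)" "norm (b - a) <= diameter K" using diam_bound[OF K] verts_sub(1)[OF K] by auto
  thus ?thesis by linarith
 qed
 obtain K0 where K0: "K0 \<in> \<T>" using T_ne by blast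
 have h: "0 < mesh_size \<T>" using dh[OF K0] d0[OF K0] by linarith
 have kp: "mesh_size \<T> <= rho * diameter K" "diameter K <= kappa * inradius K" if "K \<in> \<T>" for K
  using sr qu that by (auto simp: shape_regular_def quasi_uniform_def)
 \<comment> \<open>An element of positive diameter forces rho and kappa to be positive.\<close>
 have "0 < rho * diameter K0" "0 < kappa * inradius K0" using kp[OF K0] h d0[OF K0] by linarith+
 hence pos: "0 < rho" "0 < kappa" using d0[OF K0] inradius_ge(1)[OF K0] by (auto simp: zero_less_mult_iff)
 show ?thesis
 proof
  show "0 < mesh_size \<T>" by (rule h)
  show "0 < 1 / (2 * kappa * rho)" using pos by simp
  show "diameter K <= mesh_size \<T>" if "K \<in> \<T>" for K by (rule dh[OF that])
  show "\<exists>x. cball x (1 / (2 * kappa * rho) * mesh_size \<T>) \<subseteq> K" if "K \<in> \<T>" for K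
  proof (rule inradius_ge(2)[OF that])
   have "mesh_size \<T> <= rho * (kappa * inradius K)" using kp[OF that] pos mult_left_mono[OF kp(2)[OF that], of rho] by linarith
   thus "1 / (2 * kappa * rho) * mesh_size \<T> < inradius K" using h pos by (simp add: field_simps)
  qed
 qed
qed

end

theorem lemma5p2:
 fixes \<Omega> \<Gamma>D \<Gamma>T :: "pt set" and \<kappa> \<rho> s :: real
 assumes "polygonal_domain \<Omega>"
  and "boundary_partition \<Omega> \<Gamma>D \<Gamma>T"
  and "0 \<le> s" and "s \<le> 1"
 shows "\<exists>c>0. \<forall>\<T> \<alpha> \<sigma>.
  conforming_mesh \<Omega> \<Gamma>T \<T> \<and> shape_regular \<kappa> \<T> \<and> quasi_uniform \<rho> \<T> \<and>
  mesh_condition_M \<Omega> \<Gamma>T \<T> \<and> admissible_weights \<Omega> \<Gamma>T \<T> \<alpha> \<and> SZ_edges \<Omega> \<Gamma>D \<T> \<sigma> \<longrightarrow>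
  (\<forall>w\<in>H1 \<Omega>. clement \<Omega> \<Gamma>T \<T> \<alpha> \<sigma> w \<in> H1 \<Omega> \<inter> P1 \<T>) \<and>
  (\<forall>w\<in>H1plus s \<Omega>.
   L2_norm (lebesgue_on \<Omega>) (\<lambda>x. w x - clement \<Omega> \<Gamma>T \<T> \<alpha> \<sigma> w x) +
   mesh_size \<T> * L2_norm (lebesgue_on \<Omega>) (weak_grad \<Omega> (\<lambda>x. w x - clement \<Omega> \<Gamma>T \<T> \<alpha> \<sigma> w x))
   \<le> c * mesh_size \<T> powr (1 + s) * H1plus_seminorm s \<Omega> w)"
proof (intro exI conjI allI impI)
 \<comment> \<open>Outside its locale \<open>C11\<close> is a function of mu alone, so the constant
   is fixed before the mesh. One plus its modulus is positive whatever kappa and rho are.\<close>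
 let ?c = "qmesh.C11 (1 / (2 * \<kappa> * \<rho>))"
 show "0 < 1 + \<bar>?c\<bar>" by simp
 fix \<T> \<alpha> \<sigma>
 assume A: "conforming_mesh \<Omega> \<Gamma>T \<T> \<and> shape_regular \<kappa> \<T> \<and> quasi_uniform \<rho> \<T> \<and>
  mesh_condition_M \<Omega> \<Gamma>T \<T> \<and> admissible_weights \<Omega> \<Gamma>T \<T> \<alpha> \<and> SZ_edges \<Omega> \<Gamma>D \<T> \<sigma>"
 have m: "mesh \<Omega> \<T>" using A assms(1) by unfold_locales (auto simp: conforming_mesh_def)
 interpret qmesh \<Omega> \<T> "mesh_size \<T>" "1 / (2 * \<kappa> * \<rho>)" using mesh.mesh_size_props[OF m] A by blast
 show "\<forall>w\<in>H1 \<Omega>. clement \<Omega> \<Gamma>T \<T> \<alpha> \<sigma> w \<in> H1 \<Omega> \<inter> P1 \<T>" using clement_H1_P1 by blast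
 show "\<forall>w\<in>H1plus s \<Omega>.
   L2_norm (lebesgue_on \<Omega>) (\<lambda>x. w x - clement \<Omega> \<Gamma>T \<T> \<alpha> \<sigma> w x) +
   mesh_size \<T> * L2_norm (lebesgue_on \<Omega>) (weak_grad \<Omega> (\<lambda>x. w x - clement \<Omega> \<Gamma>T \<T> \<alpha> \<sigma> w x))
   \<le> (1 + \<bar>?c\<bar>) * mesh_size \<T> powr (1 + s) * H1plus_seminorm s \<Omega> w"
 proof
  fix w assume w: "w \<in> H1plus s \<Omega>"
  have sn: "0 \<le> H1plus_seminorm s \<Omega> w"
   by (auto simp: H1plus_seminorm_def L2_norm_eq slobodeckij_kernel_def intro!: sum_nonneg Bochner_Integration.integral_nonneg split: prod.split)
  have "L2_norm (lebesgue_on \<Omega>) (\<lambda>x. w x - clement \<Omega> \<Gamma>T \<T> \<alpha> \<sigma> w x) +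
   mesh_size \<T> * L2_norm (lebesgue_on \<Omega>) (weak_grad \<Omega> (\<lambda>x. w x - clement \<Omega> \<Gamma>T \<T> \<alpha> \<sigma> w x))
   \<le> ?c * mesh_size \<T> powr (1 + s) * H1plus_seminorm s \<Omega> w"
   using clement_estimate[OF assms(3,4) w] A by blast
  also have "\<dots> \<le> (1 + \<bar>?c\<bar>) * mesh_size \<T> powr (1 + s) * H1plus_seminorm s \<Omega> w"
   using sn by (intro mult_right_mono) auto
  finally show "L2_norm (lebesgue_on \<Omega>) (\<lambda>x. w x - clement \<Omega> \<Gamma>T \<T> \<alpha> \<sigma> w x) +
   mesh_size \<T> * L2_norm (lebesgue_on \<Omega>) (weak_grad \<Omega> (\<lambda>x. w x - clement \<Omega> \<Gamma>T \<T> \<alpha> \<sigma> w x))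
   \<le> (1 + \<bar>?c\<bar>) * mesh_size \<T> powr (1 + s) * H1plus_seminorm s \<Omega> w" .
 qed
qed

end
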